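(* Let $\mathfrak g$ be a complex simple Lie algebra with Vogel parameters $\beta,\gamma$ normalized by $\alpha=-2$. Let $l\ge 1$ be an integer such that the weights $\sigma_i=\beta_1+\cdots+\beta_i$ (defined in the context) are dominant for all $i\le l$, so that $Y_l(\beta)$ is the irreducible module with highest weight $\sigma_l$. For an integer $k\ge 1$ let $(Y_l(\beta))^{(k)}$ be its $k$-th Cartan power (the irreducible module of highest weight $k\sigma_l$). Then $$\dim (Y_l(\beta))^{(k)}=\prod_{i=1}^{l}\frac{\binom{2k+\gamma-(i-3)\beta/2-3}{2k}\binom{k+\gamma-(l+i-3)\beta/2-3}{k}\binom{k+\gamma-(l+i-4)\beta/2-4}{k}\binom{k+\gamma/2-(l-i-2)\beta/2-3}{k}}{\binom{2k+\gamma-(2l-i-3)\beta/2-4}{2k}\binom{k+i\beta/2-1}{k}\binom{k+(i-1)\beta/2}{k}\binom{k+\gamma/2-(i-1)\beta/2-1}{k}}.$$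
   Context: Generalized binomial coefficients: for an integer $y\ge 0$ and a number $x$, $\binom{y+x}{y}=\frac{(1+x)(2+x)\cdots(y+x)}{y!}$. Fix a Cartan subalgebra and positive roots of $\mathfrak g$. $\beta_1=\alpha_0$ is the highest root; $\beta_2$ is a highest long root orthogonal to $\beta_1$; $\beta_3$ is a highest long root orthogonal to $\beta_1$ and $\beta_2$; and so on. Here "a highest long root orthogonal to $\beta_1,\dots,\beta_{i-1}$" means a long root of $\mathfrak g$ which is the highest root of an irreducible component of the root subsystem formed by the roots orthogonal to $\beta_1,\dots,\beta_{i-1}$ (there may be several choices). Normalized Vogel parameters $(\beta,\gamma)$: $(1,n+2)$ for $\mathfrak{sp}_{2n}$; $(2,n)$ for $\mathfrak{sl}_n$; $(4,n-4)$ for $\mathfrak{so}_n$ (with $\beta_i=\varepsilon_{2i-1}+\varepsilon_{2i}$); $(5,6),(6,8),(8,12),(12,20)$ for $\mathfrak f_4,\mathfrak e_6,\mathfrak e_7,\mathfrak e_8$. The formula is a rational function of $\beta,\gamma$; at points where numerator and denominator both vanish it is understood after restriction to one of the series (lines in the $(\beta,\gamma)$-plane) to which $\mathfrak g$ belongs: the $\mathfrak{sp}$, $\mathfrak{sl}$, $\mathfrak{so}$ lines above, the exceptional line $(a+4,2a+4)$, or the lines $(a,a(r-2)+4)$ with fixed $r\ge 3$ containing $\mathfrak{sp}_{2r}$ ($a=1$), $\mathfrak{sl}_{2r}$ ($a=2$), $\mathfrak{so}_{4r}$ ($a=4$), and $\mathfrak e_7$ ($r=3$, $a=8$).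
   Formalization: Where the denominator vanishes, the formula is taken as the limit along the line (a, a(r-2)+4), with r≥2 allowed instead of r≥3: for so_8, l=2 the listed lines give 2 or 3 times the dimension (70 or 105 instead of 35 at k=1), and the line (a,4) gives the right value. *)

theory Defs
  imports Complex_Main
begin

section \<open>Complex simple Lie algebras and their roots\<close>

locale complex_lie_algebra =
  finite_dimensional_vector_space scale Basis
  for scale :: "complex \<Rightarrow> 'g::ab_group_add \<Rightarrow> 'g" and Basis :: "'g set" +
  fixes brk :: "'g \<Rightarrow> 'g \<Rightarrow> 'g"
  assumes brk_add_left: "brk (x + y) z = brk x z + brk y z"
    and brk_add_right: "brk x (y + z) = brk x y + brk x z"
    and brk_scale_left: "brk (scale c x) y = scale c (brk x y)"
    and brk_scale_right: "brk x (scale c y) = scale c (brk x y)"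
    and brk_self: "brk x x = 0"
    and jacobi: "brk x (brk y z) + brk y (brk z x) + brk z (brk x y) = 0"
begin

definition lie_ideal :: "'g set \<Rightarrow> bool" where
  "lie_ideal I \<longleftrightarrow> subspace I \<and> (\<forall>x. \<forall>y\<in>I. brk x y \<in> I)"

definition trace :: "('g \<Rightarrow> 'g) \<Rightarrow> complex" where
  "trace f = (\<Sum>b\<in>Basis. representation Basis (f b) b)"

definition killing :: "'g \<Rightarrow> 'g \<Rightarrow> complex" where
  "killing x y = trace (\<lambda>z. brk x (brk y z))"

definition diagonalizable :: "('g \<Rightarrow> 'g) \<Rightarrow> bool" where
  "diagonalizable f \<longleftrightarrow> span {v. \<exists>c. f v = scale c v} = UNIV"

definition toral :: "'g set \<Rightarrow> bool" where
  "toral H \<longleftrightarrow> subspace H \<and> (\<forall>x\<in>H. \<forall>y\<in>H. brk x y = 0) \<and> (\<forall>x\<in>H. diagonalizable (brk x))"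

text \<open>For semisimple Lie algebras, Cartan subalgebras are the maximal abelian subalgebras
  consisting of ad-diagonalizable elements.\<close>

definition cartan_subalgebra :: "'g set \<Rightarrow> bool" where
  "cartan_subalgebra H \<longleftrightarrow> toral H \<and> (\<forall>H'. toral H' \<and> H \<subseteq> H' \<longrightarrow> H' = H)"

text \<open>Linear functionals on \<open>H\<close> are represented by functions on the whole Lie algebra that vanish
  outside \<open>H\<close>, so that equality of functionals is equality of functions.\<close>

definition dual :: "'g set \<Rightarrow> ('g \<Rightarrow> complex) set" where
  "dual H = {\<phi>. (\<forall>x\<in>H. \<forall>y\<in>H. \<phi> (x + y) = \<phi> x + \<phi> y) \<and>
                (\<forall>c. \<forall>x\<in>H. \<phi> (scale c x) = c * \<phi> x) \<and> (\<forall>x. x \<notin> H \<longrightarrow> \<phi> x = 0)}"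

definition root_space :: "'g set \<Rightarrow> ('g \<Rightarrow> complex) \<Rightarrow> 'g set" where
  "root_space H \<alpha> = {x. \<forall>h\<in>H. brk h x = scale (\<alpha> h) x}"

definition roots :: "'g set \<Rightarrow> ('g \<Rightarrow> complex) set" where
  "roots H = {\<alpha> \<in> dual H. \<alpha> \<noteq> (\<lambda>h. 0) \<and> root_space H \<alpha> \<noteq> {0}}"

definition positive_system :: "'g set \<Rightarrow> ('g \<Rightarrow> complex) set \<Rightarrow> bool" where
  "positive_system H P \<longleftrightarrow>
     P \<subseteq> roots H \<and>
     (\<forall>\<alpha>\<in>roots H. \<alpha> \<in> P \<longleftrightarrow> (\<lambda>h. - \<alpha> h) \<notin> P) \<and>
     (\<forall>\<alpha>\<in>P. \<forall>\<beta>\<in>P. (\<lambda>h. \<alpha> h + \<beta> h) \<in> roots H \<longrightarrow> (\<lambda>h. \<alpha> h + \<beta> h) \<in> P)"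

end

locale simple_lie_algebra =
  complex_lie_algebra scale Basis brk
  for scale :: "complex \<Rightarrow> 'g::ab_group_add \<Rightarrow> 'g" and Basis and brk +
  assumes nonabelian: "\<exists>x y. brk x y \<noteq> 0"
    and simple: "lie_ideal I \<Longrightarrow> I = {0} \<or> I = UNIV"


section \<open>The sequence of highest roots\<close>

text \<open>A simple Lie algebra is identified by its Dynkin diagram: \<open>SL n\<close> is \<open>A\<^sub>n\<^sub>-\<^sub>1\<close>, \<open>SO n\<close> is \<open>B\<close> or
  \<open>D\<close> of rank \<open>\<lfloor>n/2\<rfloor>\<close>, and \<open>SP n\<close> is \<open>C\<^sub>n\<close>, that is \<open>sp\<^sub>2\<^sub>n\<close>.\<close>

datatype simple_type = SL nat | SO nat | SP nat | G2 | F4 | E6 | E7 | E8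

text \<open>\<open>so\<^sub>4\<close> is not simple. \<open>so\<^sub>3\<close> is \<open>sl\<^sub>2\<close>; its highest root is not of the form
  \<open>\<epsilon>\<^sub>1 + \<epsilon>\<^sub>2\<close>.\<close>

fun valid_type :: "simple_type \<Rightarrow> bool" where
  "valid_type (SL n) \<longleftrightarrow> n \<ge> 2"
| "valid_type (SO n) \<longleftrightarrow> n \<ge> 5"
| "valid_type (SP n) \<longleftrightarrow> n \<ge> 1"
| "valid_type _ \<longleftrightarrow> True"

fun type_rank :: "simple_type \<Rightarrow> nat" where
  "type_rank (SL n) = n - 1"
| "type_rank (SO n) = n div 2"
| "type_rank (SP n) = n"
| "type_rank G2 = 2"
| "type_rank F4 = 4"
| "type_rank E6 = 6"
| "type_rank E7 = 7"
| "type_rank E8 = 8"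

text \<open>The Dynkin diagrams, on the nodes \<open>1, \<dots>, type_rank T\<close> numbered as in Bourbaki.\<close>

definition linked :: "simple_type \<Rightarrow> nat \<Rightarrow> nat \<Rightarrow> bool" where
  "linked T i j \<longleftrightarrow>
    (let a = min i j; b = max i j; r = type_rank T in
     (case T of
        SO n \<Rightarrow> (if odd n then b = a + 1 else b = a + 1 \<and> b < r \<or> a + 2 = r \<and> b = r)
      | E6 \<Rightarrow> (a, b) \<in> {(1, 3), (2, 4)} \<or> 3 \<le> a \<and> b = a + 1
      | E7 \<Rightarrow> (a, b) \<in> {(1, 3), (2, 4)} \<or> 3 \<le> a \<and> b = a + 1
      | E8 \<Rightarrow> (a, b) \<in> {(1, 3), (2, 4)} \<or> 3 \<le> a \<and> b = a + 1
      | _ \<Rightarrow> b = a + 1))"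

text \<open>Squared lengths of the simple roots, up to a common factor.\<close>

fun sq_length :: "simple_type \<Rightarrow> nat \<Rightarrow> nat" where
  "sq_length (SO n) i = (if odd n \<and> i = n div 2 then 1 else 2)"
| "sq_length (SP n) i = (if i = n then 2 else 1)"
| "sq_length F4 i = (if i \<le> 2 then 2 else 1)"
| "sq_length G2 i = (if i = 1 then 1 else 3)"
| "sq_length _ i = 1"

text \<open>The Cartan integer \<open>2(\<alpha>\<^sub>i, \<alpha>\<^sub>j)/(\<alpha>\<^sub>j, \<alpha>\<^sub>j)\<close>: for linked nodes,
  \<open>2(\<alpha>\<^sub>i, \<alpha>\<^sub>j)\<close> is minus the larger of the two squared lengths.\<close>

definition cartan_integer :: "simple_type \<Rightarrow> nat \<Rightarrow> nat \<Rightarrow> int" where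
  "cartan_integer T i j =
    (if i = j then 2
     else if linked T i j then - int (max 1 (sq_length T i div sq_length T j))
     else 0)"

locale rooted_simple_lie_algebra =
  simple_lie_algebra scale Basis brk
  for scale :: "complex \<Rightarrow> 'g::ab_group_add \<Rightarrow> 'g" and Basis and brk +
  fixes H :: "'g set" and P :: "('g \<Rightarrow> complex) set"
  assumes cartan: "cartan_subalgebra H"
    and positive: "positive_system H P"
begin

text \<open>The element of \<open>H\<close> corresponding to a functional under the Killing form, and the induced
  bilinear form on functionals. On the roots this form is real-valued and positive definite.\<close>

definition dual_vector :: "('g \<Rightarrow> complex) \<Rightarrow> 'g" where
  "dual_vector \<phi> = (THE t. t \<in> H \<and> (\<forall>h\<in>H. killing t h = \<phi> h))"

definition ip :: "('g \<Rightarrow> complex) \<Rightarrow> ('g \<Rightarrow> complex) \<Rightarrow> complex" where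
  "ip \<phi> \<psi> = killing (dual_vector \<phi>) (dual_vector \<psi>)"

definition dominant :: "('g \<Rightarrow> complex) \<Rightarrow> bool" where
  "dominant \<phi> \<longleftrightarrow> \<phi> \<in> dual H \<and> (\<forall>\<alpha>\<in>P. 2 * ip \<phi> \<alpha> / ip \<alpha> \<alpha> \<in> \<nat>)"

definition simple_roots :: "('g \<Rightarrow> complex) set" where
  "simple_roots = {\<alpha>\<in>P. \<forall>\<beta>\<in>P. \<forall>\<gamma>\<in>P. \<alpha> \<noteq> (\<lambda>h. \<beta> h + \<gamma> h)}"

text \<open>\<open>\<alpha>\<close> numbers the simple roots so that they form the Dynkin diagram of type \<open>T\<close>.\<close>

definition has_type :: "simple_type \<Rightarrow> (nat \<Rightarrow> 'g \<Rightarrow> complex) \<Rightarrow> bool" where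
  "has_type T \<alpha> \<longleftrightarrow>
     valid_type T \<and>
     bij_betw \<alpha> {1..type_rank T} simple_roots \<and>
     (\<forall>i\<in>{1..type_rank T}. \<forall>j\<in>{1..type_rank T}.
        2 * ip (\<alpha> i) (\<alpha> j) / ip (\<alpha> j) (\<alpha> j) = of_int (cartan_integer T i j))"

definition long_root :: "('g \<Rightarrow> complex) \<Rightarrow> bool" where
  "long_root \<alpha> \<longleftrightarrow> \<alpha> \<in> roots H \<and> (\<forall>\<beta>\<in>roots H. Re (ip \<beta> \<beta>) \<le> Re (ip \<alpha> \<alpha>))"

definition irreducible_component :: "('g \<Rightarrow> complex) set \<Rightarrow> ('g \<Rightarrow> complex) set \<Rightarrow> bool" where
  "irreducible_component R C \<longleftrightarrow>
     C \<subseteq> R \<and> C \<noteq> {} \<and>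
     (\<forall>\<alpha>\<in>C. \<forall>\<beta>\<in>R - C. ip \<alpha> \<beta> = 0) \<and>
     (\<forall>D. D \<subset> C \<and> D \<noteq> {} \<longrightarrow> (\<exists>\<alpha>\<in>D. \<exists>\<beta>\<in>C - D. ip \<alpha> \<beta> \<noteq> 0))"

definition highest_root :: "('g \<Rightarrow> complex) set \<Rightarrow> ('g \<Rightarrow> complex) \<Rightarrow> bool" where
  "highest_root C \<theta> \<longleftrightarrow>
     \<theta> \<in> C \<and>
     (\<forall>\<alpha>\<in>C. \<exists>c :: ('g \<Rightarrow> complex) \<Rightarrow> nat. \<forall>h.
        \<theta> h - \<alpha> h = (\<Sum>\<gamma>\<in>C \<inter> P. of_nat (c \<gamma>) * \<gamma> h))"

text \<open>For \<open>i = 1\<close> the orthogonality condition is empty, and since the root system is irreducible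
  the only candidate for \<open>\<beta> 1\<close> is the highest root.\<close>

definition beta_sequence :: "nat \<Rightarrow> (nat \<Rightarrow> 'g \<Rightarrow> complex) \<Rightarrow> bool" where
  "beta_sequence l \<beta> \<longleftrightarrow>
     (\<forall>i\<in>{1..l}. long_root (\<beta> i) \<and>
        (\<exists>C. irreducible_component {\<alpha>\<in>roots H. \<forall>j\<in>{1..<i}. ip \<alpha> (\<beta> j) = 0} C \<and>
             highest_root C (\<beta> i)))"

end

definition sigma :: "(nat \<Rightarrow> 'g \<Rightarrow> complex) \<Rightarrow> nat \<Rightarrow> 'g \<Rightarrow> complex" where
  "sigma \<beta> i = (\<lambda>h. \<Sum>j=1..i. \<beta> j h)"

text \<open>The standard coordinates \<open>\<epsilon>\<^sub>1, \<dots>, \<epsilon>\<^sub>r\<close>, \<open>r = \<lfloor>n/2\<rfloor>\<close>, of \<open>so\<^sub>n\<close>, given the numbered simple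
  roots \<open>\<alpha>\<close>.\<close>

definition so_coordinates ::
  "nat \<Rightarrow> (nat \<Rightarrow> 'g \<Rightarrow> complex) \<Rightarrow> (nat \<Rightarrow> 'g \<Rightarrow> complex) \<Rightarrow> bool" where
  "so_coordinates n \<alpha> \<epsilon> \<longleftrightarrow>
    (let r = n div 2 in
       (\<forall>i\<in>{1..<r}. \<alpha> i = (\<lambda>h. \<epsilon> i h - \<epsilon> (i + 1) h)) \<and>
       \<alpha> r = (if odd n then \<epsilon> r else (\<lambda>h. \<epsilon> (r - 1) h + \<epsilon> r h)))"

text \<open>For \<open>so\<^sub>n\<close> the definition of the sequence also allows other choices (such as
  \<open>\<beta>\<^sub>2 = \<epsilon>\<^sub>1 - \<epsilon>\<^sub>2\<close>); the parameters \<open>(4, n - 4)\<close> go with the following one.\<close>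

definition so_convention ::
  "simple_type \<Rightarrow> (nat \<Rightarrow> 'g \<Rightarrow> complex) \<Rightarrow> nat \<Rightarrow> (nat \<Rightarrow> 'g \<Rightarrow> complex) \<Rightarrow> bool" where
  "so_convention T \<alpha> l \<beta> \<longleftrightarrow>
    (\<forall>n. T = SO n \<longrightarrow>
      (\<exists>\<epsilon>. so_coordinates n \<alpha> \<epsilon> \<and>
        (\<forall>i\<in>{1..l}. 2 * i \<le> n div 2 \<and> \<beta> i = (\<lambda>h. \<epsilon> (2 * i - 1) h + \<epsilon> (2 * i) h))))"


section \<open>Modules\<close>

locale lie_module =
  complex_lie_algebra scaleL BasisL brk +
  V: finite_dimensional_vector_space scaleV BasisV
  for scaleL :: "complex \<Rightarrow> 'g::ab_group_add \<Rightarrow> 'g" and BasisL and brk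
    and scaleV :: "complex \<Rightarrow> 'v::ab_group_add \<Rightarrow> 'v" and BasisV +
  fixes act :: "'g \<Rightarrow> 'v \<Rightarrow> 'v"
  assumes act_add_left: "act (x + y) v = act x v + act y v"
    and act_add_right: "act x (v + w) = act x v + act x w"
    and act_scale_left: "act (scaleL c x) v = scaleV c (act x v)"
    and act_scale_right: "act x (scaleV c v) = scaleV c (act x v)"
    and act_brk: "act (brk x y) v = act x (act y v) - act y (act x v)"
begin

definition has_highest_weight :: "'g set \<Rightarrow> ('g \<Rightarrow> complex) set \<Rightarrow> ('g \<Rightarrow> complex) \<Rightarrow> bool" where
  "has_highest_weight H P \<phi> \<longleftrightarrow>
     (\<exists>v. v \<noteq> 0 \<and> (\<forall>h\<in>H. act h v = scaleV (\<phi> h) v) \<and>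
          (\<forall>\<alpha>\<in>P. \<forall>x\<in>root_space H \<alpha>. act x v = 0))"

end

locale irreducible_lie_module =
  lie_module scaleL BasisL brk scaleV BasisV act
  for scaleL :: "complex \<Rightarrow> 'g::ab_group_add \<Rightarrow> 'g" and BasisL and brk
    and scaleV :: "complex \<Rightarrow> 'v::ab_group_add \<Rightarrow> 'v" and BasisV and act +
  assumes nonzero: "\<exists>v::'v. v \<noteq> 0"
    and irreducible: "V.subspace U \<Longrightarrow> (\<And>x u. u \<in> U \<Longrightarrow> act x u \<in> U) \<Longrightarrow> U = {0} \<or> U = UNIV"


section \<open>Vogel parameters and the dimension formula\<close>

text \<open>The pair \<open>(\<beta>, \<gamma>)\<close>, with \<open>\<alpha> = -2\<close>. The value for \<open>G2\<close> is the point of the exceptional line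
  \<open>(a + 4, 2 a + 4)\<close> with \<open>a = -2/3\<close>.\<close>

fun vogel_parameters :: "simple_type \<Rightarrow> real \<times> real" where
  "vogel_parameters (SP n) = (1, real n + 2)"
| "vogel_parameters (SL n) = (2, real n)"
| "vogel_parameters (SO n) = (4, real n - 4)"
| "vogel_parameters G2 = (10 / 3, 8 / 3)"
| "vogel_parameters F4 = (5, 6)"
| "vogel_parameters E6 = (6, 8)"
| "vogel_parameters E7 = (8, 12)"
| "vogel_parameters E8 = (12, 20)"

text \<open>The binomial coefficient \<open>(1 + x) \<cdots> (y + x) / y!\<close> is \<open>(y + x) gchoose y\<close>.\<close>

definition dim_numerator :: "nat \<Rightarrow> nat \<Rightarrow> real \<Rightarrow> real \<Rightarrow> real" where
  "dim_numerator l k b c =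
    (\<Prod>i=1..l.
       ((2 * real k + c - (real i - 3) * b / 2 - 3) gchoose (2 * k)) *
       ((real k + c - (real l + real i - 3) * b / 2 - 3) gchoose k) *
       ((real k + c - (real l + real i - 4) * b / 2 - 4) gchoose k) *
       ((real k + c / 2 - (real l - real i - 2) * b / 2 - 3) gchoose k))"

definition dim_denominator :: "nat \<Rightarrow> nat \<Rightarrow> real \<Rightarrow> real \<Rightarrow> real" where
  "dim_denominator l k b c =
    (\<Prod>i=1..l.
       ((2 * real k + c - (2 * real l - real i - 3) * b / 2 - 4) gchoose (2 * k)) *
       ((real k + real i * b / 2 - 1) gchoose k) *
       ((real k + (real i - 1) * b / 2) gchoose k) *
       ((real k + c / 2 - (real i - 1) * b / 2 - 1) gchoose k))"

text \<open>The series of Lie algebras on the line \<open>(a, a (r - 2) + 4)\<close>.\<close>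

definition in_fixed_rank_series :: "nat \<Rightarrow> simple_type \<Rightarrow> bool" where
  "in_fixed_rank_series r T \<longleftrightarrow>
     r \<ge> 2 \<and> (T = SP r \<or> T = SL (2 * r) \<or> T = SO (4 * r) \<or> r = 3 \<and> T = E7)"

text \<open>Where the denominator does not vanish, the value of the formula is the plain quotient and
  agrees with the limit along every line through the point. It vanishes only for \<open>so\<^sub>4\<^sub>r\<close> with
  \<open>l = r\<close> and for \<open>e\<^sub>7\<close> with \<open>l = 3\<close>, \<open>k \<ge> 3\<close>. There the value depends on the line, and the one
  that gives the dimension is \<open>(a, a (r - 2) + 4)\<close>: restriction to the line of the \<open>so\<^sub>n\<close> gives
  twice the dimension (a diagram automorphism of \<open>so\<^sub>4\<^sub>r\<close> carries the module to a second one), and on the exceptional line the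
  denominator vanishes identically for \<open>e\<^sub>7\<close>. The rank \<open>r = 2\<close> is needed for \<open>so\<^sub>8\<close> with
  \<open>l = 2\<close>.\<close>

definition dim_formula_value :: "simple_type \<Rightarrow> nat \<Rightarrow> nat \<Rightarrow> real \<Rightarrow> bool" where
  "dim_formula_value T l k d \<longleftrightarrow>
    (case vogel_parameters T of (b, c) \<Rightarrow>
       if dim_denominator l k b c \<noteq> 0 then d = dim_numerator l k b c / dim_denominator l k b c
       else (\<exists>r. in_fixed_rank_series r T \<and>
          ((\<lambda>a. dim_numerator l k a (a * (real r - 2) + 4) /
                dim_denominator l k a (a * (real r - 2) + 4)) \<longlongrightarrow> d) (at b)))"

end

theory Submission
  imports Defs "HOL-Computational_Algebra.Fundamental_Theorem_Algebra" "HOL-Library.Function_Algebras"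
begin

text \<open>The dimension is given by the Weyl dimension formula, the product of \<open>1 + (\<Lambda>, a) / (\<rho>, a)\<close> over the
  positive roots \<open>a\<close>. To prove that formula, multiply the character by the Weyl denominator. The Casimir
  operator, evaluated by traces along root strings, shows that the product is supported on the \<open>x\<close> with
  \<open>(x, x) = (\<Lambda> + \<rho>, \<Lambda> + \<rho>)\<close>, and it is antisymmetric under the simple reflections, so it is determined by
  its only dominant exponent \<open>\<Lambda> + \<rho>\<close>. Pairing it with the polynomial \<open>x \<mapsto> \<Prod>a>0. (x, a)\<close>, whose iterated
  differences along the positive roots are constant, yields the dimension up to a factor that does not
  depend on the module.

  Orthogonality and dominance determine the \<open>\<beta> i\<close>: they are \<open>e i - e (n + 1 - i)\<close> for \<open>sl\<close>, \<open>2 e i\<close> for \<open>sp\<close>,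
  and are found by enumeration in the exceptional cases; for \<open>so\<close>, they are fixed by convention. The factors
  of the Weyl formula along a string of roots with consecutive values of \<open>(\<rho>, a)\<close> telescope, since
  \<open>1 + k / x\<close> is the quotient of the binomial coefficients with parameters \<open>x\<close> and \<open>x - 1\<close>. On the line
  \<open>(a, a (r - 2) + 4)\<close> with \<open>l = r\<close> all factors but the first ones cancel.\<close>

section \<open>Linear algebra over the complex numbers\<close>

text \<open>\<open>H\<close> is given as a maximal toral subalgebra, so its self-centralization and
  the nondegeneracy of the Killing form come before any root theory. One device serves both: an
  additive map \<open>\<phi>\<close> on the complex numbers turns the grading by generalized
  eigenspaces of some \<open>brk u\<close> into a derivation. Conjugation, additive though not
  linear, makes traces into sums of squared absolute values; the identity yields the semisimple part
  of an element centralizing \<open>H\<close>. Traces of \<open>E F\<close> along a string then do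
  the work of sl2 theory twice: on the adjoint module they give positivity, multiplicity one and
  root strings, on a general module the recursion behind the Casimir identity. In the Weyl formula a
  chamber is recorded by the set of positive roots that are positive on it, and simple reflections
  move it one at a time. In the final computation the obstacle is the step size: the values
  \<open>(\<rho>, a)\<close> run in unit or half steps, the parameters of the formula in steps of
  \<open>b / 2\<close> for the Vogel parameter \<open>b\<close>, so strings have to be regrouped
  before they telescope.\<close>

locale complex_space = finite_dimensional_vector_space scale Basis
  for scale :: "complex \<Rightarrow> 'v::ab_group_add \<Rightarrow> 'v" and Basis :: "'v set"
begin

abbreviation lin :: "('v \<Rightarrow> 'v) \<Rightarrow> bool" where
  "lin f \<equiv> Vector_Spaces.linear scale scale f"

lemma linI: "(\<And>x y. f (x + y) = f x + f y) \<Longrightarrow> (\<And>c x. f (scale c x) = scale c (f x)) \<Longrightarrow> lin f"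
  by unfold_locales (auto simp: scale_right_distrib scale_left_distrib)

lemma lin_add: "lin f \<Longrightarrow> f (x + y) = f x + f y"
  by (simp add: Vector_Spaces.linear_iff)

lemma lin_scale: "lin f \<Longrightarrow> f (scale c x) = scale c (f x)"
  by (simp add: Vector_Spaces.linear_iff)

lemma lin_zero: "lin f \<Longrightarrow> f 0 = 0"
  using lin_add[of f 0 0] by simp

lemma lin_neg: "lin f \<Longrightarrow> f (- x) = - f x"
  using lin_add[of f x "- x"] lin_zero[of f] by (simp add: eq_neg_iff_add_eq_0 add.commute)

lemma lin_diff: "lin f \<Longrightarrow> f (x - y) = f x - f y"
  using lin_add[of f x "- y"] lin_neg[of f y] by simp

lemma lin_sum: "lin f \<Longrightarrow> f (\<Sum>i\<in>I. g i) = (\<Sum>i\<in>I. f (g i))"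
  by (induction I rule: infinite_finite_induct) (auto simp: lin_zero lin_add)

lemma lin_id: "lin (\<lambda>x. x)"
  by (rule linI) auto

lemma lin_comp: "lin f \<Longrightarrow> lin g \<Longrightarrow> lin (\<lambda>x. f (g x))"
  by (rule linI) (auto simp: lin_add lin_scale)

lemma lin_plus: "lin f \<Longrightarrow> lin g \<Longrightarrow> lin (\<lambda>x. f x + g x)"
  by (rule linI) (auto simp: lin_add lin_scale scale_right_distrib)

lemma lin_minus: "lin f \<Longrightarrow> lin g \<Longrightarrow> lin (\<lambda>x. f x - g x)"
  by (rule linI) (auto simp: lin_add lin_scale scale_right_diff_distrib)

lemma lin_scaled: "lin f \<Longrightarrow> lin (\<lambda>x. scale c (f x))"
  by (rule linI) (auto simp: lin_add lin_scale scale_right_distrib mult.commute)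

lemma lin_shift: "lin f \<Longrightarrow> lin (\<lambda>x. f x - scale c x)"
  by (intro lin_minus lin_scaled lin_id)

lemma lin_funpow: "lin f \<Longrightarrow> lin (f ^^ n)"
  by (induction n) (auto simp: comp_def id_def intro: lin_id lin_comp)

lemma lin_eq_on_span:
  assumes "lin f" "lin g" "\<And>b. b \<in> S \<Longrightarrow> f b = g b" "x \<in> span S"
  shows "f x = g x"
  using assms(4)
proof (induction rule: span_induct_alt)
  case base
  then show ?case using assms lin_zero by metis
next
  case (step c y z)
  then show ?case using assms by (simp add: lin_add lin_scale)
qed

section \<open>Bases and traces\<close>

definition basis :: "'v set \<Rightarrow> bool" where
  "basis B \<longleftrightarrow> independent B \<and> span B = UNIV"

lemma basis_Basis: "basis Basis"
  by (simp add: basis_def independent_Basis span_Basis)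

lemma basis_finite: "basis B \<Longrightarrow> finite B"
  using finiteI_independent basis_def by blast

lemma basis_card: "basis B \<Longrightarrow> card B = dim (UNIV :: 'v set)"
  using dim_unique[of B UNIV "card B"] basis_def by auto

lemma basis_expand: "basis B \<Longrightarrow> (\<Sum>b\<in>B. scale (representation B x b) b) = x"
  using sum_representation_eq[of B x B] basis_finite by (auto simp: basis_def)

lemma rep_add: "basis B \<Longrightarrow> representation B (x + y) b = representation B x b + representation B y b"
  by (simp add: basis_def representation_add)

lemma rep_scale: "basis B \<Longrightarrow> representation B (scale c x) b = c * representation B x b"
  by (simp add: basis_def representation_scale)

lemma rep_diff: "basis B \<Longrightarrow> representation B (x - y) b = representation B x b - representation B y b"
  by (simp add: basis_def representation_diff)

lemma rep_zero [simp]: "representation B 0 b = 0"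
  by (simp add: representation_zero)

lemma rep_sum: "basis B \<Longrightarrow> representation B (\<Sum>i\<in>I. f i) b = (\<Sum>i\<in>I. representation B (f i) b)"
  by (induction I rule: infinite_finite_induct) (auto simp: rep_add)

lemma rep_basis: "basis B \<Longrightarrow> b \<in> B \<Longrightarrow> representation B b c = (if c = b then 1 else 0)"
  by (simp add: basis_def representation_basis)

lemma rep_lin:
  assumes "basis B" "lin f"
  shows "representation B (f x) c = (\<Sum>b\<in>B. representation B x b * representation B (f b) c)"
proof -
  have "representation B (f x) c = representation B (f (\<Sum>b\<in>B. scale (representation B x b) b)) c"
    using basis_expand[OF assms(1), of x] by simp
  then show ?thesis by (simp add: lin_sum lin_scale assms rep_sum rep_scale)
qed

lemma rep_span_zero:
  assumes "basis B" "S \<subseteq> B" "x \<in> span S" "c \<notin> S"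
  shows "representation B x c = 0"
proof -
  have "representation B x = representation S x"
    using assms by (intro representation_extend) (auto simp: basis_def)
  then show ?thesis using representation_ne_zero[of S x c] assms(4) by auto
qed

lemma span_rep_zero:
  assumes "basis B" "S \<subseteq> B" "\<And>b. b \<in> B \<Longrightarrow> b \<notin> S \<Longrightarrow> representation B x b = 0"
  shows "x \<in> span S"
proof -
  have "(\<Sum>b\<in>B. scale (representation B x b) b) = (\<Sum>b\<in>S. scale (representation B x b) b)"
    by (rule sum.mono_neutral_right) (use assms basis_finite[OF assms(1)] in auto)
  then have "x = (\<Sum>b\<in>S. scale (representation B x b) b)" using basis_expand[OF assms(1), of x] by simp
  moreover have "(\<Sum>b\<in>S. scale (representation B x b) b) \<in> span S"
    by (intro span_sum span_scale span_base)
  ultimately show ?thesis by simp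
qed

text \<open>The trace of the diagonal block that belongs to a part \<open>S\<close> of a basis. For
  \<open>S\<close> the basis vectors of one weight it is the trace on a weight space, obtained
  without restricting the operator.\<close>

definition ptr :: "'v set \<Rightarrow> 'v set \<Rightarrow> ('v \<Rightarrow> 'v) \<Rightarrow> complex" where
  "ptr B S f = (\<Sum>b\<in>S. representation B (f b) b)"

lemma ptr_indep:
  assumes B: "basis B" and C: "basis C" and f: "lin f"
  shows "ptr B B f = ptr C C f"
proof -
  have "ptr B B f = (\<Sum>b\<in>B. \<Sum>c\<in>C. representation C b c * representation B (f c) b)"
    unfolding ptr_def
  proof (rule sum.cong[OF refl])
    fix b assume "b \<in> B"
    have "representation B (f b) b = representation B (f (\<Sum>c\<in>C. scale (representation C b c) c)) b"
      using basis_expand[OF C, of b] by simp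
    then show "representation B (f b) b = (\<Sum>c\<in>C. representation C b c * representation B (f c) b)"
      by (simp add: lin_sum lin_scale f B rep_sum rep_scale)
  qed
  also have "\<dots> = (\<Sum>c\<in>C. \<Sum>b\<in>B. representation B (f c) b * representation C b c)"
    by (subst sum.swap) (simp add: mult.commute)
  also have "\<dots> = (\<Sum>c\<in>C. representation C (\<Sum>b\<in>B. scale (representation B (f c) b) b) c)"
    by (simp add: C rep_sum rep_scale)
  finally show ?thesis by (simp add: basis_expand[OF B] ptr_def)
qed

text \<open>The identity tr(AB) = tr(BA) for maps between two coordinate subspaces. On weight spaces
  it moves a trace one step along a string.\<close>

lemma ptr_swap:
  assumes B: "basis B" and S: "S \<subseteq> B" and T: "T \<subseteq> B" and f: "lin f" and g: "lin g"
    and fS: "\<And>b. b \<in> S \<Longrightarrow> f b \<in> span T" and gT: "\<And>b. b \<in> T \<Longrightarrow> g b \<in> span S"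
  shows "ptr B S (\<lambda>x. g (f x)) = ptr B T (\<lambda>x. f (g x))"
proof -
  have *: "representation B (h x) c = (\<Sum>b\<in>U. representation B x b * representation B (h b) c)"
    if "lin h" "U \<subseteq> B" "x \<in> span U" for h U x c
    unfolding rep_lin[OF B that(1), of x c]
    by (rule sum.mono_neutral_right) (use rep_span_zero[OF B that(2,3)] that(2) basis_finite[OF B] in auto)
  have "ptr B S (\<lambda>x. g (f x)) = (\<Sum>b\<in>S. \<Sum>c\<in>T. representation B (f b) c * representation B (g c) b)"
    unfolding ptr_def by (intro sum.cong[OF refl] *[OF g T]) (rule fS)
  also have "\<dots> = (\<Sum>c\<in>T. \<Sum>b\<in>S. representation B (g c) b * representation B (f b) c)"
    by (subst sum.swap) (simp add: mult.commute)
  also have "\<dots> = ptr B T (\<lambda>x. f (g x))"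
    unfolding ptr_def by (intro sum.cong[OF refl] *[OF f S, symmetric]) (rule gT)
  finally show ?thesis .
qed

lemma ptr_add: "basis B \<Longrightarrow> ptr B S (\<lambda>x. f x + g x) = ptr B S f + ptr B S g"
  by (simp add: ptr_def rep_add sum.distrib)

lemma ptr_diff: "basis B \<Longrightarrow> ptr B S (\<lambda>x. f x - g x) = ptr B S f - ptr B S g"
  by (simp add: ptr_def rep_diff sum_subtractf)

lemma ptr_scale: "basis B \<Longrightarrow> ptr B S (\<lambda>x. scale c (f x)) = c * ptr B S f"
  by (simp add: ptr_def rep_scale sum_distrib_left)

lemma ptr_diag:
  assumes "basis B" "S \<subseteq> B" "\<And>b. b \<in> S \<Longrightarrow> f b = scale (d b) b"
  shows "ptr B S f = (\<Sum>b\<in>S. d b)"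
  unfolding ptr_def by (rule sum.cong) (use assms in \<open>auto simp: rep_scale rep_basis subset_iff\<close>)

definition tr :: "('v \<Rightarrow> 'v) \<Rightarrow> complex" where
  "tr f = ptr Basis Basis f"

lemma tr_eq: "basis B \<Longrightarrow> lin f \<Longrightarrow> tr f = ptr B B f"
  unfolding tr_def by (rule ptr_indep[OF basis_Basis])

lemma tr_swap: "lin f \<Longrightarrow> lin g \<Longrightarrow> tr (\<lambda>x. g (f x)) = tr (\<lambda>x. f (g x))"
  unfolding tr_def by (rule ptr_swap[OF basis_Basis]) (auto simp: span_Basis)

lemma tr_add: "tr (\<lambda>x. f x + g x) = tr f + tr g"
  unfolding tr_def by (rule ptr_add[OF basis_Basis])

lemma tr_diff: "tr (\<lambda>x. f x - g x) = tr f - tr g"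
  unfolding tr_def by (rule ptr_diff[OF basis_Basis])

lemma tr_scale: "tr (\<lambda>x. scale c (f x)) = c * tr f"
  unfolding tr_def by (rule ptr_scale[OF basis_Basis])

text \<open>A basis adapted to the flag of kernels of the powers of \<open>f\<close> makes a nilpotent \<open>f\<close> strictly
  triangular.\<close>

lemma tr_nilpotent:
  assumes f: "lin f" and nil: "\<And>x. \<exists>n. (f ^^ n) x = 0"
  shows "tr f = 0"
proof -
  have sub: "subspace {x. (f ^^ n) x = 0}" for n
    using lin_funpow[OF f, of n] by (auto simp: subspace_def lin_zero lin_add lin_scale)
  have step: "\<exists>B. independent B \<and> span B = {x. (f ^^ n) x = 0} \<and> (\<forall>b\<in>B. f b \<in> span (B - {b}))" for n
  proof (induction n)
    case 0
    show ?case by (rule exI[of _ "{}"]) (auto simp: independent_empty)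
  next
    case (Suc n)
    then obtain B where B: "independent B" "span B = {x. (f ^^ n) x = 0}"
      "\<And>b. b \<in> B \<Longrightarrow> f b \<in> span (B - {b})" by blast
    have fn: "(f ^^ n) (f x) = f ((f ^^ n) x)" for x by (metis funpow_swap1)
    let ?K = "{x. (f ^^ Suc n) x = 0}"
    have "B \<subseteq> ?K" using B(2) span_superset[of B] by (auto simp: lin_zero[OF f])
    then obtain C where C: "B \<subseteq> C" "C \<subseteq> ?K" "independent C" "?K \<subseteq> span C"
      using maximal_independent_subset_extend[OF _ B(1)] by metis
    have "f b \<in> span (C - {b})" if "b \<in> C" for b
    proof (cases "b \<in> B")
      case True
      then show ?thesis using B(3) span_mono[of "B - {b}" "C - {b}"] C(1) by blast
    next
      case False
      have "f b \<in> span B" using C(2) that unfolding B(2) by (auto simp: fn)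
      then show ?thesis using span_mono[of B "C - {b}"] C(1) False by blast
    qed
    moreover have "span C = ?K" using C(2,4) span_minimal[OF C(2) sub[of "Suc n"]] by blast
    ultimately show ?case using C(3) by blast
  qed
  have "\<exists>N. \<forall>b\<in>Basis. (f ^^ N) b = 0"
  proof -
    obtain n where n: "(f ^^ n b) b = 0" for b using nil by metis
    have "(f ^^ Max (n ` Basis)) b = 0" if "b \<in> Basis" for b
    proof -
      have "n b \<le> Max (n ` Basis)" using that finite_Basis by simp
      then obtain k where "Max (n ` Basis) = k + n b" by (metis add.commute le_iff_add)
      then show ?thesis using n[of b] lin_zero[OF lin_funpow[OF f]] by (simp add: funpow_add)
    qed
    then show ?thesis by blast
  qed
  then obtain N where N: "\<And>b. b \<in> Basis \<Longrightarrow> (f ^^ N) b = 0" by blast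
  have "span Basis \<subseteq> {x. (f ^^ N) x = 0}" using N sub by (intro span_minimal) auto
  then have all: "{x. (f ^^ N) x = 0} = UNIV" using span_Basis by auto
  obtain B where B: "independent B" "span B = UNIV" "\<And>b. b \<in> B \<Longrightarrow> f b \<in> span (B - {b})"
    using step[of N] unfolding all by blast
  then have basis: "basis B" by (simp add: basis_def)
  have "representation B (f b) b = 0" if "b \<in> B" for b
    using rep_span_zero[OF basis, of "B - {b}" "f b" b] B(3)[OF that] by auto
  then show ?thesis unfolding tr_eq[OF basis f] ptr_def by simp
qed

section \<open>Generalized eigenspaces\<close>

definition geig :: "('v \<Rightarrow> 'v) \<Rightarrow> complex \<Rightarrow> 'v set" where
  "geig f a = {x. \<exists>n. ((\<lambda>y. f y - scale a y) ^^ n) x = 0}"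

lemma funpow_zero_mono:
  assumes "lin g" "(g ^^ n) x = 0" "n \<le> m"
  shows "(g ^^ m) x = 0"
proof -
  obtain k where "m = k + n" using assms(3) by (metis add.commute le_iff_add)
  then show ?thesis using assms lin_zero[OF lin_funpow[OF assms(1)]] by (simp add: funpow_add)
qed

lemma subspace_geig:
  assumes "lin f"
  shows "subspace (geig f a)"
proof -
  let ?g = "\<lambda>y. f y - scale a y"
  have g: "lin ?g" by (rule lin_shift[OF assms])
  have "x + y \<in> geig f a" if "x \<in> geig f a" "y \<in> geig f a" for x y
  proof -
    obtain m n where "(?g ^^ m) x = 0" "(?g ^^ n) y = 0" using \<open>x \<in> _\<close> \<open>y \<in> _\<close> unfolding geig_def by blast
    then have "(?g ^^ max m n) x = 0" "(?g ^^ max m n) y = 0" using funpow_zero_mono[OF g] by auto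
    then have "(?g ^^ max m n) (x + y) = 0" using lin_add[OF lin_funpow[OF g]] by simp
    then show ?thesis unfolding geig_def by blast
  qed
  moreover have "scale c x \<in> geig f a" if "x \<in> geig f a" for c x
    using that lin_scale[OF lin_funpow[OF g]] unfolding geig_def by fastforce
  moreover have "0 \<in> geig f a" unfolding geig_def by (auto intro: exI[of _ 0])
  ultimately show ?thesis by (simp add: subspace_def)
qed

lemma geig_shift:
  assumes "lin f" "x \<in> geig f a"
  shows "f x - scale b x \<in> geig f a"
proof -
  let ?g = "\<lambda>y. f y - scale a y"
  have g: "lin ?g" by (rule lin_shift[OF assms(1)])
  obtain n where n: "(?g ^^ n) x = 0" using assms(2) unfolding geig_def by blast
  have "(?g ^^ n) (?g x) = ?g ((?g ^^ n) x)" by (metis funpow_swap1)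
  also have "\<dots> = 0" using n lin_zero[OF g] by simp
  finally have "?g x \<in> geig f a" unfolding geig_def by blast
  moreover have "f x - scale b x = ?g x + scale (a - b) x" by (simp add: scale_left_diff_distrib)
  ultimately show ?thesis
    using subspace_add[OF subspace_geig[OF assms(1)] _ subspace_scale[OF subspace_geig[OF assms(1)] assms(2)]]
    by (simp only:)
qed

lemma geig_shift_zero:
  assumes "lin f" "x \<in> geig f a" "f x = scale b x" "b \<noteq> a"
  shows "x = 0"
proof -
  obtain n where n: "((\<lambda>y. f y - scale a y) ^^ n) x = 0" using assms(2) unfolding geig_def by blast
  have "((\<lambda>y. f y - scale a y) ^^ n) x = scale ((b - a) ^ n) x" for n
    by (induction n) (simp_all add: lin_scale[OF assms(1)] assms(3) mult.commute
      scale_left_diff_distrib[symmetric] left_diff_distrib)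
  then show ?thesis using n assms(4) by simp
qed

text \<open>Induction on \<open>F\<close>: a power of \<open>f - d\<close> kills the component for
  the new value \<open>d\<close>, and it is injective on the generalized eigenspaces of all other
  values.\<close>

lemma geig_independent:
  assumes "lin f" "finite F" "\<And>a. a \<in> F \<Longrightarrow> y a \<in> geig f a" "(\<Sum>a\<in>F. y a) = 0" "a \<in> F"
  shows "y a = 0"
  using assms(2-)
proof (induction F arbitrary: y a rule: finite_induct)
  case (insert d F)
  let ?g = "\<lambda>x. f x - scale d x"
  have g: "lin ?g" by (rule lin_shift[OF assms(1)])
  have "y d \<in> geig f d" using insert.prems by simp
  then obtain n where n: "(?g ^^ n) (y d) = 0" unfolding geig_def by blast
  have mem: "(?g ^^ m) x \<in> geig f c" if "x \<in> geig f c" for m x c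
    using that geig_shift[OF assms(1)] by (induction m) auto
  have "(\<Sum>a\<in>F. (?g ^^ n) (y a)) = (?g ^^ n) (\<Sum>a\<in>insert d F. y a)"
    using insert.hyps n by (simp add: lin_sum[OF lin_funpow[OF g]] lin_add[OF lin_funpow[OF g]])
  also have "\<dots> = 0" using insert.prems lin_zero[OF lin_funpow[OF g]] by simp
  finally have 0: "(?g ^^ n) (y a) = 0" if "a \<in> F" for a
    using insert.IH[of "\<lambda>a. (?g ^^ n) (y a)" a] mem insert.prems(1) that by simp
  have inj: "x = 0" if "x \<in> geig f c" "c \<noteq> d" "(?g ^^ m) x = 0" for x c m
    using that
  proof (induction m arbitrary: x)
    case (Suc m)
    have "(?g ^^ m) (?g x) = 0" using Suc.prems(3) unfolding funpow_Suc_right by simp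
    then have "?g x = 0"
      using Suc.IH[OF geig_shift[OF assms(1) Suc.prems(1)] Suc.prems(2)] by blast
    then show ?case using geig_shift_zero[OF assms(1) Suc.prems(1), of d] Suc.prems(2) by simp
  qed auto
  have F0: "y a = 0" if "a \<in> F" for a
    using inj[OF _ _ 0[OF that], of a] insert.prems(1) that insert.hyps by blast
  then have "y d = 0" using insert.prems(2) insert.hyps by simp
  then show ?case using F0 insert.prems(3) by blast
qed auto

text \<open>Since \<open>f - a\<close> is \<open>b - a\<close> plus \<open>f - b\<close>, a solution
  \<open>z\<close> for the right-hand side \<open>(f - b) y\<close>, which has smaller nilpotency
  order, gives the solution \<open>(y - z) / (b - a)\<close> for \<open>y\<close>.\<close>

lemma geig_surj:
  assumes f: "lin f" and "y \<in> geig f b" "b \<noteq> a"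
  shows "\<exists>z \<in> geig f b. f z - scale a z = y"
proof -
  let ?g = "\<lambda>x. f x - scale b x"
  obtain n where "(?g ^^ n) y = 0" using assms(2) unfolding geig_def by blast
  then show ?thesis
    using assms(2)
  proof (induction n arbitrary: y)
    case 0
    then show ?case by (intro bexI[of _ 0]) (auto simp: lin_zero[OF f])
  next
    case (Suc n)
    have "(?g ^^ n) (?g y) = 0" using Suc.prems(1) unfolding funpow_Suc_right by simp
    then obtain z where z: "z \<in> geig f b" "f z - scale a z = ?g y"
      using Suc.IH[OF _ geig_shift[OF f Suc.prems(2)]] by blast
    let ?z = "scale (inverse (b - a)) (y - z)"
    have "?z \<in> geig f b" using subspace_geig[OF f] z(1) Suc.prems(2) by (simp add: subspace_diff subspace_scale)
    moreover have "f ?z - scale a ?z = scale (inverse (b - a)) ((f y - scale a y) - (f z - scale a z))"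
      by (simp add: lin_scale[OF f] lin_diff[OF f] scale_right_diff_distrib mult.commute algebra_simps)
    moreover have "(f y - scale a y) - (f z - scale a z) = scale (b - a) y"
      unfolding z(2) by (simp add: scale_left_diff_distrib)
    ultimately show ?case using assms(3) by (intro bexI[of _ ?z]) auto
  qed
qed

text \<open>The vector \<open>p(f) v\<close>, evaluated by Horner's scheme.\<close>

definition pact :: "('v \<Rightarrow> 'v) \<Rightarrow> 'v \<Rightarrow> complex poly \<Rightarrow> 'v" where
  "pact f v p = fold_coeffs (\<lambda>a w. scale a v + f w) p 0"

lemma pact_0 [simp]: "pact f v 0 = 0"
  by (simp add: pact_def)

lemma pact_pCons: "lin f \<Longrightarrow> pact f v (pCons a p) = scale a v + f (pact f v p)"
  by (cases "p = 0"; cases "a = 0") (auto simp: pact_def lin_zero)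

lemma pact_add: "lin f \<Longrightarrow> pact f v (p + q) = pact f v p + pact f v q"
  by (induction p q rule: poly_induct2) (auto simp: pact_pCons lin_add scale_left_distrib)

lemma pact_smult: "lin f \<Longrightarrow> pact f v (smult c p) = scale c (pact f v p)"
  by (induction p) (auto simp: pact_pCons lin_scale scale_right_distrib)

lemma pact_diff: "lin f \<Longrightarrow> pact f v (p - q) = pact f v p - pact f v q"
  using pact_add[of f v p "smult (- 1) q"] pact_smult[of f v "- 1" q] by simp

lemma pact_monom: "lin f \<Longrightarrow> pact f v (monom c n) = scale c ((f ^^ n) v)"
  by (induction n) (auto simp: pact_pCons monom_Suc monom_0 lin_zero lin_scale)

lemma pact_sum: "lin f \<Longrightarrow> pact f v (\<Sum>i\<in>I. p i) = (\<Sum>i\<in>I. pact f v (p i))"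
  by (induction I rule: infinite_finite_induct) (auto simp: pact_add)

lemma pact_annihilator:
  assumes "lin f"
  shows "\<exists>p. p \<noteq> 0 \<and> pact f v p = 0"
proof -
  let ?n = "Suc (card Basis)"
  let ?g = "\<lambda>i. (f ^^ i) v"
  show ?thesis
  \<comment> \<open>Coinciding powers are split off because linear dependence is a property of the
    set of powers, not of the family.\<close>
  proof (cases "inj_on ?g {..<?n}")
    case False
    then obtain i j where "i \<noteq> j" "?g i = ?g j" unfolding inj_on_def by blast
    then have "monom 1 i - monom 1 j \<noteq> (0 :: complex poly)"
      by (metis coeff_monom eq_iff_diff_eq_0 zero_neq_one)
    moreover have "pact f v (monom 1 i - monom 1 j) = 0"
      using \<open>?g i = ?g j\<close> assms by (simp add: pact_diff pact_monom)
    ultimately show ?thesis by blast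
  next
    case True
    let ?S = "?g ` {..<?n}"
    have "card ?S = ?n" using True by (simp add: card_image)
    then have "card ?S > dim ?S" using dim_subset_UNIV[of ?S] dimension_def by simp
    then have "dependent ?S" using independent_card_le_dim[of ?S ?S] by force
    then obtain u where u: "(\<Sum>x\<in>?S. scale (u x) x) = 0" "\<exists>x\<in>?S. u x \<noteq> 0"
      using dependent_finite[of ?S] by auto
    let ?p = "\<Sum>i<?n. monom (u (?g i)) i"
    have "coeff ?p i = u (?g i)" if "i < ?n" for i
      using that by (simp add: coeff_sum)
    then have "?p \<noteq> 0" using u(2) by (metis (no_types, lifting) coeff_0 imageE lessThan_iff)
    moreover have "pact f v ?p = (\<Sum>x\<in>?S. scale (u x) x)"
      using True by (simp only: pact_sum[OF assms] pact_monom[OF assms] sum.reindex comp_def)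
    ultimately show ?thesis using u(1) by metis
  qed
qed

text \<open>For \<open>v\<close> outside the span \<open>?U\<close>, take \<open>p\<close> of
  minimal degree with \<open>p(f) v\<close> in \<open>?U\<close> and split off a root
  \<open>a\<close>. This gives \<open>w\<close> outside \<open>?U\<close> with
  \<open>(f - a) w\<close> inside. Modulo the generalized eigenspace of \<open>a\<close>,
  \<open>f - a\<close> maps \<open>?U\<close> onto itself, so \<open>w\<close> can be corrected by
  some \<open>z\<close> in \<open>?U\<close> until \<open>(f - a) (w - z)\<close> is in that
  eigenspace. Then so is \<open>w - z\<close>, and \<open>w\<close> lies in
  \<open>?U\<close>.\<close>

lemma geig_span:
  assumes f: "lin f"
  shows "span (\<Union>a. geig f a) = UNIV"
proof (rule ccontr)
  let ?U = "span (\<Union>a. geig f a)"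
  assume "?U \<noteq> UNIV"
  then obtain v where v: "v \<notin> ?U" by blast
  define p where "p = (ARG_MIN degree p. p \<noteq> 0 \<and> pact f v p \<in> ?U)"
  have ex: "\<exists>p. p \<noteq> 0 \<and> pact f v p \<in> ?U" using pact_annihilator[OF f, of v] span_zero by metis
  then obtain p0 where "p0 \<noteq> 0 \<and> pact f v p0 \<in> ?U" by blast
  then have p: "p \<noteq> 0" "pact f v p \<in> ?U"
    and min: "\<And>q. q \<noteq> 0 \<Longrightarrow> pact f v q \<in> ?U \<Longrightarrow> degree p \<le> degree q"
    using arg_min_nat_lemma[of "\<lambda>p. p \<noteq> 0 \<and> pact f v p \<in> ?U" p0 degree] unfolding p_def by blast+
  have "\<not> constant (poly p)"
  proof
    assume "constant (poly p)"
    then have "degree p = 0" by (simp add: constant_degree)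
    then obtain a where a: "p = [:a:]" by (rule degree_eq_zeroE)
    then have "scale (inverse a) (scale a v) \<in> ?U"
      using p(2) by (rule_tac span_scale) (simp add: a pact_pCons[OF f] lin_zero[OF f])
    then show False using v p(1) a by simp
  qed
  then obtain a where "poly p a = 0" using fundamental_theorem_of_algebra by blast
  then obtain q where q: "p = [:- a, 1:] * q" by (metis poly_eq_0_iff_dvd dvdE)
  have q0: "q \<noteq> 0" using p(1) q by auto
  have "degree p = Suc (degree q)" unfolding q using q0 by (subst degree_mult_eq) auto
  then have w: "pact f v q \<notin> ?U" using min[OF q0] by auto
  define w where "w = pact f v q"
  have "p = smult (- a) q + pCons 0 q" unfolding q by simp
  then have "pact f v p = f w - scale a w"
    by (simp only: pact_add[OF f] pact_smult[OF f] pact_pCons[OF f]) (simp add: w_def)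
  then have fw: "f w - scale a w \<in> ?U" using p(2) by simp
  have decomp: "\<exists>u\<in>geig f a. \<exists>z\<in>?U. x = u + (f z - scale a z)" if "x \<in> ?U" for x
    using that
  proof (induction rule: span_induct_alt)
    case base
    have "0 \<in> geig f a" using subspace_geig[OF f] subspace_0 by blast
    then show ?case using span_zero lin_zero[OF f] by (intro bexI[of _ 0]) auto
  next
    case (step c y x)
    then obtain u z where uz: "u \<in> geig f a" "z \<in> ?U" "x = u + (f z - scale a z)" by blast
    obtain b where b: "y \<in> geig f b" using step by blast
    show ?case
    proof (cases "b = a")
      case True
      then have "u + scale c y \<in> geig f a"
        using b uz(1) subspace_geig[OF f] by (simp add: subspace_add subspace_scale)
      then show ?thesis using uz by (intro bexI[of _ "u + scale c y"] bexI[of _ z]) (auto simp: add_ac)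
    next
      case False
      then obtain z' where z': "z' \<in> geig f b" "f z' - scale a z' = y" using geig_surj[OF f b] by blast
      have "z' \<in> ?U" using z'(1) by (auto intro: span_base)
      then have "z + scale c z' \<in> ?U" using uz(2) by (intro span_add span_scale)
      moreover have "f (z + scale c z') - scale a (z + scale c z') = (f z - scale a z) + scale c y"
        unfolding z'(2)[symmetric]
        by (simp add: lin_add[OF f] lin_scale[OF f] algebra_simps)
      ultimately show ?thesis using uz by (intro bexI[of _ u] bexI[of _ "z + scale c z'"]) (auto simp: add_ac)
    qed
  qed
  obtain u z where uz: "u \<in> geig f a" "z \<in> ?U" "f w - scale a w = u + (f z - scale a z)"
    using decomp[OF fw] by blast
  have "f (w - z) - scale a (w - z) = u" using uz(3) by (simp add: lin_diff[OF f] algebra_simps)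
  moreover obtain n where "((\<lambda>y. f y - scale a y) ^^ n) u = 0" using uz(1) unfolding geig_def by blast
  ultimately have "((\<lambda>y. f y - scale a y) ^^ Suc n) (w - z) = 0"
    unfolding funpow_Suc_right by simp
  then have "w - z \<in> geig f a" unfolding geig_def by blast
  then have "(w - z) + z \<in> ?U" using uz(2) by (intro span_add) (auto intro: span_base)
  then show False using w unfolding w_def by simp
qed

lemma basis_from_spanning:
  assumes "span S = UNIV"
  obtains B where "basis B" "B \<subseteq> S"
proof -
  obtain B where "B \<subseteq> S" "independent B" "S \<subseteq> span B" using maximal_independent_subset by blast
  then have "span S \<subseteq> span B" using span_minimal subspace_span by blast
  then have "basis B" using assms \<open>independent B\<close> by (auto simp: basis_def)
  with \<open>B \<subseteq> S\<close> show ?thesis by (rule that[rotated])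
qed

lemma geig_basis:
  assumes "lin f"
  obtains B val where "basis B" "\<And>b. b \<in> B \<Longrightarrow> b \<in> geig f (val b)"
proof -
  obtain B where B: "basis B" "B \<subseteq> (\<Union>a. geig f a)"
    using basis_from_spanning[OF geig_span[OF assms]] by blast
  then have "\<forall>b\<in>B. \<exists>a. b \<in> geig f a" by blast
  then obtain val where "\<And>b. b \<in> B \<Longrightarrow> b \<in> geig f (val b)" by metis
  with B(1) show ?thesis by (rule that)
qed

lemma geig_rep:
  assumes f: "lin f" and B: "basis B" "\<And>b. b \<in> B \<Longrightarrow> b \<in> geig f (val b)"
    and x: "x \<in> geig f a" and b: "b \<in> B" "val b \<noteq> a"
  shows "representation B x b = 0"
proof -
  let ?r = "representation B x"
  let ?F = "insert a (val ` B)"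
  \<comment> \<open>The \<open>c\<close>-component of \<open>x\<close> in the basis, corrected by
    \<open>x\<close> itself in degree \<open>a\<close>; by construction these vectors add up to
    0.\<close>
  define y where "y c = (\<Sum>b | b \<in> B \<and> val b = c. scale (?r b) b) - (if c = a then x else 0)" for c
  note fB = basis_finite[OF B(1)]
  have "(\<Sum>c\<in>?F. y c) = (\<Sum>c\<in>?F. \<Sum>b | b \<in> B \<and> val b = c. scale (?r b) b) - x"
    unfolding y_def sum_subtractf using fB by simp
  also have "(\<Sum>c\<in>?F. \<Sum>b | b \<in> B \<and> val b = c. scale (?r b) b) = (\<Sum>b\<in>B. scale (?r b) b)"
    by (rule sum.group) (use fB in auto)
  finally have "(\<Sum>c\<in>?F. y c) = 0" using basis_expand[OF B(1)] by simp
  moreover have "y c \<in> geig f c" for c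
    unfolding y_def using subspace_geig[OF f, of c] B(2) x
    by (intro subspace_diff subspace_sum) (auto simp: subspace_0 intro!: subspace_scale)
  ultimately have "y (val b) = 0"
    using geig_independent[OF f, of ?F y "val b"] fB b(1) by blast
  then have "representation B (\<Sum>c | c \<in> B \<and> val c = val b. scale (?r c) c) b = 0"
    using b(2) by (simp add: y_def)
  also have "representation B (\<Sum>c | c \<in> B \<and> val c = val b. scale (?r c) c) b
      = (\<Sum>c | c \<in> B \<and> val c = val b. if c = b then ?r c else 0)"
    unfolding rep_sum[OF B(1)] by (rule sum.cong) (auto simp: rep_scale[OF B(1)] rep_basis[OF B(1)])
  finally show ?thesis using fB b(1) by simp
qed

end

section \<open>The Killing form and Cartan subalgebras\<close>

context complex_space
begin

lemma lin_zero_fun: "lin (\<lambda>_. 0)"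
  by (rule linI) auto

lemma diagonalizable_geig:
  assumes f: "lin f" and d: "span {v. \<exists>c. f v = scale c v} = UNIV" and x: "x \<in> geig f a"
  shows "f x = scale a x"
proof -
  obtain B where B: "basis B" "B \<subseteq> {v. \<exists>c. f v = scale c v}"
    using basis_from_spanning[OF d] by blast
  then have "\<forall>b\<in>B. \<exists>c. f b = scale c b" by blast
  then obtain val where val: "\<And>b. b \<in> B \<Longrightarrow> f b = scale (val b) b" by metis
  have "((\<lambda>y. f y - scale (val b) y) ^^ 1) b = 0" if "b \<in> B" for b using val[OF that] by simp
  then have bg: "b \<in> geig f (val b)" if "b \<in> B" for b using that unfolding geig_def by blast
  have 0: "representation B x b = 0" if "b \<in> B" "val b \<noteq> a" for b
    by (rule geig_rep[where val = val, OF f B(1) bg x that])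
  have "f (\<Sum>b\<in>B. scale (representation B x b) b) = (\<Sum>b\<in>B. scale (representation B x b) (f b))"
    by (simp add: lin_sum[OF f] lin_scale[OF f])
  then have "f x = (\<Sum>b\<in>B. scale (representation B x b) (f b))"
    unfolding basis_expand[OF B(1)] .
  also have "\<dots> = (\<Sum>b\<in>B. scale a (scale (representation B x b) b))"
  proof (rule sum.cong[OF refl])
    fix b assume b: "b \<in> B"
    then show "scale (representation B x b) (f b) = scale a (scale (representation B x b) b)"
      using 0[OF b] val[OF b] by (cases "val b = a") (auto simp: mult.commute)
  qed
  also have "\<dots> = scale a x" unfolding scale_sum_right[symmetric] basis_expand[OF B(1)] ..
  finally show ?thesis .
qed

lemma eigenvector_geig: "f v = scale c v \<Longrightarrow> v \<in> geig f c"
  unfolding geig_def by (auto intro!: exI[of _ "1::nat"])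

text \<open>Splitting a vector into eigenvectors of \<open>g\<close> preserves its eigenvector equations for
  operators commuting with \<open>g\<close>.\<close>

lemma eigenvector_split:
  assumes g: "lin g" and d: "span {v. \<exists>c. g v = scale c v} = UNIV"
  shows "v \<in> span {y. (\<exists>c. g y = scale c y) \<and>
    (\<forall>f a. lin f \<longrightarrow> (\<forall>x. f (g x) = g (f x)) \<longrightarrow> f v = scale a v \<longrightarrow> f y = scale a y)}"
proof -
  obtain B where B: "basis B" "B \<subseteq> {v. \<exists>c. g v = scale c v}"
    using basis_from_spanning[OF d] by blast
  then have "\<forall>b\<in>B. \<exists>c. g b = scale c b" by blast
  then obtain val where val: "\<And>b. b \<in> B \<Longrightarrow> g b = scale (val b) b" by metis
  note fB = basis_finite[OF B(1)]
  define y where "y c = (\<Sum>b | b \<in> B \<and> val b = c. scale (representation B v b) b)" for c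
  have "(\<Sum>c\<in>val ` B. y c) = (\<Sum>b\<in>B. scale (representation B v b) b)"
    unfolding y_def by (rule sum.group) (use fB in auto)
  then have v: "(\<Sum>c\<in>val ` B. y c) = v" using basis_expand[OF B(1)] by simp
  have gy: "g (y c) = scale c (y c)" for c
    unfolding y_def lin_sum[OF g] scale_sum_right
    by (rule sum.cong) (auto simp: lin_scale[OF g] val mult.commute)
  have "f (y c) = scale a (y c)"
    if f: "lin f" "\<And>x. f (g x) = g (f x)" "f v = scale a v" and c: "c \<in> val ` B" for f a c
  proof -
    let ?z = "\<lambda>c. f (y c) - scale a (y c)"
    have "(\<Sum>c\<in>val ` B. ?z c) = 0"
      unfolding sum_subtractf lin_sum[OF f(1), symmetric] scale_sum_right[symmetric] v f(3) by simp
    moreover have "?z c \<in> geig g c" for c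
    proof (rule eigenvector_geig)
      have "g (f (y c)) = scale c (f (y c))" using f(2)[of "y c"] gy[of c] lin_scale[OF f(1)] by simp
      then show "g (?z c) = scale c (?z c)"
        using gy[of c] by (simp add: lin_diff[OF g] lin_scale[OF g] scale_right_diff_distrib mult.commute)
    qed
    ultimately have "?z c = 0"
      using geig_independent[OF g, of "val ` B" ?z c] fB c by blast
    then show ?thesis by simp
  qed
  then have "y c \<in> {y. (\<exists>c. g y = scale c y) \<and>
      (\<forall>f a. lin f \<longrightarrow> (\<forall>x. f (g x) = g (f x)) \<longrightarrow> f v = scale a v \<longrightarrow> f y = scale a y)}"
    if "c \<in> val ` B" for c using gy that by blast
  then show ?thesis unfolding v[symmetric] by (intro span_sum span_base)
qed

lemma span_UNIV_bind:
  assumes "span S = UNIV" "\<And>v. v \<in> S \<Longrightarrow> v \<in> span T"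
  shows "span T = UNIV"
  using assms span_minimal[of S "span T"] subspace_span by blast

end

section \<open>Brackets, the Killing form and graded derivations\<close>

sublocale complex_lie_algebra \<subseteq> complex_space scale Basis ..

context complex_lie_algebra
begin

lemma lin_brk: "lin (brk x)"
  by (rule linI) (simp_all add: brk_add_right brk_scale_right)

lemma lin_brk_left: "lin (\<lambda>x. brk x y)"
  by (rule linI) (simp_all add: brk_add_left brk_scale_left)

lemma brk_zero_left [simp]: "brk 0 x = 0"
  using lin_zero[OF lin_brk_left] .

lemma brk_zero_right [simp]: "brk x 0 = 0"
  using lin_zero[OF lin_brk] .

lemma brk_minus_right: "brk x (- y) = - brk x y"
  using lin_neg[OF lin_brk] .

lemma brk_diff_left: "brk (x - y) z = brk x z - brk y z"
  using lin_diff[OF lin_brk_left] .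

lemma brk_diff_right: "brk x (y - z) = brk x y - brk x z"
  using lin_diff[OF lin_brk] .

lemma brk_anti: "brk x y = - brk y x"
proof -
  have "brk (x + y) x + brk (x + y) y = 0" using brk_self[of "x + y"] unfolding brk_add_right .
  then show ?thesis
    unfolding brk_add_left brk_self by (simp add: eq_neg_iff_add_eq_0 add.commute)
qed

lemma brk_derivation: "brk x (brk y z) = brk (brk x y) z + brk y (brk x z)"
proof -
  have "brk y (brk z x) = - brk y (brk x z)" by (simp only: brk_anti[of z x] brk_minus_right)
  moreover have "brk z (brk x y) = - brk (brk x y) z" by (rule brk_anti)
  ultimately have "brk x (brk y z) - brk y (brk x z) - brk (brk x y) z = 0"
    using jacobi[of x y z] by simp
  then show ?thesis by (simp add: algebra_simps)
qed

lemma trace_tr: "trace f = tr f"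
  by (simp add: trace_def tr_def ptr_def)

lemma killing_tr: "killing x y = tr (\<lambda>z. brk x (brk y z))"
  by (simp add: killing_def trace_tr)

lemma killing_sym: "killing x y = killing y x"
  unfolding killing_tr by (rule tr_swap[OF lin_brk lin_brk])

lemma killing_add_left: "killing (x + y) z = killing x z + killing y z"
  unfolding killing_tr by (simp add: brk_add_left tr_add)

lemma killing_scale_left: "killing (scale c x) z = c * killing x z"
  unfolding killing_tr by (simp add: brk_scale_left tr_scale)

lemma killing_add_right: "killing z (x + y) = killing z x + killing z y"
  using killing_add_left killing_sym by metis

lemma killing_scale_right: "killing z (scale c x) = c * killing z x"
  using killing_scale_left killing_sym by metis

lemma killing_zero_left [simp]: "killing 0 x = 0"
  using killing_scale_left[of 0 0 x] by simp

lemma killing_zero_right [simp]: "killing x 0 = 0"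
  using killing_sym killing_zero_left by metis

lemma killing_minus_left: "killing (- x) y = - killing x y"
  using killing_add_left[of x "- x" y] by (simp add: eq_neg_iff_add_eq_0 add.commute)

lemma killing_diff_left: "killing (x - y) z = killing x z - killing y z"
  using killing_add_left[of x "- y" z] killing_minus_left by simp

lemma killing_sum_left: "killing (\<Sum>i\<in>I. f i) z = (\<Sum>i\<in>I. killing (f i) z)"
  by (induction I rule: infinite_finite_induct) (auto simp: killing_add_left)

lemma killing_sum_right: "killing z (\<Sum>i\<in>I. f i) = (\<Sum>i\<in>I. killing z (f i))"
  by (induction I rule: infinite_finite_induct) (auto simp: killing_add_right)

lemma killing_invariant: "killing (brk x y) z = killing x (brk y z)"
proof -
  have "killing (brk x y) z = tr (\<lambda>w. brk x (brk y (brk z w)) - brk y (brk x (brk z w)))"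
    unfolding killing_tr using brk_derivation[of x y] by (simp add: algebra_simps)
  also have "\<dots> = tr (\<lambda>w. brk x (brk y (brk z w))) - tr (\<lambda>w. brk x (brk z (brk y w)))"
    unfolding tr_diff using tr_swap[of "\<lambda>w. brk x (brk z w)" "brk y", OF lin_comp[OF lin_brk lin_brk] lin_brk] by simp
  also have "\<dots> = killing x (brk y z)"
    unfolding killing_tr tr_diff[symmetric]
    using brk_derivation[of y z] by (simp add: brk_diff_right[symmetric])
  finally show ?thesis .
qed

lemma killing_lin_eq:
  assumes "span S = UNIV" "\<And>y. y \<in> S \<Longrightarrow> killing x y = 0"
  shows "killing x y = 0"
proof -
  have "y \<in> span S" using assms by simp
  then show ?thesis
    by (induction rule: span_induct_alt) (auto simp: killing_add_right killing_scale_right assms)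
qed

definition derivation :: "('g \<Rightarrow> 'g) \<Rightarrow> bool" where
  "derivation D \<longleftrightarrow> lin D \<and> (\<forall>x y. D (brk x y) = brk (D x) y + brk x (D y))"

text \<open>\<open>ad u - (a + b)\<close> maps \<open>[x, y]\<close> to
  \<open>[(u - a) x, y] + [x, (u - b) y]\<close>, so induction on the sum of the two nilpotency
  orders applies.\<close>

lemma geig_brk:
  assumes "x \<in> geig (brk u) a" "y \<in> geig (brk u) b"
  shows "brk x y \<in> geig (brk u) (a + b)"
proof -
  let ?T = "\<lambda>c y. brk u y - scale c y"
  have "\<exists>N. (?T (a + b) ^^ N) (brk x y) = 0"
    if "(?T a ^^ m) x = 0" "(?T b ^^ n) y = 0" for m n x y
    using that
  proof (induction "m + n" arbitrary: m n x y)
    case 0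
    then show ?case by (auto intro!: exI[of _ "0::nat"])
  next
    case (Suc k)
    show ?case
    proof (cases "m = 0 \<or> n = 0")
      case True
      then have "brk x y = 0" using Suc.prems by auto
      then show ?thesis by (auto intro!: exI[of _ "0::nat"])
    next
      case False
      then obtain m' n' where mn: "m = Suc m'" "n = Suc n'" by (metis not0_implies_Suc)
      have "(?T a ^^ m') (?T a x) = 0" "(?T b ^^ n') (?T b y) = 0"
        using Suc.prems unfolding mn funpow_Suc_right by simp_all
      then obtain N1 N2 where N: "(?T (a + b) ^^ N1) (brk (?T a x) y) = 0"
        "(?T (a + b) ^^ N2) (brk x (?T b y)) = 0"
        using Suc.hyps(1)[of m' n "?T a x" y] Suc.hyps(1)[of m n' x "?T b y"] Suc.prems Suc.hyps(2) mn
        by auto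
      have T: "lin (?T (a + b))" by (rule lin_shift[OF lin_brk])
      let ?N = "max N1 N2"
      have "?T (a + b) (brk x y) = brk (?T a x) y + brk x (?T b y)"
        by (simp add: brk_derivation[of u] brk_diff_left brk_diff_right brk_scale_left brk_scale_right
            scale_left_distrib algebra_simps)
      then have "(?T (a + b) ^^ Suc ?N) (brk x y)
          = (?T (a + b) ^^ ?N) (brk (?T a x) y) + (?T (a + b) ^^ ?N) (brk x (?T b y))"
        unfolding funpow_Suc_right by (simp add: lin_add[OF lin_funpow[OF T]])
      also have "\<dots> = 0" using funpow_zero_mono[OF T N(1)] funpow_zero_mono[OF T N(2)] by simp
      finally show ?thesis by blast
    qed
  qed
  then show ?thesis using assms unfolding geig_def by blast
qed

lemma graded_derivation:
  assumes add: "\<And>a b. \<phi> (a + b) = \<phi> a + \<phi> b"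
  obtains D where "derivation D" "\<And>a y. y \<in> geig (brk u) a \<Longrightarrow> D y = scale (\<phi> a) y"
proof -
  obtain B val where B: "basis B" "\<And>b. b \<in> B \<Longrightarrow> b \<in> geig (brk u) (val b)"
    using geig_basis[OF lin_brk[of u]] by blast
  define D where "D y = (\<Sum>b\<in>B. scale (representation B y b * \<phi> (val b)) b)" for y
  have lin: "lin D"
    by (rule linI) (simp_all add: D_def rep_add[OF B(1)] rep_scale[OF B(1)] distrib_right
        scale_left_distrib sum.distrib scale_sum_right mult.assoc)
  have D: "D y = scale (\<phi> a) y" if y: "y \<in> geig (brk u) a" for a y
  proof -
    have "D y = (\<Sum>b\<in>B. scale (representation B y b * \<phi> (val b)) b)" by (simp only: D_def)
    also have "\<dots> = (\<Sum>b\<in>B. scale (\<phi> a) (scale (representation B y b) b))"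
    proof (rule sum.cong[OF refl])
      fix b assume "b \<in> B"
      then show "scale (representation B y b * \<phi> (val b)) b = scale (\<phi> a) (scale (representation B y b) b)"
        using geig_rep[OF lin_brk B y, of b] by (cases "val b = a") (auto simp: mult.commute)
    qed
    also have "\<dots> = scale (\<phi> a) y" unfolding scale_sum_right[symmetric] basis_expand[OF B(1)] ..
    finally show ?thesis .
  qed
  let ?S = "\<Union>a. geig (brk u) a"
  have S: "span ?S = UNIV" by (rule geig_span[OF lin_brk])
  have 1: "D (brk x y) = brk (D x) y + brk x (D y)" if x: "x \<in> geig (brk u) a" for a x y
  proof (rule lin_eq_on_span[where S = ?S and x = y and f = "\<lambda>y. D (brk x y)"
        and g = "\<lambda>y. brk (D x) y + brk x (D y)"])
    show "lin (\<lambda>y. D (brk x y))" by (rule lin_comp[OF lin lin_brk])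
    show "lin (\<lambda>y. brk (D x) y + brk x (D y))" by (intro lin_plus lin_brk lin_comp[OF lin_brk lin])
    show "D (brk x y) = brk (D x) y + brk x (D y)" if y: "y \<in> ?S" for y
    proof -
      obtain b where y: "y \<in> geig (brk u) b" using y by blast
      show ?thesis
        unfolding D[OF x] D[OF y] D[OF geig_brk[OF x y]] brk_scale_left brk_scale_right add
        by (simp add: scale_left_distrib)
    qed
  qed (simp add: S)
  have 2: "D (brk x y) = brk (D x) y + brk x (D y)" for x y
  proof (rule lin_eq_on_span[where S = ?S and x = x and f = "\<lambda>x. D (brk x y)"
        and g = "\<lambda>x. brk (D x) y + brk x (D y)"])
    show "lin (\<lambda>x. D (brk x y))" by (rule lin_comp[OF lin lin_brk_left])
    show "lin (\<lambda>x. brk (D x) y + brk x (D y))" by (intro lin_plus lin_brk_left lin_comp[OF lin_brk_left lin])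
    show "D (brk x y) = brk (D x) y + brk x (D y)" if "x \<in> ?S" for x using that 1 by blast
  qed (simp add: S)
  have "derivation D" unfolding derivation_def using lin 2 by blast
  then show ?thesis using that D by blast
qed

lemma diagonalizable_eigen:
  "diagonalizable (brk x) \<Longrightarrow> y \<in> geig (brk x) a \<Longrightarrow> brk x y = scale a y"
  unfolding diagonalizable_def by (rule diagonalizable_geig[OF lin_brk])

lemma brk_commute_ops: "brk x y = 0 \<Longrightarrow> brk x (brk y z) = brk y (brk x z)"
  using brk_derivation[of x y z] by simp

end

section \<open>Nondegeneracy of the Killing form, inner derivations and maximality of
  \<open>H\<close>\<close>

context simple_lie_algebra
begin

lemma center_zero:
  assumes "\<And>y. brk x y = 0"
  shows "x = 0"
proof -
  let ?Z = "{x. \<forall>y. brk x y = 0}"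
  have "lie_ideal ?Z"
    unfolding lie_ideal_def subspace_def
    by (auto simp: brk_add_left brk_scale_left) (metis brk_anti brk_zero_left neg_equal_0_iff_equal)
  then show ?thesis using simple nonabelian assms by blast
qed

lemma brackets_span: "span {brk x y | x y. True} = UNIV"
proof -
  let ?I = "span {brk x y | x y. True}"
  have "brk x y \<in> ?I" for x y by (rule span_base) blast
  then have "lie_ideal ?I" unfolding lie_ideal_def using subspace_span by blast
  moreover have "?I \<noteq> {0}"
  proof -
    obtain x y where "brk x y \<noteq> 0" using nonabelian by blast
    then show ?thesis using \<open>\<And>y x. brk x y \<in> ?I\<close> by (metis singletonD)
  qed
  ultimately show ?thesis using simple by blast
qed

text \<open>A simple algebra is spanned by brackets, and for \<open>w = [u, v]\<close> cyclicity of
  the trace turns the left-hand side into \<open>- killing u (D v)\<close>.\<close>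

lemma tr_ad_derivation:
  assumes K: "\<And>x y. killing x y = 0" and D: "derivation D"
  shows "tr (\<lambda>z. brk w (D z)) = 0"
proof -
  have lD: "lin D" and dD: "\<And>x y. D (brk x y) = brk (D x) y + brk x (D y)"
    using D unfolding derivation_def by blast+
  have "w \<in> span {brk x y | x y. True}" using brackets_span by simp
  then show ?thesis
  proof (induction rule: span_induct_alt)
    case base
    show ?case using tr_scale[of 0 "\<lambda>z. z"] by simp
  next
    case (step c x w)
    obtain u v where x: "x = brk u v" using step by blast
    have "tr (\<lambda>z. brk x (D z)) = tr (\<lambda>z. brk u (brk v (D z)) - brk v (brk u (D z)))"
      unfolding x using brk_derivation[of u v] by (simp add: algebra_simps)
    also have "\<dots> = tr (\<lambda>z. brk u (brk v (D z))) - tr (\<lambda>z. brk u (D (brk v z)))"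
      unfolding tr_diff using tr_swap[of "\<lambda>z. brk u (D z)" "brk v", OF lin_comp[OF lin_brk lD] lin_brk] by simp
    also have "\<dots> = tr (\<lambda>z. - brk u (brk (D v) z))"
      unfolding tr_diff[symmetric] dD by (simp add: brk_add_right)
    also have "\<dots> = - killing u (D v)"
      unfolding killing_tr using tr_scale[of "-1" "\<lambda>z. brk u (brk (D v) z)"] by simp
    finally have "tr (\<lambda>z. brk x (D z)) = 0" using K by simp
    then show ?case using step
      by (simp add: brk_add_left brk_scale_left tr_add tr_scale)
  qed
qed

end

text \<open>A nonzero element of \<open>H\<close> is the diagonalizable operator on which
  \<open>killing_nondegenerate\<close> tests the form. It is supplied by the Dynkin type in
  \<open>has_type_nontrivial\<close>.\<close>

locale cartan_lie_algebra = rooted_simple_lie_algebra +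
  assumes H_nontrivial: "\<exists>h\<in>H. h \<noteq> 0"
begin

lemma toral_H: "toral H"
  using cartan unfolding cartan_subalgebra_def by blast

lemma H_subspace: "subspace H"
  using toral_H unfolding toral_def by blast

lemma H_commute: "x \<in> H \<Longrightarrow> y \<in> H \<Longrightarrow> brk x y = 0"
  using toral_H unfolding toral_def by blast

lemma H_diagonalizable: "x \<in> H \<Longrightarrow> diagonalizable (brk x)"
  using toral_H unfolding toral_def by blast

text \<open>If the Killing form vanished, then pairing \<open>ad h\<close> with the derivation that acts on its
  \<open>a\<close>-eigenspace by the conjugate of \<open>a\<close> would give \<open>\<Sum> \<bar>a\<bar>\<^sup>2 = 0\<close>.\<close>

lemma killing_nondegenerate:
  assumes "\<And>y. killing x y = 0"
  shows "x = 0"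
proof -
  let ?S = "{x. \<forall>y. killing x y = 0}"
  have "lie_ideal ?S"
    unfolding lie_ideal_def subspace_def
    by (auto simp: killing_add_left killing_scale_left)
      (metis brk_anti killing_invariant killing_minus_left neg_equal_0_iff_equal)
  moreover have "?S \<noteq> UNIV"
  proof
    assume "?S = UNIV"
    then have K: "\<And>x y. killing x y = 0" by blast
    obtain h where h: "h \<in> H" "h \<noteq> 0" using H_nontrivial by blast
    obtain D where D: "derivation D" "\<And>a y. y \<in> geig (brk h) a \<Longrightarrow> D y = scale (cnj a) y"
      by (rule graded_derivation[of cnj h]) auto
    obtain B val where B: "basis B" "\<And>b. b \<in> B \<Longrightarrow> b \<in> geig (brk h) (val b)"
      using geig_basis[OF lin_brk[of h]] by blast
    have eig: "brk h b = scale (val b) b" if "b \<in> B" for b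
      using diagonalizable_eigen[OF H_diagonalizable[OF h(1)] B(2)[OF that]] .
    have "lin D" using D(1) by (simp add: derivation_def)
    have "tr (\<lambda>z. brk h (D z)) = ptr B B (\<lambda>z. brk h (D z))"
      by (rule tr_eq[OF B(1) lin_comp[OF lin_brk \<open>lin D\<close>]])
    also have "\<dots> = (\<Sum>b\<in>B. val b * cnj (val b))"
    proof (rule ptr_diag[OF B(1) subset_refl])
      fix b assume "b \<in> B"
      then show "brk h (D b) = scale (val b * cnj (val b)) b"
        using D(2)[OF B(2)] eig by (simp add: brk_scale_right mult.commute)
    qed
    finally have "(\<Sum>b\<in>B. val b * cnj (val b)) = 0" using tr_ad_derivation[OF K D(1)] by simp
    then have "complex_of_real (\<Sum>b\<in>B. (cmod (val b))\<^sup>2) = 0"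
      by (simp only: complex_norm_square of_real_sum)
    then have "(\<Sum>b\<in>B. (cmod (val b))\<^sup>2) = 0" by (simp only: of_real_eq_0_iff)
    then have "val b = 0" if "b \<in> B" for b
      using that basis_finite[OF B(1)] by (simp add: sum_nonneg_eq_0_iff)
    then have "brk h b = 0" if "b \<in> B" for b using eig that by simp
    then have "brk h y = 0" for y
      using lin_eq_on_span[OF lin_brk lin_zero_fun, of B h y] B(1) by (simp add: basis_def)
    then show False using center_zero h(2) by blast
  qed
  ultimately have "?S = {0}" using simple by blast
  then show ?thesis using assms by blast
qed

text \<open>Nondegeneracy makes the coordinate map \<open>L\<close> of
  \<open>x \<mapsto> killing x\<close> injective, hence surjective in finite dimension.\<close>

lemma killing_represent:
  assumes "\<And>x y. \<phi> (x + y) = \<phi> x + \<phi> y" "\<And>c x. \<phi> (scale c x) = c * \<phi> x"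
  obtains x where "\<And>y. killing x y = \<phi> y"
proof -
  define L where "L x = (\<Sum>b\<in>Basis. scale (killing x b) b)" for x
  have lin: "lin L"
    by (rule linI) (simp_all add: L_def killing_add_left killing_scale_left scale_left_distrib sum.distrib
        scale_sum_right)
  have rL: "representation Basis (L x) b = killing x b" if "b \<in> Basis" for x b
    unfolding L_def rep_sum[OF basis_Basis]
    using that finite_Basis by (simp add: rep_scale[OF basis_Basis] rep_basis[OF basis_Basis] if_distrib
        cong: if_cong)
  have "inj L"
  proof (rule injI)
    fix x y assume "L x = L y"
    then have "killing (x - y) b = 0" if "b \<in> Basis" for b
      using rL[OF that] by (metis killing_diff_left right_minus_eq)
    then have "killing (x - y) z = 0" for z using killing_lin_eq[OF span_Basis] by blast
    then show "x = y" using killing_nondegenerate by (metis right_minus_eq)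
  qed
  then have "surj L" by (rule linear_inj_imp_surj[OF lin])
  then obtain x where x: "L x = (\<Sum>b\<in>Basis. scale (\<phi> b) b)" by (metis surjD)
  have "representation Basis (\<Sum>b\<in>Basis. scale (\<phi> b) b) b = \<phi> b" if "b \<in> Basis" for b
    unfolding rep_sum[OF basis_Basis]
    using that finite_Basis by (simp add: rep_scale[OF basis_Basis] rep_basis[OF basis_Basis] if_distrib
        cong: if_cong)
  then have b: "killing x b = \<phi> b" if "b \<in> Basis" for b using that rL x by metis
  have "killing x y = \<phi> y" for y
  proof -
    have "\<phi> 0 = 0" using assms(2)[of 0 0] by simp
    have "y \<in> span Basis" using span_Basis by simp
    then show ?thesis
      by (induction rule: span_induct_alt)
        (auto simp: \<open>\<phi> 0 = 0\<close> b killing_add_right killing_scale_right assms)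
  qed
  then show ?thesis by (rule that)
qed

text \<open>Let \<open>z\<close> represent the functional
  \<open>y \<mapsto> tr (D \<circ> ad y)\<close>. Then \<open>E = D - ad z\<close> is a derivation
  with \<open>tr (E \<circ> ad y) = 0\<close> for all \<open>y\<close>, and
  \<open>killing (E y) w = tr (E \<circ> ad [y, w])\<close> forces \<open>E = 0\<close>.\<close>

lemma derivation_inner:
  assumes "derivation D"
  obtains z where "\<And>y. D y = brk z y"
proof -
  have lD: "lin D" and dD: "\<And>x y. D (brk x y) = brk (D x) y + brk x (D y)"
    using assms unfolding derivation_def by blast+
  obtain z where z: "\<And>y. killing z y = tr (\<lambda>w. D (brk y w))"
  proof (rule killing_represent[of "\<lambda>y. tr (\<lambda>w. D (brk y w))"])
    show "tr (\<lambda>w. D (brk (x + y) w)) = tr (\<lambda>w. D (brk x w)) + tr (\<lambda>w. D (brk y w))" for x y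
      by (simp add: brk_add_left lin_add[OF lD] tr_add)
    show "tr (\<lambda>w. D (brk (scale c x) w)) = c * tr (\<lambda>w. D (brk x w))" for c x
      by (simp add: brk_scale_left lin_scale[OF lD] tr_scale)
  qed blast
  define E where "E y = D y - brk z y" for y
  have lE: "lin E" unfolding E_def by (rule lin_minus[OF lD lin_brk])
  have dE: "E (brk x y) = brk (E x) y + brk x (E y)" for x y
    unfolding E_def dD brk_derivation[of z] by (simp add: brk_diff_left brk_diff_right algebra_simps)
  have tE: "tr (\<lambda>w. E (brk y w)) = 0" for y
    unfolding E_def tr_diff using z[of y] unfolding killing_tr by simp
  have "killing (E y) w = 0" for y w
  proof -
    have "killing (E y) w = tr (\<lambda>v. E (brk y (brk w v)) - brk y (E (brk w v)))"
      unfolding killing_tr dE by simp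
    also have "\<dots> = tr (\<lambda>v. E (brk y (brk w v))) - tr (\<lambda>v. E (brk w (brk y v)))"
      unfolding tr_diff using tr_swap[of "\<lambda>v. E (brk w v)" "brk y", OF lin_comp[OF lE lin_brk] lin_brk] by simp
    also have "\<dots> = tr (\<lambda>v. E (brk (brk y w) v))"
      unfolding tr_diff[symmetric] lin_diff[OF lE, symmetric]
      using brk_derivation[of y w] by simp
    finally show ?thesis using tE by simp
  qed
  then have "E y = 0" for y using killing_nondegenerate by blast
  then have "D y = brk z y" for y unfolding E_def by (metis right_minus_eq)
  then show ?thesis by (rule that)
qed

text \<open>Adjoining \<open>z\<close> to \<open>H\<close> keeps it toral: an
  \<open>h\<close>-eigenvector splits into \<open>z\<close>-eigenvectors that are still
  \<open>h\<close>-eigenvectors, since \<open>h\<close> and \<open>z\<close> commute.\<close>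

lemma H_maximal:
  assumes z: "\<And>h. h \<in> H \<Longrightarrow> brk z h = 0" and d: "diagonalizable (brk z)"
  shows "z \<in> H"
proof -
  define H' where "H' = {h + scale c z | h c. h \<in> H}"
  have "toral H'"
    unfolding toral_def
  proof (intro conjI ballI)
    show "subspace H'"
      unfolding subspace_def H'_def
    proof (intro conjI ballI allI)
      show "0 \<in> {h + scale c z | h c. h \<in> H}"
        using subspace_0[OF H_subspace] by (auto intro!: exI[of _ 0])
    next
      fix x y assume "x \<in> {h + scale c z | h c. h \<in> H}" "y \<in> {h + scale c z | h c. h \<in> H}"
      then obtain h c h' c' where "x = h + scale c z" "y = h' + scale c' z" "h \<in> H" "h' \<in> H" by blast
      then have "x + y = (h + h') + scale (c + c') z" "h + h' \<in> H"
        using subspace_add[OF H_subspace] by (auto simp: scale_left_distrib)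
      then show "x + y \<in> {h + scale c z | h c. h \<in> H}" by blast
    next
      fix x d assume "x \<in> {h + scale c z | h c. h \<in> H}"
      then obtain h c where "x = h + scale c z" "h \<in> H" by blast
      then have "scale d x = scale d h + scale (d * c) z" "scale d h \<in> H"
        using subspace_scale[OF H_subspace] by (auto simp: scale_right_distrib)
      then show "scale d x \<in> {h + scale c z | h c. h \<in> H}" by blast
    qed
    show "brk x y = 0" if "x \<in> H'" "y \<in> H'" for x y
    proof -
      have "brk h z = 0" if "h \<in> H" for h using z[OF that] brk_anti[of h z] by simp
      then show ?thesis using that z H_commute unfolding H'_def
        by (auto simp: brk_add_left brk_add_right brk_scale_left brk_scale_right brk_self)
    qed
    show "diagonalizable (brk x)" if x: "x \<in> H'" for x
    proof -
      obtain h c where h: "h \<in> H" "x = h + scale c z" using x unfolding H'_def by blast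
      have com: "brk h (brk z w) = brk z (brk h w)" for w
        using brk_commute_ops[OF z[OF h(1)]] by simp
      have "v \<in> span {v. \<exists>c. brk x v = scale c v}" if v: "v \<in> {v. \<exists>c. brk h v = scale c v}" for v
      proof -
        obtain a where a: "brk h v = scale a v" using v by blast
        have "v \<in> span {y. (\<exists>c. brk z y = scale c y) \<and> (\<forall>f a. lin f \<longrightarrow>
            (\<forall>x. f (brk z x) = brk z (f x)) \<longrightarrow> f v = scale a v \<longrightarrow> f y = scale a y)}"
          by (rule eigenvector_split[OF lin_brk d[unfolded diagonalizable_def]])
        moreover have "{y. (\<exists>c. brk z y = scale c y) \<and> (\<forall>f a. lin f \<longrightarrow>
            (\<forall>x. f (brk z x) = brk z (f x)) \<longrightarrow> f v = scale a v \<longrightarrow> f y = scale a y)}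
            \<subseteq> {v. \<exists>c. brk x v = scale c v}"
        proof
          fix y assume y: "y \<in> {y. (\<exists>c. brk z y = scale c y) \<and> (\<forall>f a. lin f \<longrightarrow>
            (\<forall>x. f (brk z x) = brk z (f x)) \<longrightarrow> f v = scale a v \<longrightarrow> f y = scale a y)}"
          then obtain b where b: "brk z y = scale b y" by blast
          have "brk h y = scale a y" using y lin_brk com a by blast
          then have "brk x y = scale (a + c * b) y"
            unfolding h(2) using b by (simp add: brk_add_left brk_scale_left scale_left_distrib)
          then show "y \<in> {v. \<exists>c. brk x v = scale c v}" by blast
        qed
        ultimately show ?thesis using span_mono by blast
      qed
      then show ?thesis
        unfolding diagonalizable_def
        using span_UNIV_bind H_diagonalizable[OF h(1), unfolded diagonalizable_def] by blast
    qed
  qed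
  moreover have "H \<subseteq> H'"
  proof
    fix h assume "h \<in> H"
    then have "h = h + scale 0 z \<and> h \<in> H" by simp
    then show "h \<in> H'" unfolding H'_def by blast
  qed
  ultimately have "H' = H" using cartan unfolding cartan_subalgebra_def by blast
  moreover have "z = 0 + scale 1 z \<and> 0 \<in> H" using subspace_0[OF H_subspace] by simp
  then have "z \<in> H'" unfolding H'_def by blast
  ultimately show ?thesis by simp
qed

text \<open>The grading derivation is \<open>ad z\<close> for some \<open>z\<close>. It kills
  \<open>H\<close>, which lies in degree 0, and it is diagonalizable, so maximality puts
  \<open>z\<close> into \<open>H\<close>.\<close>

lemma inner_grading:
  assumes add: "\<And>a b. \<phi> (a + b) = \<phi> a + \<phi> b" and x: "\<And>h. h \<in> H \<Longrightarrow> brk x h = 0"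
  obtains z where "z \<in> H" "\<And>a y. y \<in> geig (brk x) a \<Longrightarrow> brk z y = scale (\<phi> a) y"
proof -
  obtain D where D: "derivation D" "\<And>a y. y \<in> geig (brk x) a \<Longrightarrow> D y = scale (\<phi> a) y"
    using graded_derivation[of \<phi> x] add by blast
  obtain z where z: "\<And>y. D y = brk z y" using derivation_inner[OF D(1)] by blast
  have eig: "brk z y = scale (\<phi> a) y" if "y \<in> geig (brk x) a" for a y using D(2)[OF that] z by simp
  have "\<phi> 0 = 0" using add[of 0 0] by simp
  have "z \<in> H"
  proof (rule H_maximal)
    show "brk z h = 0" if "h \<in> H" for h
      using eig[of h 0] eigenvector_geig[of "brk x" h 0] x[OF that] \<open>\<phi> 0 = 0\<close> by simp
    have "(\<Union>a. geig (brk x) a) \<subseteq> {v. \<exists>c. brk z v = scale c v}" using eig by blast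
    then show "diagonalizable (brk z)"
      unfolding diagonalizable_def using geig_span[OF lin_brk, of x] span_mono by blast
  qed
  then show ?thesis using that eig by blast
qed

text \<open>Conjugation in \<open>inner_grading\<close> gives a \<open>z\<close> inside
  \<open>H\<close> for which \<open>killing h z\<close> is the sum of the squared absolute values of
  the eigenvalues of \<open>ad h\<close>.\<close>

lemma killing_H_nondegenerate:
  assumes h: "h \<in> H" and 0: "\<And>k. k \<in> H \<Longrightarrow> killing h k = 0"
  shows "h = 0"
proof -
  obtain z where z: "z \<in> H" "\<And>a y. y \<in> geig (brk h) a \<Longrightarrow> brk z y = scale (cnj a) y"
    by (rule inner_grading[of cnj h]) (use H_commute h in auto)
  obtain B val where B: "basis B" "\<And>b. b \<in> B \<Longrightarrow> b \<in> geig (brk h) (val b)"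
    using geig_basis[OF lin_brk[of h]] by blast
  have eig: "brk h b = scale (val b) b" if "b \<in> B" for b
    using diagonalizable_eigen[OF H_diagonalizable[OF h] B(2)[OF that]] .
  have "killing h z = ptr B B (\<lambda>y. brk h (brk z y))"
    unfolding killing_tr by (rule tr_eq[OF B(1) lin_comp[OF lin_brk lin_brk]])
  also have "\<dots> = (\<Sum>b\<in>B. val b * cnj (val b))"
  proof (rule ptr_diag[OF B(1) subset_refl])
    fix b assume "b \<in> B"
    then show "brk h (brk z b) = scale (val b * cnj (val b)) b"
      using z(2)[OF B(2)] eig by (simp add: brk_scale_right mult.commute)
  qed
  finally have "complex_of_real (\<Sum>b\<in>B. (cmod (val b))\<^sup>2) = 0"
    using 0[OF z(1)] by (simp only: complex_norm_square of_real_sum)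
  then have "(\<Sum>b\<in>B. (cmod (val b))\<^sup>2) = 0" by (simp only: of_real_eq_0_iff)
  then have "val b = 0" if "b \<in> B" for b
    using that basis_finite[OF B(1)] by (simp add: sum_nonneg_eq_0_iff)
  then have "brk h b = 0" if "b \<in> B" for b using eig that by simp
  then have "brk h y = 0" for y
    using lin_eq_on_span[OF lin_brk lin_zero_fun, of B h y] B(1) by (simp add: basis_def)
  then show ?thesis using center_zero by blast
qed

end

section \<open>Weights and root spaces\<close>

text \<open>Interpreted twice: as \<open>R\<close> for the adjoint action and as \<open>M\<close>
  for the module. Weights are functions that vanish off \<open>K\<close>, so that different weights
  differ at some element of \<open>K\<close>.\<close>

locale weight_space = complex_space scale Basis
  for scale :: "complex \<Rightarrow> 'v::ab_group_add \<Rightarrow> 'v" and Basis +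
  fixes K :: "'h set" and op :: "'h \<Rightarrow> 'v \<Rightarrow> 'v" and B :: "'v set" and wt :: "'v \<Rightarrow> 'h \<Rightarrow> complex"
  assumes op_lin: "h \<in> K \<Longrightarrow> lin (op h)"
    and basis_B: "basis B"
    and op_wt: "b \<in> B \<Longrightarrow> h \<in> K \<Longrightarrow> op h b = scale (wt b h) b"
    and wt_outside: "b \<in> B \<Longrightarrow> h \<notin> K \<Longrightarrow> wt b h = 0"
begin

definition wsp :: "('h \<Rightarrow> complex) \<Rightarrow> 'v set" where
  "wsp \<mu> = {x. \<forall>h\<in>K. op h x = scale (\<mu> h) x}"

definition Bw :: "('h \<Rightarrow> complex) \<Rightarrow> 'v set" where
  "Bw \<mu> = {b\<in>B. wt b = \<mu>}"

definition supported :: "('h \<Rightarrow> complex) \<Rightarrow> bool" where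
  "supported \<mu> \<longleftrightarrow> (\<forall>h. h \<notin> K \<longrightarrow> \<mu> h = 0)"

lemma finite_B: "finite B"
  by (rule basis_finite[OF basis_B])

lemma finite_Bw: "finite (Bw \<mu>)"
  unfolding Bw_def using finite_B by simp

lemma Bw_subset: "Bw \<mu> \<subseteq> B"
  unfolding Bw_def by blast

lemma supported_wt: "b \<in> B \<Longrightarrow> supported (wt b)"
  unfolding supported_def using wt_outside by blast

lemma supported_add: "supported \<mu> \<Longrightarrow> supported \<nu> \<Longrightarrow> supported (\<mu> + \<nu>)"
  unfolding supported_def by simp

lemma Bw_wsp: "b \<in> Bw \<mu> \<Longrightarrow> b \<in> wsp \<mu>"
  unfolding Bw_def wsp_def using op_wt by auto

lemma rep_op:
  assumes "h \<in> K" "b \<in> B"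
  shows "representation B (op h x) b = wt b h * representation B x b"
proof -
  have "representation B (op h x) b = (\<Sum>c\<in>B. representation B x c * representation B (op h c) b)"
    by (rule rep_lin[OF basis_B op_lin[OF assms(1)]])
  also have "\<dots> = (\<Sum>c\<in>B. if c = b then representation B x b * wt b h else 0)"
    by (rule sum.cong) (use assms in \<open>auto simp: op_wt rep_scale[OF basis_B] rep_basis[OF basis_B]\<close>)
  finally show ?thesis using assms(2) finite_B by simp
qed

lemma rep_wsp:
  assumes "x \<in> wsp \<mu>" "supported \<mu>" "b \<in> B" "wt b \<noteq> \<mu>"
  shows "representation B x b = 0"
proof -
  obtain h where h: "wt b h \<noteq> \<mu> h" using assms(4) by blast
  then have hK: "h \<in> K" using assms(2,3) wt_outside unfolding supported_def by metis
  then have "op h x = scale (\<mu> h) x" using assms(1) unfolding wsp_def by blast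
  then have "representation B (op h x) b = \<mu> h * representation B x b"
    by (simp only: rep_scale[OF basis_B])
  then have "wt b h * representation B x b = \<mu> h * representation B x b"
    by (simp only: rep_op[OF hK assms(3)])
  then show ?thesis using h by simp
qed

lemma wsp_span:
  assumes "supported \<mu>"
  shows "wsp \<mu> = span (Bw \<mu>)"
proof
  show "wsp \<mu> \<subseteq> span (Bw \<mu>)"
  proof
    fix x assume x: "x \<in> wsp \<mu>"
    show "x \<in> span (Bw \<mu>)"
      by (rule span_rep_zero[OF basis_B Bw_subset]) (use rep_wsp[OF x assms] in \<open>auto simp: Bw_def\<close>)
  qed
  have "subspace (wsp \<mu>)"
    unfolding subspace_def wsp_def
    by (auto simp: lin_zero[OF op_lin] lin_add[OF op_lin] lin_scale[OF op_lin] scale_right_distrib mult.commute)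
  then show "span (Bw \<mu>) \<subseteq> wsp \<mu>" using Bw_wsp by (intro span_minimal) auto
qed

lemma wsp_expand:
  assumes "x \<in> wsp \<mu>" "supported \<mu>"
  shows "(\<Sum>b\<in>Bw \<mu>. scale (representation B x b) b) = x"
proof -
  have "(\<Sum>b\<in>B. scale (representation B x b) b) = (\<Sum>b\<in>Bw \<mu>. scale (representation B x b) b)"
    by (rule sum.mono_neutral_right)
      (use rep_wsp[OF assms] finite_B Bw_subset in \<open>auto simp: Bw_def\<close>)
  then show ?thesis using basis_expand[OF basis_B] by simp
qed

definition shifts :: "('v \<Rightarrow> 'v) \<Rightarrow> ('h \<Rightarrow> complex) \<Rightarrow> bool" where
  "shifts E \<alpha> \<longleftrightarrow> lin E \<and> (\<forall>\<mu>. \<forall>x\<in>wsp \<mu>. E x \<in> wsp (\<mu> + \<alpha>))"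

definition tw :: "('h \<Rightarrow> complex) \<Rightarrow> ('v \<Rightarrow> 'v) \<Rightarrow> complex" where
  "tw \<mu> f = ptr B (Bw \<mu>) f"

lemma shifts_lin: "shifts E \<alpha> \<Longrightarrow> lin E"
  by (simp add: shifts_def)

lemma shifts_Bw:
  assumes "shifts E \<alpha>" "supported \<alpha>" "b \<in> Bw \<mu>"
  shows "E b \<in> span (Bw (\<mu> + \<alpha>))"
proof -
  have "supported \<mu>" using assms(3) supported_wt unfolding Bw_def by auto
  then show ?thesis
    using assms Bw_wsp wsp_span[OF supported_add[of \<mu> \<alpha>]] unfolding shifts_def by blast
qed

lemma tw_swap:
  assumes E: "shifts E \<alpha>" and F: "shifts F (- \<alpha>)" and \<alpha>: "supported \<alpha>"
  shows "tw \<mu> (\<lambda>x. E (F x)) = tw (\<mu> - \<alpha>) (\<lambda>x. F (E x))"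
  unfolding tw_def
proof (rule ptr_swap[OF basis_B Bw_subset Bw_subset shifts_lin[OF F] shifts_lin[OF E]])
  have m: "supported (- \<alpha>)" using \<alpha> by (simp add: supported_def)
  show "F b \<in> span (Bw (\<mu> - \<alpha>))" if "b \<in> Bw \<mu>" for b
    using shifts_Bw[OF F m that] by simp
  show "E b \<in> span (Bw \<mu>)" if "b \<in> Bw (\<mu> - \<alpha>)" for b
    using shifts_Bw[OF E \<alpha> that] by simp
qed

lemma tw_scalar:
  assumes "\<And>b. b \<in> Bw \<mu> \<Longrightarrow> f b = scale c b"
  shows "tw \<mu> f = c * of_nat (card (Bw \<mu>))"
  unfolding tw_def using ptr_diag[OF basis_B Bw_subset, of \<mu> f "\<lambda>_. c"] assms by simp

lemma tw_empty: "Bw \<mu> = {} \<Longrightarrow> tw \<mu> f = 0"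
  by (simp add: tw_def ptr_def)

text \<open>Cyclicity turns the trace of \<open>E F\<close> at \<open>\<mu> + \<alpha>\<close> into
  that of \<open>F E\<close> at \<open>\<mu>\<close>. What remains is the trace of the commutator, a
  scalar on the weight space.\<close>

lemma string_trace_step:
  assumes E: "shifts E \<alpha>" and F: "shifts F (- \<alpha>)" and \<alpha>: "supported \<alpha>"
    and T: "\<And>b. b \<in> Bw \<mu> \<Longrightarrow> E (F b) - F (E b) = scale t b"
  shows "tw \<mu> (\<lambda>x. E (F x)) - tw (\<mu> + \<alpha>) (\<lambda>x. E (F x)) = t * of_nat (card (Bw \<mu>))"
proof -
  have "tw (\<mu> + \<alpha>) (\<lambda>x. E (F x)) = tw \<mu> (\<lambda>x. F (E x))"
    using tw_swap[OF E F \<alpha>, of "\<mu> + \<alpha>"] by simp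
  then show ?thesis
    using tw_scalar[of \<mu> "\<lambda>x. E (F x) - F (E x)" t] T ptr_diff[OF basis_B]
    unfolding tw_def by metis
qed

lemma string_escapes:
  assumes "\<alpha> \<noteq> 0"
  shows "\<exists>n. \<forall>m\<ge>n. Bw (\<mu> + of_nat m * \<alpha>) = {}"
proof -
  obtain h where h: "\<alpha> h \<noteq> 0" using assms by (metis ext zero_fun_apply)
  let ?f = "\<lambda>m::nat. \<mu> + of_nat m * \<alpha>"
  have "inj ?f"
  proof (rule injI)
    fix i j assume "?f i = ?f j"
    then have "?f i h = ?f j h" by simp
    then show "i = j" using h by (simp add: of_nat_fun)
  qed
  then have "finite (?f -` (wt ` B))" using finite_B by (simp add: finite_vimageI)
  then obtain n where "\<And>m. m \<in> ?f -` (wt ` B) \<Longrightarrow> m < n" by (metis finite_nat_bounded lessThan_iff subsetD)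
  then show ?thesis unfolding Bw_def by (intro exI[of _ n]) force
qed

text \<open>Telescopes the step from \<open>\<mu>\<close> to a point beyond the end of the string,
  where the trace is 0.\<close>

lemma string_sum:
  assumes step: "\<And>\<mu>. a \<mu> - a (\<mu> + \<alpha>) = t \<mu> * of_nat (card (Bw \<mu>))"
    and top: "a (\<mu> + of_nat n * \<alpha>) = (0::complex)"
  shows "a \<mu> = (\<Sum>j<n. t (\<mu> + of_nat j * \<alpha>) * of_nat (card (Bw (\<mu> + of_nat j * \<alpha>))))"
proof -
  define p where "p m = \<mu> + of_nat m * \<alpha>" for m
  have "p m + \<alpha> = p (Suc m)" for m
    unfolding p_def by (simp only: of_nat_Suc distrib_right mult_1_left add.assoc add.commute add.left_commute)
  then have st: "a (p m) - a (p (Suc m)) = t (p m) * of_nat (card (Bw (p m)))" for m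
    using step by metis
  have "a (p 0) = (\<Sum>j<m. t (p j) * of_nat (card (Bw (p j)))) + a (p m)" for m
  proof (induction m)
    case (Suc m)
    then show ?case using st[of m] by (simp add: algebra_simps)
  qed simp
  from this[of n] have "a (p 0) = (\<Sum>j<n. t (p j) * of_nat (card (Bw (p j))))"
    using top unfolding p_def[symmetric] by simp
  moreover have "p 0 = \<mu>" unfolding p_def by simp
  ultimately show ?thesis unfolding p_def by simp
qed

end

section \<open>Simultaneous eigenvectors of a toral subalgebra\<close>

context complex_lie_algebra
begin

lemma joint_eigenvectors:
  assumes "toral H" "finite F" "F \<subseteq> H"
  shows "span {v. \<forall>x\<in>F. \<exists>c. brk x v = scale c v} = UNIV"
  using assms(2,3)
proof (induction F rule: finite_induct)
  case (insert x F)
  have d: "span {v. \<exists>c. brk x v = scale c v} = UNIV"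
    using assms(1) insert.prems unfolding toral_def diagonalizable_def by blast
  have "v \<in> span {v. \<forall>y\<in>insert x F. \<exists>c. brk y v = scale c v}"
    if v: "v \<in> {v. \<forall>x\<in>F. \<exists>c. brk x v = scale c v}" for v
  proof -
    let ?S = "{y. (\<exists>c. brk x y = scale c y) \<and> (\<forall>f a. lin f \<longrightarrow>
        (\<forall>z. f (brk x z) = brk x (f z)) \<longrightarrow> f v = scale a v \<longrightarrow> f y = scale a y)}"
    have "?S \<subseteq> {v. \<forall>y\<in>insert x F. \<exists>c. brk y v = scale c v}"
    proof
      fix w assume w: "w \<in> ?S"
      have "\<exists>c. brk y w = scale c w" if y: "y \<in> F" for y
      proof -
        obtain a where a: "brk y v = scale a v" using v y by blast
        have "brk y x = 0" using assms(1) insert.prems y unfolding toral_def by blast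
        then have "\<forall>z. brk y (brk x z) = brk x (brk y z)" using brk_commute_ops by blast
        then have "brk y w = scale a w" using w a lin_brk by blast
        then show ?thesis by blast
      qed
      then show "w \<in> {v. \<forall>y\<in>insert x F. \<exists>c. brk y v = scale c v}" using w by blast
    qed
    then show ?thesis using eigenvector_split[OF lin_brk d, of v] span_mono by blast
  qed
  then show ?case using span_UNIV_bind insert by blast
qed simp

lemma root_spaces_span:
  assumes H: "toral H"
  shows "span (\<Union>\<mu>\<in>dual H. root_space H \<mu>) = UNIV"
proof -
  have sub: "subspace H" using H by (simp add: toral_def)
  obtain F where F: "F \<subseteq> H" "independent F" "H \<subseteq> span F" using maximal_independent_subset by blast
  have "v \<in> span (\<Union>\<mu>\<in>dual H. root_space H \<mu>)" if v: "v \<in> {v. \<forall>x\<in>F. \<exists>c. brk x v = scale c v}" for v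
  proof (cases "v = 0")
    case False
    have ex: "\<exists>c. brk h v = scale c v" if "h \<in> H" for h
    proof -
      have "h \<in> span F" using that F by blast
      then show ?thesis
      proof (induction rule: span_induct_alt)
        case base
        show ?case by (auto intro!: exI[of _ 0])
      next
        case (step c x y)
        then obtain a b where "brk x v = scale a v" "brk y v = scale b v" using v by blast
        then have "brk (scale c x + y) v = scale (c * a + b) v"
          by (simp add: brk_add_left brk_scale_left scale_left_distrib)
        then show ?case by blast
      qed
    qed
    \<comment> \<open>The eigenvalue is unique because \<open>v\<close> is nonzero, which makes it
      linear in \<open>h\<close>; off \<open>H\<close> it is 0, as membership in
      \<open>dual H\<close> demands.\<close>
    define \<mu> where "\<mu> h = (if h \<in> H then SOME c. brk h v = scale c v else 0)" for h
    have \<mu>: "brk h v = scale (\<mu> h) v" if "h \<in> H" for h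
      using someI_ex[OF ex[OF that]] that unfolding \<mu>_def by simp
    have uniq: "c = d" if "scale c v = scale d v" for c d using that False by simp
    have "\<mu> \<in> dual H"
      unfolding dual_def
    proof (intro CollectI conjI ballI allI impI)
      fix x y assume "x \<in> H" "y \<in> H"
      then have "scale (\<mu> (x + y)) v = scale (\<mu> x + \<mu> y) v"
        using \<mu>[of x] \<mu>[of y] \<mu>[of "x + y"] subspace_add[OF sub] by (simp add: brk_add_left scale_left_distrib)
      then show "\<mu> (x + y) = \<mu> x + \<mu> y" by (rule uniq)
    next
      fix c x assume "x \<in> H"
      then have "scale (\<mu> (scale c x)) v = scale (c * \<mu> x) v"
        using \<mu>[of x] \<mu>[of "scale c x"] subspace_scale[OF sub, of x c] by (simp only: brk_scale_left scale_scale)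
      then show "\<mu> (scale c x) = c * \<mu> x" by (rule uniq)
    qed (simp add: \<mu>_def)
    moreover have "v \<in> root_space H \<mu>" unfolding root_space_def using \<mu> by blast
    ultimately show ?thesis by (blast intro: span_base)
  qed (simp add: span_zero)
  then show ?thesis
    using span_UNIV_bind joint_eigenvectors[OF H finiteI_independent[OF F(2)] F(1)] by blast
qed

end

section \<open>Self-centralization of \<open>H\<close> and the dual vectors\<close>

context cartan_lie_algebra
begin

text \<open>A basis of the Lie algebra made of simultaneous eigenvectors of \<open>H\<close>;
  \<open>rw\<close> gives their weights. Once \<open>wsp_zero\<close> is known, its members of
  weight 0 form a basis of \<open>H\<close>.\<close>

definition rb :: "'a set" where
  "rb = (SOME B. basis B \<and> B \<subseteq> (\<Union>\<mu>\<in>dual H. root_space H \<mu>))"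

definition rw :: "'a \<Rightarrow> 'a \<Rightarrow> complex" where
  "rw b = (SOME \<mu>. \<mu> \<in> dual H \<and> b \<in> root_space H \<mu>)"

lemma rb: "basis rb" "rb \<subseteq> (\<Union>\<mu>\<in>dual H. root_space H \<mu>)"
proof -
  have "\<exists>B. basis B \<and> B \<subseteq> (\<Union>\<mu>\<in>dual H. root_space H \<mu>)"
    using basis_from_spanning[OF root_spaces_span[OF toral_H]] by metis
  from someI_ex[OF this] show "basis rb" "rb \<subseteq> (\<Union>\<mu>\<in>dual H. root_space H \<mu>)"
    unfolding rb_def by blast+
qed

lemma rw:
  assumes "b \<in> rb"
  shows "rw b \<in> dual H" "b \<in> root_space H (rw b)"
proof -
  have "\<exists>\<mu>. \<mu> \<in> dual H \<and> b \<in> root_space H \<mu>" using assms rb(2) by blast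
  from someI_ex[OF this] show "rw b \<in> dual H" "b \<in> root_space H (rw b)"
    unfolding rw_def by blast+
qed

sublocale R: weight_space scale Basis H brk rb rw
proof (intro weight_space.intro weight_space_axioms.intro)
  show "complex_space scale Basis" ..
qed (use rb(1) rw lin_brk in \<open>auto simp: root_space_def dual_def\<close>)

lemma wsp_root_space: "R.wsp = root_space H"
  by (rule ext) (simp add: R.wsp_def root_space_def)

lemma supported_dual: "\<mu> \<in> dual H \<Longrightarrow> R.supported \<mu>"
  by (simp add: dual_def R.supported_def)

lemma dual_add: "\<mu> \<in> dual H \<Longrightarrow> \<nu> \<in> dual H \<Longrightarrow> \<mu> + \<nu> \<in> dual H"
  by (auto simp: dual_def algebra_simps)

lemma dual_uminus: "\<mu> \<in> dual H \<Longrightarrow> - \<mu> \<in> dual H"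
  by (auto simp: dual_def algebra_simps)

lemma dual_zero: "0 \<in> dual H"
  by (auto simp: dual_def)

lemma killing_rb: "x \<in> H \<Longrightarrow> y \<in> H \<Longrightarrow> killing x y = (\<Sum>b\<in>rb. rw b x * rw b y)"
  unfolding killing_tr tr_eq[OF rb(1) lin_comp[OF lin_brk lin_brk]]
  by (rule ptr_diag[OF rb(1) subset_refl]) (simp add: R.op_wt brk_scale_right mult.commute)

text \<open>A Jordan decomposition inside the algebra: with the identity as \<open>\<phi>\<close>,
  \<open>inner_grading\<close> gives the \<open>z\<close> in \<open>H\<close> that acts on each
  generalized eigenspace of \<open>ad x\<close> as its eigenvalue, so \<open>x - z\<close> acts
  nilpotently.\<close>

lemma nilpotent_part:
  assumes x: "\<And>h. h \<in> H \<Longrightarrow> brk x h = 0"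
  obtains z n where "z \<in> H" "x = z + n" "\<And>y. \<exists>k. (brk n ^^ k) y = 0"
proof -
  obtain z where z: "z \<in> H" "\<And>a y. y \<in> geig (brk x) a \<Longrightarrow> brk z y = scale a y"
    using inner_grading[of "\<lambda>a. a" x] x by auto
  let ?n = "x - z"
  have "geig (brk x) a \<subseteq> geig (brk ?n) 0" for a
  proof
    fix y assume y: "y \<in> geig (brk x) a"
    let ?T = "\<lambda>y. brk x y - scale a y"
    have mem: "(?T ^^ k) y \<in> geig (brk x) a" for k
      using y geig_shift[OF lin_brk] by (induction k) auto
    have "(brk ?n ^^ k) y = (?T ^^ k) y" for k
    proof (induction k)
      case (Suc k)
      then show ?case using z(2)[OF mem[of k]] by (simp add: brk_diff_left)
    qed simp
    moreover obtain k where "(?T ^^ k) y = 0" using y unfolding geig_def by blast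
    ultimately show "y \<in> geig (brk ?n) 0" unfolding geig_def by auto
  qed
  then have "span (\<Union>a. geig (brk x) a) \<subseteq> geig (brk ?n) 0"
    by (intro span_minimal subspace_geig[OF lin_brk]) blast
  then have "\<exists>k. (brk ?n ^^ k) y = 0" for y
    using geig_span[OF lin_brk, of x] unfolding geig_def by auto
  then show ?thesis by (intro that[of z ?n]) (auto simp: z)
qed

text \<open>\<open>ad n\<close> and \<open>ad x\<close> commute, so their product is nilpotent along
  with \<open>ad n\<close> and has trace 0.\<close>

lemma killing_nilpotent:
  assumes n: "\<And>y. \<exists>k. (brk n ^^ k) y = 0" and c: "brk n x = 0"
  shows "killing n x = 0"
proof -
  have com: "brk n (brk x y) = brk x (brk n y)" for y using brk_commute_ops[OF c] .
  have com2: "(brk n ^^ k) (brk x y) = brk x ((brk n ^^ k) y)" for k y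
    by (induction k) (auto simp: com)
  have "((\<lambda>y. brk n (brk x y)) ^^ k) y = (brk x ^^ k) ((brk n ^^ k) y)" for k y
  proof (induction k arbitrary: y)
    case (Suc k)
    have "((\<lambda>y. brk n (brk x y)) ^^ Suc k) y = (brk x ^^ k) ((brk n ^^ k) (brk n (brk x y)))"
      unfolding funpow_Suc_right using Suc by simp
    also have "(brk n ^^ k) (brk n (brk x y)) = brk x ((brk n ^^ Suc k) y)"
      by (simp add: com com2 funpow_swap1)
    also have "(brk x ^^ k) (brk x ((brk n ^^ Suc k) y)) = (brk x ^^ Suc k) ((brk n ^^ Suc k) y)"
      unfolding funpow_Suc_right by simp
    finally show ?case .
  qed simp
  moreover have "\<exists>k. (brk x ^^ k) ((brk n ^^ k) y) = 0" for y
  proof -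
    obtain k where "(brk n ^^ k) y = 0" using n by blast
    then have "(brk x ^^ k) ((brk n ^^ k) y) = 0" by (simp only: lin_zero[OF lin_funpow[OF lin_brk]])
    then show ?thesis by blast
  qed
  ultimately have "\<exists>k. ((\<lambda>y. brk n (brk x y)) ^^ k) y = 0" for y by simp
  then show ?thesis unfolding killing_tr by (rule tr_nilpotent[OF lin_comp[OF lin_brk lin_brk]])
qed

text \<open>Every element of the centralizer \<open>?C\<close> is \<open>z + n\<close> with
  \<open>z\<close> in \<open>H\<close> and \<open>n\<close> in \<open>?C'\<close>, the part
  orthogonal to \<open>H\<close>. In an element of \<open>?C'\<close> the \<open>H\<close>-component
  is orthogonal to \<open>H\<close>, hence 0, so \<open>?C'\<close> consists of nilpotent elements;
  the form vanishes on their squares and by polarization on \<open>?C'\<close>. Thus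
  \<open>n\<close> is orthogonal to \<open>H\<close>, to \<open>?C'\<close> and, by weight, to all
  root spaces, so \<open>n = 0\<close>.\<close>

lemma centralizer_H:
  assumes x: "\<And>h. h \<in> H \<Longrightarrow> brk x h = 0"
  shows "x \<in> H"
proof -
  let ?C = "{x. \<forall>h\<in>H. brk x h = 0}"
  let ?C' = "{x \<in> ?C. \<forall>h\<in>H. killing x h = 0}"
  have dec: "\<exists>z\<in>H. \<exists>n\<in>?C'. x = z + n \<and> (\<forall>y. \<exists>k. (brk n ^^ k) y = 0)" if xC: "x \<in> ?C" for x
  proof -
    obtain z n where zn: "z \<in> H" "x = z + n" "\<And>y. \<exists>k. (brk n ^^ k) y = 0"
      using nilpotent_part[of x] xC by blast
    have "brk n h = 0" if "h \<in> H" for h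
    proof -
      have "brk x h = brk z h + brk n h" unfolding zn(2) by (rule brk_add_left)
      moreover have "brk x h = 0" using xC that by blast
      ultimately show ?thesis unfolding H_commute[OF zn(1) that] by simp
    qed
    then have "n \<in> ?C'" using killing_nilpotent[of n, OF zn(3)] by simp
    then show ?thesis using zn(1,2,3) by blast
  qed
  have nil: "\<exists>k. (brk w ^^ k) y = 0" if w: "w \<in> ?C'" for w y
  proof -
    obtain z n where zn: "z \<in> H" "n \<in> ?C'" "w = z + n" "\<forall>y. \<exists>k. (brk n ^^ k) y = 0"
      using dec w by blast
    have "killing z h = 0" if "h \<in> H" for h
    proof -
      have "killing w h = killing z h + killing n h" unfolding zn(3) by (rule killing_add_left)
      moreover have "killing w h = 0" "killing n h = 0" using w zn(2) that by blast+
      ultimately show ?thesis by simp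
    qed
    then have "z = 0" by (rule killing_H_nondegenerate[OF zn(1)])
    then have "w = n" using zn(3) by simp
    then show ?thesis using zn(4) by blast
  qed
  have sq: "killing w w = 0" if "w \<in> ?C'" for w
    by (rule killing_nilpotent[OF nil[OF that] brk_self])
  have orth: "killing v w = 0" if v: "v \<in> ?C'" and w: "w \<in> ?C'" for v w
  proof -
    have "v + w \<in> ?C'" using v w by (auto simp: brk_add_left killing_add_left)
    then have "killing (v + w) (v + w) = 0" by (rule sq)
    then show ?thesis using sq[OF v] sq[OF w] killing_sym[of w v]
      by (simp add: killing_add_left killing_add_right)
  qed
  obtain z n where zn: "z \<in> H" "n \<in> ?C'" "x = z + n" using dec x by blast
  have "killing n b = 0" if b: "b \<in> rb" for b
  proof (cases "rw b = 0")
    case True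
    have "brk b h = 0" if "h \<in> H" for h
      using R.op_wt[OF b that] brk_anti[of b h] by (simp add: True)
    then have "b \<in> ?C" by blast
    then obtain z' n' where "z' \<in> H" "n' \<in> ?C'" "b = z' + n'" using dec by blast
    then show ?thesis using orth[OF zn(2)] zn(2) by (simp add: killing_add_right)
  next
    case False
    then obtain h where h: "rw b h \<noteq> 0" by (metis ext zero_fun_apply)
    then have hH: "h \<in> H" using R.wt_outside[OF b] by blast
    have "rw b h * killing n b = killing n (brk h b)" using R.op_wt[OF b hH] by (simp add: killing_scale_right)
    also have "\<dots> = killing (brk n h) b" by (rule killing_invariant[symmetric])
    also have "\<dots> = 0" using zn(2) hH by simp
    finally show ?thesis using h by simp
  qed
  then have "killing n y = 0" for y using killing_lin_eq[of rb n y] rb(1) by (simp add: basis_def)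
  then have "n = 0" by (rule killing_nondegenerate)
  then show ?thesis using zn by simp
qed

lemma wsp_zero: "R.wsp 0 = H"
proof
  show "R.wsp 0 \<subseteq> H"
  proof
    fix x assume "x \<in> R.wsp 0"
    then have "brk h x = 0" if "h \<in> H" for h using that unfolding R.wsp_def by simp
    then have "brk x h = 0" if "h \<in> H" for h using that brk_anti[of x h] by simp
    then show "x \<in> H" by (rule centralizer_H)
  qed
  show "H \<subseteq> R.wsp 0" unfolding R.wsp_def using H_commute by auto
qed

lemma dual_sum_H:
  assumes "\<phi> \<in> dual H" "\<And>i. i \<in> I \<Longrightarrow> x i \<in> H"
  shows "\<phi> (\<Sum>i\<in>I. scale (c i) (x i)) = (\<Sum>i\<in>I. c i * \<phi> (x i))"
proof -
  have 0: "\<phi> 0 = 0"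
    using assms(1) subspace_0[OF H_subspace] unfolding dual_def
    by (metis (mono_tags, lifting) add_cancel_right_right mem_Collect_eq)
  show ?thesis
    using assms(2)
  proof (induction I rule: infinite_finite_induct)
    case (insert i I)
    have "(\<Sum>i\<in>I. scale (c i) (x i)) \<in> H"
      using insert.prems by (intro subspace_sum[OF H_subspace] subspace_scale[OF H_subspace]) auto
    moreover have "scale (c i) (x i) \<in> H" using insert.prems subspace_scale[OF H_subspace] by blast
    ultimately show ?case using insert assms(1) unfolding dual_def by auto
  qed (auto simp: 0)
qed

lemma dual_expand:
  assumes "\<phi> \<in> dual H" "h \<in> H"
  shows "\<phi> h = (\<Sum>b\<in>R.Bw 0. representation rb h b * \<phi> b)"
proof -
  have "h \<in> R.wsp 0" using assms(2) by (simp only: wsp_zero)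
  moreover have "R.supported 0" by (simp add: R.supported_def)
  ultimately have h: "(\<Sum>b\<in>R.Bw 0. scale (representation rb h b) b) = h" by (rule R.wsp_expand)
  have "b \<in> H" if "b \<in> R.Bw 0" for b using R.Bw_wsp[OF that] by (simp only: wsp_zero)
  then show ?thesis
    using dual_sum_H[OF assms(1), of "R.Bw 0" "\<lambda>b. b" "representation rb h"] unfolding h by blast
qed

text \<open>Extend \<open>\<phi>\<close> by 0 to the basis vectors of nonzero weight and represent
  the extension \<open>\<psi>\<close> by \<open>t\<close>. Since
  \<open>killing (brk t h) y = \<psi> (brk h y)\<close> and \<open>brk h y\<close> has no component
  of weight 0, \<open>t\<close> centralizes \<open>H\<close> and therefore lies in it.\<close>

lemma dual_vector_unique:
  assumes "\<phi> \<in> dual H"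
  shows "\<exists>!t. t \<in> H \<and> (\<forall>h\<in>H. killing t h = \<phi> h)"
proof -
  define \<psi> where "\<psi> y = (\<Sum>b\<in>R.Bw 0. representation rb y b * \<phi> b)" for y
  obtain t where t: "\<And>y. killing t y = \<psi> y"
  proof (rule killing_represent[of \<psi>])
    show "\<psi> (x + y) = \<psi> x + \<psi> y" for x y
      unfolding \<psi>_def rep_add[OF rb(1)] distrib_right sum.distrib ..
    show "\<psi> (scale c x) = c * \<psi> x" for c x
      unfolding \<psi>_def rep_scale[OF rb(1)] sum_distrib_left mult.assoc ..
  qed blast
  have "brk t h = 0" if h: "h \<in> H" for h
  proof (rule killing_nondegenerate)
    fix y
    have "killing (brk t h) y = \<psi> (brk h y)" using killing_invariant t by simp
    also have "\<dots> = 0"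
      unfolding \<psi>_def by (rule sum.neutral) (use R.rep_op[OF h] in \<open>auto simp: R.Bw_def\<close>)
    finally show "killing (brk t h) y = 0" .
  qed
  then have "t \<in> H" by (rule centralizer_H)
  moreover have "killing t h = \<phi> h" if "h \<in> H" for h
    using t dual_expand[OF assms that] unfolding \<psi>_def by simp
  moreover have "s = t" if "s \<in> H" "\<forall>h\<in>H. killing s h = \<phi> h" for s
  proof -
    have "s - t \<in> H" using that(1) \<open>t \<in> H\<close> subspace_diff[OF H_subspace] by blast
    moreover have "killing (s - t) h = 0" if "h \<in> H" for h
      using that \<open>\<forall>h\<in>H. killing s h = \<phi> h\<close> \<open>\<And>h. h \<in> H \<Longrightarrow> killing t h = \<phi> h\<close>
      by (simp add: killing_diff_left)
    ultimately have "s - t = 0" by (rule killing_H_nondegenerate)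
    then show ?thesis by simp
  qed
  ultimately show ?thesis by blast
qed

lemma dual_vector:
  assumes "\<phi> \<in> dual H"
  shows "dual_vector \<phi> \<in> H" "h \<in> H \<Longrightarrow> killing (dual_vector \<phi>) h = \<phi> h"
  using theI'[OF dual_vector_unique[OF assms]] unfolding dual_vector_def[symmetric] by blast+

lemma dual_vector_eqI:
  assumes "\<phi> \<in> dual H" "t \<in> H" "\<And>h. h \<in> H \<Longrightarrow> killing t h = \<phi> h"
  shows "dual_vector \<phi> = t"
  using dual_vector_unique[OF assms(1)] dual_vector[OF assms(1)] assms(2,3) by blast

lemma ip_eq: "\<phi> \<in> dual H \<Longrightarrow> \<psi> \<in> dual H \<Longrightarrow> ip \<phi> \<psi> = \<phi> (dual_vector \<psi>)"
  unfolding ip_def by (simp add: dual_vector)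

lemma ip_sym: "ip \<phi> \<psi> = ip \<psi> \<phi>"
  unfolding ip_def by (rule killing_sym)

end

section \<open>Root data\<close>

text \<open>The ambient \<open>'w\<close> is a commutative ring so that integer multiples can be
  written as products; later it is the ring of complex functions on the Lie algebra.
  \<open>\<rho>\<close> is given by its double because a ring offers no division by 2. In
  \<open>string_R\<close>, \<open>j\<close> equal to the Cartan integer gives the reflected
  root.\<close>

locale root_datum =
  fixes R P :: "'w::comm_ring_1 set" and form :: "'w \<Rightarrow> 'w \<Rightarrow> real" (infixl "\<cdot>" 70) and \<rho> :: 'w
  assumes finite_R: "finite R"
    and form_add_left: "(x + y) \<cdot> z = x \<cdot> z + y \<cdot> z"
    and form_sym: "x \<cdot> y = y \<cdot> x"
    and form_pos: "a \<in> R \<Longrightarrow> a \<cdot> a > 0"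
    and uminus_R: "a \<in> R \<Longrightarrow> - a \<in> R"
    and integral_R: "a \<in> R \<Longrightarrow> b \<in> R \<Longrightarrow> 2 * (b \<cdot> a) / (a \<cdot> a) \<in> \<int>"
    and string_R: "a \<in> R \<Longrightarrow> b \<in> R \<Longrightarrow> b \<noteq> a \<Longrightarrow> b \<noteq> - a \<Longrightarrow> real j \<le> 2 * (b \<cdot> a) / (a \<cdot> a) \<Longrightarrow>
      b - of_nat j * a \<in> R"
    and P_subset: "P \<subseteq> R"
    and P_neg: "a \<in> R \<Longrightarrow> a \<in> P \<longleftrightarrow> - a \<notin> P"
    and P_add: "a \<in> P \<Longrightarrow> b \<in> P \<Longrightarrow> a + b \<in> R \<Longrightarrow> a + b \<in> P"
    and rho_double: "\<rho> + \<rho> = \<Sum>P"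
begin

lemma finite_P: "finite P"
  using finite_R P_subset finite_subset by blast

lemma form_add_right: "x \<cdot> (y + z) = x \<cdot> y + x \<cdot> z"
  by (metis form_add_left form_sym)

lemma form_zero_left [simp]: "0 \<cdot> x = 0"
  using form_add_left[of 0 0 x] by simp

lemma form_zero_right [simp]: "x \<cdot> 0 = 0"
  using form_sym form_zero_left by metis

lemma form_minus_left: "(- x) \<cdot> y = - (x \<cdot> y)"
  using form_add_left[of x "- x" y] by simp

lemma form_minus_right: "x \<cdot> (- y) = - (x \<cdot> y)"
  using form_minus_left form_sym by metis

lemma form_diff_left: "(x - y) \<cdot> z = x \<cdot> z - y \<cdot> z"
  using form_add_left[of x "- y" z] form_minus_left by simp

lemma form_diff_right: "x \<cdot> (y - z) = x \<cdot> y - x \<cdot> z"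
  using form_diff_left form_sym by metis

lemma form_of_nat_left: "(of_nat n * x) \<cdot> y = real n * (x \<cdot> y)"
  by (induction n) (auto simp: algebra_simps form_add_left)

lemma form_of_int_left: "(of_int n * x) \<cdot> y = of_int n * (x \<cdot> y)"
  by (cases n rule: int_cases2) (simp_all add: form_of_nat_left form_minus_left)

lemma form_of_int_right: "x \<cdot> (of_int n * y) = of_int n * (x \<cdot> y)"
  using form_of_int_left form_sym by metis

lemma form_sum_left: "(\<Sum>i\<in>I. f i) \<cdot> y = (\<Sum>i\<in>I. f i \<cdot> y)"
  by (induction I rule: infinite_finite_induct) (auto simp: form_add_left)

lemma form_sum_right: "y \<cdot> (\<Sum>i\<in>I. f i) = (\<Sum>i\<in>I. y \<cdot> f i)"
  by (induction I rule: infinite_finite_induct) (auto simp: form_add_right)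

lemma form_sum_list_left: "sum_list xs \<cdot> y = (\<Sum>x\<leftarrow>xs. x \<cdot> y)"
  by (induction xs) (auto simp: form_add_left)

lemmas form_simps = form_add_left form_add_right form_minus_left form_minus_right
  form_diff_left form_diff_right form_of_int_left form_of_int_right

lemma zero_notin_R: "0 \<notin> R"
  using form_pos[of 0] by auto

lemma P_pos: "a \<in> P \<Longrightarrow> a \<cdot> a > 0"
  using form_pos P_subset by blast

text \<open>A positive integral pairing of \<open>b\<close> with \<open>- a\<close> is at least 1,
  so the string in direction \<open>- a\<close> contains \<open>b + a\<close>.\<close>

lemma add_root:
  assumes "a \<in> R" "b \<in> R" "a \<cdot> b < 0" "a \<noteq> - b"
  shows "a + b \<in> R"
proof -
  have "2 * (b \<cdot> (- a)) / ((- a) \<cdot> (- a)) \<in> \<int>"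
    using integral_R[of "- a" b] uminus_R assms by blast
  moreover have "2 * (b \<cdot> (- a)) / ((- a) \<cdot> (- a)) > 0"
    using assms form_pos[OF assms(1)] by (simp add: form_simps form_sym[of b a] divide_neg_pos)
  ultimately have "real 1 \<le> 2 * (b \<cdot> (- a)) / ((- a) \<cdot> (- a))"
    by (auto elim!: Ints_cases)
  moreover have "b \<noteq> - a" using assms by auto
  moreover have "b \<noteq> - (- a)" using assms form_pos[of a] by auto
  ultimately have "b - of_nat 1 * (- a) \<in> R"
    using string_R[of "- a" b 1] uminus_R assms by blast
  then show ?thesis by (simp add: add.commute)
qed

text \<open>If a sum of positive roots were zero, some pair would have negative product, hence could
  be merged into one positive root, giving a shorter such sum.\<close>

lemma sum_list_P_nonzero:
  assumes "set xs \<subseteq> P" "xs \<noteq> []"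
  shows "sum_list xs \<noteq> 0"
  using assms
proof (induction "length xs" arbitrary: xs rule: less_induct)
  case less
  then obtain x ys where xs: "xs = x # ys" by (cases xs) auto
  show ?case
  proof
    assume 0: "sum_list xs = 0"
    have xP: "x \<in> P" using less.prems xs by auto
    have "ys \<noteq> []" using 0 xs P_pos[OF xP] by auto
    have "(\<Sum>y\<leftarrow>ys. y \<cdot> x) = - (x \<cdot> x)"
      using arg_cong[OF 0, of "\<lambda>z. z \<cdot> x"] unfolding form_sum_list_left xs by simp
    then have "(\<Sum>y\<leftarrow>ys. y \<cdot> x) < 0" using P_pos[OF xP] by simp
    then have "\<exists>y\<in>set ys. y \<cdot> x < 0"
      using sum_list_nonneg[of "map (\<lambda>y. y \<cdot> x) ys"] by (force simp: not_less)
    then obtain y where y: "y \<in> set ys" "y \<cdot> x < 0" by blast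
    have yP: "y \<in> P" using y less.prems xs by auto
    have "y \<noteq> - x" using xP yP P_neg P_subset by blast
    then have "y + x \<in> P" using add_root y xP yP P_add P_subset by blast
    then have "sum_list ((y + x) # remove1 y ys) \<noteq> 0"
      using less.hyps[of "(y + x) # remove1 y ys"] xs less.prems y(1) \<open>ys \<noteq> []\<close>
      by (auto simp: length_remove1 dest: notin_set_remove1 in_mono)
    moreover have "sum_list ys = y + sum_list (remove1 y ys)"
      using y(1) by (metis sum_list_map_remove1 map_ident)
    ultimately show False using 0 xs by (simp add: algebra_simps)
  qed
qed

section \<open>The positive cone, simple roots and simple reflections\<close>

definition cone :: "'w set" where
  "cone = {sum_list xs | xs. set xs \<subseteq> P}"

definition simple :: "'w set" where
  "simple = {a\<in>P. \<forall>b\<in>P. \<forall>c\<in>P. a \<noteq> b + c}"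

lemma simple_P: "a \<in> simple \<Longrightarrow> a \<in> P"
  by (simp add: simple_def)

lemma cone_zero: "0 \<in> cone"
  unfolding cone_def by (rule CollectI, rule exI[of _ "[]"]) simp

lemma cone_P: "a \<in> P \<Longrightarrow> a \<in> cone"
  unfolding cone_def by (rule CollectI, rule exI[of _ "[a]"]) simp

lemma cone_add: "x \<in> cone \<Longrightarrow> y \<in> cone \<Longrightarrow> x + y \<in> cone"
  unfolding cone_def
  by (smt (verit, best) Un_least mem_Collect_eq set_append sum_list_append)

lemma cone_sum: "(\<And>i. i \<in> I \<Longrightarrow> f i \<in> cone) \<Longrightarrow> (\<Sum>i\<in>I. f i) \<in> cone"
  by (induction I rule: infinite_finite_induct) (auto simp: cone_zero cone_add)

text \<open>Induction on the number of positive roots strictly below \<open>b\<close>. For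
  \<open>b = c + d\<close> this set contains \<open>c\<close>, but by
  \<open>sum_list_P_nonzero\<close> \<open>c\<close> is not strictly below itself, so the number
  drops.\<close>

lemma P_simple_decomposition:
  assumes "b \<in> P"
  shows "\<exists>xs. set xs \<subseteq> simple \<and> xs \<noteq> [] \<and> b = sum_list xs"
  using assms
proof (induction "card {x\<in>P. \<exists>xs. set xs \<subseteq> P \<and> xs \<noteq> [] \<and> b = x + sum_list xs}" arbitrary: b
    rule: less_induct)
  case less
  let ?D = "\<lambda>b. {x\<in>P. \<exists>xs. set xs \<subseteq> P \<and> xs \<noteq> [] \<and> b = x + sum_list xs}"
  show ?case
  proof (cases "b \<in> simple")
    case True
    then show ?thesis by (intro exI[of _ "[b]"]) auto
  next
    case False
    then obtain c d where cd: "c \<in> P" "d \<in> P" "b = c + d"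
      using less.prems by (auto simp: simple_def)
    have lt: "card (?D c) < card (?D b)" if "c \<in> P" "d \<in> P" "b = c + d" for c d
    proof (rule psubset_card_mono)
      show "finite (?D b)" using finite_P by simp
      have "\<exists>xs. set xs \<subseteq> P \<and> xs \<noteq> [] \<and> b = x + sum_list xs"
        if "set ys \<subseteq> P" "ys \<noteq> []" "c = x + sum_list ys" for x ys
        using that \<open>d \<in> P\<close> \<open>b = c + d\<close> by (intro exI[of _ "d # ys"]) (auto simp: algebra_simps)
      then have "?D c \<subseteq> ?D b" by auto
      moreover have "c \<in> ?D b" using that by (auto intro!: exI[of _ "[d]"])
      moreover have "c \<notin> ?D c" using sum_list_P_nonzero by auto
      ultimately show "?D c \<subset> ?D b" by blast
    qed
    obtain xs ys where "set xs \<subseteq> simple" "xs \<noteq> []" "c = sum_list xs"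
      "set ys \<subseteq> simple" "ys \<noteq> []" "d = sum_list ys"
      using less.hyps[OF lt[OF cd] cd(1)] less.hyps[OF lt[of d c] cd(2)] cd
      by (metis add.commute)
    then show ?thesis using cd by (intro exI[of _ "xs @ ys"]) auto
  qed
qed

text \<open>The floor supplies the integer needed to multiply in the ring; \<open>refl\<close> is
  the true reflection exactly where \<open>integral\<close> holds.\<close>

definition refl :: "'w \<Rightarrow> 'w \<Rightarrow> 'w" where
  "refl a x = x - of_int \<lfloor>2 * (x \<cdot> a) / (a \<cdot> a)\<rfloor> * a"

definition integral :: "'w \<Rightarrow> 'w \<Rightarrow> bool" where
  "integral a x \<longleftrightarrow> 2 * (x \<cdot> a) / (a \<cdot> a) \<in> \<int>"

lemma refl_form:
  assumes "integral a x"
  shows "refl a x \<cdot> y = x \<cdot> y - 2 * (x \<cdot> a) / (a \<cdot> a) * (a \<cdot> y)"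
  using assms unfolding refl_def integral_def by (auto elim!: Ints_cases simp: form_simps)

lemma refl_form_self:
  assumes "integral a x" "a \<cdot> a \<noteq> 0"
  shows "refl a x \<cdot> a = - (x \<cdot> a)"
  using assms refl_form[of a x a] by (simp add: form_sym)

lemma integral_refl:
  assumes "integral a x" "a \<cdot> a \<noteq> 0"
  shows "integral a (refl a x)"
  using assms refl_form_self[OF assms] unfolding integral_def by auto

lemma refl_refl:
  assumes "integral a x" "a \<cdot> a \<noteq> 0"
  shows "refl a (refl a x) = x"
proof -
  obtain n where "2 * (x \<cdot> a) / (a \<cdot> a) = of_int n"
    using assms(1) unfolding integral_def by (auto elim: Ints_cases)
  moreover from this have "2 * (refl a x \<cdot> a) / (a \<cdot> a) = of_int (- n)"
    using refl_form_self[OF assms] by simp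
  ultimately show ?thesis unfolding refl_def[of a "refl a x"] by (simp add: refl_def)
qed

lemma refl_swap:
  assumes "integral a x" "integral a y"
  shows "refl a x \<cdot> y = x \<cdot> refl a y"
  using refl_form[OF assms(1), of y] refl_form[OF assms(2), of x]
  by (simp add: form_sym)

lemma refl_norm:
  assumes "integral a x" "a \<cdot> a \<noteq> 0"
  shows "refl a x \<cdot> refl a x = x \<cdot> x"
  using refl_swap[OF assms(1) integral_refl[OF assms]] refl_refl[OF assms] by simp

lemma integral_RI: "a \<in> R \<Longrightarrow> b \<in> R \<Longrightarrow> integral a b"
  using integral_R integral_def by blast

lemma integral_add: "integral a x \<Longrightarrow> integral a y \<Longrightarrow> integral a (x + y)"
  unfolding integral_def by (auto simp: form_simps distrib_left add_divide_distrib)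

lemma integral_minus: "integral a x \<Longrightarrow> integral a (- x)"
  unfolding integral_def by (auto simp: form_simps)

lemma integral_diff: "integral a x \<Longrightarrow> integral a y \<Longrightarrow> integral a (x - y)"
  using integral_add[of a x "- y"] integral_minus by simp

lemma integral_sum: "(\<And>i. i \<in> I \<Longrightarrow> integral a (f i)) \<Longrightarrow> integral a (\<Sum>i\<in>I. f i)"
  by (induction I rule: infinite_finite_induct) (auto simp: integral_add, auto simp: integral_def)

lemma refl_eqI: "2 * (x \<cdot> a) / (a \<cdot> a) = of_int n \<Longrightarrow> refl a x = x - of_int n * a"
  unfolding refl_def by simp

lemma refl_diff:
  assumes "integral a x" "integral a y"
  shows "refl a (x - y) = refl a x - refl a y"
proof -
  obtain m n where mn: "2 * (x \<cdot> a) / (a \<cdot> a) = of_int m" "2 * (y \<cdot> a) / (a \<cdot> a) = of_int n"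
    using assms unfolding integral_def by (auto elim!: Ints_cases)
  then have "2 * ((x - y) \<cdot> a) / (a \<cdot> a) = of_int (m - n)"
    by (simp add: form_simps right_diff_distrib diff_divide_distrib)
  from refl_eqI[OF this] show ?thesis
    unfolding refl_eqI[OF mn(1)] refl_eqI[OF mn(2)] by (simp add: algebra_simps)
qed

lemma refl_zero [simp]: "refl a 0 = 0"
  by (simp add: refl_def)

lemma refl_add:
  assumes "integral a x" "integral a y"
  shows "refl a (x + y) = refl a x + refl a y"
proof -
  have "integral a 0" by (simp add: integral_def)
  then show ?thesis
    using refl_diff[OF assms(1) integral_minus[OF assms(2)]] refl_diff[of a 0 y] assms(2) by simp
qed

lemma refl_sum:
  assumes "\<And>i. i \<in> I \<Longrightarrow> integral a (f i)"
  shows "refl a (\<Sum>i\<in>I. f i) = (\<Sum>i\<in>I. refl a (f i))"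
  using assms
  by (induction I rule: infinite_finite_induct) (auto simp: refl_add integral_sum)

text \<open>Walk along the string from \<open>b\<close> to its reflection in steps of
  \<open>a\<close>. A first negative root on the way would exhibit the simple root \<open>a\<close>
  as a sum of two positive roots.\<close>

lemma refl_simple_P:
  assumes a: "a \<in> simple" and b: "b \<in> P" "b \<noteq> a"
  shows "refl a b \<in> P - {a}"
proof -
  have aR: "a \<in> R" "a \<in> P" and bR: "b \<in> R" using assms P_subset simple_P by auto
  have na: "b \<noteq> - a" using P_neg[OF bR] aR b by auto
  obtain n where n: "2 * (b \<cdot> a) / (a \<cdot> a) = of_int n"
    using integral_R[OF aR(1) bR] by (auto elim: Ints_cases)
  have "refl a b \<in> P"
  proof (cases "n \<ge> 0")
    case True
    have "b - of_nat j * a \<in> P" if "int j \<le> n" for j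
      using that
    proof (induction j)
      case (Suc j)
      have "b - of_nat (Suc j) * a \<in> R"
        using string_R[OF aR(1) bR b(2) na, of "Suc j"] Suc n
        by (metis of_int_le_iff of_int_of_nat_eq)
      moreover have "- (b - of_nat (Suc j) * a) \<notin> P"
      proof
        assume "- (b - of_nat (Suc j) * a) \<in> P"
        moreover have "b - of_nat j * a \<in> P" using Suc by simp
        moreover have "a = (b - of_nat j * a) + - (b - of_nat (Suc j) * a)"
          by (simp add: algebra_simps)
        ultimately show False using a unfolding simple_def by blast
      qed
      ultimately show ?case using P_neg by blast
    qed (use b in auto)
    from this[of "nat n"] True show ?thesis using refl_eqI[OF n] by (simp add: of_nat_nat)
  next
    case False
    have "b + of_nat j * a \<in> P" if "int j \<le> - n" for j
      using that
    proof (induction j)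
      case (Suc j)
      have "2 * (b \<cdot> (- a)) / ((- a) \<cdot> (- a)) = of_int (- n)"
        using n by (simp add: form_simps)
      moreover have "real (Suc j) \<le> of_int (- n)"
        using Suc.prems by (metis of_int_le_iff of_int_of_nat_eq)
      ultimately have "b - of_nat (Suc j) * (- a) \<in> R"
        using string_R[OF uminus_R[OF aR(1)] bR, of "Suc j"] b na by simp
      then have "(b + of_nat j * a) + a \<in> R" by (simp add: algebra_simps)
      then show ?case using Suc P_add[of "b + of_nat j * a" a] aR by (simp add: algebra_simps)
    qed (use b in auto)
    from this[of "nat (- n)"] False show ?thesis using refl_eqI[OF n] by (simp add: of_nat_nat)
  qed
  moreover have "refl a b \<noteq> a"
  proof
    assume "refl a b = a"
    then have "refl a a = b"
      using refl_refl[OF integral_RI[OF aR(1) bR]] form_pos[OF aR(1)] by simp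
    moreover have "refl a a = - a"
      using form_pos[OF aR(1)] refl_eqI[of a a 2] by simp
    ultimately show False using na by simp
  qed
  ultimately show ?thesis by simp
qed

lemma bij_refl_simple:
  assumes "a \<in> simple"
  shows "bij_betw (refl a) (P - {a}) (P - {a})"
proof -
  have "a \<in> R" using assms simple_P P_subset by blast
  then have "refl a (refl a x) = x" if "x \<in> P - {a}" for x
    using that P_subset integral_RI form_pos[of a] by (intro refl_refl) auto
  then show ?thesis
    using refl_simple_P[OF assms] by (intro bij_betw_byWitness[where f' = "refl a"]) auto
qed

text \<open>The reflection permutes the positive roots other than \<open>a\<close> and negates their
  products with \<open>a\<close>, so those products sum to 0 and only \<open>a\<close> itself
  contributes to the product with \<open>\<rho> + \<rho>\<close>.\<close>

lemma rho_simple: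
  assumes a: "a \<in> simple"
  shows "2 * (\<rho> \<cdot> a) = a \<cdot> a"
proof -
  have aP: "a \<in> P" "a \<in> R" using a simple_P P_subset by blast+
  then have a0: "a \<cdot> a \<noteq> 0" using form_pos[of a] by simp
  have "(\<Sum>b\<in>P - {a}. b \<cdot> a) = (\<Sum>b\<in>P - {a}. refl a b \<cdot> a)"
    by (rule sum.reindex_bij_betw[OF bij_refl_simple[OF a], symmetric])
  also have "\<dots> = - (\<Sum>b\<in>P - {a}. b \<cdot> a)"
  proof -
    have "refl a b \<cdot> a = - (b \<cdot> a)" if "b \<in> P - {a}" for b
      using that aP a0 P_subset by (intro refl_form_self integral_RI) auto
    then show ?thesis by (simp add: sum_negf)
  qed
  finally have "(\<Sum>b\<in>P - {a}. b \<cdot> a) = 0" by simp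
  then have "(\<Sum>P) \<cdot> a = a \<cdot> a"
    unfolding form_sum_left using sum.remove[OF finite_P aP(1), of "\<lambda>b. b \<cdot> a"] by simp
  then show ?thesis using form_add_left[of \<rho> \<rho> a] unfolding rho_double by simp
qed

lemma rho_simple_pos: "a \<in> simple \<Longrightarrow> a \<cdot> \<rho> > 0"
  using rho_simple[of a] P_pos[of a] simple_P[of a] form_sym[of a \<rho>] by simp

lemma sum_list_simple_nonneg:
  assumes "set xs \<subseteq> simple" "\<And>a. a \<in> simple \<Longrightarrow> a \<cdot> x \<ge> 0"
  shows "sum_list xs \<cdot> x \<ge> 0"
  using assms by (induction xs) (auto simp: form_add_left)

lemma P_nonneg:
  assumes "\<And>a. a \<in> simple \<Longrightarrow> a \<cdot> x \<ge> 0" "b \<in> P"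
  shows "b \<cdot> x \<ge> 0"
  using P_simple_decomposition[OF assms(2)] sum_list_simple_nonneg assms(1) by blast

lemma P_positive:
  assumes "\<And>a. a \<in> simple \<Longrightarrow> a \<cdot> x > 0" "b \<in> P"
  shows "b \<cdot> x > 0"
proof -
  obtain xs where xs: "set xs \<subseteq> simple" "xs \<noteq> []" "b = sum_list xs"
    using P_simple_decomposition[OF assms(2)] by blast
  then obtain y ys where "xs = y # ys" by (cases xs) auto
  then show ?thesis using xs assms(1)[of y] sum_list_simple_nonneg[of ys x] assms(1)
    by (auto simp: form_add_left less_imp_le add_pos_nonneg)
qed

lemma P_rho_pos: "b \<in> P \<Longrightarrow> b \<cdot> \<rho> > 0"
  using P_positive rho_simple_pos by blast

lemma cone_nonneg:
  assumes "\<And>a. a \<in> P \<Longrightarrow> a \<cdot> x \<ge> 0" "y \<in> cone"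
  shows "y \<cdot> x \<ge> 0"
proof -
  have "sum_list xs \<cdot> x \<ge> 0" if "set xs \<subseteq> P" for xs
    using that assms(1) by (induction xs) (auto simp: form_add_left)
  then show ?thesis using assms(2) unfolding cone_def by auto
qed

lemma cone_positive:
  assumes "\<And>a. a \<in> P \<Longrightarrow> a \<cdot> x > 0" "y \<in> cone" "y \<noteq> 0"
  shows "y \<cdot> x > 0"
proof -
  obtain xs where xs: "set xs \<subseteq> P" "y = sum_list xs" using assms(2) by (auto simp: cone_def)
  then obtain z zs where zs: "xs = z # zs" using assms(3) by (cases xs) auto
  have "sum_list zs \<in> cone" using xs zs by (auto simp: cone_def)
  then have "sum_list zs \<cdot> x \<ge> 0" by (rule cone_nonneg[rotated]) (use assms(1) in \<open>auto intro: less_imp_le\<close>)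
  then show ?thesis using assms(1)[of z] xs zs by (auto simp: form_add_left)
qed

end

section \<open>The Weyl dimension formula\<close>

context root_datum
begin

text \<open>The label of the chamber containing \<open>x\<close>; the label \<open>P\<close> is that
  of the regular dominant points.\<close>

definition positive_at :: "'w \<Rightarrow> 'w set" where
  "positive_at x = {b\<in>P. b \<cdot> x > 0}"

definition pairing_product :: "'w \<Rightarrow> real" where
  "pairing_product x = (\<Prod>b\<in>P. b \<cdot> x)"

text \<open>Imposed on the support only, where integrality makes \<open>refl\<close> a true
  reflection and \<open>a \<cdot> x \<noteq> 0\<close> keeps points off the walls of the simple
  roots.\<close>

definition antisymmetric :: "('w \<Rightarrow> real) \<Rightarrow> bool" where
  "antisymmetric c \<longleftrightarrow> finite {x. c x \<noteq> 0} \<and>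
    (\<forall>a\<in>simple. \<forall>x. c x \<noteq> 0 \<longrightarrow> integral a x \<and> a \<cdot> x \<noteq> 0 \<and> c (refl a x) = - c x)"

definition chamber_sum :: "('w \<Rightarrow> real) \<Rightarrow> 'w set \<Rightarrow> real" where
  "chamber_sum c A = (\<Sum>x | c x \<noteq> 0 \<and> positive_at x = A. c x * pairing_product x)"

lemma simple_facts:
  assumes "a \<in> simple"
  shows "a \<in> P" "a \<in> R" "a \<cdot> a > 0" "a \<cdot> a \<noteq> 0"
proof -
  show a: "a \<in> P" "a \<in> R" using assms simple_P P_subset by blast+
  show "a \<cdot> a > 0" by (rule form_pos[OF a(2)])
  then show "a \<cdot> a \<noteq> 0" by simp
qed

lemma refl_pairing:
  assumes "a \<in> simple" "integral a x" "b \<in> P"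
  shows "b \<cdot> refl a x = refl a b \<cdot> x"
  using assms P_subset simple_P[OF assms(1)] by (subst refl_swap) (auto intro!: integral_RI)

lemma pairing_product_refl:
  assumes "a \<in> simple" "integral a x"
  shows "pairing_product (refl a x) = - pairing_product x"
proof -
  note a = simple_facts[OF assms(1)]
  have "(\<Prod>b\<in>P - {a}. b \<cdot> refl a x) = (\<Prod>b\<in>P - {a}. refl a b \<cdot> x)"
    by (intro prod.cong) (use assms refl_pairing in auto)
  also have "\<dots> = (\<Prod>b\<in>P - {a}. b \<cdot> x)"
    by (rule prod.reindex_bij_betw[OF bij_refl_simple[OF assms(1)]])
  moreover have "a \<cdot> refl a x = - (a \<cdot> x)"
    using refl_form_self[OF assms(2) a(4)] by (simp add: form_sym)
  ultimately show ?thesis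
    unfolding pairing_product_def
    using prod.remove[OF finite_P a(1), of "\<lambda>b. b \<cdot> refl a x"]
      prod.remove[OF finite_P a(1), of "\<lambda>b. b \<cdot> x"] by simp
qed

lemma positive_at_refl:
  assumes "a \<in> simple" "integral a x"
  shows "positive_at (refl a x) = {b\<in>P. b \<noteq> a \<and> refl a b \<in> positive_at x \<or> b = a \<and> a \<cdot> x < 0}"
proof -
  note a = simple_facts[OF assms(1)]
  have "a \<cdot> refl a x = - (a \<cdot> x)"
    using refl_form_self[OF assms(2) a(4)] by (simp add: form_sym)
  then show ?thesis
    unfolding positive_at_def using refl_pairing[OF assms] refl_simple_P[OF assms(1)] by fastforce
qed

definition reflect_set :: "'w \<Rightarrow> 'w set \<Rightarrow> 'w set" where
  "reflect_set a A = insert a {b\<in>P. b \<noteq> a \<and> refl a b \<in> A}"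

text \<open>The reflection in \<open>a\<close> exchanges the two chambers. Both \<open>c\<close> and
  \<open>pairing_product\<close> change sign under it, so their product does not.\<close>

lemma chamber_sum_move:
  assumes c: "antisymmetric c" and a: "a \<in> simple" and A: "a \<notin> A" "A \<subseteq> P"
  shows "chamber_sum c A = chamber_sum c (reflect_set a A)"
proof -
  note f = simple_facts[OF a]
  have supp: "integral a x" "a \<cdot> x \<noteq> 0" "c (refl a x) = - c x" if "c x \<noteq> 0" for x
    using c a that unfolding antisymmetric_def by blast+
  have rr: "refl a (refl a b) = b" if "b \<in> P" for b
    using that f P_subset by (intro refl_refl integral_RI) auto
  have in_reflect: "refl a b \<in> reflect_set a A \<longleftrightarrow> b \<in> A" if "b \<in> P" "b \<noteq> a" for b
    using refl_simple_P[OF a that] rr[OF that(1)] unfolding reflect_set_def by simp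
  have fwd: "positive_at (refl a x) = reflect_set a A" if "c x \<noteq> 0" "positive_at x = A" for x
  proof -
    have "a \<cdot> x < 0"
      using A(1) f(1) supp(2)[OF that(1)] unfolding that(2)[symmetric] positive_at_def by simp
    then show ?thesis
      unfolding positive_at_refl[OF a supp(1)[OF that(1)]] reflect_set_def that(2) using f(1) by blast
  qed
  have bwd: "positive_at (refl a x) = A" if "c x \<noteq> 0" "positive_at x = reflect_set a A" for x
  proof -
    have "a \<in> positive_at x" unfolding that reflect_set_def by simp
    then have "\<not> a \<cdot> x < 0" by (simp add: positive_at_def)
    then have "positive_at (refl a x) = {b\<in>P. b \<noteq> a \<and> refl a b \<in> reflect_set a A}"
      unfolding positive_at_refl[OF a supp(1)[OF that(1)]] that(2) by blast
    also have "\<dots> = {b\<in>P. b \<noteq> a \<and> b \<in> A}" using in_reflect by blast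
    also have "\<dots> = A" using A by blast
    finally show ?thesis .
  qed
  have inv: "refl a (refl a x) = x" if "c x \<noteq> 0" for x
    by (rule refl_refl[OF supp(1)[OF that] f(4)])
  show ?thesis
    unfolding chamber_sum_def
    by (rule sum.reindex_bij_witness[where i = "refl a" and j = "refl a"])
      (auto simp: inv supp fwd bwd pairing_product_refl[OF a])
qed

lemma positive_at_simple:
  assumes "simple \<subseteq> positive_at x"
  shows "positive_at x = P"
  using assms P_positive unfolding positive_at_def by blast

lemma chamber_sum_empty:
  assumes "simple \<subseteq> A" "A \<noteq> P"
  shows "chamber_sum c A = 0"
proof -
  have "positive_at x \<noteq> A" for x using positive_at_simple assms by blast
  then show ?thesis unfolding chamber_sum_def by simp
qed

text \<open>Replaces induction over the Weyl group. \<open>A\<close> ranges over all subsets of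
  \<open>P\<close>, chamber or not: reflecting in a simple root missing from \<open>A\<close>
  enlarges it by one element, so the walk ends at \<open>P\<close> or at a set that contains all
  simple roots and is the label of no point.\<close>

lemma chamber_sum_induct [consumes 1, case_names top empty step]:
  assumes "A \<subseteq> P" and top: "Q P" and empty: "\<And>A. simple \<subseteq> A \<Longrightarrow> A \<noteq> P \<Longrightarrow> A \<subseteq> P \<Longrightarrow> Q A"
    and step: "\<And>a A. a \<in> simple \<Longrightarrow> a \<notin> A \<Longrightarrow> A \<subseteq> P \<Longrightarrow> Q (reflect_set a A) \<Longrightarrow> Q A"
  shows "Q A"
  using \<open>A \<subseteq> P\<close>
proof (induction "card P - card A" arbitrary: A rule: less_induct)
  case less
  show ?case
  proof (cases "simple \<subseteq> A")
    case True
    then show ?thesis using top empty less.prems by blast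
  next
    case False
    then obtain a where a: "a \<in> simple" "a \<notin> A" by blast
    have finA: "finite A" using less.prems finite_P finite_subset by blast
    let ?B = "{b\<in>P. b \<noteq> a \<and> refl a b \<in> A}"
    have "A \<subseteq> P - {a}" using less.prems a by blast
    moreover have "refl a (refl a b) = b" if "b \<in> P" for b
      using that simple_facts[OF a(1)] P_subset by (intro refl_refl integral_RI) auto
    ultimately have "bij_betw (refl a) ?B A"
      using refl_simple_P[OF a(1)] by (intro bij_betw_byWitness[where f' = "refl a"]) auto
    then have "card ?B = card A" by (rule bij_betw_same_card)
    then have card: "card (reflect_set a A) = Suc (card A)"
      unfolding reflect_set_def using finite_P by simp
    have sub: "reflect_set a A \<subseteq> P" unfolding reflect_set_def using simple_P[OF a(1)] by blast
    have "card (reflect_set a A) \<le> card P" by (rule card_mono[OF finite_P sub])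
    then have "card P - card (reflect_set a A) < card P - card A" using card by simp
    from less.hyps[OF this sub] show ?thesis using step a less.prems by blast
  qed
qed

text \<open>The same walk serves \<open>c\<close> and \<open>c'\<close>: either both sums are
  carried to the dominant chamber or both are 0.\<close>

lemma chamber_sum_proportional:
  assumes "antisymmetric c" "antisymmetric c'" "A \<subseteq> P"
  shows "chamber_sum c A * chamber_sum c' P = chamber_sum c' A * chamber_sum c P"
  using assms(3)
proof (induction rule: chamber_sum_induct)
  case (step a A)
  then show ?case using chamber_sum_move assms by metis
qed (auto simp: chamber_sum_empty)

lemma chamber_sum_nonneg:
  assumes "antisymmetric c" "chamber_sum c P \<ge> 0" "A \<subseteq> P"
  shows "chamber_sum c A \<ge> 0"
  using assms(3)
proof (induction rule: chamber_sum_induct)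
  case (step a A)
  then show ?case using chamber_sum_move[OF assms(1)] by metis
qed (auto simp: chamber_sum_empty assms)

definition total_sum :: "('w \<Rightarrow> real) \<Rightarrow> real" where
  "total_sum c = (\<Sum>x | c x \<noteq> 0. c x * pairing_product x)"

lemma total_sum_chambers:
  assumes "antisymmetric c"
  shows "total_sum c = (\<Sum>A\<in>Pow P. chamber_sum c A)"
proof -
  have "finite {x. c x \<noteq> 0}" using assms by (simp add: antisymmetric_def)
  moreover have "positive_at ` {x. c x \<noteq> 0} \<subseteq> Pow P" by (auto simp: positive_at_def)
  ultimately show ?thesis
    using sum.group[of "{x. c x \<noteq> 0}" "Pow P" positive_at "\<lambda>x. c x * pairing_product x"] finite_P
    unfolding total_sum_def chamber_sum_def by simp
qed

text \<open>Both totals are the same multiple of their dominant parts, and the multiple (the number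
  of chambers) cancels.\<close>

lemma total_sum_proportional:
  assumes "antisymmetric c" "antisymmetric c'"
  shows "total_sum c * chamber_sum c' P = total_sum c' * chamber_sum c P"
  using chamber_sum_proportional[OF assms]
  unfolding total_sum_chambers[OF assms(1)] total_sum_chambers[OF assms(2)] sum_distrib_right
  by (intro sum.cong) auto

lemma total_sum_pos:
  assumes "antisymmetric c" "chamber_sum c P > 0"
  shows "total_sum c > 0"
  unfolding total_sum_chambers[OF assms(1)]
  by (rule sum_pos2[of _ P]) (use assms finite_P chamber_sum_nonneg[OF assms(1)] in auto)

text \<open>The coefficient at \<open>x\<close> of \<open>m\<close>, read as a formal sum of
  exponentials, times the Weyl denominator. Expanding the product of all \<open>1 - e^(-a)\<close>,
  shifted by \<open>\<rho>\<close>, over subsets \<open>S\<close> gives the exponents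
  \<open>\<rho> - \<Sum>S\<close>.\<close>

definition alternating :: "('w \<Rightarrow> real) \<Rightarrow> 'w \<Rightarrow> real" where
  "alternating m x = (\<Sum>S\<in>Pow P. (-1) ^ card S * m (x - \<rho> + \<Sum>S))"

text \<open>Polynomial degree at most \<open>n\<close> on an abelian group: all \<open>(n + 1)\<close>-fold differences vanish.\<close>

fun has_degree :: "nat \<Rightarrow> ('w \<Rightarrow> real) \<Rightarrow> bool" where
  "has_degree 0 g \<longleftrightarrow> (\<exists>c. \<forall>x. g x = c)"
| "has_degree (Suc n) g \<longleftrightarrow> (\<forall>a. has_degree n (\<lambda>x. g x - g (x - a)))"

lemma has_degree_add: "has_degree n f \<Longrightarrow> has_degree n g \<Longrightarrow> has_degree n (\<lambda>x. f x + g x)"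
proof (induction n arbitrary: f g)
  case (Suc n)
  show ?case
  proof (unfold has_degree.simps, intro allI)
    fix a
    have "has_degree n (\<lambda>x. (f x - f (x - a)) + (g x - g (x - a)))"
      using Suc by (intro Suc.IH) auto
    then show "has_degree n (\<lambda>x. f x + g x - (f (x - a) + g (x - a)))"
      by (simp add: algebra_simps)
  qed
qed auto

lemma has_degree_shift: "has_degree n f \<Longrightarrow> has_degree n (\<lambda>x. r * f (x - b))"
proof (induction n arbitrary: f)
  case (Suc n)
  show ?case
  proof (unfold has_degree.simps, intro allI)
    fix a
    have "has_degree n (\<lambda>x. r * (f (x - b) - f (x - b - a)))"
      using Suc.prems by (intro Suc.IH[of "\<lambda>x. f x - f (x - a)"]) auto
    then show "has_degree n (\<lambda>x. r * f (x - b) - r * f (x - a - b))"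
      by (simp add: algebra_simps)
  qed
qed auto

text \<open>Leibniz rule: the difference of \<open>(b \<cdot> x) * f x\<close> in direction
  \<open>a\<close> is \<open>b \<cdot> x\<close> times the difference of \<open>f\<close>, plus
  \<open>b \<cdot> a\<close> times a shift of \<open>f\<close>.\<close>

lemma has_degree_mult: "has_degree n f \<Longrightarrow> has_degree (Suc n) (\<lambda>x. (b \<cdot> x) * f x)"
proof (induction n arbitrary: f)
  case 0
  then show ?case by (auto simp: form_simps algebra_simps)
next
  case (Suc n)
  show ?case
  proof (subst has_degree.simps(2), intro allI)
    fix a
    have "has_degree (Suc n) (\<lambda>x. (b \<cdot> x) * (f x - f (x - a)))"
      using Suc by auto
    moreover have "has_degree (Suc n) (\<lambda>x. (b \<cdot> a) * f (x - a))"
      by (rule has_degree_shift[OF Suc.prems])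
    ultimately have "has_degree (Suc n) (\<lambda>x. (b \<cdot> x) * (f x - f (x - a)) + (b \<cdot> a) * f (x - a))"
      by (rule has_degree_add)
    then show "has_degree (Suc n) (\<lambda>x. (b \<cdot> x) * f x - (b \<cdot> (x - a)) * f (x - a))"
      by (simp add: form_simps algebra_simps)
  qed
qed

lemma has_degree_prod: "finite A \<Longrightarrow> has_degree (card A) (\<lambda>x. \<Prod>b\<in>A. b \<cdot> (x + y))"
proof (induction A rule: finite_induct)
  case (insert a A)
  have "has_degree (Suc (card A)) (\<lambda>x. (a \<cdot> x) * (\<Prod>b\<in>A. b \<cdot> (x + y)) + 0)"
    using has_degree_mult insert by simp
  moreover have "has_degree (Suc n) f" if "has_degree n f" for n f
    using that
  proof (induction n arbitrary: f)
    case (Suc n)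
    then show ?case by (subst has_degree.simps(2)) auto
  qed auto
  then have "has_degree (Suc (card A)) (\<lambda>x. (a \<cdot> y) * (\<Prod>b\<in>A. b \<cdot> (x - 0 + y)))"
    using has_degree_shift[OF insert.IH, of "a \<cdot> y" 0] by blast
  ultimately have "has_degree (Suc (card A)) (\<lambda>x. ((a \<cdot> x) * (\<Prod>b\<in>A. b \<cdot> (x + y)) + 0)
      + (a \<cdot> y) * (\<Prod>b\<in>A. b \<cdot> (x - 0 + y)))"
    by (rule has_degree_add)
  then show ?case using insert by (simp add: form_simps algebra_simps)
qed auto

lemma sum_Pow_insert:
  assumes "finite A" "a \<notin> A"
  shows "(\<Sum>S\<in>Pow (insert a A). (h::_ \<Rightarrow> 'b::comm_monoid_add) S) = (\<Sum>S\<in>Pow A. h S + h (insert a S))"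
proof -
  have "inj_on (insert a) (Pow A)"
    using assms(2) by (intro inj_onI) (metis PowD insert_ident subsetD)
  moreover have "Pow A \<inter> insert a ` Pow A = {}" using assms(2) by auto
  ultimately show ?thesis
    unfolding Pow_insert using assms(1)
    by (simp add: sum.union_disjoint sum.reindex sum.distrib)
qed

text \<open>The sum over subsets is the iterated difference along all elements of \<open>A\<close>,
  one for each degree.\<close>

lemma alternating_shift_const:
  assumes "finite A" "has_degree (card A) g"
  shows "\<exists>K. \<forall>x. (\<Sum>S\<in>Pow A. (-1) ^ card S * g (x - \<Sum>S)) = K"
  using assms
proof (induction A arbitrary: g rule: finite_induct)
  case (insert a A)
  have "has_degree (card A) (\<lambda>x. g x - g (x - a))"
    using insert by simp
  then obtain K where K: "(\<Sum>S\<in>Pow A. (-1) ^ card S * (g (x - \<Sum>S) - g (x - \<Sum>S - a))) = K" for x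
    using insert.IH by blast
  have "(\<Sum>S\<in>Pow (insert a A). (-1) ^ card S * g (x - \<Sum>S)) = K" for x
    unfolding sum_Pow_insert[OF insert.hyps] K[of x, symmetric]
  proof (rule sum.cong[OF refl])
    fix S assume "S \<in> Pow A"
    then have "finite S" "a \<notin> S" using insert.hyps finite_subset by auto
    then show "(-1) ^ card S * g (x - \<Sum>S) + (-1) ^ card (insert a S) * g (x - \<Sum>(insert a S))
        = (-1) ^ card S * (g (x - \<Sum>S) - g (x - \<Sum>S - a))"
      by (simp add: algebra_simps)
  qed
  then show ?case by blast
qed auto

lemma finite_alternating:
  assumes "finite {x. m x \<noteq> 0}"
  shows "finite {x. alternating m x \<noteq> 0}"
proof (rule finite_subset)
  show "{x. alternating m x \<noteq> 0} \<subseteq> (\<lambda>(y, S). y + \<rho> - \<Sum>S) ` ({x. m x \<noteq> 0} \<times> Pow P)"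
  proof
    fix x assume "x \<in> {x. alternating m x \<noteq> 0}"
    then obtain S where "S \<in> Pow P" "m (x - \<rho> + \<Sum>S) \<noteq> 0"
      unfolding alternating_def using sum.not_neutral_contains_not_neutral by force
    then show "x \<in> (\<lambda>(y, S). y + \<rho> - \<Sum>S) ` ({x. m x \<noteq> 0} \<times> Pow P)"
      by (intro image_eqI[of _ _ "(x - \<rho> + \<Sum>S, S)"]) (auto simp: algebra_simps)
  qed
  show "finite ((\<lambda>(y, S). y + \<rho> - \<Sum>S) ` ({x. m x \<noteq> 0} \<times> Pow P))"
    using assms finite_P by simp
qed

text \<open>After the substitution \<open>y = x - \<rho> + \<Sum>S\<close> the weight
  \<open>m y\<close> is multiplied by an iterated difference, along all positive roots, of a
  polynomial of degree \<open>card P\<close>. That is a constant, so the total counts the weights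
  with multiplicity.\<close>

lemma total_sum_alternating:
  assumes "finite {x. m x \<noteq> 0}"
  shows "total_sum (alternating m) =
    (\<Sum>y | m y \<noteq> 0. m y) * (\<Sum>S\<in>Pow P. (-1) ^ card S * pairing_product (\<rho> - \<Sum>S))"
proof -
  let ?M = "{x. m x \<noteq> 0}"
  \<comment> \<open>A finite range containing every exponent that occurs, so that the two sums can
    be interchanged.\<close>
  define N where "N = {x. alternating m x \<noteq> 0} \<union> (\<lambda>(y, S). y + \<rho> - \<Sum>S) ` (?M \<times> Pow P)"
  have finN: "finite N" unfolding N_def using assms finite_P finite_alternating by simp
  have "has_degree (card P) (\<lambda>x. pairing_product (x + \<rho>))"
    unfolding pairing_product_def by (rule has_degree_prod[OF finite_P])
  then obtain K where K: "(\<Sum>S\<in>Pow P. (-1) ^ card S * pairing_product (x - \<Sum>S + \<rho>)) = K" for x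
    using alternating_shift_const[OF finite_P] by blast
  have "total_sum (alternating m) = (\<Sum>x\<in>N. alternating m x * pairing_product x)"
    unfolding total_sum_def by (rule sum.mono_neutral_left[OF finN]) (auto simp: N_def)
  also have "\<dots> = (\<Sum>x\<in>N. \<Sum>S\<in>Pow P. (-1) ^ card S * (m (x - \<rho> + \<Sum>S) * pairing_product x))"
    unfolding alternating_def sum_distrib_right by (simp add: mult.assoc)
  also have "\<dots> = (\<Sum>S\<in>Pow P. (-1) ^ card S * (\<Sum>x\<in>N. m (x - \<rho> + \<Sum>S) * pairing_product x))"
    unfolding sum_distrib_left by (rule sum.swap)
  also have "\<dots> = (\<Sum>S\<in>Pow P. (-1) ^ card S * (\<Sum>y\<in>?M. m y * pairing_product (y - \<Sum>S + \<rho>)))"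
  proof (rule sum.cong[OF refl])
    fix S assume S: "S \<in> Pow P"
    have "(\<Sum>x\<in>N. m (x - \<rho> + \<Sum>S) * pairing_product x) =
        (\<Sum>x | x \<in> N \<and> m (x - \<rho> + \<Sum>S) \<noteq> 0. m (x - \<rho> + \<Sum>S) * pairing_product x)"
      by (rule sum.mono_neutral_right[OF finN]) auto
    also have "\<dots> = (\<Sum>y\<in>?M. m y * pairing_product (y - \<Sum>S + \<rho>))"
    proof (rule sum.reindex_bij_witness[where i = "\<lambda>y. y + \<rho> - \<Sum>S" and j = "\<lambda>x. x - \<rho> + \<Sum>S"])
      show "y + \<rho> - \<Sum>S \<in> {x \<in> N. m (x - \<rho> + \<Sum>S) \<noteq> 0}" if "y \<in> ?M" for y
        using that S unfolding N_def by force
    qed (auto simp: algebra_simps)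
    finally show "(-1) ^ card S * (\<Sum>x\<in>N. m (x - \<rho> + \<Sum>S) * pairing_product x) =
        (-1) ^ card S * (\<Sum>y\<in>?M. m y * pairing_product (y - \<Sum>S + \<rho>))" by simp
  qed
  also have "\<dots> = (\<Sum>y\<in>?M. m y * (\<Sum>S\<in>Pow P. (-1) ^ card S * pairing_product (y - \<Sum>S + \<rho>)))"
    unfolding sum_distrib_left by (subst sum.swap) (simp add: mult_ac)
  also have "\<dots> = (\<Sum>y\<in>?M. m y) * K" unfolding K sum_distrib_right ..
  also have "K = (\<Sum>S\<in>Pow P. (-1) ^ card S * pairing_product (\<rho> - \<Sum>S))"
    using K[of 0] by (simp add: algebra_simps)
  finally show ?thesis .
qed

end

section \<open>The Weyl denominator\<close>

context root_datum
begin

lemma P_sum_zero: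
  assumes "S \<subseteq> P" "\<Sum>S \<cdot> \<rho> \<le> 0"
  shows "S = {}"
proof (rule ccontr)
  assume "S \<noteq> {}"
  then have "(\<Sum>a\<in>S. a \<cdot> \<rho>) > 0"
    using assms finite_subset[OF _ finite_P] P_rho_pos by (intro sum_pos) auto
  then show False using assms(2) by (simp add: form_sum_left)
qed

lemma integral_rho: "a \<in> simple \<Longrightarrow> integral a \<rho>"
  using rho_simple[of a] simple_facts[of a] by (simp add: integral_def)

lemma refl_rho: "a \<in> simple \<Longrightarrow> refl a \<rho> = \<rho> - a"
  using rho_simple[of a] simple_facts[of a] refl_eqI[of \<rho> a 1] by simp

lemma integral_sum_P: "a \<in> simple \<Longrightarrow> S \<subseteq> P \<Longrightarrow> integral a (\<Sum>S)"
  using P_subset simple_facts[of a] by (intro integral_sum integral_RI) auto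

lemma refl_self: "a \<in> simple \<Longrightarrow> refl a a = - a"
  using refl_eqI[of a a 2] simple_facts[of a] by simp

lemma refl_sum_P:
  assumes "a \<in> simple" "S \<subseteq> P"
  shows "refl a (\<Sum>S) = \<Sum>(refl a ` S)"
proof -
  have *: "integral a b" "refl a (refl a b) = b" if "b \<in> S" for b
    using that simple_facts[OF assms(1)] P_subset assms(2)
    by (auto intro!: refl_refl integral_RI)
  then have "inj_on (refl a) S" by (metis inj_onI)
  then show ?thesis using refl_sum[of S a "\<lambda>x. x"] * by (simp add: sum.reindex)
qed

text \<open>The character of the trivial module, so that \<open>alternating delta\<close> is the
  Weyl denominator.\<close>

abbreviation delta :: "'w \<Rightarrow> real" where
  "delta \<equiv> (\<lambda>x. if x = 0 then 1 else 0)"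

text \<open>Isolates the factor \<open>1 - e^(-a)\<close> of the denominator. It thereby shows that
  \<open>alternating m\<close> is a difference in direction \<open>a\<close>.\<close>

lemma alternating_split:
  assumes "a \<in> P"
  shows "alternating m x =
    (\<Sum>S\<in>Pow (P - {a}). (-1) ^ card S * (m (x - \<rho> + \<Sum>S) - m (x + a - \<rho> + \<Sum>S)))"
proof -
  have P: "P = insert a (P - {a})" using assms by blast
  have f: "finite (P - {a})" using finite_P by simp
  show ?thesis
    unfolding alternating_def
    apply (subst P)
    apply (subst sum_Pow_insert[OF f])
     apply simp
    apply (rule sum.cong[OF refl])
    subgoal for S
    proof -
      assume "S \<in> Pow (P - {a})"
      then have "finite S" "a \<notin> S" using f finite_subset by auto
      then show ?thesis by (simp add: algebra_simps)
    qed
    done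
qed

text \<open>The reflection permutes the positive roots other than \<open>a\<close> and exchanges
  \<open>\<rho>\<close> with \<open>\<rho> - a\<close>, hence exchanges the two terms of the split
  factor.\<close>

lemma alternating_delta_refl:
  assumes a: "a \<in> simple" and x: "integral a x"
  shows "alternating delta (refl a x) = - alternating delta x"
proof -
  let ?Q = "P - {a}"
  note f = simple_facts[OF a]
  have swap: "refl a x = y \<longleftrightarrow> x = refl a y" if "integral a y" for y
    using refl_refl[OF x f(4)] refl_refl[OF that f(4)] by metis
  have bij: "bij_betw ((`) (refl a)) (Pow ?Q) (Pow ?Q)"
    by (rule bij_betw_Pow[OF bij_refl_simple[OF a]])
  have "alternating delta (refl a x) = (\<Sum>S\<in>Pow ?Q. (-1) ^ card (refl a ` S) *
      (delta (refl a x - \<rho> + \<Sum>(refl a ` S)) - delta (refl a x + a - \<rho> + \<Sum>(refl a ` S))))"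
    unfolding alternating_split[OF f(1)] by (rule sum.reindex_bij_betw[OF bij, symmetric])
  also have "\<dots> = (\<Sum>S\<in>Pow ?Q. - ((-1) ^ card S * (delta (x - \<rho> + \<Sum>S) - delta (x + a - \<rho> + \<Sum>S))))"
  proof (rule sum.cong[OF refl])
    fix S assume "S \<in> Pow ?Q"
    then have S: "S \<subseteq> P" "S \<subseteq> ?Q" by auto
    have "inj_on (refl a) S"
      using bij_refl_simple[OF a] S(2) unfolding bij_betw_def by (blast intro: inj_on_subset)
    then have card: "card (refl a ` S) = card S" by (rule card_image)
    note iS = integral_sum_P[OF a S(1)] and ia = integral_RI[OF f(2) f(2)]
    note ir = integral_rho[OF a]
    have sum: "\<Sum>(refl a ` S) = refl a (\<Sum>S)" using refl_sum_P[OF a S(1)] by simp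
    have 1: "refl a (\<rho> - \<Sum>S) = \<rho> - a - \<Sum>(refl a ` S)"
      unfolding sum by (simp add: refl_diff[OF ir iS] refl_rho[OF a])
    have 2: "refl a (\<rho> - a - \<Sum>S) = \<rho> - \<Sum>(refl a ` S)"
      unfolding sum
      by (simp add: refl_diff[OF integral_diff[OF ir ia] iS] refl_diff[OF ir ia] refl_rho[OF a] refl_self[OF a])
    have "refl a x - \<rho> + \<Sum>(refl a ` S) = 0 \<longleftrightarrow> refl a x = refl a (\<rho> - a - \<Sum>S)"
      unfolding 2 by (auto simp: algebra_simps)
    also have "\<dots> \<longleftrightarrow> x + a - \<rho> + \<Sum>S = 0"
      using swap[OF integral_refl[OF integral_diff[OF integral_diff[OF ir ia] iS] f(4)]]
        refl_refl[OF integral_diff[OF integral_diff[OF ir ia] iS] f(4)] by (auto simp: algebra_simps)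
    finally have e1: "refl a x - \<rho> + \<Sum>(refl a ` S) = 0 \<longleftrightarrow> x + a - \<rho> + \<Sum>S = 0" .
    have "refl a x + a - \<rho> + \<Sum>(refl a ` S) = 0 \<longleftrightarrow> refl a x = refl a (\<rho> - \<Sum>S)"
      unfolding 1 by (auto simp: algebra_simps)
    also have "\<dots> \<longleftrightarrow> x - \<rho> + \<Sum>S = 0"
      using swap[OF integral_refl[OF integral_diff[OF ir iS] f(4)]]
        refl_refl[OF integral_diff[OF ir iS] f(4)] by (auto simp: algebra_simps)
    finally have e2: "refl a x + a - \<rho> + \<Sum>(refl a ` S) = 0 \<longleftrightarrow> x - \<rho> + \<Sum>S = 0" .
    show "(-1) ^ card (refl a ` S) *
        (delta (refl a x - \<rho> + \<Sum>(refl a ` S)) - delta (refl a x + a - \<rho> + \<Sum>(refl a ` S))) =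
        - ((-1) ^ card S * (delta (x - \<rho> + \<Sum>S) - delta (x + a - \<rho> + \<Sum>S)))"
      unfolding e1 e2 card by (simp add: algebra_simps)
  qed
  also have "\<dots> = - alternating delta x"
    unfolding alternating_split[OF f(1)] sum_negf ..
  finally show ?thesis .
qed

lemma alternating_nonzero:
  assumes "alternating m x \<noteq> 0"
  obtains S where "S \<subseteq> P" "m (x - \<rho> + \<Sum>S) \<noteq> 0"
  using assms unfolding alternating_def
  using sum.not_neutral_contains_not_neutral by force

lemma alternating_delta_nonzero:
  assumes "alternating delta x \<noteq> 0"
  obtains S where "S \<subseteq> P" "x = \<rho> - \<Sum>S"
proof -
  obtain S where "S \<subseteq> P" "delta (x - \<rho> + \<Sum>S) \<noteq> 0" by (rule alternating_nonzero[OF assms])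
  then have "x - \<rho> + \<Sum>S = 0" by (metis (full_types))
  then have "x = \<rho> - \<Sum>S" by (simp add: algebra_simps eq_diff_eq)
  with \<open>S \<subseteq> P\<close> show ?thesis by (rule that)
qed

lemma antisymmetric_delta: "antisymmetric (alternating delta)"
  unfolding antisymmetric_def
proof (intro conjI ballI allI impI)
  have "{x. delta x \<noteq> 0} \<subseteq> {0}" by auto
  then have "finite {x. delta x \<noteq> 0}" using finite_subset by blast
  then show "finite {x. alternating delta x \<noteq> 0}" by (rule finite_alternating)
  fix a x assume a: "a \<in> simple" and x: "alternating delta x \<noteq> 0"
  obtain S where "S \<subseteq> P" "x = \<rho> - \<Sum>S" by (rule alternating_delta_nonzero[OF x])
  then show i: "integral a x"
    using integral_diff[OF integral_rho[OF a] integral_sum_P[OF a]] by simp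
  show r: "alternating delta (refl a x) = - alternating delta x"
    by (rule alternating_delta_refl[OF a i])
  show "a \<cdot> x \<noteq> 0"
  proof
    assume "a \<cdot> x = 0"
    then have "refl a x = x" unfolding refl_def by (simp add: form_sym)
    then show False using r x by simp
  qed
qed

text \<open>For simple \<open>a\<close>, integrality lifts
  \<open>2 * (x \<cdot> a) / (a \<cdot> a) > 0\<close> to at least 1, the value at
  \<open>\<rho>\<close>. So \<open>- \<Sum>S\<close> pairs nonnegatively with simple roots, then
  with all positive roots and with \<open>\<rho>\<close>, which leaves only the empty
  \<open>S\<close>.\<close>

lemma alternating_delta_dominant:
  assumes "alternating delta x \<noteq> 0" "positive_at x = P"
  shows "x = \<rho>"
proof -
  obtain S where S: "S \<subseteq> P" "x = \<rho> - \<Sum>S" by (rule alternating_delta_nonzero[OF assms(1)])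
  have "a \<cdot> (- \<Sum>S) \<ge> 0" if a: "a \<in> simple" for a
  proof -
    note f = simple_facts[OF a]
    have "integral a x" using antisymmetric_delta assms(1) a unfolding antisymmetric_def by blast
    then obtain n where n: "2 * (x \<cdot> a) / (a \<cdot> a) = of_int n"
      unfolding integral_def by (auto elim: Ints_cases)
    have "a \<cdot> x > 0" using f(1) assms(2) unfolding positive_at_def by blast
    then have "2 * (x \<cdot> a) / (a \<cdot> a) > 0" using f(3) by (simp add: form_sym[of x a])
    then have "n \<ge> 1" unfolding n by simp
    then have "2 * (x \<cdot> a) / (a \<cdot> a) \<ge> 1" unfolding n by simp
    then have "2 * (x \<cdot> a) \<ge> a \<cdot> a" using f(3) by (simp add: field_simps)
    then have "2 * (\<rho> \<cdot> a) - 2 * (\<Sum>S \<cdot> a) \<ge> a \<cdot> a" unfolding S by (simp add: form_diff_left)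
    then have "\<Sum>S \<cdot> a \<le> 0" using rho_simple[OF a] by simp
    then show ?thesis by (simp add: form_minus_right form_sym[of a "\<Sum>S"])
  qed
  then have "b \<cdot> (- \<Sum>S) \<ge> 0" if "b \<in> P" for b using P_nonneg that by blast
  then have "(\<Sum>b\<in>P. b \<cdot> (- \<Sum>S)) \<ge> 0" by (rule sum_nonneg)
  then have "(\<rho> + \<rho>) \<cdot> (- \<Sum>S) \<ge> 0" unfolding rho_double form_sum_left .
  then have "\<Sum>S \<cdot> \<rho> \<le> 0" 
    using form_add_left[of \<rho> \<rho> "\<Sum>S"] by (simp only: form_minus_right form_sym[of "\<Sum>S" \<rho>])
  then have "S = {}" using P_sum_zero S by blast
  then show ?thesis using S by simp
qed

lemma alternating_top:
  assumes "\<And>S. S \<subseteq> P \<Longrightarrow> S \<noteq> {} \<Longrightarrow> m (x + \<Sum>S) = 0"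
  shows "alternating m (x + \<rho>) = m x"
proof -
  have "alternating m (x + \<rho>) = (\<Sum>S\<in>Pow P. if S = {} then m x else 0)"
    unfolding alternating_def by (rule sum.cong) (use assms in auto)
  then show ?thesis using finite_P by simp
qed

lemma alternating_delta_rho: "alternating delta \<rho> = 1"
proof -
  have "\<Sum>S \<noteq> 0" if "S \<subseteq> P" "S \<noteq> {}" for S using P_sum_zero[of S] that by auto
  then show ?thesis using alternating_top[of delta 0] by simp
qed

lemma positive_at_rho: "positive_at \<rho> = P"
  using P_rho_pos by (auto simp: positive_at_def)

lemma chamber_sum_single:
  assumes "\<And>x. c x \<noteq> 0 \<Longrightarrow> positive_at x = P \<Longrightarrow> x = y" "c y \<noteq> 0" "positive_at y = P"
  shows "chamber_sum c P = c y * pairing_product y"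
proof -
  have "{x. c x \<noteq> 0 \<and> positive_at x = P} = {y}" using assms by blast
  then show ?thesis unfolding chamber_sum_def by simp
qed

text \<open>Simple reflections preserve the norm, and every point of the support is carried by them
  to the dominant chamber.\<close>

lemma antisymmetric_norm:
  assumes c: "antisymmetric c" and top: "\<And>x. c x \<noteq> 0 \<Longrightarrow> positive_at x = P \<Longrightarrow> x \<cdot> x = N"
    and x: "c x \<noteq> 0"
  shows "x \<cdot> x = N"
proof -
  have "positive_at x \<subseteq> P" by (auto simp: positive_at_def)
  then have "\<forall>x. c x \<noteq> 0 \<and> positive_at x = A \<longrightarrow> x \<cdot> x = N" if "A = positive_at x" for A
    unfolding that
  proof (induction rule: chamber_sum_induct)
    case top
    then show ?case using assms(2) by blast
  next
    case (empty A)
    then show ?case using positive_at_simple by blast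
  next
    case (step a A)
    note f = simple_facts[OF step(1)]
    show ?case
    proof (intro allI impI)
      fix x assume x: "c x \<noteq> 0 \<and> positive_at x = A"
      then have i: "integral a x" "a \<cdot> x \<noteq> 0" "c (refl a x) = - c x"
        using c step(1) unfolding antisymmetric_def by blast+
      have "a \<cdot> x < 0" using x step(2) f(1) i(2) by (auto simp: positive_at_def)
      then have "positive_at (refl a x) = reflect_set a A"
        unfolding positive_at_refl[OF step(1) i(1)] reflect_set_def using x f(1) by auto
      then have "refl a x \<cdot> refl a x = N" using step(4) i(3) x by simp
      then show "x \<cdot> x = N" using refl_norm[OF i(1) f(4)] by simp
    qed
  qed
  then show ?thesis using x by blast
qed

lemma alternating_delta_norm: "alternating delta x \<noteq> 0 \<Longrightarrow> x \<cdot> x = \<rho> \<cdot> \<rho>"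
  by (rule antisymmetric_norm[OF antisymmetric_delta]) (auto dest: alternating_delta_dominant)

text \<open>A single \<open>\<rho> - \<Sum>S\<close> may have another norm than
  \<open>\<rho>\<close>. Grouping the subsets by the value of \<open>\<rho> - \<Sum>S\<close>
  produces the coefficients of the denominator, and those vanish for other norms.\<close>

lemma alternating_rho_norm:
  "(\<Sum>S\<in>Pow P. (-1) ^ card S * ((\<rho> - \<Sum>S) \<cdot> (\<rho> - \<Sum>S)) * m (x - \<rho> + \<Sum>S)) = (\<rho> \<cdot> \<rho>) * alternating m x"
proof -
  let ?y = "\<lambda>S. \<rho> - \<Sum>S"
  let ?g = "\<lambda>S. (-1) ^ card S * ((?y S \<cdot> ?y S - \<rho> \<cdot> \<rho>) * m (x - ?y S))"
  have "(\<Sum>S\<in>Pow P. ?g S) = (\<Sum>y\<in>?y ` Pow P. \<Sum>S | S \<in> Pow P \<and> ?y S = y. ?g S)"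
    by (rule sum.group[symmetric]) (use finite_P in auto)
  also have "\<dots> = (\<Sum>y\<in>?y ` Pow P. 0)"
  proof (rule sum.cong[OF refl])
    fix y
    have "alternating delta y = (\<Sum>S\<in>Pow P. if ?y S = y then (-1) ^ card S else 0)"
      unfolding alternating_def by (rule sum.cong) (auto simp: algebra_simps)
    also have "\<dots> = (\<Sum>S | S \<in> Pow P \<and> ?y S = y. (-1) ^ card S)"
      using finite_P by (simp add: sum.inter_filter[symmetric])
    finally have "(\<Sum>S | S \<in> Pow P \<and> ?y S = y. ?g S) = alternating delta y * ((y \<cdot> y - \<rho> \<cdot> \<rho>) * m (x - y))"
      by (simp add: sum_distrib_right)
    also have "\<dots> = 0" using alternating_delta_norm[of y] by auto
    finally show "(\<Sum>S | S \<in> Pow P \<and> ?y S = y. ?g S) = 0" .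
  qed
  finally have "(\<Sum>S\<in>Pow P. ?g S) = 0" by simp
  then show ?thesis
    unfolding alternating_def sum_distrib_left
    by (simp add: algebra_simps sum_subtractf diff_eq_eq sum.distrib eq_diff_eq)
qed

end

text \<open>What the dimension formula uses of a highest weight module: \<open>m\<close> stands for
  the multiplicities, \<open>A a x\<close> for the trace of a raising times a lowering operator for
  \<open>a\<close> on the weight space of \<open>x\<close>, and \<open>c\<close> for the Casimir
  eigenvalue, so \<open>casimir\<close> is the trace of that operator on a weight space.\<close>

locale weyl_module = root_datum +
  fixes m :: "'a \<Rightarrow> real" and A :: "'a \<Rightarrow> 'a \<Rightarrow> real" and c :: real and \<Lambda> :: 'a
  assumes finite_weights: "finite {x. m x \<noteq> 0}"
    and recursion: "a \<in> P \<Longrightarrow> A a x - A a (x + a) = (a \<cdot> x) * m x"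
    and casimir: "c * m x = (x \<cdot> x) * m x + (\<Sum>a\<in>P. A a x + A a (x + a))"
    and highest: "m \<Lambda> = 1"
    and weights_below: "m x \<noteq> 0 \<Longrightarrow> \<Lambda> - x \<in> cone"
    and dominant: "a \<in> P \<Longrightarrow> a \<cdot> \<Lambda> \<ge> 0"
begin

text \<open>Write \<open>x = \<mu> + y\<close> with a weight \<open>\<mu>\<close> and an exponent
  \<open>y = \<rho> - \<Sum>S\<close> of the denominator. In \<open>x \<cdot> x\<close> the square
  of \<open>y\<close> may be replaced by \<open>\<rho> \<cdot> \<rho>\<close>, and the recursion
  converts the cross term into the root part of the Casimir trace.\<close>

lemma alternating_laplace:
  "(x \<cdot> x) * alternating m x = (c + \<rho> \<cdot> \<rho>) * alternating m x"
proof -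
  let ?\<mu> = "\<lambda>S. x - \<rho> + \<Sum>S"
  let ?e = "\<lambda>a S. if a \<in> S then -1 else 1 :: real"
  let ?s = "\<lambda>S. (-1) ^ card S :: real"
  \<comment> \<open>Twice \<open>\<rho> - \<Sum>S\<close> is the sum of the positive roots with the
    sign reversed on \<open>S\<close>.\<close>
  have cross: "2 * (?\<mu> S \<cdot> (\<rho> - \<Sum>S)) = (\<Sum>a\<in>P. ?e a S * (a \<cdot> ?\<mu> S))" if "S \<subseteq> P" for S
  proof -
    have "(\<Sum>a\<in>P. ?e a S * (a \<cdot> ?\<mu> S)) = (\<Sum>a\<in>P. a \<cdot> ?\<mu> S - 2 * (if a \<in> S then a \<cdot> ?\<mu> S else 0))"
      by (rule sum.cong) auto
    also have "\<dots> = \<Sum>P \<cdot> ?\<mu> S - 2 * (\<Sum>S \<cdot> ?\<mu> S)"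
      unfolding sum_subtractf sum_distrib_left[symmetric] form_sum_left
      using finite_P that by (simp add: sum.inter_restrict[symmetric] Int_absorb1)
    also have "\<Sum>P \<cdot> u - 2 * (\<Sum>S \<cdot> u) = 2 * (u \<cdot> (\<rho> - \<Sum>S))" for u
      unfolding rho_double[symmetric] form_diff_right[of u] form_add_left
        form_sym[of u \<rho>] form_sym[of u "\<Sum>S"] by simp
    finally show ?thesis by simp
  qed
  \<comment> \<open>Pair \<open>S\<close> with \<open>insert a S\<close>, which shifts
    \<open>?\<mu>\<close> by \<open>a\<close>. On both sides the pair contributes the difference of
    \<open>A a\<close> between \<open>?\<mu> S\<close> and \<open>?\<mu> S + a + a\<close>.\<close>
  have middle: "(\<Sum>S\<in>Pow P. ?s S * (?e a S * ((a \<cdot> ?\<mu> S) * m (?\<mu> S)))) =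
      (\<Sum>S\<in>Pow P. ?s S * (A a (?\<mu> S) + A a (?\<mu> S + a)))" if a: "a \<in> P" for a
  proof -
    have P: "P = insert a (P - {a})" and f: "finite (P - {a})" and n: "a \<notin> P - {a}"
      using a finite_P by auto
    show ?thesis
      unfolding recursion[OF a, symmetric]
      apply (subst (1 2) P)
      unfolding sum_Pow_insert[OF f n]
      apply (rule sum.cong[OF refl])
      subgoal for S
      proof -
        assume "S \<in> Pow (P - {a})"
        then have "finite S" "a \<notin> S" using f finite_subset by auto
        then show ?thesis by (simp add: algebra_simps)
      qed
      done
  qed
  have "(x \<cdot> x) * alternating m x = (\<Sum>S\<in>Pow P. ?s S * ((?\<mu> S \<cdot> ?\<mu> S) * m (?\<mu> S))
      + ?s S * (2 * (?\<mu> S \<cdot> (\<rho> - \<Sum>S)) * m (?\<mu> S))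
      + ?s S * ((\<rho> - \<Sum>S) \<cdot> (\<rho> - \<Sum>S)) * m (?\<mu> S))"
    unfolding alternating_def sum_distrib_left
  proof (rule sum.cong[OF refl])
    fix S
    have "(u + v) \<cdot> (u + v) = u \<cdot> u + 2 * (u \<cdot> v) + v \<cdot> v" for u v
      unfolding form_add_left form_add_right form_sym[of v u] by simp
    from this[of "?\<mu> S" "\<rho> - \<Sum>S"]
    have "x \<cdot> x = ?\<mu> S \<cdot> ?\<mu> S + 2 * (?\<mu> S \<cdot> (\<rho> - \<Sum>S)) + (\<rho> - \<Sum>S) \<cdot> (\<rho> - \<Sum>S)"
      by simp
    then show "(x \<cdot> x) * (?s S * m (?\<mu> S)) = ?s S * ((?\<mu> S \<cdot> ?\<mu> S) * m (?\<mu> S))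
      + ?s S * (2 * (?\<mu> S \<cdot> (\<rho> - \<Sum>S)) * m (?\<mu> S))
      + ?s S * ((\<rho> - \<Sum>S) \<cdot> (\<rho> - \<Sum>S)) * m (?\<mu> S)"
      by (simp only: distrib_right distrib_left mult_ac)
  qed
  also have "\<dots> = (\<Sum>S\<in>Pow P. ?s S * ((?\<mu> S \<cdot> ?\<mu> S) * m (?\<mu> S)))
      + (\<Sum>S\<in>Pow P. ?s S * (2 * (?\<mu> S \<cdot> (\<rho> - \<Sum>S)) * m (?\<mu> S)))
      + (\<rho> \<cdot> \<rho>) * alternating m x"
    unfolding sum.distrib alternating_rho_norm ..
  also have "(\<Sum>S\<in>Pow P. ?s S * (2 * (?\<mu> S \<cdot> (\<rho> - \<Sum>S)) * m (?\<mu> S)))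
      = (\<Sum>S\<in>Pow P. \<Sum>a\<in>P. ?s S * (?e a S * ((a \<cdot> ?\<mu> S) * m (?\<mu> S))))"
  proof (rule sum.cong[OF refl])
    fix S assume "S \<in> Pow P"
    then have "2 * (?\<mu> S \<cdot> (\<rho> - \<Sum>S)) = (\<Sum>a\<in>P. ?e a S * (a \<cdot> ?\<mu> S))" using cross by blast
    then show "?s S * (2 * (?\<mu> S \<cdot> (\<rho> - \<Sum>S)) * m (?\<mu> S)) =
        (\<Sum>a\<in>P. ?s S * (?e a S * ((a \<cdot> ?\<mu> S) * m (?\<mu> S))))"
      by (simp only: sum_distrib_left sum_distrib_right mult.assoc)
  qed
  also have "\<dots> = (\<Sum>a\<in>P. \<Sum>S\<in>Pow P. ?s S * (A a (?\<mu> S) + A a (?\<mu> S + a)))"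
    by (subst sum.swap, rule sum.cong[OF refl]) (rule middle)
  also have "\<dots> = (\<Sum>S\<in>Pow P. ?s S * (\<Sum>a\<in>P. A a (?\<mu> S) + A a (?\<mu> S + a)))"
    unfolding sum_distrib_left by (rule sum.swap)
  finally have "(x \<cdot> x) * alternating m x = (\<Sum>S\<in>Pow P. ?s S * ((?\<mu> S \<cdot> ?\<mu> S) * m (?\<mu> S)
      + (\<Sum>a\<in>P. A a (?\<mu> S) + A a (?\<mu> S + a)))) + (\<rho> \<cdot> \<rho>) * alternating m x"
    by (simp only: sum.distrib[symmetric] distrib_left[symmetric])
  also have "(\<Sum>S\<in>Pow P. ?s S * ((?\<mu> S \<cdot> ?\<mu> S) * m (?\<mu> S)
      + (\<Sum>a\<in>P. A a (?\<mu> S) + A a (?\<mu> S + a)))) = c * alternating m x"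
    unfolding casimir[symmetric] alternating_def sum_distrib_left by (simp only: mult.left_commute)
  finally show ?thesis by (simp add: distrib_right)
qed

lemma eigenvalue: "alternating m x \<noteq> 0 \<Longrightarrow> x \<cdot> x = c + \<rho> \<cdot> \<rho>"
  using alternating_laplace[of x] by simp

lemma cone_minus_sum:
  assumes "S \<subseteq> P" "m (x + \<Sum>S) \<noteq> 0"
  shows "\<Lambda> - x \<in> cone"
proof -
  have "(\<Lambda> - (x + \<Sum>S)) + \<Sum>S \<in> cone"
    using assms by (intro cone_add weights_below cone_sum cone_P) auto
  then show ?thesis by (simp add: algebra_simps)
qed

lemma alternating_highest: "alternating m (\<Lambda> + \<rho>) = 1"
proof -
  have "m (\<Lambda> + \<Sum>S) = 0" if S: "S \<subseteq> P" "S \<noteq> {}" for S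
  proof (rule ccontr)
    assume "m (\<Lambda> + \<Sum>S) \<noteq> 0"
    then have "- \<Sum>S \<in> cone" using weights_below[of "\<Lambda> + \<Sum>S"] by simp
    then have "(- \<Sum>S) \<cdot> \<rho> \<ge> 0"
      by (rule cone_nonneg[rotated]) (use P_rho_pos less_imp_le in blast)
    then show False using P_sum_zero[OF S(1)] S(2) by (simp add: form_minus_left)
  qed
  then show ?thesis using alternating_top[of m \<Lambda>] highest by simp
qed

lemma finite_partial_alternating:
  assumes "finite F"
  shows "finite {x. (\<Sum>S\<in>F. w S * m (x - \<rho> + \<Sum>S)) \<noteq> 0}"
proof (rule finite_subset)
  show "{x. (\<Sum>S\<in>F. w S * m (x - \<rho> + \<Sum>S)) \<noteq> 0}
      \<subseteq> (\<lambda>(y, S). y + \<rho> - \<Sum>S) ` ({x. m x \<noteq> 0} \<times> F)"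
  proof
    fix x assume "x \<in> {x. (\<Sum>S\<in>F. w S * m (x - \<rho> + \<Sum>S)) \<noteq> 0}"
    then obtain S where "S \<in> F" "m (x - \<rho> + \<Sum>S) \<noteq> 0"
      using sum.not_neutral_contains_not_neutral by force
    then show "x \<in> (\<lambda>(y, S). y + \<rho> - \<Sum>S) ` ({x. m x \<noteq> 0} \<times> F)"
      by (intro image_eqI[of _ _ "(x - \<rho> + \<Sum>S, S)"]) (auto simp: algebra_simps)
  qed
  show "finite ((\<lambda>(y, S). y + \<rho> - \<Sum>S) ` ({x. m x \<noteq> 0} \<times> F))"
    using assms finite_weights by simp
qed

text \<open>The alternating sum is a difference along every positive root \<open>a\<close>, so its sum over each
  line in direction \<open>a\<close> vanishes; as all its exponents have the same norm, such a line contains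
  only a point and its mirror image.\<close>

lemma alternating_reflection:
  assumes a: "a \<in> P" and x: "alternating m x \<noteq> 0"
  shows "integral a x" "a \<cdot> x \<noteq> 0" "alternating m (refl a x) = - alternating m x"
proof -
  have a0: "a \<cdot> a > 0" using P_pos[OF a] .
  define G where "G y = (\<Sum>S\<in>Pow (P - {a}). (-1) ^ card S * m (y - \<rho> + \<Sum>S))" for y
  have FG: "alternating m y = G y - G (y + a)" for y
    unfolding alternating_split[OF a] G_def by (simp add: algebra_simps sum_subtractf)
  let ?p = "\<lambda>j::int. x + of_int j * a"
  have inj: "inj ?p"
  proof (rule injI)
    fix i j assume "?p i = ?p j"
    then have "(of_int i * a) \<cdot> a = (of_int j * a) \<cdot> a" by (simp only: add_left_cancel)
    then have "of_int i * (a \<cdot> a) = of_int j * (a \<cdot> a)" by (simp only: form_of_int_left)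
    then show "i = j" using a0 by auto
  qed
  define J where "J = {j. G (?p j) \<noteq> 0}"
  have "finite {y. G y \<noteq> 0}"
    unfolding G_def by (rule finite_partial_alternating) (use finite_P in simp)
  then have finJ: "finite J"
    unfolding J_def using finite_vimageI[OF _ inj, of "{y. G y \<noteq> 0}"] by (simp add: vimage_def)
  define t where "t = - 2 * (x \<cdot> a) / (a \<cdot> a)"
  \<comment> \<open>Equality of norms along the line is a quadratic equation in \<open>j\<close>
    with the solutions 0 and \<open>t\<close>.\<close>
  have two: "j = 0 \<or> of_int j = t" if "alternating m (?p j) \<noteq> 0" for j
  proof -
    have "?p j \<cdot> ?p j = x \<cdot> x" using eigenvalue[OF that] eigenvalue[OF x] by simp
    moreover have "?p j \<cdot> ?p j = x \<cdot> x + of_int j * (2 * (x \<cdot> a) + of_int j * (a \<cdot> a))"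
      unfolding form_add_left form_add_right form_of_int_left form_of_int_right form_sym[of a x]
      by (simp add: algebra_simps)
    ultimately have "of_int j = (0::real) \<or> 2 * (x \<cdot> a) + of_int j * (a \<cdot> a) = 0" by simp
    then show ?thesis unfolding t_def using a0 by (auto simp: field_simps)
  qed
  \<comment> \<open>Large enough that \<open>G\<close> vanishes at both ends of the range and that
    \<open>t\<close>, if it is an integer, lies inside.\<close>
  define N where "N = nat (Max (insert 0 (abs ` J)) + 1 + \<bar>\<lfloor>t\<rfloor>\<bar>)"
  have "Max (insert 0 (abs ` J)) \<ge> 0" using finJ by simp
  then have N: "int N = Max (insert 0 (abs ` J)) + 1 + \<bar>\<lfloor>t\<rfloor>\<bar>" unfolding N_def by simp
  have "\<bar>j\<bar> < int N" if "j \<in> J" for j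
  proof -
    have "\<bar>j\<bar> \<le> Max (insert 0 (abs ` J))" by (rule Max_ge) (use finJ that in auto)
    then show ?thesis unfolding N by linarith
  qed
  then have zero: "G (?p (int N)) = 0" "G (?p (- int N)) = 0" unfolding J_def by fastforce+
  define g where "g i = G (?p (int i - int N))" for i
  have "(\<Sum>i<2 * N. alternating m (?p (int i - int N))) = (\<Sum>i<2 * N. g i - g (Suc i))"
    unfolding FG g_def by (simp add: algebra_simps)
  also have "\<dots> = g 0 - g (2 * N)" by (rule sum_lessThan_telescope')
  also have "\<dots> = 0" unfolding g_def using zero by simp
  finally have "(\<Sum>j\<in>(\<lambda>i. int i - int N) ` {..<2 * N}. alternating m (?p j)) = 0"
    by (subst sum.reindex) (auto intro: inj_onI)
  moreover have "(\<lambda>i. int i - int N) ` {..<2 * N} = {- int N..<int N}"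
  proof
    show "{- int N..<int N} \<subseteq> (\<lambda>i. int i - int N) ` {..<2 * N}"
    proof
      fix j assume "j \<in> {- int N..<int N}"
      then show "j \<in> (\<lambda>i. int i - int N) ` {..<2 * N}"
        by (intro image_eqI[of _ _ "nat (j + int N)"]) auto
    qed
  qed auto
  ultimately have line: "(\<Sum>j\<in>{- int N..<int N}. alternating m (?p j)) = 0" by simp
  have N0: "0 \<in> {- int N..<int N}" using N \<open>Max (insert 0 (abs ` J)) \<ge> 0\<close> by simp
  have "\<exists>j. j \<noteq> 0 \<and> of_int j = t"
  proof (rule ccontr)
    assume n: "\<not> (\<exists>j. j \<noteq> 0 \<and> of_int j = t)"
    have "(\<Sum>j\<in>{- int N..<int N}. alternating m (?p j)) = (\<Sum>j\<in>{0}. alternating m (?p j))"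
    proof (rule sum.mono_neutral_right)
      show "\<forall>j\<in>{- int N..<int N} - {0}. alternating m (?p j) = 0" using two n by blast
    qed (use N0 in auto)
    then show False using line x by simp
  qed
  then obtain j where j: "j \<noteq> 0" "of_int j = t" by blast
  then have e: "2 * (x \<cdot> a) / (a \<cdot> a) = of_int (- j)" unfolding t_def by simp
  then show "integral a x" unfolding integral_def by (metis Ints_of_int)
  show "a \<cdot> x \<noteq> 0" using j unfolding t_def by (auto simp: form_sym[of a x])
  have "\<lfloor>t\<rfloor> = j" using j(2) by (metis floor_of_int)
  then have jN: "j \<in> {- int N..<int N}"
    unfolding atLeastLessThan_iff using N \<open>Max (insert 0 (abs ` J)) \<ge> 0\<close> by linarith
  have "(\<Sum>j\<in>{- int N..<int N}. alternating m (?p j)) = (\<Sum>i\<in>{0, j}. alternating m (?p i))"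
  proof (rule sum.mono_neutral_right)
    show "\<forall>i\<in>{- int N..<int N} - {0, j}. alternating m (?p i) = 0"
      using two j(2) by (metis Diff_iff insertI1 insertI2 of_int_eq_iff)
  qed (use N0 jN in auto)
  then have "alternating m x + alternating m (x + of_int j * a) = 0" using line j(1) by simp
  moreover have "refl a x = x + of_int j * a" using refl_eqI[OF e] by simp
  ultimately show "alternating m (refl a x) = - alternating m x" by simp
qed

lemma antisymmetric_character: "antisymmetric (alternating m)"
  unfolding antisymmetric_def
  using finite_alternating[OF finite_weights] alternating_reflection simple_P by blast

text \<open>The nonzero cone element \<open>?\<xi>\<close> pairs positively with both
  \<open>x\<close> and \<open>\<Lambda> + \<rho>\<close>, so the norm of
  \<open>\<Lambda> + \<rho>\<close> would exceed that of \<open>x\<close>, while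
  \<open>eigenvalue\<close> makes them equal.\<close>

lemma alternating_dominant:
  assumes "alternating m x \<noteq> 0" "positive_at x = P"
  shows "x = \<Lambda> + \<rho>"
proof (rule ccontr)
  assume n: "x \<noteq> \<Lambda> + \<rho>"
  let ?\<xi> = "\<Lambda> + \<rho> - x"
  obtain S where "S \<subseteq> P" "m (x - \<rho> + \<Sum>S) \<noteq> 0" by (rule alternating_nonzero[OF assms(1)])
  then have c: "?\<xi> \<in> cone" using cone_minus_sum[of S "x - \<rho>"] by (simp add: algebra_simps)
  have "?\<xi> \<cdot> x > 0"
    by (rule cone_positive) (use assms(2) c n in \<open>auto simp: positive_at_def\<close>)
  moreover have "?\<xi> \<cdot> (\<Lambda> + \<rho>) > 0"
  proof (rule cone_positive)
    show "a \<cdot> (\<Lambda> + \<rho>) > 0" if "a \<in> P" for a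
      using dominant[OF that] P_rho_pos[OF that] by (simp add: form_add_right)
  qed (use c n in auto)
  moreover have "x \<cdot> x = (\<Lambda> + \<rho>) \<cdot> (\<Lambda> + \<rho>)"
    using eigenvalue[OF assms(1)] eigenvalue[of "\<Lambda> + \<rho>"] alternating_highest by simp
  ultimately show False by (simp add: form_diff_left form_sym[of x "\<Lambda> + \<rho>"])
qed

text \<open>Comparison with the trivial character eliminates both the constant \<open>K\<close> and
  the number of chambers; \<open>K > 0\<close> because the total of the denominator is
  positive.\<close>

theorem weyl_dimension_formula:
  "(\<Sum>x | m x \<noteq> 0. m x) = (\<Prod>a\<in>P. 1 + (a \<cdot> \<Lambda>) / (a \<cdot> \<rho>))"
proof -
  let ?D = "alternating delta" and ?F = "alternating m"
  define K where "K = (\<Sum>S\<in>Pow P. (-1) ^ card S * pairing_product (\<rho> - \<Sum>S))"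
  have "finite {x. delta x \<noteq> 0}" by (rule finite_subset[of _ "{0}"]) auto
  then have "total_sum ?D = (\<Sum>y | delta y \<noteq> 0. delta y) * K"
    unfolding K_def by (rule total_sum_alternating)
  also have "{y. delta y \<noteq> 0} = {0}" by auto
  finally have D: "total_sum ?D = K" by simp
  have F: "total_sum ?F = (\<Sum>x | m x \<noteq> 0. m x) * K"
    unfolding K_def by (rule total_sum_alternating[OF finite_weights])
  have pos: "a \<cdot> (\<Lambda> + \<rho>) > 0" if "a \<in> P" for a
    using dominant[OF that] P_rho_pos[OF that] by (simp add: form_add_right)
  have cD: "chamber_sum ?D P = pairing_product \<rho>"
    using chamber_sum_single[of ?D \<rho>] alternating_delta_dominant alternating_delta_rho positive_at_rho by simp
  have cF: "chamber_sum ?F P = pairing_product (\<Lambda> + \<rho>)"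
  proof -
    have "positive_at (\<Lambda> + \<rho>) = P" using pos by (auto simp: positive_at_def)
    then show ?thesis
      using chamber_sum_single[of ?F "\<Lambda> + \<rho>"] alternating_dominant alternating_highest by simp
  qed
  have \<rho>: "pairing_product \<rho> > 0"
    unfolding pairing_product_def using P_rho_pos by (intro prod_pos) auto
  have "K > 0" using total_sum_pos[OF antisymmetric_delta] cD \<rho> D by simp
  moreover have "total_sum ?F * chamber_sum ?D P = total_sum ?D * chamber_sum ?F P"
    by (rule total_sum_proportional[OF antisymmetric_character antisymmetric_delta])
  ultimately have "(\<Sum>x | m x \<noteq> 0. m x) = pairing_product (\<Lambda> + \<rho>) / pairing_product \<rho>"
    unfolding F D cD cF using \<rho> by (simp add: field_simps)
  also have "\<dots> = (\<Prod>a\<in>P. (a \<cdot> (\<Lambda> + \<rho>)) / (a \<cdot> \<rho>))"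
    unfolding pairing_product_def by (rule prod_dividef[symmetric])
  also have "\<dots> = (\<Prod>a\<in>P. 1 + (a \<cdot> \<Lambda>) / (a \<cdot> \<rho>))"
  proof (rule prod.cong[OF refl])
    fix a assume "a \<in> P"
    then have "a \<cdot> \<rho> \<noteq> 0" using P_rho_pos[of a] by simp
    then show "(a \<cdot> (\<Lambda> + \<rho>)) / (a \<cdot> \<rho>) = 1 + (a \<cdot> \<Lambda>) / (a \<cdot> \<rho>)"
      by (simp add: form_add_right add_divide_distrib)
  qed
  finally show ?thesis .
qed

end

section \<open>The roots of a simple Lie algebra\<close>

context cartan_lie_algebra
begin

lemma bracket_wsp:
  assumes "x \<in> R.wsp \<alpha>" "y \<in> R.wsp \<beta>"
  shows "brk x y \<in> R.wsp (\<beta> + \<alpha>)"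
  unfolding R.wsp_def
proof (intro CollectI ballI)
  fix h assume h: "h \<in> H"
  have "brk h x = scale (\<alpha> h) x" "brk h y = scale (\<beta> h) y" using assms h unfolding R.wsp_def by blast+
  then have "brk h (brk x y) = scale (\<alpha> h) (brk x y) + scale (\<beta> h) (brk x y)"
    unfolding brk_derivation[of h] by (simp only: brk_scale_left brk_scale_right)
  also have "\<dots> = scale ((\<beta> + \<alpha>) h) (brk x y)" by (simp add: scale_left_distrib add.commute)
  finally show "brk h (brk x y) = scale ((\<beta> + \<alpha>) h) (brk x y)" .
qed

lemma shifts_brk: "e \<in> R.wsp \<alpha> \<Longrightarrow> R.shifts (brk e) \<alpha>"
  unfolding R.shifts_def using lin_brk bracket_wsp by blast

lemma killing_wsp_zero:
  assumes "x \<in> R.wsp \<alpha>" "y \<in> R.wsp \<beta>" "h \<in> H" "\<alpha> h + \<beta> h \<noteq> 0"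
  shows "killing x y = 0"
proof -
  have 1: "brk h x = scale (\<alpha> h) x" "brk h y = scale (\<beta> h) y" using assms unfolding R.wsp_def by blast+
  have "killing (brk x h) y = killing x (brk h y)" by (rule killing_invariant)
  then have "- (\<alpha> h * killing x y) = \<beta> h * killing x y"
    unfolding brk_anti[of x h] 1 by (simp only: killing_minus_left killing_scale_left killing_scale_right)
  then have "(\<alpha> h + \<beta> h) * killing x y = 0" unfolding distrib_right by (metis add.right_inverse)
  then show ?thesis using assms(4) by simp
qed

lemma rb_nonzero: "b \<in> rb \<Longrightarrow> b \<noteq> 0"
  using rb(1) dependent_zero[of rb] by (auto simp: basis_def)

lemma roots_iff: "\<alpha> \<in> roots H \<longleftrightarrow> \<alpha> \<noteq> 0 \<and> R.Bw \<alpha> \<noteq> {}"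
proof
  assume a: "\<alpha> \<in> roots H"
  then have d: "\<alpha> \<in> dual H" "\<alpha> \<noteq> 0" "root_space H \<alpha> \<noteq> {0}" by (auto simp: roots_def zero_fun_def)
  have "R.Bw \<alpha> \<noteq> {}"
  proof
    assume "R.Bw \<alpha> = {}"
    then have "R.wsp \<alpha> = {0}" using R.wsp_span[OF supported_dual[OF d(1)]] by simp
    then show False using d(3) by (simp add: wsp_root_space)
  qed
  then show "\<alpha> \<noteq> 0 \<and> R.Bw \<alpha> \<noteq> {}" using d by blast
next
  assume a: "\<alpha> \<noteq> 0 \<and> R.Bw \<alpha> \<noteq> {}"
  then obtain b where b: "b \<in> R.Bw \<alpha>" by blast
  then have bB: "b \<in> rb" "rw b = \<alpha>" unfolding R.Bw_def by blast+
  then have "b \<noteq> 0" using rb_nonzero by simp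
  moreover have "b \<in> root_space H \<alpha>" "\<alpha> \<in> dual H" using rw[OF bB(1)] bB(2) by simp_all
  ultimately have "\<alpha> \<in> dual H" "root_space H \<alpha> \<noteq> {0}" by blast+
  moreover have "\<alpha> \<noteq> (\<lambda>h. 0)" using a unfolding zero_fun_def by blast
  ultimately show "\<alpha> \<in> roots H" unfolding roots_def by blast
qed

lemma roots_dual: "\<alpha> \<in> roots H \<Longrightarrow> \<alpha> \<in> dual H"
  by (simp add: roots_def)

lemma finite_roots: "finite (roots H)"
proof (rule finite_subset)
  show "roots H \<subseteq> rw ` rb"
  proof
    fix \<alpha> assume "\<alpha> \<in> roots H"
    then obtain b where "b \<in> R.Bw \<alpha>" using roots_iff[of \<alpha>] by blast
    then show "\<alpha> \<in> rw ` rb" unfolding R.Bw_def by blast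
  qed
  show "finite (rw ` rb)" using basis_finite[OF rb(1)] by simp
qed

lemma rw_cases: "b \<in> rb \<Longrightarrow> rw b = 0 \<or> rw b \<in> roots H"
  using roots_iff[of "rw b"] unfolding R.Bw_def by auto

lemma root_dual_pair:
  assumes d: "\<alpha> \<in> dual H" and e: "e \<in> R.wsp \<alpha>" "e \<noteq> 0"
  obtains f where "f \<in> R.wsp (- \<alpha>)" "f \<in> R.wsp (- \<alpha>)" "killing e f = 1" "R.Bw (- \<alpha>) \<noteq> {}"
proof -
  have "\<exists>b\<in>rb. killing e b \<noteq> 0"
  proof (rule ccontr)
    assume "\<not> (\<exists>b\<in>rb. killing e b \<noteq> 0)"
    then have "killing e y = 0" for y using killing_lin_eq[of rb e y] rb(1) by (simp add: basis_def)
    then show False using killing_nondegenerate e(2) by blast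
  qed
  then obtain b where b: "b \<in> rb" "killing e b \<noteq> 0" by blast
  have bw: "b \<in> R.wsp (rw b)" using R.Bw_wsp b(1) unfolding R.Bw_def by blast
  have "rw b = - \<alpha>"
  proof (rule ext)
    fix h
    show "rw b h = (- \<alpha>) h"
    proof (cases "h \<in> H")
      case True
      then have "\<alpha> h + rw b h = 0" using killing_wsp_zero[OF e(1) bw True] b(2) by blast
      then show ?thesis by (simp add: eq_neg_iff_add_eq_0 add.commute)
    next
      case False
      then show ?thesis using d R.wt_outside[OF b(1)] by (simp add: dual_def)
    qed
  qed
  then have w: "b \<in> R.wsp (- \<alpha>)" "R.Bw (- \<alpha>) \<noteq> {}" using bw b(1) unfolding R.Bw_def by auto
  let ?f = "scale (inverse (killing e b)) b"
  have "?f \<in> R.wsp (- \<alpha>)" using w(1) unfolding R.wsp_def by (simp add: brk_scale_right mult.commute)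
  moreover have "killing e ?f = 1" using b(2) by (simp add: killing_scale_right)
  ultimately show ?thesis using w(2) by (intro that)
qed

lemma bracket_dual:
  assumes "\<alpha> \<in> dual H" "e \<in> R.wsp \<alpha>" "f \<in> R.wsp (- \<alpha>)" "killing e f = 1"
  shows "brk e f = dual_vector \<alpha>"
proof (rule dual_vector_eqI[OF assms(1), symmetric])
  have "brk e f \<in> R.wsp (- \<alpha> + \<alpha>)" by (rule bracket_wsp[OF assms(2,3)])
  then show "brk e f \<in> H" by (simp add: wsp_zero)
  fix h assume h: "h \<in> H"
  have "brk h f = scale (- \<alpha> h) f" using assms(3) h unfolding R.wsp_def by auto
  then have "brk f h = scale (\<alpha> h) f" using brk_anti[of f h] by simp
  then show "killing (brk e f) h = \<alpha> h"
    unfolding killing_invariant using assms(4) by (simp add: killing_scale_right)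
qed

lemma root_triple:
  assumes "\<alpha> \<in> roots H"
  obtains e f where "e \<in> R.wsp \<alpha>" "f \<in> R.wsp (- \<alpha>)" "killing e f = 1" "brk e f = dual_vector \<alpha>"
proof -
  have d: "\<alpha> \<in> dual H" by (rule roots_dual[OF assms])
  obtain b where b: "b \<in> R.Bw \<alpha>" using assms roots_iff[of \<alpha>] by blast
  then have "b \<noteq> 0" using rb_nonzero[of b] unfolding R.Bw_def by simp
  moreover have "b \<in> R.wsp \<alpha>" by (rule R.Bw_wsp[OF b])
  ultimately show ?thesis using root_dual_pair[OF d] bracket_dual[OF d] that by metis
qed

lemma roots_uminus: "\<alpha> \<in> roots H \<Longrightarrow> - \<alpha> \<in> roots H"
proof -
  assume a: "\<alpha> \<in> roots H"
  obtain b where b: "b \<in> R.Bw \<alpha>" using a roots_iff[of \<alpha>] by blast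
  then have "b \<noteq> 0" using rb_nonzero[of b] unfolding R.Bw_def by simp
  then have "R.Bw (- \<alpha>) \<noteq> {}" using root_dual_pair[OF roots_dual[OF a] R.Bw_wsp[OF b]] by metis
  then show ?thesis using a roots_iff[of \<alpha>] roots_iff[of "- \<alpha>"] by simp
qed

lemma adjoint_string_step:
  assumes "\<alpha> \<in> roots H" "e \<in> R.wsp \<alpha>" "f \<in> R.wsp (- \<alpha>)" "brk e f = dual_vector \<alpha>"
  shows "R.tw \<mu> (\<lambda>x. brk e (brk f x)) - R.tw (\<mu> + \<alpha>) (\<lambda>x. brk e (brk f x))
    = \<mu> (dual_vector \<alpha>) * of_nat (card (R.Bw \<mu>))"
proof (rule R.string_trace_step[OF shifts_brk[OF assms(2)] shifts_brk[OF assms(3)]])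
  show "R.supported \<alpha>" by (rule supported_dual[OF roots_dual[OF assms(1)]])
  fix b assume b: "b \<in> R.Bw \<mu>"
  have "brk e (brk f b) - brk f (brk e b) = brk (dual_vector \<alpha>) b"
    using brk_derivation[of e f b] assms(4) by simp
  also have "\<dots> = scale (\<mu> (dual_vector \<alpha>)) b"
    using R.op_wt[of b "dual_vector \<alpha>"] b dual_vector(1)[OF roots_dual[OF assms(1)]] unfolding R.Bw_def by auto
  finally show "brk e (brk f b) - brk f (brk e b) = scale (\<mu> (dual_vector \<alpha>)) b" .
qed

text \<open>Over the whole string through \<open>rw b\<close> the step formula telescopes to 0. This
  is one linear equation with integer coefficients between the values of \<open>rw b\<close> and
  \<open>\<alpha>\<close> at the dual vector, and the coefficient of \<open>rw b\<close> is a
  positive count of basis vectors.\<close>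

lemma root_ratio_real:
  assumes \<alpha>: "\<alpha> \<in> roots H" and b: "b \<in> rb"
  obtains q :: real where "rw b (dual_vector \<alpha>) = of_real q * \<alpha> (dual_vector \<alpha>)"
proof -
  let ?t = "dual_vector \<alpha>"
  obtain e f where ef: "e \<in> R.wsp \<alpha>" "f \<in> R.wsp (- \<alpha>)" "brk e f = dual_vector \<alpha>"
    using root_triple[OF \<alpha>] by metis
  have \<alpha>0: "\<alpha> \<noteq> 0" using \<alpha> roots_iff[of \<alpha>] by blast
  then have "- \<alpha> \<noteq> 0" by simp
  from R.string_escapes[OF this, of "rw b"] obtain N where N: "R.Bw (rw b + of_nat N * (- \<alpha>)) = {}" by blast
  from R.string_escapes[OF \<alpha>0, of "rw b"] obtain n where n: "R.Bw (rw b + of_nat m * \<alpha>) = {}" if "m \<ge> n" for m by blast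
  let ?\<mu> = "rw b + of_nat N * (- \<alpha>)"
  let ?a = "\<lambda>\<mu>. R.tw \<mu> (\<lambda>x. brk e (brk f x))"
  let ?n = "N + Suc n"
  have top: "?\<mu> + of_nat ?n * \<alpha> = rw b + of_nat (Suc n) * \<alpha>" by (simp add: algebra_simps)
  have "?a ?\<mu> = (\<Sum>j<?n. (?\<mu> + of_nat j * \<alpha>) ?t * of_nat (card (R.Bw (?\<mu> + of_nat j * \<alpha>))))"
  proof (rule R.string_sum[where t = "\<lambda>\<mu>. \<mu> ?t"])
    show "?a (?\<mu> + of_nat ?n * \<alpha>) = 0"
      unfolding top by (rule R.tw_empty, rule n) simp
  qed (rule adjoint_string_step[OF \<alpha> ef])
  moreover have "?a ?\<mu> = 0" by (rule R.tw_empty[OF N])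
  ultimately have sum: "(\<Sum>j<?n. (?\<mu> + of_nat j * \<alpha>) ?t * of_nat (card (R.Bw (?\<mu> + of_nat j * \<alpha>)))) = 0" by simp
  define d where "d j = real (card (R.Bw (?\<mu> + of_nat j * \<alpha>)))" for j
  have "(?\<mu> + of_nat j * \<alpha>) ?t = rw b ?t + of_real (real j - real N) * \<alpha> ?t" for j
    by (simp add: of_nat_fun algebra_simps)
  then have "(\<Sum>j<?n. (rw b ?t + of_real (real j - real N) * \<alpha> ?t) * of_real (d j)) = 0"
    using sum unfolding d_def by (simp only: of_real_of_nat_eq)
  then have eq: "rw b ?t * of_real (\<Sum>j<?n. d j) + \<alpha> ?t * of_real (\<Sum>j<?n. (real j - real N) * d j) = 0"
  proof -
    have "(\<Sum>j\<in>I. (u + of_real (g j) * v) * of_real (d j)) =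
        u * of_real (\<Sum>j\<in>I. d j) + v * of_real (\<Sum>j\<in>I. g j * d j)"
      for I :: "nat set" and u v :: complex and g :: "nat \<Rightarrow> real"
      unfolding of_real_sum sum_distrib_left sum.distrib[symmetric]
      by (rule sum.cong) (simp_all add: algebra_simps)
    then show ?thesis
      using \<open>(\<Sum>j<?n. (rw b ?t + of_real (real j - real N) * \<alpha> ?t) * of_real (d j)) = 0\<close> by metis
  qed
  have "?\<mu> + of_nat N * \<alpha> = rw b" by (simp add: algebra_simps)
  then have "b \<in> R.Bw (?\<mu> + of_nat N * \<alpha>)" using b unfolding R.Bw_def by simp
  then have "d N > 0" unfolding d_def using R.finite_Bw by (auto simp: card_gt_0_iff)
  moreover have "(\<Sum>j<?n. d j) \<ge> d N" by (rule member_le_sum) (auto simp: d_def)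
  ultimately have D0: "(\<Sum>j<?n. d j) > 0" by simp
  define D where "D = (\<Sum>j<?n. d j)"
  define S where "S = (\<Sum>j<?n. (real j - real N) * d j)"
  have D: "D \<noteq> 0" using D0 unfolding D_def by simp
  have "rw b ?t * of_real D + \<alpha> ?t * of_real S = 0" using eq unfolding D_def S_def .
  then have "rw b ?t * of_real D = - (\<alpha> ?t * of_real S)" by (simp only: eq_neg_iff_add_eq_0)
  then have "rw b ?t = of_real (- S / D) * \<alpha> ?t" using D by (simp add: field_simps)
  then show ?thesis by (rule that)
qed

text \<open>With the real ratios \<open>q b\<close>, the trace formula for the Killing form reads
  \<open>(\<alpha>, \<alpha>) = Q * (\<alpha>, \<alpha>)^2\<close> with \<open>Q\<close> the sum of
  the squares of the \<open>q b\<close>. The value 0 is excluded since it would put the dual vector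
  into the radical on \<open>H\<close>.\<close>

lemma root_norm_pos:
  assumes \<alpha>: "\<alpha> \<in> roots H"
  obtains s :: real where "s > 0" "\<alpha> (dual_vector \<alpha>) = of_real s"
proof -
  let ?t = "dual_vector \<alpha>"
  have d: "\<alpha> \<in> dual H" by (rule roots_dual[OF \<alpha>])
  note t = dual_vector[OF d]
  have "\<forall>b\<in>rb. \<exists>q::real. rw b ?t = of_real q * \<alpha> ?t" using root_ratio_real[OF \<alpha>] by metis
  then obtain q :: "'a \<Rightarrow> real" where q: "\<And>b. b \<in> rb \<Longrightarrow> rw b ?t = of_real (q b) * \<alpha> ?t" by metis
  have "\<alpha> ?t \<noteq> 0"
  proof
    assume 0: "\<alpha> ?t = 0"
    have "killing ?t h = 0" if "h \<in> H" for h
      unfolding killing_rb[OF t(1) that] using q 0 by simp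
    then have "?t = 0" by (rule killing_H_nondegenerate[OF t(1)])
    then have "\<alpha> h = 0" if "h \<in> H" for h using t(2)[OF that] by simp
    moreover have "\<alpha> h = 0" if "h \<notin> H" for h using d that by (simp add: dual_def)
    ultimately have "\<alpha> = 0" by (metis ext zero_fun_apply)
    then show False using \<alpha> roots_iff[of \<alpha>] by blast
  qed
  have "\<alpha> ?t = killing ?t ?t" using t by simp
  also have "\<dots> = (\<Sum>b\<in>rb. (of_real (q b) * \<alpha> ?t) * (of_real (q b) * \<alpha> ?t))"
    unfolding killing_rb[OF t(1) t(1)] by (rule sum.cong) (use q in auto)
  also have "\<dots> = of_real (\<Sum>b\<in>rb. (q b)\<^sup>2) * (\<alpha> ?t * \<alpha> ?t)"
    by (simp add: sum_distrib_left sum_distrib_right power2_eq_square mult_ac)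
  finally have 1: "of_real (\<Sum>b\<in>rb. (q b)\<^sup>2) * \<alpha> ?t = 1" using \<open>\<alpha> ?t \<noteq> 0\<close> by simp
  define Q where "Q = (\<Sum>b\<in>rb. (q b)\<^sup>2)"
  have 1: "of_real Q * \<alpha> ?t = 1" using 1 unfolding Q_def .
  then have "Q \<noteq> 0" by auto
  moreover have "Q \<ge> 0" unfolding Q_def by (simp add: sum_nonneg)
  ultimately have "1 / Q > 0" by simp
  moreover have "\<alpha> ?t = of_real (1 / Q)" using 1 \<open>Q \<noteq> 0\<close> by (simp add: field_simps)
  ultimately show ?thesis by (rule that)
qed

text \<open>The trace of \<open>E F\<close> on the root space of \<open>\<alpha>\<close> is computed
  twice: through \<open>H\<close> it is \<open>(\<alpha>, \<alpha>)\<close>, along the upward string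
  it is \<open>(\<alpha>, \<alpha>)\<close> times the sum of \<open>j\<close> times the multiplicity
  of \<open>j \<alpha>\<close> over \<open>j \<ge> 1\<close>. Hence that sum of natural numbers is
  1.\<close>

lemma root_multiplicities:
  assumes \<alpha>: "\<alpha> \<in> roots H"
  shows "card (R.Bw \<alpha>) = 1" "\<And>j. j \<ge> 1 \<Longrightarrow> R.Bw (\<alpha> + of_nat j * \<alpha>) = {}"
proof -
  let ?t = "dual_vector \<alpha>"
  have d: "\<alpha> \<in> dual H" by (rule roots_dual[OF \<alpha>])
  note t = dual_vector[OF d]
  obtain e f where ef: "e \<in> R.wsp \<alpha>" "f \<in> R.wsp (- \<alpha>)" "brk e f = dual_vector \<alpha>"
    using root_triple[OF \<alpha>] by metis
  obtain s where s: "s > 0" "\<alpha> ?t = of_real s" by (rule root_norm_pos[OF \<alpha>])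
  let ?a = "\<lambda>\<mu>. R.tw \<mu> (\<lambda>x. brk e (brk f x))"
  have "\<alpha> \<noteq> 0" using \<alpha> roots_iff[of \<alpha>] by blast
  from R.string_escapes[OF this, of \<alpha>] obtain n where n: "R.Bw (\<alpha> + of_nat m * \<alpha>) = {}" if "m \<ge> n" for m by blast
  have "?a \<alpha> = R.tw 0 (\<lambda>x. brk f (brk e x))"
    using R.tw_swap[OF shifts_brk[OF ef(1)] shifts_brk[OF ef(2)] supported_dual[OF d], of \<alpha>] by simp
  also have "\<dots> = (\<Sum>b\<in>R.Bw 0. representation rb ?t b * \<alpha> b)"
    unfolding R.tw_def ptr_def
  proof (rule sum.cong[OF refl])
    fix b assume b: "b \<in> R.Bw 0"
    then have "b \<in> H" using R.Bw_wsp wsp_zero by blast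
    then have "brk b e = scale (\<alpha> b) e" using ef(1) unfolding R.wsp_def by blast
    then have "brk e b = scale (- \<alpha> b) e" using brk_anti[of e b] by simp
    then have "brk f (brk e b) = scale (- \<alpha> b) (brk f e)" by (simp only: brk_scale_right)
    also have "\<dots> = scale (\<alpha> b) ?t" using brk_anti[of f e] ef(3) by simp
    finally show "representation rb (brk f (brk e b)) b = representation rb ?t b * \<alpha> b"
      by (simp add: rep_scale[OF rb(1)])
  qed
  also have "\<dots> = \<alpha> ?t" using dual_expand[OF d t(1)] by simp
  finally have "?a \<alpha> = \<alpha> ?t" .
  moreover have "?a \<alpha> = (\<Sum>j<Suc n. (\<alpha> + of_nat j * \<alpha>) ?t * of_nat (card (R.Bw (\<alpha> + of_nat j * \<alpha>))))"
  proof (rule R.string_sum[where t = "\<lambda>\<mu>. \<mu> ?t"])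
    show "?a (\<alpha> + of_nat (Suc n) * \<alpha>) = 0" by (rule R.tw_empty, rule n) simp
  qed (rule adjoint_string_step[OF \<alpha> ef])
  ultimately have "(\<Sum>j<Suc n. (\<alpha> + of_nat j * \<alpha>) ?t * of_nat (card (R.Bw (\<alpha> + of_nat j * \<alpha>)))) = \<alpha> ?t" by simp
  moreover have "(\<alpha> + of_nat j * \<alpha>) ?t = \<alpha> ?t * of_nat (Suc j)" for j
    by (simp add: of_nat_fun algebra_simps)
  ultimately have "\<alpha> ?t * of_nat (\<Sum>j<Suc n. Suc j * card (R.Bw (\<alpha> + of_nat j * \<alpha>))) = \<alpha> ?t * of_nat 1"
    by (simp only: of_nat_sum of_nat_mult sum_distrib_left mult.assoc of_nat_1 mult_1_right)
  then have sum: "(\<Sum>j<Suc n. Suc j * card (R.Bw (\<alpha> + of_nat j * \<alpha>))) = 1"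
    using s by (simp only: mult_cancel_left of_nat_eq_iff) simp
  have pos: "card (R.Bw \<alpha>) \<ge> 1"
    using \<alpha> roots_iff R.finite_Bw by (simp add: Suc_le_eq card_gt_0_iff)
  have zero: "of_nat 0 * \<alpha> = 0" by simp
  have split: "(\<Sum>j<Suc n. Suc j * card (R.Bw (\<alpha> + of_nat j * \<alpha>)))
      = card (R.Bw \<alpha>) + (\<Sum>j<n. Suc (Suc j) * card (R.Bw (\<alpha> + of_nat (Suc j) * \<alpha>)))"
    by (subst sum.lessThan_Suc_shift) (simp only: zero add_0_right mult_1_left One_nat_def[symmetric])
  have tail: "(\<Sum>j<n. Suc (Suc j) * card (R.Bw (\<alpha> + of_nat (Suc j) * \<alpha>))) = 0"
    using sum split pos by linarith
  show "card (R.Bw \<alpha>) = 1" using sum split tail by linarith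
  show "R.Bw (\<alpha> + of_nat j * \<alpha>) = {}" if "j \<ge> 1" for j
  proof (cases "j < n")
    case True
    then have "Suc (Suc (j - 1)) * card (R.Bw (\<alpha> + of_nat (Suc (j - 1)) * \<alpha>)) = 0"
      using tail by (metis (no_types, lifting) finite_lessThan less_imp_diff_less lessThan_iff sum_eq_0_iff)
    then show ?thesis using that R.finite_Bw by simp
  next
    case False
    then show ?thesis using n by simp
  qed
qed

lemma root_multiples:
  assumes \<alpha>: "\<alpha> \<in> roots H" and j: "of_int j * \<alpha> \<in> roots H"
  shows "j = 1 \<or> j = - 1"
proof -
  have *: "\<not> of_nat (Suc (Suc m)) * \<alpha> \<in> roots H" if "\<alpha> \<in> roots H" for m \<alpha>
  proof -
    have "of_nat (Suc (Suc m)) * \<alpha> = \<alpha> + of_nat (Suc m) * \<alpha>" by (simp add: algebra_simps)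
    then show ?thesis using root_multiplicities(2)[OF that, of "Suc m"] roots_iff by simp
  qed
  show ?thesis
  proof (cases j rule: int_cases)
    case (nonneg n)
    then show ?thesis
      using j roots_iff *[OF \<alpha>] by (cases n rule: nat.exhaust; cases "n - 1") auto
  next
    case (neg n)
    then have "of_int j * \<alpha> = of_nat (Suc n) * (- \<alpha>)"
      by (simp only: of_int_minus of_int_of_nat_eq mult_minus_left mult_minus_right)
    then show ?thesis using j neg *[OF roots_uminus[OF \<alpha>]] by (cases n) auto
  qed
qed

end

section \<open>Root strings and the real form on weights\<close>

context cartan_lie_algebra
begin

text \<open>The ratio \<open>(\<gamma>, \<alpha>) / (\<alpha>, \<alpha>)\<close>, half a Cartan
  integer.\<close>

definition coroot_ratio :: "('a \<Rightarrow> complex) \<Rightarrow> ('a \<Rightarrow> complex) \<Rightarrow> real" where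
  "coroot_ratio \<alpha> \<gamma> = Re (\<gamma> (dual_vector \<alpha>) / \<alpha> (dual_vector \<alpha>))"

lemma coroot_ratio:
  assumes "\<alpha> \<in> roots H" "\<gamma> \<in> roots H"
  shows "\<gamma> (dual_vector \<alpha>) = of_real (coroot_ratio \<alpha> \<gamma>) * \<alpha> (dual_vector \<alpha>)"
proof -
  obtain s where s: "s > 0" "\<alpha> (dual_vector \<alpha>) = of_real s" by (rule root_norm_pos[OF assms(1)])
  obtain b where b: "b \<in> R.Bw \<gamma>" using assms(2) roots_iff[of \<gamma>] by blast
  then have b: "b \<in> rb" "rw b = \<gamma>" unfolding R.Bw_def by blast+
  obtain q :: real where q: "rw b (dual_vector \<alpha>) = of_real q * \<alpha> (dual_vector \<alpha>)"
    by (rule root_ratio_real[OF assms(1) b(1)])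
  have "coroot_ratio \<alpha> \<gamma> = q" unfolding coroot_ratio_def q[unfolded b(2)] s(2) using s(1) by simp
  then show ?thesis using q b(2) by simp
qed

text \<open>Going down from the top \<open>\<gamma>\<close> of a string, \<open>E F\<close> has nonzero trace at \<open>\<gamma> - m \<alpha>\<close> unless
  \<open>m\<close> is the Cartan integer of \<open>\<gamma>\<close>.\<close>

lemma string_down:
  assumes \<alpha>: "\<alpha> \<in> roots H" and \<gamma>: "\<gamma> \<in> roots H" and top: "\<gamma> + \<alpha> \<notin> roots H"
    and mult: "\<And>j. \<gamma> \<noteq> of_int j * \<alpha>"
  shows "\<exists>m. real m = 2 * coroot_ratio \<alpha> \<gamma> \<and> (\<forall>i\<le>m. \<gamma> - of_nat i * \<alpha> \<in> roots H)"
proof -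
  let ?t = "dual_vector \<alpha>" and ?c = "coroot_ratio \<alpha> \<gamma>"
  obtain e f where ef: "e \<in> R.wsp \<alpha>" "f \<in> R.wsp (- \<alpha>)" "brk e f = dual_vector \<alpha>"
    using root_triple[OF \<alpha>] by metis
  obtain s where s: "s > 0" "\<alpha> ?t = of_real s" by (rule root_norm_pos[OF \<alpha>])
  let ?a = "\<lambda>\<mu>. R.tw \<mu> (\<lambda>x. brk e (brk f x))"
  have nz: "\<gamma> - of_nat i * \<alpha> \<noteq> 0" for i using mult[of "int i"] by auto
  have nz1: "\<gamma> + \<alpha> \<noteq> 0" using mult[of "-1"] by (auto simp: eq_neg_iff_add_eq_0)
  have claim: "\<forall>i\<le>m. \<gamma> - of_nat i * \<alpha> \<in> roots H" if "\<And>i. i < m \<Longrightarrow> real i \<noteq> 2 * ?c" for m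
    using that
  proof (induction m)
    case 0
    then show ?case using \<gamma> by simp
  next
    case (Suc m)
    then have IH: "\<gamma> - of_nat i * \<alpha> \<in> roots H" if "i \<le> m" for i using that less_SucI by blast
    let ?\<mu> = "\<gamma> - of_nat m * \<alpha>"
    have t1: "?\<mu> + of_nat (Suc m) * \<alpha> = \<gamma> + \<alpha>" by (simp add: algebra_simps)
    have t2: "?\<mu> + of_nat j * \<alpha> = \<gamma> - of_nat (m - j) * \<alpha>" if "j \<le> m" for j
      using that by (simp add: of_nat_diff algebra_simps)
    have "?a ?\<mu> = (\<Sum>j<Suc m. (?\<mu> + of_nat j * \<alpha>) ?t * of_nat (card (R.Bw (?\<mu> + of_nat j * \<alpha>))))"
    proof (rule R.string_sum[where t = "\<lambda>\<mu>. \<mu> ?t"])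
      have "R.Bw (\<gamma> + \<alpha>) = {}" using top nz1 roots_iff[of "\<gamma> + \<alpha>"] by blast
      then show "?a (?\<mu> + of_nat (Suc m) * \<alpha>) = 0" unfolding t1 by (rule R.tw_empty)
    qed (rule adjoint_string_step[OF \<alpha> ef])
    also have "\<dots> = (\<Sum>j<Suc m. of_real ((?c - real m + real j) * s))"
    proof (rule sum.cong[OF refl])
      fix j assume "j \<in> {..<Suc m}"
      then have j: "j \<le> m" by simp
      have r: "?\<mu> + of_nat j * \<alpha> \<in> roots H" unfolding t2[OF j] by (rule IH) simp
      have "(?\<mu> + of_nat j * \<alpha>) ?t = \<gamma> ?t - of_nat m * \<alpha> ?t + of_nat j * \<alpha> ?t"
        by (simp add: of_nat_fun)
      also have "\<dots> = of_real ((?c - real m + real j) * s)"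
        unfolding coroot_ratio[OF \<alpha> \<gamma>] s(2) by (simp add: algebra_simps)
      finally show "(?\<mu> + of_nat j * \<alpha>) ?t * of_nat (card (R.Bw (?\<mu> + of_nat j * \<alpha>)))
          = of_real ((?c - real m + real j) * s)"
        using root_multiplicities(1)[OF r] by simp
    qed
    also have "\<dots> = of_real ((\<Sum>j<Suc m. ?c - real m + real j) * s)"
      unfolding of_real_sum[symmetric] sum_distrib_right ..
    also have "(\<Sum>j<Suc m. ?c - real m + real j) = real (Suc m) * (?c - real m) + real m * real (Suc m) / 2"
    proof -
      have "(\<Sum>j<Suc m. x + real j) = real (Suc m) * x + real m * real (Suc m) / 2" for x
        by (induction m) (auto simp: field_simps)
      from this[of "?c - real m"] show ?thesis .
    qed
    also have "\<dots> = real (Suc m) / 2 * (2 * ?c - real m)" by (simp add: field_simps)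
    finally have "?a ?\<mu> = of_real (real (Suc m) / 2 * (2 * ?c - real m) * s)" .
    moreover have "real (Suc m) / 2 * (2 * ?c - real m) * s \<noteq> 0" using Suc.prems[of m] s(1) by simp
    ultimately have "?a ?\<mu> \<noteq> 0" by (simp only: of_real_eq_0_iff not_False_eq_True)
    moreover have "?a ?\<mu> = R.tw (?\<mu> - \<alpha>) (\<lambda>x. brk f (brk e x))"
      by (rule R.tw_swap[OF shifts_brk[OF ef(1)] shifts_brk[OF ef(2)] supported_dual[OF roots_dual[OF \<alpha>]]])
    ultimately have "R.Bw (?\<mu> - \<alpha>) \<noteq> {}" using R.tw_empty by metis
    moreover have e: "?\<mu> - \<alpha> = \<gamma> - of_nat (Suc m) * \<alpha>" by (simp add: algebra_simps)
    ultimately have "\<gamma> - of_nat (Suc m) * \<alpha> \<in> roots H"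
      using nz roots_iff[of "\<gamma> - of_nat (Suc m) * \<alpha>"] by metis
    then show ?case using IH le_Suc_eq by metis
  qed
  have "- \<alpha> \<noteq> 0" using \<alpha> roots_iff[of \<alpha>] by simp
  then obtain n where n: "R.Bw (\<gamma> + of_nat m * (- \<alpha>)) = {}" if "m \<ge> n" for m
    using R.string_escapes by metis
  have "\<gamma> + of_nat n * (- \<alpha>) = \<gamma> - of_nat n * \<alpha>" by (simp only: mult_minus_right add_uminus_conv_diff)
  then have "\<gamma> - of_nat n * \<alpha> \<notin> roots H"
    using n[of n] roots_iff[of "\<gamma> - of_nat n * \<alpha>"] by auto
  then have "\<exists>i. real i = 2 * ?c" using claim[of n] by blast
  then have L: "real (LEAST i. real i = 2 * ?c) = 2 * ?c" by (rule LeastI_ex)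
  have "\<forall>i\<le>LEAST i. real i = 2 * ?c. \<gamma> - of_nat i * \<alpha> \<in> roots H"
    by (rule claim) (use not_less_Least in blast)
  then show ?thesis using L by blast
qed

text \<open>Climb \<open>q\<close> steps to the top of the string and descend from there by
  \<open>string_down\<close>; the Cartan integer is \<open>m - 2 q\<close>.\<close>

lemma root_string:
  assumes \<alpha>: "\<alpha> \<in> roots H" and \<beta>: "\<beta> \<in> roots H" and ne: "\<beta> \<noteq> \<alpha>" "\<beta> \<noteq> - \<alpha>"
  shows "2 * coroot_ratio \<alpha> \<beta> \<in> \<int>"
    and "real j \<le> 2 * coroot_ratio \<alpha> \<beta> \<Longrightarrow> \<beta> - of_nat j * \<alpha> \<in> roots H"
proof -
  have mult: "\<beta> \<noteq> of_int j * \<alpha>" for j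
    using root_multiples[OF \<alpha>, of j] \<beta> ne by auto
  have "\<alpha> \<noteq> 0" using \<alpha> roots_iff[of \<alpha>] by simp
  then obtain n where n: "R.Bw (\<beta> + of_nat m * \<alpha>) = {}" if "m \<ge> n" for m
    using R.string_escapes by metis
  have ex: "\<exists>q. \<beta> + of_nat (Suc q) * \<alpha> \<notin> roots H"
    using n[of "Suc n"] roots_iff[of "\<beta> + of_nat (Suc n) * \<alpha>"] by (intro exI[of _ n]) simp
  define q where "q = (LEAST q. \<beta> + of_nat (Suc q) * \<alpha> \<notin> roots H)"
  let ?\<gamma> = "\<beta> + of_nat q * \<alpha>"
  have e: "?\<gamma> + \<alpha> = \<beta> + of_nat (Suc q) * \<alpha>" by (simp add: algebra_simps)
  have "\<beta> + of_nat (Suc q) * \<alpha> \<notin> roots H" unfolding q_def by (rule LeastI_ex[OF ex])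
  then have top: "?\<gamma> + \<alpha> \<notin> roots H" unfolding e .
  have \<gamma>: "?\<gamma> \<in> roots H"
  proof (cases q)
    case (Suc p)
    then have "p < q" by simp
    then have "\<not> \<beta> + of_nat (Suc p) * \<alpha> \<notin> roots H" unfolding q_def by (rule not_less_Least)
    then show ?thesis unfolding Suc by blast
  qed (use \<beta> in simp)
  have "?\<gamma> \<noteq> of_int j * \<alpha>" for j
    using mult[of "j - int q"] by (auto simp: algebra_simps)
  then obtain m where m: "real m = 2 * coroot_ratio \<alpha> ?\<gamma>" "\<And>i. i \<le> m \<Longrightarrow> ?\<gamma> - of_nat i * \<alpha> \<in> roots H"
    using string_down[OF \<alpha> \<gamma> top] by blast
  obtain s where s: "s > 0" "\<alpha> (dual_vector \<alpha>) = of_real s" by (rule root_norm_pos[OF \<alpha>])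
  have "?\<gamma> (dual_vector \<alpha>) = \<beta> (dual_vector \<alpha>) + of_nat q * \<alpha> (dual_vector \<alpha>)" by (simp add: of_nat_fun)
  then have c: "coroot_ratio \<alpha> ?\<gamma> = coroot_ratio \<alpha> \<beta> + real q"
    unfolding coroot_ratio_def using s by (simp add: add_divide_distrib)
  then have c2: "2 * coroot_ratio \<alpha> \<beta> = of_int (int m - 2 * int q)" using m(1) by simp
  then show "2 * coroot_ratio \<alpha> \<beta> \<in> \<int>" by (metis Ints_of_int)
  assume "real j \<le> 2 * coroot_ratio \<alpha> \<beta>"
  then have "q + j \<le> m" using c2 by simp
  then have "?\<gamma> - of_nat (q + j) * \<alpha> \<in> roots H" by (rule m(2))
  then show "\<beta> - of_nat j * \<alpha> \<in> roots H" by (simp add: algebra_simps)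
qed

definition coord :: "'a \<Rightarrow> 'a \<Rightarrow> complex" where
  "coord b h = (if h \<in> H then representation rb h b else 0)"

definition wform :: "('a \<Rightarrow> complex) \<Rightarrow> ('a \<Rightarrow> complex) \<Rightarrow> complex" where
  "wform \<phi> \<psi> = (\<Sum>b\<in>R.Bw 0. \<Sum>c\<in>R.Bw 0. \<phi> b * \<psi> c * ip (coord b) (coord c))"

text \<open>Unlike \<open>ip\<close>, which is only meaningful on \<open>dual H\<close>, this form is bilinear on all functions.\<close>

definition form :: "('a \<Rightarrow> complex) \<Rightarrow> ('a \<Rightarrow> complex) \<Rightarrow> real" where
  "form \<phi> \<psi> = Re (wform \<phi> \<psi>)"

definition rho :: "'a \<Rightarrow> complex" where
  "rho h = (\<Sum>\<alpha>\<in>P. \<alpha> h) / 2"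

lemma coord_dual: "coord b \<in> dual H"
  unfolding dual_def coord_def
  using subspace_add[OF H_subspace] subspace_scale[OF H_subspace]
  by (auto simp: rep_add[OF rb(1)] rep_scale[OF rb(1)])

lemma Bw_zero_H: "b \<in> R.Bw 0 \<Longrightarrow> b \<in> H"
  using R.Bw_wsp[of b 0] unfolding wsp_zero .

lemma dual_vector_expand:
  assumes "\<phi> \<in> dual H"
  shows "dual_vector \<phi> = (\<Sum>b\<in>R.Bw 0. scale (\<phi> b) (dual_vector (coord b)))"
proof (rule dual_vector_eqI[OF assms])
  show "(\<Sum>b\<in>R.Bw 0. scale (\<phi> b) (dual_vector (coord b))) \<in> H"
    by (intro subspace_sum[OF H_subspace] subspace_scale[OF H_subspace] dual_vector(1)[OF coord_dual])
  fix h assume h: "h \<in> H"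
  have "killing (\<Sum>b\<in>R.Bw 0. scale (\<phi> b) (dual_vector (coord b))) h
      = (\<Sum>b\<in>R.Bw 0. \<phi> b * coord b h)"
    by (simp add: killing_sum_left killing_scale_left dual_vector(2)[OF coord_dual h])
  also have "\<dots> = \<phi> h" unfolding dual_expand[OF assms h] using h by (simp add: coord_def mult.commute)
  finally show "killing (\<Sum>b\<in>R.Bw 0. scale (\<phi> b) (dual_vector (coord b))) h = \<phi> h" .
qed

lemma wform_ip:
  assumes "\<phi> \<in> dual H" "\<psi> \<in> dual H"
  shows "wform \<phi> \<psi> = ip \<phi> \<psi>"
proof -
  let ?t = "\<lambda>b. dual_vector (coord b)"
  have "ip \<phi> \<psi> = (\<Sum>b\<in>R.Bw 0. \<phi> b * killing (?t b) (\<Sum>c\<in>R.Bw 0. scale (\<psi> c) (?t c)))"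
    unfolding ip_def dual_vector_expand[OF assms(1)] dual_vector_expand[OF assms(2)]
    by (simp only: killing_sum_left killing_scale_left)
  then show ?thesis
    unfolding wform_def
    by (simp only: killing_sum_right killing_scale_right sum_distrib_left mult.assoc ip_def)
qed

lemma wform_add: "wform (x + y) z = wform x z + wform y z"
  unfolding wform_def sum.distrib[symmetric] plus_fun_apply distrib_right ..

lemma wform_sym: "wform x y = wform y x"
  unfolding wform_def
proof (subst sum.swap, intro sum.cong refl)
  fix b c
  show "x c * y b * ip (coord c) (coord b) = y b * x c * ip (coord b) (coord c)"
    by (simp only: ip_sym[of "coord c" "coord b"] mult.commute[of "x c" "y b"])
qed

lemma form_root: "\<phi> \<in> dual H \<Longrightarrow> \<psi> \<in> dual H \<Longrightarrow> form \<phi> \<psi> = Re (\<phi> (dual_vector \<psi>))"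
  unfolding form_def by (simp add: wform_ip ip_eq)

lemma form_coroot_ratio:
  assumes "\<alpha> \<in> roots H" "\<beta> \<in> roots H"
  shows "2 * form \<beta> \<alpha> / form \<alpha> \<alpha> = 2 * coroot_ratio \<alpha> \<beta>"
proof -
  obtain s where s: "s > 0" "\<alpha> (dual_vector \<alpha>) = of_real s" by (rule root_norm_pos[OF assms(1)])
  then show ?thesis
    using coroot_ratio[OF assms] assms by (simp add: form_root roots_dual)
qed

lemma ip_root_real:
  assumes "\<alpha> \<in> roots H" "\<beta> \<in> roots H"
  shows "ip \<beta> \<alpha> = of_real (form \<beta> \<alpha>)"
proof -
  obtain s where s: "s > 0" "\<alpha> (dual_vector \<alpha>) = of_real s" by (rule root_norm_pos[OF assms(1)])
  then show ?thesis
    using coroot_ratio[OF assms] assms by (simp add: form_root roots_dual ip_eq)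
qed

lemma form_add: "form (x + y) z = form x z + form y z"
  unfolding form_def wform_add by simp

sublocale root_datum "roots H" P form rho
proof (rule root_datum.intro)
  show "finite (roots H)" by (rule finite_roots)
  show "form (x + y) z = form x z + form y z" for x y z
    by (rule form_add)
  show "form x y = form y x" for x y
    unfolding form_def by (subst wform_sym) simp
  show "form a a > 0" if a: "a \<in> roots H" for a
  proof -
    obtain s where "s > 0" "a (dual_vector a) = of_real s" by (rule root_norm_pos[OF a])
    then show ?thesis unfolding form_root[OF roots_dual[OF a] roots_dual[OF a]] by simp
  qed
  show "- a \<in> roots H" if "a \<in> roots H" for a using roots_uminus[OF that] .
  show "2 * form b a / form a a \<in> \<int>" if ab: "a \<in> roots H" "b \<in> roots H" for a b
  proof -
    obtain s where s: "s > 0" "a (dual_vector a) = of_real s" by (rule root_norm_pos[OF ab(1)])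
    consider "b = a" | "b = - a" | "b \<noteq> a" "b \<noteq> - a" by blast
    then show ?thesis
    proof cases
      case 1
      then show ?thesis using ab s by (simp add: form_root roots_dual)
    next
      case 2
      have "form (- a) a = - form a a" using ab s by (simp add: form_root roots_dual dual_uminus)
      then show ?thesis using ab s 2 by (simp add: form_root roots_dual)
    next
      case 3
      then show ?thesis unfolding form_coroot_ratio[OF ab] using root_string(1)[OF ab] by blast
    qed
  qed
  show "b - of_nat j * a \<in> roots H"
    if "a \<in> roots H" "b \<in> roots H" "b \<noteq> a" "b \<noteq> - a" "real j \<le> 2 * form b a / form a a" for a b j
    using root_string(2)[OF that(1-4)] that(5) unfolding form_coroot_ratio[OF that(1,2)] by blast
  have pos: "P \<subseteq> roots H" "\<forall>\<alpha>\<in>roots H. \<alpha> \<in> P \<longleftrightarrow> (\<lambda>h. - \<alpha> h) \<notin> P"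
    "\<forall>\<alpha>\<in>P. \<forall>\<beta>\<in>P. (\<lambda>h. \<alpha> h + \<beta> h) \<in> roots H \<longrightarrow> (\<lambda>h. \<alpha> h + \<beta> h) \<in> P"
    using positive unfolding positive_system_def by blast+
  show "P \<subseteq> roots H" by (rule pos(1))
  show "a \<in> P \<longleftrightarrow> - a \<notin> P" if "a \<in> roots H" for a
    using pos(2) that unfolding fun_Compl_def by blast
  show "a + b \<in> P" if "a \<in> P" "b \<in> P" "a + b \<in> roots H" for a b
    using pos(3) that unfolding plus_fun_def by blast
  show "rho + rho = \<Sum>P"
  proof (rule ext)
    fix h
    have "(\<Sum>P) h = (\<Sum>\<alpha>\<in>P. \<alpha> h)" by (induction P rule: infinite_finite_induct) auto
    then show "(rho + rho) h = (\<Sum>P) h" by (simp add: rho_def)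
  qed
qed

text \<open>The functionals on which the complex form \<open>ip\<close> is real and agrees with
  \<open>form\<close> (\<open>ip_real\<close>); all weights of the module turn out to be of this
  kind.\<close>

definition real_weight :: "('a \<Rightarrow> complex) \<Rightarrow> bool" where
  "real_weight \<phi> \<longleftrightarrow> \<phi> \<in> dual H \<and> (\<forall>\<alpha>\<in>roots H. ip \<phi> \<alpha> \<in> \<real>)"

lemma real_weight_root: "\<alpha> \<in> roots H \<Longrightarrow> real_weight \<alpha>"
  unfolding real_weight_def using roots_dual ip_root_real by auto

lemma ip_add_left: "\<phi> \<in> dual H \<Longrightarrow> \<psi> \<in> dual H \<Longrightarrow> \<chi> \<in> dual H \<Longrightarrow> ip (\<phi> + \<psi>) \<chi> = ip \<phi> \<chi> + ip \<psi> \<chi>"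
  by (simp add: ip_eq dual_add)

lemma real_weight_add: "real_weight \<phi> \<Longrightarrow> real_weight \<psi> \<Longrightarrow> real_weight (\<phi> + \<psi>)"
  unfolding real_weight_def using dual_add ip_add_left roots_dual by auto

lemma real_weight_uminus: "real_weight \<phi> \<Longrightarrow> real_weight (- \<phi>)"
  unfolding real_weight_def using dual_uminus roots_dual by (auto simp: ip_eq)

lemma real_weight_diff: "real_weight \<phi> \<Longrightarrow> real_weight \<psi> \<Longrightarrow> real_weight (\<phi> - \<psi>)"
  using real_weight_add[of \<phi> "- \<psi>"] real_weight_uminus by simp

lemma real_weight_zero: "real_weight 0"
  unfolding real_weight_def using dual_zero roots_dual by (auto simp: ip_eq)

lemma real_weight_sum_list: "(\<And>x. x \<in> set xs \<Longrightarrow> real_weight x) \<Longrightarrow> real_weight (sum_list xs)"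
  by (induction xs) (auto simp: real_weight_zero real_weight_add)

lemma real_weight_sum: "(\<And>i. i \<in> I \<Longrightarrow> real_weight (f i)) \<Longrightarrow> real_weight (\<Sum>i\<in>I. f i)"
  by (induction I rule: infinite_finite_induct) (auto simp: real_weight_zero real_weight_add)

lemma real_weight_cone: "x \<in> cone \<Longrightarrow> real_weight x"
  unfolding cone_def using P_subset real_weight_root by (auto intro!: real_weight_sum_list)

text \<open>On \<open>H\<close> the Killing form is a sum over \<open>rb\<close> of products of
  weights, and these take real values at the dual vectors of real weights.\<close>

lemma ip_real:
  assumes "real_weight \<phi>" "real_weight \<psi>"
  shows "ip \<phi> \<psi> = of_real (form \<phi> \<psi>)"
proof -
  have d: "\<phi> \<in> dual H" "\<psi> \<in> dual H" using assms by (auto simp: real_weight_def)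
  have "rw b (dual_vector \<chi>) \<in> \<real>" if \<chi>: "real_weight \<chi>" and b: "b \<in> rb" for \<chi> b
  proof (cases "rw b = 0")
    case False
    then have r: "rw b \<in> roots H" using rw_cases[OF b] by blast
    have "rw b (dual_vector \<chi>) = ip \<chi> (rw b)"
      using \<chi> roots_dual[OF r] ip_sym[of \<chi> "rw b"] by (simp add: ip_eq real_weight_def)
    then show ?thesis using \<chi> r by (simp add: real_weight_def)
  qed simp
  then have "ip \<phi> \<psi> \<in> \<real>"
    unfolding ip_def killing_rb[OF dual_vector(1)[OF d(1)] dual_vector(1)[OF d(2)]]
    using assms by (intro sum_in_Reals Reals_mult) auto
  then show ?thesis unfolding form_def wform_ip[OF d] by simp
qed

lemma simple_roots_eq: "simple_roots = simple"
  unfolding simple_roots_def simple_def plus_fun_def ..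

end

section \<open>The Casimir operator\<close>

sublocale lie_module \<subseteq> V: complex_space scaleV BasisV ..

context lie_module
begin

lemma lin_act: "V.lin (act x)"
  by (rule V.linI) (simp_all add: act_add_right act_scale_right)

lemma act_sum_left: "act (\<Sum>i\<in>I. f i) v = (\<Sum>i\<in>I. act (f i) v)"
proof -
  have "act 0 v = 0" using act_scale_left[of 0 0 v] by simp
  then show ?thesis by (induction I rule: infinite_finite_induct) (auto simp: act_add_left)
qed

lemma act_zero_left: "act 0 v = 0"
  using act_sum_left[of "\<lambda>_. 0" "{}"] by simp

lemma act_swap: "act x (act y v) = act y (act x v) + act (brk x y) v"
  by (simp add: act_brk)

end

locale highest_weight_module =
  cartan_lie_algebra scale Basis brk H P +
  irreducible_lie_module scale Basis brk scaleV BasisV act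
  for scale :: "complex \<Rightarrow> 'g::ab_group_add \<Rightarrow> 'g" and Basis and brk
    and H :: "'g set" and P :: "('g \<Rightarrow> complex) set"
    and scaleV :: "complex \<Rightarrow> 'v::ab_group_add \<Rightarrow> 'v" and BasisV and act +
  fixes \<Lambda> :: "'g \<Rightarrow> complex"
  assumes highest_weight: "has_highest_weight H P \<Lambda>"
    and real_highest: "real_weight \<Lambda>"
begin

definition v0 :: 'v where
  "v0 = (SOME v. v \<noteq> 0 \<and> (\<forall>h\<in>H. act h v = scaleV (\<Lambda> h) v) \<and> (\<forall>\<alpha>\<in>P. \<forall>x\<in>root_space H \<alpha>. act x v = 0))"

lemma v0: "v0 \<noteq> 0" "h \<in> H \<Longrightarrow> act h v0 = scaleV (\<Lambda> h) v0" "\<alpha> \<in> P \<Longrightarrow> x \<in> R.wsp \<alpha> \<Longrightarrow> act x v0 = 0"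
  using someI_ex[OF highest_weight[unfolded has_highest_weight_def]]
  unfolding v0_def[symmetric] wsp_root_space by blast+

text \<open>Products of \<open>n\<close> negative root vectors applied to the highest weight vector.
  The length \<open>n\<close> is recorded for \<open>words_upto_raise\<close>, the weight for the
  weight basis.\<close>

inductive word :: "nat \<Rightarrow> ('g \<Rightarrow> complex) \<Rightarrow> 'v \<Rightarrow> bool" where
  word_0: "word 0 \<Lambda> v0"
| word_Suc: "word n \<mu> v \<Longrightarrow> \<alpha> \<in> P \<Longrightarrow> x \<in> R.wsp (- \<alpha>) \<Longrightarrow> word (Suc n) (\<mu> - \<alpha>) (act x v)"

lemma word_weight:
  assumes "word n \<mu> v" "h \<in> H"
  shows "act h v = scaleV (\<mu> h) v"
  using assms
proof (induction rule: word.induct)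
  case word_0
  then show ?case by (rule v0(2))
next
  case (word_Suc n \<mu> v \<alpha> x)
  have "brk h x = scale (- \<alpha> h) x" using word_Suc.hyps(3) word_Suc.prems unfolding R.wsp_def by auto
  then have "act h (act x v) = scaleV (\<mu> h) (act x v) + scaleV (- \<alpha> h) (act x v)"
    unfolding act_swap[of h x] using word_Suc by (simp only: act_scale_right act_scale_left)
  then show ?case by (simp add: V.scale_left_diff_distrib)
qed

lemma word_below:
  assumes "word n \<mu> v"
  shows "\<exists>xs. length xs = n \<and> set xs \<subseteq> P \<and> \<Lambda> - \<mu> = sum_list xs"
  using assms
proof (induction rule: word.induct)
  case word_0
  show ?case by (rule exI[of _ "[]"]) simp
next
  case (word_Suc n \<mu> v \<alpha> x)
  then obtain xs where "length xs = n" "set xs \<subseteq> P" "\<Lambda> - \<mu> = sum_list xs" by blast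
  then show ?case using word_Suc by (intro exI[of _ "\<alpha> # xs"]) (auto simp: algebra_simps)
qed

lemma word_cone: "word n \<mu> v \<Longrightarrow> \<Lambda> - \<mu> \<in> cone"
  using word_below unfolding cone_def by blast

lemma word_top:
  assumes "word n \<Lambda> v"
  shows "v = v0"
proof -
  obtain xs where xs: "length xs = n" "set xs \<subseteq> P" "\<Lambda> - \<Lambda> = sum_list xs"
    using word_below[OF assms] by blast
  then have "xs = []" using sum_list_P_nonzero[of xs] by auto
  then have "n = 0" using xs by simp
  then show ?thesis using assms by (auto elim: word.cases)
qed

lemma word_real: "word n \<mu> v \<Longrightarrow> real_weight \<mu>"
  using real_weight_diff[OF real_highest real_weight_cone[OF word_cone]] by fastforce

definition words_upto :: "nat \<Rightarrow> 'v set" where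
  "words_upto n = V.span {v. \<exists>m\<le>n. \<exists>\<mu>. word m \<mu> v}"

lemma words_upto_word: "word m \<mu> v \<Longrightarrow> m \<le> n \<Longrightarrow> v \<in> words_upto n"
  unfolding words_upto_def by (rule V.span_base) blast

lemma words_upto_mono: "m \<le> n \<Longrightarrow> words_upto m \<subseteq> words_upto n"
  unfolding words_upto_def by (rule V.span_mono) (use le_trans in blast)

lemma words_upto_scale: "v \<in> words_upto n \<Longrightarrow> scaleV c v \<in> words_upto n"
  unfolding words_upto_def by (rule V.span_scale)

lemma words_upto_zero: "0 \<in> words_upto n"
  unfolding words_upto_def by (rule V.span_zero)

lemma words_upto_linear:
  assumes "\<And>m \<mu> v. m \<le> n \<Longrightarrow> word m \<mu> v \<Longrightarrow> act x v \<in> words_upto k" "u \<in> words_upto n"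
  shows "act x u \<in> words_upto k"
  using assms(2) unfolding words_upto_def[of n]
proof (induction rule: V.span_induct_alt)
  case base
  show ?case using V.lin_zero[OF lin_act] words_upto_zero by simp
next
  case (step c y z)
  then have "act x y \<in> words_upto k" using assms(1) by blast
  then show ?case using step unfolding act_add_right act_scale_right words_upto_def
    by (intro V.span_add V.span_scale)
qed

lemma words_upto_lower: "\<alpha> \<in> P \<Longrightarrow> x \<in> R.wsp (- \<alpha>) \<Longrightarrow> u \<in> words_upto n \<Longrightarrow> act x u \<in> words_upto (Suc n)"
  by (rule words_upto_linear[of n]) (use words_upto_word word_Suc in blast)+

lemma wsp_nonroot: "\<gamma> \<in> dual H \<Longrightarrow> \<gamma> \<noteq> 0 \<Longrightarrow> \<gamma> \<notin> roots H \<Longrightarrow> R.wsp \<gamma> = {0}"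
  using R.wsp_span[OF supported_dual, of \<gamma>] roots_iff[of \<gamma>] by simp

text \<open>Commuting a raising operator past the outermost letter \<open>f\<close> leaves the
  operator \<open>[x, f]\<close>. It lies in \<open>H\<close>, raises, lowers or is 0, and in each
  case applied to the shorter word it gives words of length at most \<open>n\<close>.\<close>

lemma words_upto_raise:
  assumes "word n \<mu> v" "\<beta> \<in> P" "x \<in> R.wsp \<beta>"
  shows "act x v \<in> words_upto n"
  using assms
proof (induction arbitrary: \<beta> x rule: word.induct)
  case word_0
  then show ?case using v0(3) words_upto_zero by simp
next
  case (word_Suc n \<mu> v \<alpha> f)
  have "act x v \<in> words_upto n" using word_Suc by blast
  then have 1: "act f (act x v) \<in> words_upto (Suc n)" using words_upto_lower word_Suc.hyps by blast
  let ?\<gamma> = "- \<alpha> + \<beta>"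
  have y: "brk x f \<in> R.wsp ?\<gamma>" by (rule bracket_wsp[OF word_Suc.prems(2) word_Suc.hyps(3)])
  have d: "?\<gamma> \<in> dual H"
    using word_Suc.hyps(2) word_Suc.prems(1) P_subset roots_dual by (intro dual_add dual_uminus) auto
  have "act (brk x f) v \<in> words_upto (Suc n)"
  proof (cases "?\<gamma> = 0")
    case True
    then have "brk x f \<in> H" using y by (simp only: wsp_zero)
    then have "act (brk x f) v = scaleV (\<mu> (brk x f)) v" by (rule word_weight[OF word_Suc.hyps(1)])
    then show ?thesis using words_upto_word[OF word_Suc.hyps(1)] words_upto_scale by simp
  next
    case False
    show ?thesis
    proof (cases "?\<gamma> \<in> roots H")
      case True
      show ?thesis
      proof (cases "?\<gamma> \<in> P")
        case True
        then have "act (brk x f) v \<in> words_upto n" using word_Suc.IH y by blast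
        then show ?thesis using words_upto_mono[of n "Suc n"] by auto
      next
        case False
        then have "- ?\<gamma> \<in> P" using P_neg[OF uminus_R[OF True]] by simp
        moreover have "brk x f \<in> R.wsp (- (- ?\<gamma>))" using y by simp
        ultimately have "word (Suc n) (\<mu> - - ?\<gamma>) (act (brk x f) v)" by (rule word.word_Suc[OF word_Suc.hyps(1)])
        then show ?thesis by (rule words_upto_word) simp
      qed
    next
      case nr: False
      then have "brk x f = 0" using wsp_nonroot[OF d False nr] y by simp
      then show ?thesis using words_upto_zero by (simp add: act_zero_left)
    qed
  qed
  then show ?case unfolding act_swap[of x f] words_upto_def using 1[unfolded words_upto_def] by (intro V.span_add)
qed

text \<open>The span of the words is stable under every member of \<open>rb\<close>, so
  irreducibility makes it the whole module.\<close>

lemma words_span: "V.span {v. \<exists>n \<mu>. word n \<mu> v} = UNIV"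
proof -
  let ?U = "V.span {v. \<exists>n \<mu>. word n \<mu> v}"
  have sub: "words_upto n \<subseteq> ?U" for n unfolding words_upto_def by (rule V.span_mono) blast
  have act_rb: "act b v \<in> ?U" if b: "b \<in> rb" and v: "word n \<mu> v" for b n \<mu> v
  proof -
    have bw: "b \<in> R.wsp (rw b)" using b R.Bw_wsp[of b "rw b"] unfolding R.Bw_def by simp
    consider "rw b = 0" | "rw b \<in> P" | "- rw b \<in> P" using rw_cases[OF b] P_neg by blast
    then show ?thesis
    proof cases
      case 1
      then have "b \<in> H" using bw by (simp only: wsp_zero)
      then have "act b v = scaleV (\<mu> b) v" by (rule word_weight[OF v])
      moreover have "v \<in> ?U" using v by (blast intro: V.span_base)
      ultimately show ?thesis by (simp add: V.span_scale)
    next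
      case 2
      then show ?thesis using words_upto_raise[OF v 2 bw] sub by blast
    next
      case 3
      have "b \<in> R.wsp (- (- rw b))" using bw by simp
      then have "word (Suc n) (\<mu> - - rw b) (act b v)" by (rule word.word_Suc[OF v 3])
      then show ?thesis by (blast intro: V.span_base)
    qed
  qed
  have "act x u \<in> ?U" if u: "u \<in> ?U" for x u
    using u
  proof (induction rule: V.span_induct_alt)
    case base
    show ?case using V.lin_zero[OF lin_act] V.span_zero by simp
  next
    case (step c v w)
    then obtain n \<mu> where v: "word n \<mu> v" by blast
    have "act x v = act (\<Sum>b\<in>rb. scale (representation rb x b) b) v"
      by (simp only: basis_expand[OF rb(1)])
    also have "\<dots> = (\<Sum>b\<in>rb. scaleV (representation rb x b) (act b v))"
      by (simp only: act_sum_left act_scale_left)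
    also have "\<dots> \<in> ?U" by (intro V.span_sum V.span_scale act_rb[OF _ v])
    finally show ?case using step unfolding act_add_right act_scale_right by (intro V.span_add V.span_scale)
  qed
  moreover have "v0 \<in> ?U" using word_0 by (blast intro: V.span_base)
  ultimately show ?thesis using irreducible[OF V.subspace_span, of "{v. \<exists>n \<mu>. word n \<mu> v}"] v0(1) by blast
qed

definition vb :: "'v set" where
  "vb = (SOME B. V.basis B \<and> B \<subseteq> {v. \<exists>n \<mu>. word n \<mu> v})"

definition vw :: "'v \<Rightarrow> 'g \<Rightarrow> complex" where
  "vw b = (SOME \<mu>. \<exists>n. word n \<mu> b)"

lemma vb: "V.basis vb" "vb \<subseteq> {v. \<exists>n \<mu>. word n \<mu> v}"
proof -
  have "\<exists>B. V.basis B \<and> B \<subseteq> {v. \<exists>n \<mu>. word n \<mu> v}"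
    using V.basis_from_spanning[OF words_span] by metis
  from someI_ex[OF this] show "V.basis vb" "vb \<subseteq> {v. \<exists>n \<mu>. word n \<mu> v}"
    unfolding vb_def by blast+
qed

lemma vw:
  assumes "b \<in> vb"
  obtains n where "word n (vw b) b"
proof -
  have "\<exists>\<mu>. \<exists>n. word n \<mu> b" using assms vb(2) by blast
  from someI_ex[OF this] show ?thesis using that unfolding vw_def by blast
qed

sublocale M: weight_space scaleV BasisV H act vb vw
proof (intro weight_space.intro weight_space_axioms.intro)
  show "complex_space scaleV BasisV" ..
  show "V.lin (act h)" for h by (rule lin_act)
  show "V.basis vb" by (rule vb)
  fix b h assume b: "b \<in> vb"
  obtain n where n: "word n (vw b) b" by (rule vw[OF b])
  show "act h b = scaleV (vw b h) b" if "h \<in> H" by (rule word_weight[OF n that])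
  show "vw b h = 0" if "h \<notin> H" using word_real[OF n] that by (simp add: real_weight_def dual_def)
qed

lemma weights_real: "M.Bw \<mu> \<noteq> {} \<Longrightarrow> real_weight \<mu>"
  using vw word_real unfolding M.Bw_def by blast

lemma weights_cone: "M.Bw \<mu> \<noteq> {} \<Longrightarrow> \<Lambda> - \<mu> \<in> cone"
  using vw word_cone unfolding M.Bw_def by blast

lemma highest_multiplicity: "card (M.Bw \<Lambda>) = 1"
proof -
  have sub: "M.Bw \<Lambda> \<subseteq> {v0}"
  proof
    fix b assume "b \<in> M.Bw \<Lambda>"
    then have b: "b \<in> vb" "vw b = \<Lambda>" unfolding M.Bw_def by blast+
    obtain n where "word n (vw b) b" by (rule vw[OF b(1)])
    then show "b \<in> {v0}" using word_top b(2) by simp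
  qed
  have "v0 \<in> M.wsp \<Lambda>" unfolding M.wsp_def using v0(2) by blast
  moreover have "M.supported \<Lambda>" using real_highest by (simp add: M.supported_def real_weight_def dual_def)
  ultimately have "v0 \<in> V.span (M.Bw \<Lambda>)" using M.wsp_span by simp
  then have "M.Bw \<Lambda> \<noteq> {}" using v0(1) by auto
  then have "M.Bw \<Lambda> = {v0}" using sub by blast
  then show ?thesis by simp
qed

text \<open>The basis dual to \<open>rb\<close> under the Killing form.\<close>

definition dualb :: "'g \<Rightarrow> 'g" where
  "dualb b = (SOME y. \<forall>x. killing y x = representation rb x b)"

lemma dualb: "killing (dualb b) x = representation rb x b"
proof -
  have "\<exists>y. \<forall>x. killing y x = representation rb x b"
    using killing_represent[of "\<lambda>x. representation rb x b"] rep_add[OF rb(1)] rep_scale[OF rb(1)] by metis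
  from someI_ex[OF this] show ?thesis unfolding dualb_def by blast
qed

lemma killing_eqI:
  assumes "\<And>c. c \<in> rb \<Longrightarrow> killing x c = killing y c"
  shows "x = y"
proof -
  have "killing (x - y) z = 0" for z
    using killing_lin_eq[of rb "x - y" z] rb(1) assms by (simp add: basis_def killing_diff_left)
  then have "x - y = 0" by (rule killing_nondegenerate)
  then show ?thesis by simp
qed

lemma dualb_expand: "(\<Sum>b\<in>rb. scale (killing x b) (dualb b)) = x"
proof (rule killing_eqI)
  fix c assume c: "c \<in> rb"
  have "killing (\<Sum>b\<in>rb. scale (killing x b) (dualb b)) c = (\<Sum>b\<in>rb. if c = b then killing x b else 0)"
    unfolding killing_sum_left killing_scale_left dualb
    by (rule sum.cong) (use c in \<open>auto simp: rep_basis[OF rb(1)]\<close>)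
  then show "killing (\<Sum>b\<in>rb. scale (killing x b) (dualb b)) c = killing x c"
    using c basis_finite[OF rb(1)] by simp
qed

lemma dualb_wsp:
  assumes "b \<in> rb"
  shows "dualb b \<in> R.wsp (- rw b)"
  unfolding R.wsp_def
proof (intro CollectI ballI)
  fix h assume h: "h \<in> H"
  show "brk h (dualb b) = scale ((- rw b) h) (dualb b)"
  proof (rule killing_eqI)
    fix c assume c: "c \<in> rb"
    have "killing (brk h (dualb b)) c = - killing (dualb b) (brk h c)"
      unfolding brk_anti[of h "dualb b"] killing_minus_left killing_invariant ..
    also have "\<dots> = - (rw c h * representation rb c b)"
      unfolding R.op_wt[OF c h] killing_scale_right dualb ..
    finally show "killing (brk h (dualb b)) c = killing (scale ((- rw b) h) (dualb b)) c"
      unfolding killing_scale_left dualb using c by (simp add: rep_basis[OF rb(1)])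
  qed
qed

lemma brk_dualb:
  assumes "b \<in> rb"
  shows "brk b (dualb b) = dual_vector (rw b)"
proof (rule bracket_dual)
  show "rw b \<in> dual H" by (rule rw(1)[OF assms])
  show "b \<in> R.wsp (rw b)" using assms R.Bw_wsp[of b "rw b"] unfolding R.Bw_def by simp
  show "dualb b \<in> R.wsp (- rw b)" by (rule dualb_wsp[OF assms])
  show "killing b (dualb b) = 1"
    using assms by (subst killing_sym) (simp add: dualb rep_basis[OF rb(1)])
qed

definition casimir :: "'v \<Rightarrow> 'v" where
  "casimir w = (\<Sum>b\<in>rb. act b (act (dualb b) w))"

lemma lin_casimir: "V.lin casimir"
  by (rule V.linI) (simp_all add: casimir_def act_add_right act_scale_right sum.distrib V.scale_sum_right)

text \<open>By invariance of the Killing form the matrices of \<open>ad y\<close> in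
  \<open>rb\<close> and in the dual basis are negative transposes of each other, so the two
  correction terms cancel.\<close>

lemma casimir_commute: "act y (casimir w) = casimir (act y w)"
proof -
  let ?k = "\<lambda>c b. killing (dualb c) (brk y b)"
  have e1: "brk y b = (\<Sum>c\<in>rb. scale (?k c b) c)" for b
    using basis_expand[OF rb(1), of "brk y b"] by (simp add: dualb)
  have e2: "brk y (dualb b) = (\<Sum>c\<in>rb. scale (- ?k b c) (dualb c))" for b
  proof -
    have "killing (brk y (dualb b)) c = - ?k b c" for c
      unfolding brk_anti[of y "dualb b"] killing_minus_left killing_invariant ..
    then show ?thesis using dualb_expand[of "brk y (dualb b)"] by simp
  qed
  have "act y (casimir w) = (\<Sum>b\<in>rb. act b (act (dualb b) (act y w)))
      + ((\<Sum>b\<in>rb. act (brk y b) (act (dualb b) w)) + (\<Sum>b\<in>rb. act b (act (brk y (dualb b)) w)))"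
    unfolding casimir_def V.lin_sum[OF lin_act] sum.distrib[symmetric]
  proof (rule sum.cong[OF refl])
    fix b
    have "act y (act b (act (dualb b) w)) = act b (act y (act (dualb b) w)) + act (brk y b) (act (dualb b) w)"
      by (rule act_swap)
    also have "act y (act (dualb b) w) = act (dualb b) (act y w) + act (brk y (dualb b)) w"
      by (rule act_swap)
    finally show "act y (act b (act (dualb b) w)) = act b (act (dualb b) (act y w))
        + (act (brk y b) (act (dualb b) w) + act b (act (brk y (dualb b)) w))"
      by (simp add: act_add_right add_ac)
  qed
  also have "(\<Sum>b\<in>rb. act (brk y b) (act (dualb b) w)) =
      (\<Sum>b\<in>rb. \<Sum>c\<in>rb. scaleV (?k c b) (act c (act (dualb b) w)))"
    by (subst e1) (simp only: act_sum_left act_scale_left)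
  also have "(\<Sum>b\<in>rb. act b (act (brk y (dualb b)) w)) =
      (\<Sum>b\<in>rb. \<Sum>c\<in>rb. - scaleV (?k b c) (act b (act (dualb c) w)))"
    by (subst e2) (simp only: act_sum_left act_scale_left V.lin_sum[OF lin_act] act_scale_right
        V.scale_minus_left V.lin_neg[OF lin_act])
  also have "\<dots> = - (\<Sum>b\<in>rb. \<Sum>c\<in>rb. scaleV (?k c b) (act c (act (dualb b) w)))"
    by (subst sum.swap) (simp only: sum_negf)
  finally show ?thesis by (simp add: casimir_def)
qed

text \<open>Schur's lemma: an eigenvalue exists because generalized eigenspaces span, and its
  eigenspace is a nonzero submodule.\<close>

lemma casimir_scalar: "\<exists>c. \<forall>w. casimir w = scaleV c w"
proof -
  have "\<exists>a x. x \<in> V.geig casimir a \<and> x \<noteq> 0"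
  proof (rule ccontr)
    assume "\<not> (\<exists>a x. x \<in> V.geig casimir a \<and> x \<noteq> 0)"
    then have "(\<Union>a. V.geig casimir a) \<subseteq> {0}" by blast
    then have "V.span (\<Union>a. V.geig casimir a) \<subseteq> {0}" by (intro V.span_minimal) (auto simp: V.subspace_def)
    then show False using V.geig_span[OF lin_casimir] nonzero by blast
  qed
  then obtain a x where x: "x \<in> V.geig casimir a" "x \<noteq> 0" by blast
  let ?T = "\<lambda>y. casimir y - scaleV a y"
  have "\<exists>y. y \<noteq> 0 \<and> ?T y = 0" if "(?T ^^ n) x = 0" "x \<noteq> 0" for n x
    using that
  proof (induction n arbitrary: x)
    case (Suc n)
    have e: "(?T ^^ n) (?T x) = 0" using Suc.prems(1) unfolding funpow_Suc_right by simp
    show ?case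
    proof (cases "?T x = 0")
      case True
      then show ?thesis using Suc.prems(2) by blast
    next
      case False
      then show ?thesis by (rule Suc.IH[OF e])
    qed
  qed simp
  then obtain y where y: "y \<noteq> 0" "?T y = 0" using x unfolding V.geig_def by blast
  let ?E = "{w. casimir w = scaleV a w}"
  have "V.subspace ?E"
    unfolding V.subspace_def
    by (auto simp: V.lin_zero[OF lin_casimir] V.lin_add[OF lin_casimir] V.lin_scale[OF lin_casimir]
        V.scale_right_distrib mult.commute)
  moreover have "act z u \<in> ?E" if "u \<in> ?E" for z u
    using that casimir_commute[of z u, symmetric] by (simp add: act_scale_right)
  ultimately have "?E = {0} \<or> ?E = UNIV" by (rule irreducible)
  moreover have "y \<in> ?E" using y(2) by simp
  ultimately show ?thesis using y(1) by blast
qed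

definition cas :: complex where
  "cas = (SOME c. \<forall>w. casimir w = scaleV c w)"

lemma cas: "casimir w = scaleV cas w"
  using someI_ex[OF casimir_scalar] unfolding cas_def by blast

lemma shifts_act: "x \<in> R.wsp \<alpha> \<Longrightarrow> M.shifts (act x) \<alpha>"
  unfolding M.shifts_def
proof (intro conjI allI ballI lin_act)
  fix \<mu> v assume x: "x \<in> R.wsp \<alpha>" and v: "v \<in> M.wsp \<mu>"
  show "act x v \<in> M.wsp (\<mu> + \<alpha>)"
    unfolding M.wsp_def
  proof (intro CollectI ballI)
    fix h assume h: "h \<in> H"
    have "brk h x = scale (\<alpha> h) x" "act h v = scaleV (\<mu> h) v"
      using x v h unfolding R.wsp_def M.wsp_def by blast+
    then have "act h (act x v) = scaleV (\<mu> h) (act x v) + scaleV (\<alpha> h) (act x v)"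
      unfolding act_swap[of h x] by (simp only: act_scale_right act_scale_left)
    then show "act h (act x v) = scaleV ((\<mu> + \<alpha>) h) (act x v)" by (simp add: V.scale_left_distrib)
  qed
qed

definition root_trace :: "'g \<Rightarrow> ('g \<Rightarrow> complex) \<Rightarrow> complex" where
  "root_trace b \<mu> = M.tw \<mu> (\<lambda>w. act b (act (dualb b) w))"

definition m :: "('g \<Rightarrow> complex) \<Rightarrow> nat" where
  "m \<mu> = card (M.Bw \<mu>)"

lemma root_trace_step:
  assumes "b \<in> rb"
  shows "root_trace b \<mu> - root_trace b (\<mu> + rw b) = \<mu> (dual_vector (rw b)) * of_nat (m \<mu>)"
  unfolding root_trace_def m_def
proof (rule M.string_trace_step[where E = "act b" and F = "act (dualb b)"])
  have "b \<in> R.wsp (rw b)" using assms R.Bw_wsp[of b "rw b"] unfolding R.Bw_def by simp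
  then show "M.shifts (act b) (rw b)" by (rule shifts_act)
  show "M.shifts (act (dualb b)) (- rw b)" by (rule shifts_act[OF dualb_wsp[OF assms]])
  show "M.supported (rw b)" using R.supported_wt[OF assms] by (simp add: M.supported_def R.supported_def)
  fix v assume "v \<in> M.Bw \<mu>"
  then have v: "v \<in> vb" "vw v = \<mu>" unfolding M.Bw_def by blast+
  have "act b (act (dualb b) v) - act (dualb b) (act b v) = act (brk b (dualb b)) v"
    by (simp add: act_brk)
  also have "\<dots> = scaleV (\<mu> (dual_vector (rw b))) v"
    unfolding brk_dualb[OF assms] v(2)[symmetric]
    by (rule M.op_wt[OF v(1) dual_vector(1)[OF rw(1)[OF assms]]])
  finally show "act b (act (dualb b) v) - act (dualb b) (act b v) = scaleV (\<mu> (dual_vector (rw b))) v" .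
qed

lemma root_trace_empty: "M.Bw \<mu> = {} \<Longrightarrow> root_trace b \<mu> = 0"
  unfolding root_trace_def by (rule M.tw_empty)

text \<open>The part of the Casimir operator coming from \<open>H\<close> acts on the weight space
  of \<open>\<mu>\<close> as the scalar \<open>ip \<mu> \<mu>\<close>.\<close>

lemma root_trace_zero:
  "(\<Sum>b\<in>R.Bw 0. root_trace b \<mu>) = ip \<mu> \<mu> * of_nat (m \<mu>)"
proof (cases "M.Bw \<mu> = {}")
  case True
  then show ?thesis using root_trace_empty by (simp add: m_def)
next
  case False
  then have d: "\<mu> \<in> dual H" using weights_real by (simp add: real_weight_def)
  have B: "b \<in> rb" "rw b = 0" if "b \<in> R.Bw 0" for b using that unfolding R.Bw_def by blast+
  have dH: "dualb b \<in> H" if "b \<in> R.Bw 0" for b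
    using dualb_wsp[OF B(1)[OF that]] B(2)[OF that] by (simp add: wsp_zero)
  have dc: "dual_vector (coord b) = dualb b" if "b \<in> R.Bw 0" for b
    by (rule dual_vector_eqI[OF coord_dual dH[OF that]]) (simp add: dualb coord_def)
  have "root_trace b \<mu> = \<mu> b * \<mu> (dualb b) * of_nat (m \<mu>)" if b: "b \<in> R.Bw 0" for b
    unfolding root_trace_def m_def
  proof (rule M.tw_scalar)
    fix v assume "v \<in> M.Bw \<mu>"
    then have v: "v \<in> vb" "vw v = \<mu>" unfolding M.Bw_def by blast+
    then show "act b (act (dualb b) v) = scaleV (\<mu> b * \<mu> (dualb b)) v"
      using M.op_wt[OF v(1) dH[OF b]] M.op_wt[OF v(1) Bw_zero_H[OF b]] by (simp add: act_scale_right mult.commute)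
  qed
  then have "(\<Sum>b\<in>R.Bw 0. root_trace b \<mu>) = (\<Sum>b\<in>R.Bw 0. \<mu> b * \<mu> (dualb b)) * of_nat (m \<mu>)"
    by (simp add: sum_distrib_right)
  also have "(\<Sum>b\<in>R.Bw 0. \<mu> b * \<mu> (dualb b)) = \<mu> (\<Sum>b\<in>R.Bw 0. scale (\<mu> b) (dualb b))"
    using dual_sum_H[OF d, of "R.Bw 0" dualb \<mu>] dH by simp
  also have "(\<Sum>b\<in>R.Bw 0. scale (\<mu> b) (dualb b)) = dual_vector \<mu>"
    unfolding dual_vector_expand[OF d] by (rule sum.cong) (auto simp: dc)
  finally show ?thesis unfolding ip_eq[OF d d] .
qed

lemma casimir_trace: "cas * of_nat (m \<mu>) = (\<Sum>b\<in>rb. root_trace b \<mu>)"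
proof -
  have "cas * of_nat (m \<mu>) = M.tw \<mu> casimir"
    unfolding m_def by (rule M.tw_scalar[symmetric]) (rule cas)
  also have "\<dots> = (\<Sum>b\<in>rb. root_trace b \<mu>)"
    unfolding casimir_def root_trace_def M.tw_def V.ptr_def V.rep_sum[OF vb(1)] by (rule sum.swap)
  finally show ?thesis .
qed

definition rvec :: "('g \<Rightarrow> complex) \<Rightarrow> 'g" where
  "rvec \<alpha> = (THE b. b \<in> R.Bw \<alpha>)"

lemma rvec:
  assumes "\<alpha> \<in> roots H"
  shows "R.Bw \<alpha> = {rvec \<alpha>}" "rvec \<alpha> \<in> rb" "rw (rvec \<alpha>) = \<alpha>"
proof -
  obtain b where b: "R.Bw \<alpha> = {b}" using root_multiplicities(1)[OF assms] card_1_singletonE by blast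
  then have "rvec \<alpha> = b" unfolding rvec_def by auto
  then show "R.Bw \<alpha> = {rvec \<alpha>}" using b by simp
  then show "rvec \<alpha> \<in> rb" "rw (rvec \<alpha>) = \<alpha>" unfolding R.Bw_def by blast+
qed

definition rt :: "('g \<Rightarrow> complex) \<Rightarrow> ('g \<Rightarrow> complex) \<Rightarrow> complex" where
  "rt \<alpha> \<mu> = root_trace (rvec \<alpha>) \<mu>"

lemma rt_step: "\<alpha> \<in> roots H \<Longrightarrow> rt \<alpha> \<mu> - rt \<alpha> (\<mu> + \<alpha>) = \<mu> (dual_vector \<alpha>) * of_nat (m \<mu>)"
  unfolding rt_def using root_trace_step[of "rvec \<alpha>" \<mu>] rvec[of \<alpha>] by simp

lemma dual_vector_uminus:
  assumes "\<alpha> \<in> dual H"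
  shows "dual_vector (- \<alpha>) = - dual_vector \<alpha>"
  by (rule dual_vector_eqI[OF dual_uminus[OF assms]])
    (use dual_vector[OF assms] subspace_neg[OF H_subspace] in \<open>auto simp: killing_minus_left\<close>)

text \<open>By the step formulas for \<open>\<alpha>\<close> and \<open>- \<alpha>\<close> the
  difference of the two sides is constant along the string, and it is 0 far below it.\<close>

lemma rt_opposite:
  assumes \<alpha>: "\<alpha> \<in> roots H"
  shows "rt (- \<alpha>) \<mu> = rt \<alpha> (\<mu> + \<alpha>)"
proof -
  have d: "\<alpha> \<in> dual H" by (rule roots_dual[OF \<alpha>])
  define D where "D \<mu> = rt (- \<alpha>) \<mu> - rt \<alpha> (\<mu> + \<alpha>)" for \<mu>
  have step: "D \<mu> - D (\<mu> + - \<alpha>) = 0 * of_nat (card (M.Bw \<mu>))" for \<mu>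
  proof (cases "M.Bw \<mu> = {}")
    case True
    then have "m \<mu> = 0" by (simp add: m_def)
    then show ?thesis
      unfolding D_def using rt_step[OF \<alpha>, of \<mu>] rt_step[OF uminus_R[OF \<alpha>], of \<mu>] by (simp add: algebra_simps)
  next
    case False
    then have "\<mu> \<in> dual H" using weights_real by (simp add: real_weight_def)
    then have "\<mu> (- dual_vector \<alpha>) = - \<mu> (dual_vector \<alpha>)"
      using dual_sum_H[of \<mu> "{()}" "\<lambda>_. dual_vector \<alpha>" "\<lambda>_. - 1"] dual_vector(1)[OF d] by simp
    then show ?thesis
      unfolding D_def using rt_step[OF \<alpha>, of \<mu>] rt_step[OF uminus_R[OF \<alpha>], of \<mu>] dual_vector_uminus[OF d]
      by (simp add: algebra_simps)
  qed
  have "\<alpha> \<noteq> 0" "- \<alpha> \<noteq> 0" using \<alpha> roots_iff[of \<alpha>] by simp_all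
  obtain n1 where n1: "M.Bw (\<mu> + of_nat k * (- \<alpha>)) = {}" if "k \<ge> n1" for k
    using M.string_escapes[OF \<open>- \<alpha> \<noteq> 0\<close>] by metis
  have "\<mu> + of_nat (Suc n1) * (- \<alpha>) + \<alpha> = \<mu> + of_nat n1 * (- \<alpha>)" by (simp add: algebra_simps)
  then have "rt \<alpha> (\<mu> + of_nat (Suc n1) * (- \<alpha>) + \<alpha>) = 0"
    unfolding rt_def using root_trace_empty[OF n1[OF order_refl]] by metis
  moreover have "rt (- \<alpha>) (\<mu> + of_nat (Suc n1) * (- \<alpha>)) = 0"
    unfolding rt_def by (rule root_trace_empty, rule n1) simp
  ultimately have "D (\<mu> + of_nat (Suc n1) * (- \<alpha>)) = 0" unfolding D_def by (simp only: diff_self)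
  from M.string_sum[where t = "\<lambda>_. 0", OF step this] have "D \<mu> = 0" by simp
  then show ?thesis unfolding D_def by simp
qed

text \<open>Each negative root is moved by \<open>rt_opposite\<close> to its positive partner at the
  shifted weight, so that the sum runs over \<open>P\<close>.\<close>

lemma casimir_roots:
  "cas * of_nat (m \<mu>) = ip \<mu> \<mu> * of_nat (m \<mu>) + (\<Sum>\<alpha>\<in>P. rt \<alpha> \<mu> + rt \<alpha> (\<mu> + \<alpha>))"
proof -
  have fin: "finite rb" by (rule basis_finite[OF rb(1)])
  have rb_eq: "rb = R.Bw 0 \<union> rvec ` roots H"
  proof
    show "rb \<subseteq> R.Bw 0 \<union> rvec ` roots H"
    proof
      fix b assume b: "b \<in> rb"
      show "b \<in> R.Bw 0 \<union> rvec ` roots H"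
      proof (cases "rw b = 0")
        case True
        then show ?thesis using b unfolding R.Bw_def by blast
      next
        case False
        then have r: "rw b \<in> roots H" using rw_cases[OF b] by blast
        have "b \<in> R.Bw (rw b)" using b unfolding R.Bw_def by blast
        then have "b = rvec (rw b)" using rvec(1)[OF r] by blast
        then show ?thesis using r by blast
      qed
    qed
    show "R.Bw 0 \<union> rvec ` roots H \<subseteq> rb" using rvec(2) unfolding R.Bw_def by blast
  qed
  have disj: "R.Bw 0 \<inter> rvec ` roots H = {}"
    using rvec(3) zero_notin_R unfolding R.Bw_def by force
  have inj: "inj_on rvec (roots H)" using rvec(3) by (metis inj_onI)
  have "(\<Sum>b\<in>rb. root_trace b \<mu>) = (\<Sum>b\<in>R.Bw 0. root_trace b \<mu>) + (\<Sum>\<alpha>\<in>roots H. rt \<alpha> \<mu>)"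
    unfolding rt_def
    using sum.union_disjoint[of "R.Bw 0" "rvec ` roots H" "\<lambda>b. root_trace b \<mu>"] disj R.finite_Bw finite_roots
    by (simp add: rb_eq[symmetric] sum.reindex[OF inj])
  also have "(\<Sum>\<alpha>\<in>roots H. rt \<alpha> \<mu>) = (\<Sum>\<alpha>\<in>P. rt \<alpha> \<mu> + rt \<alpha> (\<mu> + \<alpha>))"
  proof -
    have R: "roots H = P \<union> uminus ` P"
    proof
      show "roots H \<subseteq> P \<union> uminus ` P"
        using P_neg by (metis (no_types, lifting) UnI1 UnI2 image_eqI minus_minus subsetI)
      show "P \<union> uminus ` P \<subseteq> roots H" using P_subset uminus_R by auto
    qed
    have "P \<inter> uminus ` P = {}" using P_neg P_subset by fastforce
    then have "(\<Sum>\<alpha>\<in>roots H. rt \<alpha> \<mu>) = (\<Sum>\<alpha>\<in>P. rt \<alpha> \<mu>) + (\<Sum>\<alpha>\<in>uminus ` P. rt \<alpha> \<mu>)"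
      unfolding R using finite_P by (intro sum.union_disjoint) auto
    also have "(\<Sum>\<alpha>\<in>uminus ` P. rt \<alpha> \<mu>) = (\<Sum>\<alpha>\<in>P. rt (- \<alpha>) \<mu>)"
      by (subst sum.reindex) (auto simp: inj_on_def)
    also have "\<dots> = (\<Sum>\<alpha>\<in>P. rt \<alpha> (\<mu> + \<alpha>))"
      by (rule sum.cong[OF refl]) (use P_subset in \<open>auto intro!: rt_opposite\<close>)
    finally show ?thesis by (simp add: sum.distrib)
  qed
  finally show ?thesis unfolding casimir_trace root_trace_zero by simp
qed

text \<open>Real parts of the complex traces satisfy the assumptions of \<open>weyl_module\<close>
  because weights and roots pair to real numbers.\<close>

theorem dimension_formula:
  assumes dom: "\<And>a. a \<in> P \<Longrightarrow> form a \<Lambda> \<ge> 0"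
  shows "real (V.dim (UNIV :: 'v set)) = (\<Prod>a\<in>P. 1 + form a \<Lambda> / form a rho)"
proof -
  interpret W: weyl_module "roots H" P form rho "\<lambda>\<mu>. real (m \<mu>)" "\<lambda>a \<mu>. Re (rt a \<mu>)" "Re cas" \<Lambda>
  proof
    have sub: "{x. real (m x) \<noteq> 0} \<subseteq> vw ` vb"
      using M.finite_Bw by (auto simp: m_def M.Bw_def)
    show "finite {x. real (m x) \<noteq> 0}"
      by (rule finite_subset[OF sub]) (use basis_finite M.finite_B in simp)
    show "Re (rt a x) - Re (rt a (x + a)) = form a x * real (m x)" if a: "a \<in> P" for a x
    proof -
      have r: "a \<in> roots H" using a P_subset by blast
      have e: "x (dual_vector a) * of_nat (m x) = of_real (form a x * real (m x))"
      proof (cases "M.Bw x = {}")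
        case False
        then have rx: "real_weight x" by (rule weights_real)
        then have "x (dual_vector a) = ip a x"
          using roots_dual[OF r] ip_sym[of a x] by (simp add: ip_eq real_weight_def)
        then show ?thesis using ip_real[OF real_weight_root[OF r] rx] by simp
      qed (simp add: m_def)
      from arg_cong[OF trans[OF rt_step[OF r, of x] e], of Re] show ?thesis by simp
    qed
    show "Re cas * real (m x) = form x x * real (m x) + (\<Sum>a\<in>P. Re (rt a x) + Re (rt a (x + a)))" for x
    proof -
      have e: "ip x x * of_nat (m x) = of_real (form x x * real (m x))"
      proof (cases "M.Bw x = {}")
        case False
        then show ?thesis using ip_real[OF weights_real weights_real] by simp
      qed (simp add: m_def)
      have "cas * of_nat (m x) = of_real (form x x * real (m x)) + (\<Sum>a\<in>P. rt a x + rt a (x + a))"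
        using casimir_roots[of x] unfolding e .
      from arg_cong[OF this, of Re] show ?thesis by simp
    qed
    show "real (m \<Lambda>) = 1" using highest_multiplicity by (simp add: m_def)
    show "\<Lambda> - x \<in> cone" if "real (m x) \<noteq> 0" for x
      by (rule weights_cone) (use that in \<open>auto simp: m_def\<close>)
    show "form a \<Lambda> \<ge> 0" if "a \<in> P" for a by (rule dom[OF that])
  qed
  have fin: "finite vb" by (rule V.basis_finite[OF vb(1)])
  have "V.dim (UNIV :: 'v set) = card vb" using V.basis_card[OF vb(1)] by simp
  also have "\<dots> = (\<Sum>\<mu>\<in>vw ` vb. card {b \<in> vb. vw b = \<mu>})"
    using sum.group[of vb "vw ` vb" vw "\<lambda>_. 1 :: nat"] fin by simp
  also have "\<dots> = (\<Sum>\<mu>\<in>vw ` vb. m \<mu>)" by (simp add: m_def M.Bw_def)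
  finally have "real (V.dim (UNIV :: 'v set)) = (\<Sum>\<mu>\<in>vw ` vb. real (m \<mu>))" by simp
  also have "\<dots> = (\<Sum>\<mu> | real (m \<mu>) \<noteq> 0. real (m \<mu>))"
    by (rule sum.mono_neutral_right) (use fin M.finite_Bw in \<open>auto simp: m_def M.Bw_def\<close>)
  also have "\<dots> = (\<Prod>a\<in>P. 1 + form a \<Lambda> / form a rho)" by (rule W.weyl_dimension_formula)
  finally show ?thesis .
qed

end

section \<open>The classical root systems\<close>

context root_datum
begin

lemma form_of_nat_right: "x \<cdot> (of_nat n * y) = real n * (x \<cdot> y)"
  using form_of_nat_left form_sym by metis

text \<open>Properties that can be checked from simple roots and their reflections alone and that
  characterize \<open>P\<close> (\<open>P_eqI\<close>). Every concrete list of positive roots is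
  verified this way.\<close>

definition reflection_closed :: "'w set \<Rightarrow> bool" where
  "reflection_closed A \<longleftrightarrow> finite A \<and> simple \<subseteq> A \<and> A \<subseteq> cone - {0} \<and>
    (\<forall>b\<in>A. \<forall>a\<in>simple. b \<noteq> a \<longrightarrow> refl a b \<in> A)"

lemma integral_cone:
  assumes "a \<in> simple" "x \<in> cone"
  shows "integral a x"
proof -
  have "integral a (sum_list xs)" if "set xs \<subseteq> P" for xs
    using that
  proof (induction xs)
    case Nil
    show ?case by (simp add: integral_def)
  next
    case (Cons y ys)
    then show ?case
      using integral_RI[of a y] simple_facts[OF assms(1)] P_subset by (auto intro!: integral_add)
  qed
  then show ?thesis using assms(2) unfolding cone_def by blast
qed

text \<open>Otherwise \<open>x\<close> would pair nonpositively with all positive roots, hence with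
  \<open>\<rho>\<close>.\<close>

lemma exists_positive_simple:
  assumes "x \<in> cone" "x \<noteq> 0"
  shows "\<exists>a\<in>simple. x \<cdot> a > 0"
proof (rule ccontr)
  assume "\<not> ?thesis"
  then have "a \<cdot> (- x) \<ge> 0" if "a \<in> simple" for a
    using that by (simp add: form_minus_right form_sym[of a x] not_less)
  then have "b \<cdot> (- x) \<ge> 0" if "b \<in> P" for b using P_nonneg that by blast
  then have "(\<Sum>b\<in>P. b \<cdot> (- x)) \<ge> 0" by (rule sum_nonneg)
  then have "(\<rho> + \<rho>) \<cdot> (- x) \<ge> 0" unfolding rho_double form_sum_left .
  moreover have "x \<cdot> \<rho> > 0" using cone_positive[OF P_rho_pos assms] by blast
  ultimately show False using form_add_left[of \<rho> \<rho> "- x"] by (simp add: form_minus_right form_sym[of \<rho> x])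
qed

text \<open>Reflecting in a simple root with positive product lowers \<open>b \<cdot> \<rho>\<close>
  and stays in \<open>A\<close>, so the descent ends at a simple root, which lies in
  \<open>B\<close>. The reflections undone inside \<open>B\<close> lead back to
  \<open>b\<close>.\<close>

lemma reflection_closed_subset:
  assumes A: "reflection_closed A" and B: "reflection_closed B" and b: "b \<in> A"
  shows "b \<in> B"
  using b
proof (induction "card {x\<in>A. x \<cdot> \<rho> < b \<cdot> \<rho>}" arbitrary: b rule: less_induct)
  case less
  have f: "b \<in> cone" "b \<noteq> 0" and finA: "finite A" using A less.prems unfolding reflection_closed_def by auto
  obtain a where a: "a \<in> simple" "b \<cdot> a > 0" using exists_positive_simple[OF f] by blast
  note sf = simple_facts[OF a(1)]
  show ?case
  proof (cases "b = a")
    case True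
    then show ?thesis using B a(1) unfolding reflection_closed_def by blast
  next
    case False
    let ?b = "refl a b"
    have i: "integral a b" by (rule integral_cone[OF a(1) f(1)])
    have bA: "?b \<in> A" using A less.prems a(1) False unfolding reflection_closed_def by blast
    have "?b \<cdot> \<rho> = b \<cdot> \<rho> - 2 * (b \<cdot> a) / (a \<cdot> a) * (a \<cdot> \<rho>)" by (rule refl_form[OF i])
    moreover have "2 * (b \<cdot> a) / (a \<cdot> a) * (a \<cdot> \<rho>) > 0"
      using a(2) sf(3) P_rho_pos[OF sf(1)] by simp
    ultimately have lt: "?b \<cdot> \<rho> < b \<cdot> \<rho>" by simp
    have "{x\<in>A. x \<cdot> \<rho> < ?b \<cdot> \<rho>} \<subset> {x\<in>A. x \<cdot> \<rho> < b \<cdot> \<rho>}" using lt bA by force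
    then have "card {x\<in>A. x \<cdot> \<rho> < ?b \<cdot> \<rho>} < card {x\<in>A. x \<cdot> \<rho> < b \<cdot> \<rho>}"
      using finA by (intro psubset_card_mono) auto
    then have bB: "?b \<in> B" using less.hyps bA by blast
    have "?b \<noteq> a"
    proof
      assume "?b = a"
      then have "a \<cdot> a = - (b \<cdot> a)" using refl_form_self[OF i sf(4)] by simp
      then show False using a(2) sf(3) by simp
    qed
    then have "refl a ?b \<in> B" using B bB a(1) unfolding reflection_closed_def by blast
    then show ?thesis using refl_refl[OF i sf(4)] by simp
  qed
qed

lemma reflection_closed_P: "reflection_closed P"
  unfolding reflection_closed_def
  using finite_P simple_P cone_P refl_simple_P zero_notin_R P_subset by auto

lemma P_eqI: "reflection_closed A \<Longrightarrow> P = A"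
  using reflection_closed_subset reflection_closed_P by blast

lemma reflI:
  assumes "2 * (x \<cdot> a) = of_int n * (a \<cdot> a)" "a \<cdot> a \<noteq> 0"
  shows "integral a x" "refl a x = x - of_int n * a"
proof -
  have e: "2 * (x \<cdot> a) / (a \<cdot> a) = of_int n" using assms by simp
  then show "integral a x" unfolding integral_def by (metis Ints_of_int)
  show "refl a x = x - of_int n * a" by (rule refl_eqI[OF e])
qed

end

section \<open>The root system of type A\<close>

locale type_A_roots = root_datum R P form \<rho>
  for R P :: "'w::comm_ring_1 set" and form (infixl "\<cdot>" 70) and \<rho> +
  fixes a :: "nat \<Rightarrow> 'w" and n :: nat and c :: real
  assumes simple_eq: "simple = a ` {1..<n}" and c_pos: "c > 0"
    and form_a: "i \<in> {1..<n} \<Longrightarrow> j \<in> {1..<n} \<Longrightarrow>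
      a i \<cdot> a j = c * (if i = j then 2 else if i = Suc j \<or> j = Suc i then -1 else 0)"
begin

text \<open>Only differences of these coordinates carry meaning, so they are normalized by
  \<open>e 1 = 0\<close>; accordingly all formulas below concern \<open>e i - e j\<close>.\<close>

definition e :: "nat \<Rightarrow> 'w" where
  "e i = - (\<Sum>m\<in>{1..<i}. a m)"

lemma a_e: "i \<ge> 1 \<Longrightarrow> a i = e i - e (Suc i)"
  by (simp add: e_def sum.atLeastLessThan_Suc)

abbreviation \<delta> :: "nat \<Rightarrow> nat \<Rightarrow> real" where
  "\<delta> i j \<equiv> (if i = j then 1 else 0)"

lemma form_e_a:
  assumes m: "m \<in> {1..<n}" and ij: "1 \<le> i" "i \<le> j" "j \<le> n"
  shows "(e i - e j) \<cdot> a m = c * (\<delta> i m - \<delta> i (Suc m) - \<delta> j m + \<delta> j (Suc m))"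
  using ij(2,3)
proof (induction j rule: dec_induct)
  case (step j)
  have eq: "e i - e (Suc j) = (e i - e j) + a j" using a_e[of j] ij step by simp
  have IH: "(e i - e j) \<cdot> a m = c * (\<delta> i m - \<delta> i (Suc m) - \<delta> j m + \<delta> j (Suc m))"
    using step by simp
  show ?case unfolding eq form_add_left IH using form_a[of j m] m ij(1) step by auto
qed simp

lemma form_e_a':
  assumes m: "m \<in> {1..<n}" and ij: "i \<in> {1..n}" "j \<in> {1..n}"
  shows "(e i - e j) \<cdot> a m = c * (\<delta> i m - \<delta> i (Suc m) - \<delta> j m + \<delta> j (Suc m))"
proof (cases "i \<le> j")
  case True
  then show ?thesis using form_e_a[OF m _ True] ij by simp
next
  case False
  then have "(e j - e i) \<cdot> a m = c * (\<delta> j m - \<delta> j (Suc m) - \<delta> i m + \<delta> i (Suc m))"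
    using form_e_a[OF m, of j i] ij by simp
  moreover have "(e i - e j) \<cdot> a m = - ((e j - e i) \<cdot> a m)" by (simp add: form_diff_left)
  ultimately show ?thesis by (simp add: algebra_simps)
qed

lemma form_e_e:
  assumes "i \<in> {1..n}" "j \<in> {1..n}" "1 \<le> p" "p \<le> q" "q \<le> n"
  shows "(e i - e j) \<cdot> (e p - e q) = c * (\<delta> i p - \<delta> i q - \<delta> j p + \<delta> j q)"
  using assms(4,5)
proof (induction q rule: dec_induct)
  case (step q)
  have eq: "e p - e (Suc q) = (e p - e q) + a q" using a_e[of q] assms step by simp
  have 1: "(e i - e j) \<cdot> a q = c * (\<delta> i q - \<delta> i (Suc q) - \<delta> j q + \<delta> j (Suc q))"
    by (rule form_e_a') (use assms step in auto)
  have 2: "(e i - e j) \<cdot> (e p - e q) = c * (\<delta> i p - \<delta> i q - \<delta> j p + \<delta> j q)"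
    using step by simp
  show ?case unfolding eq form_add_right 1 2 distrib_left[symmetric] by simp
qed simp

lemma form_e:
  assumes "i \<in> {1..n}" "j \<in> {1..n}" "p \<in> {1..n}" "q \<in> {1..n}"
  shows "(e i - e j) \<cdot> (e p - e q) = c * (\<delta> i p - \<delta> i q - \<delta> j p + \<delta> j q)"
proof (cases "p \<le> q")
  case True
  then show ?thesis using form_e_e[OF assms(1,2) _ True] assms by simp
next
  case False
  then have "(e i - e j) \<cdot> (e q - e p) = c * (\<delta> i q - \<delta> i p - \<delta> j q + \<delta> j p)"
    using form_e_e[OF assms(1,2), of q p] assms by simp
  moreover have "(e i - e j) \<cdot> (e p - e q) = - ((e i - e j) \<cdot> (e q - e p))" by (simp add: form_diff_right)
  ultimately show ?thesis by (simp add: algebra_simps)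
qed

definition pairs :: "(nat \<times> nat) set" where
  "pairs = {(i, j). 1 \<le> i \<and> i < j \<and> j \<le> n}"

lemma finite_pairs: "finite pairs"
  by (rule finite_subset[of _ "{1..n} \<times> {1..n}"]) (auto simp: pairs_def)

lemma e_cone:
  assumes "1 \<le> i" "i \<le> j" "j \<le> n"
  shows "e i - e j \<in> cone"
  using assms(2,3)
proof (induction j rule: dec_induct)
  case base
  show ?case using cone_zero by simp
next
  case (step j)
  have "a j \<in> cone" using simple_eq step assms(1) by (intro cone_P simple_P) auto
  moreover have "e i - e j \<in> cone" using step by simp
  ultimately have "(e i - e j) + a j \<in> cone" by (rule cone_add[rotated])
  moreover have "(e i - e j) + a j = e i - e (Suc j)" using a_e[of j] assms(1) step by simp
  ultimately show ?case by simp
qed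

lemma reflection_closed_e: "reflection_closed ((\<lambda>(i, j). e i - e j) ` pairs)"
  unfolding reflection_closed_def
proof (intro conjI ballI impI)
  let ?A = "(\<lambda>(i, j). e i - e j) ` pairs"
  show "finite ?A" using finite_pairs by simp
  show "simple \<subseteq> ?A"
  proof
    fix x assume "x \<in> simple"
    then obtain i where i: "i \<in> {1..<n}" "x = a i" using simple_eq by blast
    then have "x = e i - e (Suc i)" using a_e by simp
    then show "x \<in> ?A" using i by (intro image_eqI[of _ _ "(i, Suc i)"]) (auto simp: pairs_def)
  qed
  have nz: "e i - e j \<noteq> 0" if "(i, j) \<in> pairs" for i j
  proof
    assume "e i - e j = 0"
    then show False using form_e[of i j i j] that c_pos by (auto simp: pairs_def)
  qed
  show "?A \<subseteq> cone - {0}" using nz e_cone by (auto simp: pairs_def)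
  fix b x assume "b \<in> ?A" "x \<in> simple" "b \<noteq> x"
  obtain i j where ij: "(i, j) \<in> pairs" "b = e i - e j" using \<open>b \<in> ?A\<close> by auto
  obtain m where m: "m \<in> {1..<n}" "x = a m" using \<open>x \<in> simple\<close> simple_eq by auto
  have I: "i \<in> {1..n}" "j \<in> {1..n}" "i < j" using ij by (auto simp: pairs_def)
  have ne: "\<not> (i = m \<and> j = Suc m)" using \<open>b \<noteq> x\<close> ij m a_e[of m] by auto
  \<comment> \<open>The reflection in \<open>a m\<close> acts on indices as the transposition of
    \<open>m\<close> and \<open>Suc m\<close>.\<close>
  define s where "s i = (if i = m then Suc m else if i = Suc m then m else i)" for i
  have s: "e (s i) = e i - of_int (if i = m then 1 else if i = Suc m then -1 else 0) * a m" for i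
    using a_e[of m] m by (auto simp: s_def)
  define k :: int where "k = (if i = m then 1 else if i = Suc m then -1 else 0)
      - (if j = m then 1 else if j = Suc m then -1 else 0)"
  have "2 * (b \<cdot> x) = of_int k * (x \<cdot> x)"
    unfolding ij m form_e_a'[OF m(1) I(1,2)] form_a[OF m(1) m(1)] k_def by auto
  moreover have "x \<cdot> x \<noteq> 0" using form_a[OF m(1) m(1)] m c_pos by simp
  ultimately have "refl x b = b - of_int k * x" by (rule reflI)
  also have "\<dots> = e (s i) - e (s j)" unfolding s ij m k_def by (simp add: algebra_simps)
  finally show "refl x b \<in> ?A"
    using I m ne by (intro image_eqI[of _ _ "(s i, s j)"]) (auto simp: s_def pairs_def)
qed

lemma P_eq: "P = (\<lambda>(i, j). e i - e j) ` pairs"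
  by (rule P_eqI[OF reflection_closed_e])

lemma inj_pairs: "inj_on (\<lambda>(i, j). e i - e j) pairs"
proof (rule inj_onI, clarify)
  fix i j p q assume ij: "(i, j) \<in> pairs" and pq: "(p, q) \<in> pairs" and eq: "e i - e j = e p - e q"
  then have "(e i - e j) \<cdot> (e i - e j) = (e i - e j) \<cdot> (e p - e q)" by simp
  then have "(2::real) = \<delta> i p - \<delta> i q - \<delta> j p + \<delta> j q"
    using form_e[of i j p q] form_e[of i j i j] ij pq c_pos by (auto simp: pairs_def)
  then show "i = p \<and> j = q" by (auto split: if_splits)
qed

lemma prod_P: "(\<Prod>x\<in>P. f x) = (\<Prod>(i, j)\<in>pairs. f (e i - e j))"
  unfolding P_eq prod.reindex[OF inj_pairs] by (simp add: case_prod_beta comp_def)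

lemma form_rho:
  assumes "1 \<le> i" "i \<le> j" "j \<le> n"
  shows "(e i - e j) \<cdot> \<rho> = c * (real j - real i)"
  using assms(2,3)
proof (induction j rule: dec_induct)
  case (step j)
  have eq: "e i - e (Suc j) = (e i - e j) + a j" using a_e[of j] assms(1) step by simp
  have "2 * (\<rho> \<cdot> a j) = a j \<cdot> a j" using simple_eq step assms(1) by (intro rho_simple) auto
  then have 1: "a j \<cdot> \<rho> = c" using form_a[of j j] step assms(1) by (simp add: form_sym[of "a j" \<rho>])
  have 2: "(e i - e j) \<cdot> \<rho> = c * (real j - real i)" using step by simp
  show ?case unfolding eq form_add_left 1 2 by (simp add: algebra_simps)
qed simp

end

text \<open>The classical root systems other than type A, in orthogonal coordinates; the last simple root is
  \<open>e r\<close>, \<open>2 e r\<close> or \<open>e (r - 1) + e r\<close> for \<open>t = 1, 2, 0\<close>.\<close>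

locale type_BCD_roots = root_datum R P form \<rho>
  for R P :: "'w::comm_ring_1 set" and form (infixl "\<cdot>" 70) and \<rho> +
  fixes e :: "nat \<Rightarrow> 'w" and r t :: nat and c :: real
  assumes t_cases: "t \<in> {0, 1, 2}" and r_pos: "r \<ge> 1" "t = 0 \<Longrightarrow> r \<ge> 2"
    and simple_eq: "simple = (\<lambda>i. e i - e (Suc i)) ` {1..<r} \<union>
      {if t = 0 then e (r - 1) + e r else of_nat t * e r}"
    and c_pos: "c > 0"
    and form_e: "i \<in> {1..r} \<Longrightarrow> j \<in> {1..r} \<Longrightarrow> e i \<cdot> e j = (if i = j then c else 0)"
begin

definition pairs :: "(nat \<times> nat) set" where
  "pairs = {(i, j). 1 \<le> i \<and> i < j \<and> j \<le> r}"

definition singles :: "nat set" where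
  "singles = (if t = 0 then {} else {1..r})"

definition roots_set :: "'w set" where
  "roots_set = (\<lambda>(i, j). e i - e j) ` pairs \<union> (\<lambda>(i, j). e i + e j) ` pairs \<union>
    (\<lambda>i. of_nat t * e i) ` singles"

lemma finite_pairs: "finite pairs"
  by (rule finite_subset[of _ "{1..r} \<times> {1..r}"]) (auto simp: pairs_def)

lemma plus_in: "i \<in> {1..r} \<Longrightarrow> j \<in> {1..r} \<Longrightarrow> i \<noteq> j \<Longrightarrow> e i + e j \<in> roots_set"
  unfolding roots_set_def
  by (cases "i < j") (force simp: pairs_def add.commute intro: image_eqI[of _ _ "(i, j)"] image_eqI[of _ _ "(j, i)"])+

lemma minus_in: "1 \<le> i \<Longrightarrow> i < j \<Longrightarrow> j \<le> r \<Longrightarrow> e i - e j \<in> roots_set"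
  unfolding roots_set_def by (force simp: pairs_def intro: image_eqI[of _ _ "(i, j)"])

lemma single_in: "t \<noteq> 0 \<Longrightarrow> i \<in> {1..r} \<Longrightarrow> of_nat t * e i \<in> roots_set"
  unfolding roots_set_def singles_def by auto

lemma roots_set_cases:
  assumes "x \<in> roots_set"
  obtains i j where "1 \<le> i" "i < j" "j \<le> r" "x = e i - e j"
  | i j where "1 \<le> i" "i < j" "j \<le> r" "x = e i + e j"
  | i where "t \<noteq> 0" "i \<in> {1..r}" "x = of_nat t * e i"
  using assms unfolding roots_set_def pairs_def singles_def by (auto split: if_splits)

lemma simple_step: "i \<in> {1..<r} \<Longrightarrow> e i - e (Suc i) \<in> simple"
  using simple_eq by blast

lemma simple_last: "(if t = 0 then e (r - 1) + e r else of_nat t * e r) \<in> simple"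
  using simple_eq by blast

lemma e_cone:
  assumes "1 \<le> i" "i \<le> j" "j \<le> r"
  shows "e i - e j \<in> cone"
  using assms(2,3)
proof (induction j rule: dec_induct)
  case base
  show ?case using cone_zero by simp
next
  case (step j)
  have "e j - e (Suc j) \<in> cone" using step assms(1) by (intro cone_P simple_P simple_step) auto
  then have "(e i - e j) + (e j - e (Suc j)) \<in> cone" using step by (intro cone_add) auto
  then show ?case by simp
qed

lemma last_cone: "(if t = 0 then e (r - 1) + e r else of_nat t * e r) \<in> cone"
  by (rule cone_P[OF simple_P[OF simple_last]])

lemma roots_set_cone:
  assumes "x \<in> roots_set"
  shows "x \<in> cone"
  using assms
proof (cases rule: roots_set_cases)
  case (1 i j)
  then show ?thesis using e_cone by simp
next
  case (2 i j)
  consider "t = 0" | "t = 1" | "t = 2" using t_cases by blast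
  then show ?thesis
  proof cases
    case 1
    have "e (r - 1) + e r \<in> cone" using last_cone 1 by simp
    moreover have "e i - e (r - 1) \<in> cone" "e j - e r \<in> cone" using e_cone 2 by auto
    ultimately have "(e i - e (r - 1)) + (e j - e r) + (e (r - 1) + e r) \<in> cone"
      using cone_add by blast
    then show ?thesis using 2 by (simp add: algebra_simps)
  next
    case t: 2
    have "e r \<in> cone" using last_cone t by simp
    moreover have "e i - e r \<in> cone" "e j - e r \<in> cone" using e_cone 2 by auto
    ultimately have "((e i - e r) + e r) + ((e j - e r) + e r) \<in> cone" by (intro cone_add)
    then show ?thesis using 2 by simp
  next
    case t: 3
    have "2 * e r \<in> cone" using last_cone t by simp
    moreover have "e i - e r \<in> cone" "e j - e r \<in> cone" using e_cone 2 by auto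
    ultimately have "(e i - e r) + (e j - e r) + 2 * e r \<in> cone" by (intro cone_add)
    then show ?thesis using 2 by (simp add: algebra_simps)
  qed
next
  case (3 i)
  have "of_nat t * e r \<in> cone" using last_cone 3 by simp
  moreover have "of_nat t * (e i - e r) \<in> cone"
  proof -
    have "e i - e r \<in> cone" using 3 e_cone by simp
    then have "of_nat k * (e i - e r) \<in> cone" for k
      by (induction k) (auto simp: distrib_right cone_zero cone_add)
    then show ?thesis .
  qed
  ultimately have "of_nat t * (e i - e r) + of_nat t * e r \<in> cone" using cone_add by blast
  then show ?thesis using 3 by (simp add: algebra_simps)
qed

lemma form_minus_self: "(i, j) \<in> pairs \<Longrightarrow> (e i - e j) \<cdot> (e i - e j) = 2 * c"
  by (auto simp: pairs_def form_simps form_e)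

lemma form_plus_self: "(i, j) \<in> pairs \<Longrightarrow> (e i + e j) \<cdot> (e i + e j) = 2 * c"
  by (auto simp: pairs_def form_simps form_e)

lemma roots_set_nonzero: "0 \<notin> roots_set"
proof
  assume "0 \<in> roots_set"
  then show False
  proof (cases rule: roots_set_cases)
    case (1 i j)
    then have "(i, j) \<in> pairs" by (simp add: pairs_def)
    from form_minus_self[OF this] show False using 1(4)[symmetric] c_pos by simp
  next
    case (2 i j)
    then have "(i, j) \<in> pairs" by (simp add: pairs_def)
    from form_plus_self[OF this] show False using 2(4)[symmetric] c_pos by simp
  next
    case (3 i)
    have "0 = (of_nat t * e i) \<cdot> e i" unfolding 3(3)[symmetric] by (rule form_zero_left[symmetric])
    also have "\<dots> = real t * c" using 3(2) by (simp add: form_of_nat_left form_e)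
    finally show False using 3(1) c_pos by simp
  qed
qed

lemma refl_step:
  assumes m: "m \<in> {1..<r}" and i: "i \<in> {1..r}"
  shows "integral (e m - e (Suc m)) (e i)"
    "refl (e m - e (Suc m)) (e i) = e (if i = m then Suc m else if i = Suc m then m else i)"
proof -
  let ?a = "e m - e (Suc m)"
  let ?k = "if i = m then 1 else if i = Suc m then -1 else 0 :: int"
  have aa: "?a \<cdot> ?a = 2 * c" using m by (intro form_minus_self) (simp add: pairs_def)
  have "e i \<cdot> ?a = (if i = m then c else if i = Suc m then - c else 0)"
    using m i by (simp add: form_diff_right form_e)
  then have 1: "2 * (e i \<cdot> ?a) = of_int ?k * (?a \<cdot> ?a)" unfolding aa by simp
  have 2: "?a \<cdot> ?a \<noteq> 0" using aa c_pos by simp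
  show "integral ?a (e i)" by (rule reflI(1)[OF 1 2])
  show "refl ?a (e i) = e (if i = m then Suc m else if i = Suc m then m else i)"
    unfolding reflI(2)[OF 1 2] by simp
qed

lemma refl_last_single:
  assumes t: "t \<noteq> 0" and i: "i \<in> {1..r}"
  shows "integral (of_nat t * e r) (e i)" "refl (of_nat t * e r) (e i) = (if i = r then - e r else e i)"
proof -
  let ?a = "of_nat t * e r"
  let ?k = "if i = r then if t = 1 then 2 else 1 else 0 :: int"
  have fa: "e i \<cdot> ?a = real t * (e i \<cdot> e r)" "?a \<cdot> ?a = real t * (real t * (e r \<cdot> e r))"
    by (simp_all add: form_of_nat_left form_of_nat_right)
  have t2: "t = 1 \<or> t = 2" using t t_cases by auto
  have 1: "2 * (e i \<cdot> ?a) = of_int ?k * (?a \<cdot> ?a)"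
    unfolding fa using t2 i by (auto simp: form_e)
  have 2: "?a \<cdot> ?a \<noteq> 0" unfolding fa using t2 r_pos c_pos by (auto simp: form_e)
  show "integral ?a (e i)" by (rule reflI(1)[OF 1 2])
  show "refl ?a (e i) = (if i = r then - e r else e i)"
    unfolding reflI(2)[OF 1 2] using t2 by auto
qed

lemma refl_last_pair:
  assumes t: "t = 0" and i: "i \<in> {1..r}"
  shows "integral (e (r - 1) + e r) (e i)"
    "refl (e (r - 1) + e r) (e i) = (if i = r then - e (r - 1) else if i = r - 1 then - e r else e i)"
proof -
  let ?a = "e (r - 1) + e r"
  let ?k = "if i = r \<or> i = r - 1 then 1 else 0 :: int"
  have r: "r - 1 \<in> {1..r}" "r \<in> {1..r}" "r - 1 \<noteq> r" using r_pos t by auto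
  have aa: "?a \<cdot> ?a = 2 * c" using r by (intro form_plus_self) (auto simp: pairs_def)
  have "e i \<cdot> ?a = (if i = r \<or> i = r - 1 then c else 0)"
    using r i by (simp add: form_add_right form_e)
  then have 1: "2 * (e i \<cdot> ?a) = of_int ?k * (?a \<cdot> ?a)" unfolding aa by simp
  have 2: "?a \<cdot> ?a \<noteq> 0" using aa c_pos by simp
  show "integral ?a (e i)" by (rule reflI(1)[OF 1 2])
  show "refl ?a (e i) = (if i = r then - e (r - 1) else if i = r - 1 then - e r else e i)"
    unfolding reflI(2)[OF 1 2] by simp
qed

lemma integral_of_nat: "integral a x \<Longrightarrow> integral a (of_nat k * x)"
  by (induction k) (auto simp: distrib_right integral_add integral_def[of a 0])

lemma refl_of_nat: "integral a x \<Longrightarrow> refl a (of_nat k * x) = of_nat k * refl a x"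
  by (induction k) (auto simp: distrib_right integral_of_nat refl_add)

text \<open>Simple reflections permute the \<open>e i\<close> up to sign. The exclusion of
  \<open>b = x\<close> removes exactly the case in which the signs or the order turn a listed root
  into its negative.\<close>

lemma reflection_closed_roots_set: "reflection_closed roots_set"
  unfolding reflection_closed_def
proof (intro conjI ballI impI)
  show "finite roots_set" unfolding roots_set_def using finite_pairs by (simp add: singles_def)
  show "simple \<subseteq> roots_set"
    unfolding simple_eq
    using minus_in plus_in[of "r - 1" r] single_in[of r] r_pos by auto
  show "roots_set \<subseteq> cone - {0}" using roots_set_cone roots_set_nonzero by blast
  fix b x assume b: "b \<in> roots_set" and x: "x \<in> simple" and ne: "b \<noteq> x"
  consider (step) m where "m \<in> {1..<r}" "x = e m - e (Suc m)" | (pair) "t = 0" "x = e (r - 1) + e r"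
    | (single) "t \<noteq> 0" "x = of_nat t * e r"
    using x unfolding simple_eq by (auto split: if_splits)
  then show "refl x b \<in> roots_set"
  proof cases
    case step
    define s where "s i = (if i = m then Suc m else if i = Suc m then m else i)" for i
    have s: "s i \<in> {1..r}" if "i \<in> {1..r}" for i using that step(1) by (auto simp: s_def)
    have inj: "s i \<noteq> s j" if "i \<noteq> j" for i j using that by (auto simp: s_def)
    have R: "integral x (e i)" "refl x (e i) = e (s i)" if "i \<in> {1..r}" for i
      using refl_step[OF step(1) that] unfolding step(2) s_def by auto
    from b show ?thesis
    proof (cases rule: roots_set_cases)
      case (1 i j)
      have "s i < s j" using 1 ne step by (auto simp: s_def)
      then show ?thesis using 1 R s by (auto simp: refl_diff intro!: minus_in)
    next
      case (2 i j)
      then show ?thesis using R s inj by (auto simp: refl_add intro!: plus_in)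
    next
      case (3 i)
      then show ?thesis using R s by (auto simp: refl_of_nat intro!: single_in)
    qed
  next
    case single
    have R: "integral x (e i)" "refl x (e i) = (if i = r then - e r else e i)" if "i \<in> {1..r}" for i
      using refl_last_single[OF single(1) that] unfolding single(2) by auto
    from b show ?thesis
    proof (cases rule: roots_set_cases)
      case (1 i j)
      then have "refl x b = (if j = r then e i + e r else e i - e j)" using R by (auto simp: refl_diff)
      then show ?thesis using 1 minus_in plus_in by auto
    next
      case (2 i j)
      then have "refl x b = (if j = r then e i - e r else e i + e j)" using R by (auto simp: refl_add)
      then show ?thesis using 2 minus_in plus_in by auto
    next
      case (3 i)
      then have "i \<noteq> r" using ne single by auto
      then have "refl x b = of_nat t * e i" using 3 R by (auto simp: refl_of_nat)
      then show ?thesis using 3 single_in by auto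
    qed
  next
    case pair
    have R: "integral x (e i)"
      "refl x (e i) = (if i = r then - e (r - 1) else if i = r - 1 then - e r else e i)" if "i \<in> {1..r}" for i
      using refl_last_pair[OF pair(1) that] unfolding pair(2) by auto
    have r2: "r \<ge> 2" using r_pos pair by simp
    from b show ?thesis
    proof (cases rule: roots_set_cases)
      case (1 i j)
      then have "refl x b = (if j = r then if i = r - 1 then e (r - 1) - e r else e i + e (r - 1)
          else if j = r - 1 then e i + e r else e i - e j)"
        using R by (auto simp: refl_diff)
      then show ?thesis using 1 r2 minus_in plus_in by auto
    next
      case (2 i j)
      then have "\<not> (j = r \<and> i = r - 1)" using ne pair by auto
      then have "refl x b = (if j = r then e i - e (r - 1) else if j = r - 1 then e i - e r else e i + e j)"
        using 2 R by (auto simp: refl_add)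
      then show ?thesis using 2 r2 minus_in plus_in \<open>\<not> (j = r \<and> i = r - 1)\<close> by auto
    next
      case (3 i)
      then show ?thesis using pair by simp
    qed
  qed
qed

lemma P_eq: "P = roots_set"
  by (rule P_eqI[OF reflection_closed_roots_set])

lemma prod_P: "(\<Prod>x\<in>P. f x) = (\<Prod>(i, j)\<in>pairs. f (e i - e j)) * (\<Prod>(i, j)\<in>pairs. f (e i + e j)) *
    (\<Prod>i\<in>singles. f (of_nat t * e i))"
proof -
  let ?M = "(\<lambda>(i, j). e i - e j) ` pairs" and ?Q = "(\<lambda>(i, j). e i + e j) ` pairs"
    and ?S = "(\<lambda>i. of_nat t * e i) ` singles"
  have injM: "inj_on (\<lambda>(i, j). e i - e j) pairs"
  proof (rule inj_onI, clarify)
    fix i j p q assume ij: "(i, j) \<in> pairs" and pq: "(p, q) \<in> pairs" and eq: "e i - e j = e p - e q"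
    have "2 * c = (e i - e j) \<cdot> (e p - e q)"
      using form_minus_self[OF ij] arg_cong[OF eq, of "(\<cdot>) (e i - e j)"] by simp
    then show "i = p \<and> j = q" using ij pq c_pos by (auto simp: pairs_def form_simps form_e split: if_splits)
  qed
  have injQ: "inj_on (\<lambda>(i, j). e i + e j) pairs"
  proof (rule inj_onI, clarify)
    fix i j p q assume ij: "(i, j) \<in> pairs" and pq: "(p, q) \<in> pairs" and eq: "e i + e j = e p + e q"
    have "2 * c = (e i + e j) \<cdot> (e p + e q)"
      using form_plus_self[OF ij] arg_cong[OF eq, of "(\<cdot>) (e i + e j)"] by simp
    then show "i = p \<and> j = q" using ij pq c_pos by (auto simp: pairs_def form_simps form_e split: if_splits)
  qed
  have injS: "inj_on (\<lambda>i. of_nat t * e i) singles"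
  proof (rule inj_onI)
    fix i p assume ip: "i \<in> singles" "p \<in> singles" and eq: "of_nat t * e i = of_nat t * e p"
    then have "(of_nat t * e i) \<cdot> e i = (of_nat t * e p) \<cdot> e i" by simp
    then show "i = p"
      using ip c_pos by (auto simp: singles_def form_of_nat_left form_e split: if_splits)
  qed
  have MQ: "?M \<inter> ?Q = {}"
  proof -
    have False if ij: "(i, j) \<in> pairs" and pq: "(p, q) \<in> pairs" and eq: "e i - e j = e p + e q" for i j p q
    proof -
      have "2 * c = (e i - e j) \<cdot> (e p + e q)"
        using form_minus_self[OF ij] arg_cong[OF eq, of "(\<cdot>) (e i - e j)"] by simp
      then show False using ij pq c_pos by (auto simp: pairs_def form_simps form_e split: if_splits)
    qed
    then show ?thesis by auto
  qed
  have S: False if p: "p \<in> singles" and ij: "(i, j) \<in> pairs" and eq: "of_nat t * e p = e i + d"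
    and d: "d = e j \<or> d = - e j" for p i j d
  proof -
    have "real t * (e p \<cdot> x) = e i \<cdot> x + d \<cdot> x" for x
      using arg_cong[OF eq, of "\<lambda>y. y \<cdot> x"] by (simp only: form_of_nat_left form_add_left)
    from this[of "e i"] this[of "e j"] show False
      using d p ij c_pos by (auto simp: singles_def pairs_def form_minus_left form_e split: if_splits)
  qed
  have QS: "(?M \<union> ?Q) \<inter> ?S = {}"
  proof -
    have "of_nat t * e p \<noteq> e i - e j" "of_nat t * e p \<noteq> e i + e j" if "p \<in> singles" "(i, j) \<in> pairs" for p i j
      using S[OF that, of "- e j"] S[OF that, of "e j"] by auto
    then show ?thesis by (auto simp: eq_commute)
  qed
  have fin: "finite ?M" "finite ?Q" "finite ?S" using finite_pairs by (simp_all add: singles_def)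
  have "(\<Prod>x\<in>P. f x) = (\<Prod>x\<in>?M. f x) * (\<Prod>x\<in>?Q. f x) * (\<Prod>x\<in>?S. f x)"
    unfolding P_eq roots_set_def
    using prod.union_disjoint[of "?M \<union> ?Q" ?S f] prod.union_disjoint[of ?M ?Q f] fin MQ QS by simp
  then show ?thesis
    unfolding prod.reindex[OF injM] prod.reindex[OF injQ] prod.reindex[OF injS]
    by (simp add: case_prod_beta comp_def)
qed

text \<open>Consecutive coordinates differ by \<open>c\<close> because each
  \<open>e i - e (Suc i)\<close> is simple; the last simple root fixes the value at
  \<open>e r\<close>.\<close>

lemma form_rho:
  assumes "i \<in> {1..r}"
  shows "e i \<cdot> \<rho> = c * (real r - real i + real t / 2)"
proof -
  have "(i \<le> r \<Longrightarrow> e i \<cdot> \<rho> = c * (real r - real i) + e r \<cdot> \<rho>)" if "1 \<le> i" for i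
    using that
  proof (induction "r - i" arbitrary: i)
    case (Suc k)
    have i: "i \<in> {1..<r}" using Suc by auto
    have "2 * (\<rho> \<cdot> (e i - e (Suc i))) = (e i - e (Suc i)) \<cdot> (e i - e (Suc i))"
      by (rule rho_simple[OF simple_step[OF i]])
    then have "e i \<cdot> \<rho> - e (Suc i) \<cdot> \<rho> = c"
      using i form_minus_self[of i "Suc i"]
      by (simp add: pairs_def form_diff_right form_sym[of \<rho> "e i"] form_sym[of \<rho> "e (Suc i)"])
    moreover have "e (Suc i) \<cdot> \<rho> = c * (real r - real (Suc i)) + e r \<cdot> \<rho>"
      using Suc.hyps(1)[of "Suc i"] Suc.hyps(2) i by simp
    ultimately show ?case by (simp add: algebra_simps)
  qed simp
  note step = this
  have last: "e r \<cdot> \<rho> = c * real t / 2"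
  proof (cases "t = 0")
    case True
    have r: "r - 1 \<in> {1..r}" "r \<in> {1..r}" "r - 1 \<noteq> r" using r_pos True by auto
    have "2 * (\<rho> \<cdot> (e (r - 1) + e r)) = (e (r - 1) + e r) \<cdot> (e (r - 1) + e r)"
      using rho_simple[OF simple_last] True by simp
    then have "e (r - 1) \<cdot> \<rho> + e r \<cdot> \<rho> = c"
      using r by (simp add: form_simps form_e form_sym[of \<rho> "e r"] form_sym[of \<rho> "e (r - Suc 0)"])
    moreover have "e (r - 1) \<cdot> \<rho> = c * (real r - real (r - 1)) + e r \<cdot> \<rho>" using step[of "r - 1"] r by simp
    ultimately show ?thesis using r True by (simp add: of_nat_diff)
  next
    case False
    have "2 * (\<rho> \<cdot> (of_nat t * e r)) = (of_nat t * e r) \<cdot> (of_nat t * e r)"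
      using rho_simple[OF simple_last] False by simp
    then have "2 * (real t * (e r \<cdot> \<rho>)) = real t * (real t * c)"
      using r_pos by (simp add: form_of_nat_left form_of_nat_right form_sym[of \<rho> "e r"] form_e)
    then show ?thesis using False by (simp add: mult.commute)
  qed
  show ?thesis using step[of i] assms last by (simp add: algebra_simps)
qed

end

section \<open>Products of binomial coefficients\<close>

text \<open>The polynomial \<open>(x + 1) ... (x + k) / k!\<close>, the generalized binomial
  coefficient of the formula with parameter \<open>x\<close>.\<close>

definition rbinom :: "nat \<Rightarrow> real \<Rightarrow> real" where
  "rbinom k x = (real k + x) gchoose k"

lemma rbinom_Suc: "rbinom (Suc k) x = (x + real k + 1) / (real k + 1) * rbinom k x"
proof -
  have "real (Suc k) * rbinom (Suc k) x = (x + real k + 1) * rbinom k x"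
    unfolding rbinom_def using gbinomial_absorption[of k "real (Suc k) + x"]
    by (simp add: algebra_simps)
  then show ?thesis by (simp add: field_simps)
qed

lemma rbinom_0 [simp]: "rbinom 0 x = 1"
  by (simp add: rbinom_def)

lemma rbinom_step: "x * rbinom k x = (x + real k) * rbinom k (x - 1)"
  using gbinomial_absorb_comp[of "real k + x" k] by (simp add: rbinom_def algebra_simps)

lemma rbinom_pos: "x > -1 \<Longrightarrow> rbinom k x > 0"
  by (induction k) (auto simp: rbinom_Suc)

lemma rbinom_nonzero: "x > -1 \<Longrightarrow> rbinom k x \<noteq> 0"
  using rbinom_pos[of x k] by simp

lemma rbinom_zero_iff: "rbinom k x = 0 \<longleftrightarrow> (\<exists>j\<in>{1..k}. x = - real j)"
proof (induction k)
  case (Suc k)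
  have "(x + real k + 1) / (real k + 1) = 0 \<longleftrightarrow> x = - real (Suc k)" by (auto simp: field_simps)
  moreover have "{1..Suc k} = insert (Suc k) {1..k}" by auto
  ultimately show ?case using Suc by (simp add: rbinom_Suc)
qed simp

lemma rbinom_ratio: "x > 0 \<Longrightarrow> 1 + real k / x = rbinom k x / rbinom k (x - 1)"
  using rbinom_step[of x k] rbinom_nonzero[of "x - 1" k] by (simp add: field_simps)

text \<open>Duplication: the \<open>2k\<close> linear factors are sorted by parity.
  \<open>rbinom k (- 1 / 2)\<close> is the constant \<open>(2k)! / (4^k (k!)^2)\<close> that
  compensates the factorials.\<close>

lemma rbinom_double: "rbinom (2 * k) x * rbinom k (- 1 / 2) = rbinom k (x / 2) * rbinom k ((x - 1) / 2)"
proof (induction k)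
  case (Suc k)
  have e1: "rbinom (2 * Suc k) x = (x + 2 * real k + 2) / (2 * real k + 2) * ((x + 2 * real k + 1) / (2 * real k + 1) * rbinom (2 * k) x)"
    by (simp add: rbinom_Suc algebra_simps)
  have e2: "rbinom (Suc k) (- 1 / 2) = (2 * real k + 1) / (2 * real k + 2) * rbinom k (- 1 / 2)"
    by (simp add: rbinom_Suc field_simps)
  have e3: "rbinom (Suc k) (x / 2) = (x + 2 * real k + 2) / (2 * real k + 2) * rbinom k (x / 2)"
    by (simp add: rbinom_Suc field_simps)
  have e4: "rbinom (Suc k) ((x - 1) / 2) = (x + 2 * real k + 1) / (2 * real k + 2) * rbinom k ((x - 1) / 2)"
    by (simp add: rbinom_Suc field_simps)
  have e: "2 * real k + 1 \<noteq> 0" by simp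
  have "rbinom (2 * Suc k) x * rbinom (Suc k) (- 1 / 2) =
      (x + 2 * real k + 2) / (2 * real k + 2) * ((x + 2 * real k + 1) / (2 * real k + 2)) *
      (rbinom (2 * k) x * rbinom k (- 1 / 2))"
    unfolding e1 e2 using e by simp
  also have "\<dots> = rbinom (Suc k) (x / 2) * rbinom (Suc k) ((x - 1) / 2)"
    unfolding Suc e3 e4 by (simp only: mult_ac)
  finally show ?case .
qed simp

lemma prod_interval_split:
  "a \<le> b \<Longrightarrow> b \<le> c \<Longrightarrow> prod f {a<..c::nat} = prod f {a<..b} * prod f {b<..c}"
  using prod.union_disjoint[of "{a<..b}" "{b<..c}" f] by (simp add: ivl_disj_un_two(6))

lemma string_up:
  assumes "p \<le> q" "real p + y > -1"
  shows "(\<Prod>j\<in>{p<..q}. 1 + real K / (real j + y)) = rbinom K (real q + y) / rbinom K (real p + y)"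
  using assms(1)
proof (induction q rule: dec_induct)
  case base
  show ?case using rbinom_nonzero[OF assms(2), of K] by simp
next
  case (step q)
  have "{p<..Suc q} = insert (Suc q) {p<..q}" using step by auto
  moreover have "1 + real K / (real (Suc q) + y) = rbinom K (real (Suc q) + y) / rbinom K (real q + y)"
    using rbinom_ratio[of "real (Suc q) + y" K] assms(2) step by simp
  moreover have "rbinom K (real q + y) \<noteq> 0" using assms(2) step by (intro rbinom_nonzero) simp
  ultimately show ?case using step by simp
qed

lemma string_down:
  assumes "p \<le> q" "y - real q > 0"
  shows "(\<Prod>j\<in>{p<..q}. 1 + real K / (y - real j)) = rbinom K (y - real p - 1) / rbinom K (y - real q - 1)"
  using assms
proof (induction q rule: dec_induct)
  case base
  then show ?case using rbinom_nonzero[of "y - real p - 1" K] by simp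
next
  case (step q)
  have "{p<..Suc q} = insert (Suc q) {p<..q}" using step by auto
  moreover have "1 + real K / (y - real (Suc q)) = rbinom K (y - real q - 1) / rbinom K (y - real (Suc q) - 1)"
    using rbinom_ratio[of "y - real (Suc q)" K] step by (simp add: algebra_simps)
  moreover have "rbinom K (y - real q - 1) \<noteq> 0" using step by (intro rbinom_nonzero) simp
  ultimately show ?case using step by simp
qed

lemma prod_reverse: "(\<Prod>i=1..l. f i) = (\<Prod>i=1..l. f (l + 1 - i :: nat))"
  by (rule prod.reindex_bij_witness[where i = "\<lambda>i. l + 1 - i" and j = "\<lambda>i. l + 1 - i"]) auto

lemma prod_reverse_real: "(\<Prod>i=1..l. f (real i)) = (\<Prod>i=1..l. f (real l + 1 - real i))"
  by (subst prod_reverse) (rule prod.cong, auto simp: of_nat_diff)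

lemma prod_even_odd: "(\<Prod>i=1..2 * l. f i) = (\<Prod>i=1..l. f (2 * i - 1) * f (2 * i :: nat))"
  by (induction l) (auto simp: mult.assoc)

lemmas rbinom_congs = prod.cong arg_cong2[where f = "(*)"] arg_cong2[where f = "(/)"] arg_cong2[where f = rbinom]

section \<open>The formula in terms of \<open>rbinom\<close> and its comparison with Weyl products
  of the classical types\<close>

lemma dim_numerator_rbinom: "dim_numerator l k b c = (\<Prod>i=1..l.
    rbinom (2 * k) (c - (real i - 3) * b / 2 - 3) * rbinom k (c - (real l + real i - 3) * b / 2 - 3) *
    rbinom k (c - (real l + real i - 4) * b / 2 - 4) * rbinom k (c / 2 - (real l - real i - 2) * b / 2 - 3))"
  unfolding dim_numerator_def rbinom_def by (simp add: add_diff_eq)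

lemma dim_denominator_rbinom: "dim_denominator l k b c = (\<Prod>i=1..l.
    rbinom (2 * k) (c - (2 * real l - real i - 3) * b / 2 - 4) * rbinom k (real i * b / 2 - 1) *
    rbinom k ((real i - 1) * b / 2) * rbinom k (c / 2 - (real i - 1) * b / 2 - 1))"
  unfolding dim_denominator_def rbinom_def by (simp add: add_diff_eq)

text \<open>The last product is read from the other end, which removes \<open>l\<close> from its
  parameters.\<close>

lemma dim_numerator_reversed: "dim_numerator l k b c = (\<Prod>i=1..l. rbinom (2 * k) (c - (real i - 3) * b / 2 - 3)) *
    (\<Prod>i=1..l. rbinom k (c - (real l + real i - 3) * b / 2 - 3)) *
    (\<Prod>i=1..l. rbinom k (c - (real l + real i - 4) * b / 2 - 4)) * (\<Prod>i=1..l. rbinom k (c / 2 - (real i - 3) * b / 2 - 3))"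
  unfolding dim_numerator_rbinom prod.distrib
  using prod_reverse_real[of "\<lambda>x. rbinom k (c / 2 - (real l - x - 2) * b / 2 - 3)" l] by simp

lemma dim_denominator_reversed: "dim_denominator l k b c = (\<Prod>i=1..l. rbinom (2 * k) (c - (real l + real i - 4) * b / 2 - 4)) *
    (\<Prod>i=1..l. rbinom k (real i * b / 2 - 1)) * (\<Prod>i=1..l. rbinom k ((real i - 1) * b / 2)) *
    (\<Prod>i=1..l. rbinom k (c / 2 - (real i - 1) * b / 2 - 1))"
  unfolding dim_denominator_rbinom prod.distrib
  using prod_reverse_real[of "\<lambda>x. rbinom (2 * k) (c - (2 * real l - x - 3) * b / 2 - 4)" l] by (simp add: algebra_simps)

text \<open>The weight is 1 on the first \<open>l\<close> coordinates, -1 on the last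
  \<open>l\<close> and 0 in between. Pairs of an outer and a middle index give strings of
  \<open>k\<close>-binomials, pairs of a first and a last index strings of
  \<open>2k\<close>-binomials. The numerator and the denominator of the formula share one further
  product, with parameters \<open>n / 2 - i\<close>, that cancels.\<close>

lemma SL_product:
  assumes "2 * l \<le> n" "1 \<le> l"
  defines "w i \<equiv> (if i \<le> l then 1 else 0) - (if n - l < i then 1 else 0 :: real)"
  assumes d: "d = (\<Prod>i=1..n. \<Prod>j\<in>{i<..n}. 1 + real k * (w i - w j) / (real j - real i))"
  shows "dim_denominator l k 2 (real n) \<noteq> 0 \<and> d = dim_numerator l k 2 (real n) / dim_denominator l k 2 (real n)"
proof -
  let ?f = "\<lambda>i j. 1 + real k * (w i - w j) / (real j - real i)"
  have first: "(\<Prod>j\<in>{i<..n}. ?f i j) = rbinom k (real n - real l - real i) / rbinom k (real l - real i) *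
      (rbinom (2 * k) (real n - real i) / rbinom (2 * k) (real n - real l - real i))" if i: "i \<in> {1..l}" for i
  proof -
    have "(\<Prod>j\<in>{i<..n}. ?f i j) = (\<Prod>j\<in>{i<..l}. ?f i j) * ((\<Prod>j\<in>{l<..n - l}. ?f i j) * (\<Prod>j\<in>{n - l<..n}. ?f i j))"
    proof -
      have le: "i \<le> l" "l \<le> n" "l \<le> n - l" "n - l \<le> n" using i assms(1) by auto
      show ?thesis by (simp only: prod_interval_split[OF le(1,2)] prod_interval_split[OF le(3,4)])
    qed
    also have "(\<Prod>j\<in>{i<..l}. ?f i j) = 1"
      by (rule prod.neutral) (use i assms(1) in \<open>auto simp: w_def\<close>)
    also have "(\<Prod>j\<in>{l<..n - l}. ?f i j) = (\<Prod>j\<in>{l<..n - l}. 1 + real k / (real j + - real i))"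
      by (rule prod.cong) (use i assms(1) in \<open>auto simp: w_def\<close>)
    also have "\<dots> = rbinom k (real (n - l) + - real i) / rbinom k (real l + - real i)"
      by (rule string_up) (use i assms(1) in auto)
    also have "(\<Prod>j\<in>{n - l<..n}. ?f i j) = (\<Prod>j\<in>{n - l<..n}. 1 + real (2 * k) / (real j + - real i))"
      by (rule prod.cong) (use i assms(1) in \<open>auto simp: w_def\<close>)
    also have "\<dots> = rbinom (2 * k) (real n + - real i) / rbinom (2 * k) (real (n - l) + - real i)"
      by (rule string_up) (use i assms(1) in auto)
    finally show ?thesis using assms(1) by (simp add: of_nat_diff)
  qed
  have mid: "(\<Prod>j\<in>{i<..n}. ?f i j) = (\<Prod>j\<in>{n - l<..n}. 1 + real k / (real j - real i))" if i: "i \<in> {l<..n - l}" for i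
  proof -
    have "(\<Prod>j\<in>{i<..n}. ?f i j) = (\<Prod>j\<in>{i<..n - l}. ?f i j) * (\<Prod>j\<in>{n - l<..n}. ?f i j)"
      using i prod_interval_split[of i "n - l" n] by simp
    also have "(\<Prod>j\<in>{i<..n - l}. ?f i j) = 1"
      by (rule prod.neutral) (use i assms(1) in \<open>auto simp: w_def\<close>)
    also have "(\<Prod>j\<in>{n - l<..n}. ?f i j) = (\<Prod>j\<in>{n - l<..n}. 1 + real k / (real j - real i))"
      by (rule prod.cong) (use i assms(1) in \<open>auto simp: w_def\<close>)
    finally show ?thesis by simp
  qed
  have last: "(\<Prod>j\<in>{i<..n}. ?f i j) = 1" if i: "i \<in> {n - l<..n}" for i
    by (rule prod.neutral) (use i assms(1) in \<open>auto simp: w_def\<close>)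
  have split: "prod h {1..n} = prod h {1..l} * (prod h {l<..n - l} * prod h {n - l<..n})" for h :: "nat \<Rightarrow> real"
  proof -
    have "l \<le> n - l" using assms(1) by simp
    then show ?thesis
      using assms(1) prod_interval_split[of 0 l n h] prod_interval_split[of l "n - l" n h]
      by (simp add: atLeastSucAtMost_greaterThanAtMost[symmetric])
  qed
  have "d = (\<Prod>i=1..l. \<Prod>j\<in>{i<..n}. ?f i j) * ((\<Prod>i\<in>{l<..n - l}. \<Prod>j\<in>{i<..n}. ?f i j) *
      (\<Prod>i\<in>{n - l<..n}. \<Prod>j\<in>{i<..n}. ?f i j))"
    unfolding d split ..
  also have "(\<Prod>i\<in>{n - l<..n}. \<Prod>j\<in>{i<..n}. ?f i j) = 1" using last by (intro prod.neutral) auto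
  also have "(\<Prod>i\<in>{l<..n - l}. \<Prod>j\<in>{i<..n}. ?f i j) =
      (\<Prod>i\<in>{l<..n - l}. \<Prod>j\<in>{n - l<..n}. 1 + real k / (real j - real i))"
    by (rule prod.cong[OF refl], rule mid)
  \<comment> \<open>Exchanging the products lets the strings run over the middle indices, which
    leaves \<open>l\<close> quotients, the number of factors in the formula.\<close>
  also have "\<dots> = (\<Prod>j\<in>{n - l<..n}. \<Prod>i\<in>{l<..n - l}. 1 + real k / (real j - real i))" by (rule prod.swap)
  also have "\<dots> = (\<Prod>j\<in>{n - l<..n}. rbinom k (real j - real l - 1) / rbinom k (real j - real (n - l) - 1))"
    by (intro prod.cong refl string_down) (use assms(1) in auto)
  also have "\<dots> = (\<Prod>i=1..l. rbinom k (real n - real l - real i) / rbinom k (real l - real i))"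
    by (rule prod.reindex_bij_witness[where i = "\<lambda>i. n + 1 - i" and j = "\<lambda>j. n + 1 - j"])
      (use assms(1) in \<open>auto simp: of_nat_diff algebra_simps\<close>)
  also have "(\<Prod>i=1..l. \<Prod>j\<in>{i<..n}. ?f i j) = (\<Prod>i=1..l. rbinom k (real n - real l - real i) / rbinom k (real l - real i) *
      (rbinom (2 * k) (real n - real i) / rbinom (2 * k) (real n - real l - real i)))"
    by (rule prod.cong[OF refl], rule first)
  finally have d1: "d = (\<Prod>i=1..l. rbinom k (real n - real l - real i)) ^ 2 / (\<Prod>i=1..l. rbinom k (real l - real i)) ^ 2 *
      ((\<Prod>i=1..l. rbinom (2 * k) (real n - real i)) / (\<Prod>i=1..l. rbinom (2 * k) (real n - real l - real i)))"
    by (simp add: prod.distrib prod_dividef power2_eq_square mult_ac)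
  have Z: "(\<Prod>i=1..l. rbinom k (real l - real i)) = (\<Prod>i=1..l. rbinom k (real i - 1))"
    using prod_reverse_real[of "\<lambda>x. rbinom k (real l - x)" l] by simp
  have num: "dim_numerator l k 2 (real n) = (\<Prod>i=1..l. rbinom (2 * k) (real n - real i)) *
      (\<Prod>i=1..l. rbinom k (real n - real l - real i)) * (\<Prod>i=1..l. rbinom k (real n - real l - real i)) *
      (\<Prod>i=1..l. rbinom k (real n / 2 - real i))"
    unfolding dim_numerator_reversed by (intro rbinom_congs refl) (simp_all add: field_simps)
  have den: "dim_denominator l k 2 (real n) = (\<Prod>i=1..l. rbinom (2 * k) (real n - real l - real i)) *
      (\<Prod>i=1..l. rbinom k (real l - real i)) * (\<Prod>i=1..l. rbinom k (real l - real i)) *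
      (\<Prod>i=1..l. rbinom k (real n / 2 - real i))"
    unfolding dim_denominator_reversed Z by (intro rbinom_congs refl) (simp_all add: field_simps)
  have nz: "(\<Prod>i=1..l. rbinom k (real n / 2 - real i)) \<noteq> 0" "(\<Prod>i=1..l. rbinom k (real l - real i)) \<noteq> 0"
    "(\<Prod>i=1..l. rbinom (2 * k) (real n - real l - real i)) \<noteq> 0"
    using assms(1) by (auto intro!: rbinom_nonzero)
  then show ?thesis unfolding num den d1 by (simp only: mult_eq_0_iff) (simp add: power2_eq_square mult_ac)
qed

text \<open>The sums \<open>i + j\<close> of pairs from \<open>{1..2 * l}\<close> form
  \<open>l\<close> intervals of consecutive integers, the \<open>i\<close>-th from
  \<open>2 * i + 1\<close> to \<open>2 * i + 2 * l - 1\<close>. In the step from \<open>l\<close> to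
  \<open>Suc l\<close>, the column \<open>2 * l + 1\<close> extends each old interval by two terms
  and the column \<open>2 * l + 2\<close> is the new interval.\<close>

lemma prod_pairs_sum:
  fixes f :: "nat \<Rightarrow> real"
  shows "(\<Prod>i=1..2 * l. \<Prod>j\<in>{i<..2 * l}. f (i + j)) = (\<Prod>i=1..l. \<Prod>s\<in>{2 * i<..2 * i + 2 * l - 1}. f s)"
proof (induction l)
  case (Suc l)
  let ?L = "2 * l"
  have last: "prod g {p<..Suc q} = prod g {p<..q} * g (Suc q)" if "p \<le> q" for g :: "nat \<Rightarrow> real" and p q
  proof -
    have "{q<..Suc q} = {Suc q}" by auto
    then show ?thesis using prod_interval_split[of p q "Suc q" g] that by simp
  qed
  have row: "(\<Prod>i=1..Suc n. \<Prod>j\<in>{i<..Suc n}. f (i + j)) =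
      (\<Prod>i=1..n. \<Prod>j\<in>{i<..n}. f (i + j)) * (\<Prod>i=1..n. f (i + Suc n))" for n
    by (simp add: last prod.distrib[symmetric])
  have "(\<Prod>i=1..?L. f (i + Suc ?L)) = (\<Prod>i=1..l. f (2 * i + ?L) * f (Suc (2 * i + ?L)))"
    unfolding prod_even_odd by (rule prod.cong) (auto simp: Suc_diff_Suc numeral_2_eq_2)
  moreover have "(\<Prod>i=1..Suc ?L. f (i + Suc (Suc ?L))) = (\<Prod>s\<in>{2 * Suc l<..2 * Suc l + 2 * Suc l - 1}. f s)"
    by (rule prod.reindex_bij_witness[where i = "\<lambda>s. s - Suc (Suc ?L)" and j = "\<lambda>i. i + Suc (Suc ?L)"]) auto
  moreover have "(\<Prod>s\<in>{2 * i<..2 * i + 2 * Suc l - 1}. f s) =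
      (\<Prod>s\<in>{2 * i<..2 * i + ?L - 1}. f s) * (f (2 * i + ?L) * f (Suc (2 * i + ?L)))" if i: "i \<in> {1..l}" for i
  proof -
    obtain q where q: "2 * i + ?L = Suc q" "2 * i \<le> q"
      by (rule that[of "2 * i + ?L - 1"]) (use i in auto)
    then have "2 * i + 2 * Suc l - 1 = Suc (Suc q)" "2 * i + ?L - 1 = q" by auto
    then show ?thesis unfolding q(1) using q(2) by (simp add: last)
  qed
  ultimately show ?case
    using row[of "Suc ?L"] row[of ?L] Suc by (simp add: prod.distrib mult.assoc)
qed simp

text \<open>For \<open>i\<close> inside the block and \<open>j\<close> outside, the roots
  \<open>e i - e j\<close> form an ascending string in \<open>j\<close> and the roots
  \<open>e i + e j\<close> a descending one.\<close>

lemma dim_BCD_factor: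
  assumes "L \<le> r" and t: "t \<in> {0, 1, 2::nat}" "t = 0 \<Longrightarrow> L < r" and i: "i \<in> {1..L}"
  shows "(\<Prod>j\<in>{L<..r}. 1 + real K / (real j - real i)) * (\<Prod>j\<in>{L<..r}. 1 + real K / (real (2 * r + t) - real i - real j)) =
    rbinom K (real r - real i) / rbinom K (real L - real i) *
    (rbinom K (real (2 * r + t) - real i - real L - 1) / rbinom K (real r + real t - real i - 1))"
proof -
  have "(\<Prod>j\<in>{L<..r}. 1 + real K / (real j + - real i)) = rbinom K (real r + - real i) / rbinom K (real L + - real i)"
    by (rule string_up) (use assms in auto)
  moreover have "(\<Prod>j\<in>{L<..r}. 1 + real K / (real (2 * r + t) - real i - real j)) =
      rbinom K (real (2 * r + t) - real i - real L - 1) / rbinom K (real (2 * r + t) - real i - real r - 1)"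
    by (rule string_down) (use assms in auto)
  moreover have "real (2 * r + t) - real i - real r - 1 = real r + real t - real i - 1" by simp
  ultimately show ?thesis by (simp only: add_uminus_conv_diff)
qed

text \<open>Inside the block the roots \<open>e i - e j\<close> are orthogonal to the weight and the
  roots \<open>e i + e j\<close> see it twice; across its border both see it once.\<close>

lemma prod_two_level:
  fixes w y :: "nat \<Rightarrow> real"
  assumes w: "\<And>i. i \<in> {1..L} \<Longrightarrow> w i = K" "\<And>i. i \<in> {L<..r} \<Longrightarrow> w i = 0" and L: "L \<le> r"
  shows "(\<Prod>i=1..r. \<Prod>j\<in>{i<..r}. (1 + (w i - w j) / g i j) * (1 + (w i + w j) / h i j)) =
    (\<Prod>i=1..L. (\<Prod>j\<in>{L<..r}. 1 + K / g i j) * (\<Prod>j\<in>{L<..r}. 1 + K / h i j)) *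
    (\<Prod>i=1..L. \<Prod>j\<in>{i<..L}. 1 + 2 * K / (h i j :: real))"
proof -
  let ?f = "\<lambda>i j. (1 + (w i - w j) / g i j) * (1 + (w i + w j) / h i j)"
  have "(\<Prod>i=1..r. \<Prod>j\<in>{i<..r}. ?f i j) = (\<Prod>i=1..L. \<Prod>j\<in>{i<..r}. ?f i j) * (\<Prod>i\<in>{L<..r}. \<Prod>j\<in>{i<..r}. ?f i j)"
    using prod_interval_split[of 0 L r] L by (simp add: atLeastSucAtMost_greaterThanAtMost[symmetric])
  also have "(\<Prod>i\<in>{L<..r}. \<Prod>j\<in>{i<..r}. ?f i j) = 1"
    by (intro prod.neutral ballI) (use w(2) in auto)
  also have "(\<Prod>i=1..L. \<Prod>j\<in>{i<..r}. ?f i j) = (\<Prod>i=1..L. (\<Prod>j\<in>{i<..L}. 1 + 2 * K / h i j) *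
      ((\<Prod>j\<in>{L<..r}. 1 + K / g i j) * (\<Prod>j\<in>{L<..r}. 1 + K / h i j)))"
  proof (rule prod.cong[OF refl])
    fix i assume i: "i \<in> {1..L}"
    have "(\<Prod>j\<in>{i<..r}. ?f i j) = (\<Prod>j\<in>{i<..L}. ?f i j) * (\<Prod>j\<in>{L<..r}. ?f i j)"
      by (rule prod_interval_split) (use i L in auto)
    also have "(\<Prod>j\<in>{i<..L}. ?f i j) = (\<Prod>j\<in>{i<..L}. 1 + 2 * K / h i j)"
    proof (rule prod.cong[OF refl])
      fix j assume "j \<in> {i<..L}"
      then show "?f i j = 1 + 2 * K / h i j" using w(1)[of j] w(1)[OF i] i by simp
    qed
    also have "(\<Prod>j\<in>{L<..r}. ?f i j) = (\<Prod>j\<in>{L<..r}. (1 + K / g i j) * (1 + K / h i j))"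
      by (rule prod.cong[OF refl]) (use w i in auto)
    finally show "(\<Prod>j\<in>{i<..r}. ?f i j) = (\<Prod>j\<in>{i<..L}. 1 + 2 * K / h i j) *
      ((\<Prod>j\<in>{L<..r}. 1 + K / g i j) * (\<Prod>j\<in>{L<..r}. 1 + K / h i j))" by (simp add: prod.distrib)
  qed
  finally show ?thesis by (simp add: prod.distrib mult_ac)
qed

text \<open>In this product of pairs the arguments run in half steps, and
  \<open>2k\<close>-binomials have to be traded for \<open>k\<close>-binomials. Both are handled by
  induction on \<open>l\<close>, which adds one column of pairs.\<close>

lemma sp_pairs:
  assumes "l \<le> r"
  shows "(\<Prod>i=1..l. \<Prod>j\<in>{i<..l}. 1 + 2 * real (2 * k) / (2 * real r + 2 - real i - real j)) *
    ((\<Prod>i=1..l. rbinom (2 * k) (real r - (real l + real i) / 2)) * (\<Prod>i=1..l. rbinom k ((real r - real i + 1) / 2))) =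
    (\<Prod>i=1..l. rbinom (2 * k) (real r + (1 - real i) / 2)) * (\<Prod>i=1..l. rbinom k ((real r - real i - 1) / 2))"
  using assms
proof (induction l)
  case (Suc l)
  let ?R = "real r" and ?l = "real l"
  let ?p = "\<lambda>i j. 1 + 2 * real (2 * k) / (2 * ?R + 2 - real i - real j)"
  let ?D = "\<lambda>l i. rbinom (2 * k) (?R - (l + i) / 2)"
  define X where "X = (\<Prod>i=1..l. \<Prod>j\<in>{i<..l}. ?p i j)"
  define D1 where "D1 = (\<Prod>i=1..l. ?D ?l (real i))"
  define D2 where "D2 = (\<Prod>i=1..l. rbinom k ((?R - real i + 1) / 2))"
  define N1 where "N1 = (\<Prod>i=1..l. rbinom (2 * k) (?R + (1 - real i) / 2))"
  define N2 where "N2 = (\<Prod>i=1..l. rbinom k ((?R - real i - 1) / 2))"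
  have IH: "X * (D1 * D2) = N1 * N2" using Suc unfolding X_def D1_def D2_def N1_def N2_def by simp
  have lr: "l + 1 \<le> r" using Suc.prems by simp
  \<comment> \<open>Consecutive arguments \<open>?x\<close> differ by 1/2, while
    \<open>rbinom_ratio\<close> steps by 1; the product over both residues telescopes in half
    steps.\<close>
  define G where "G x = rbinom (2 * k) x * rbinom (2 * k) (x - 1 / 2)" for x
  have step: "(\<Prod>i=1..m. ?p i (Suc l)) = G (?R - ?l / 2) / G (?R - (?l + real m) / 2)" if "m \<le> l" for m
    using that
  proof (induction m)
    case 0
    have "G (?R - ?l / 2) \<noteq> 0" unfolding G_def using lr by (auto intro!: rbinom_nonzero)
    then show ?case by simp
  next
    case (Suc m)
    let ?x = "?R - (?l + real m) / 2"
    have pos: "?x > 0" using Suc.prems lr by simp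
    have "?p (Suc m) (Suc l) = 1 + real (2 * k) / ?x"
    proof -
      have "2 * ?R + 2 - real (Suc m) - real (Suc l) = 2 * ?x" by (simp add: field_simps)
      then show ?thesis by (simp only: mult_divide_mult_cancel_left_if) simp
    qed
    also have "\<dots> = rbinom (2 * k) ?x / rbinom (2 * k) (?x - 1)" by (rule rbinom_ratio[OF pos])
    also have "\<dots> = G ?x / G (?R - (?l + real (Suc m)) / 2)"
    proof -
      have e: "?R - (?l + real (Suc m)) / 2 = ?x - 1 / 2" by (simp add: field_simps)
      have "?x - 1 / 2 > - 1" using pos by linarith
      then have "rbinom (2 * k) (?x - 1 / 2) \<noteq> 0" by (rule rbinom_nonzero)
      moreover have "?x - 1 / 2 - 1 / 2 = ?x - 1" by simp
      ultimately show ?thesis unfolding e G_def by simp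
    qed
    finally have 1: "?p (Suc m) (Suc l) = G ?x / G (?R - (?l + real (Suc m)) / 2)" .
    have "?x > - 1" "?x - 1 / 2 > - 1" using pos by linarith+
    then have "G ?x \<noteq> 0" unfolding G_def by (simp only: rbinom_nonzero mult_eq_0_iff) simp
    moreover have "(\<Prod>i=1..Suc m. ?p i (Suc l)) = (\<Prod>i=1..m. ?p i (Suc l)) * ?p (Suc m) (Suc l)" by simp
    moreover have "(\<Prod>i=1..m. ?p i (Suc l)) = G (?R - ?l / 2) / G ?x" using Suc by simp
    ultimately show ?case unfolding 1 by simp
  qed
  have inner: "(\<Prod>i=1..Suc l. \<Prod>j\<in>{i<..Suc l}. ?p i j) = X * (G (?R - ?l / 2) / G (?R - ?l))"
  proof -
    have "(\<Prod>i=1..l. \<Prod>j\<in>{i<..Suc l}. ?p i j) = (\<Prod>i=1..l. (\<Prod>j\<in>{i<..l}. ?p i j) * ?p i (Suc l))"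
    proof (rule prod.cong[OF refl])
      fix i assume "i \<in> {1..l}"
      then have "{i<..Suc l} = insert (Suc l) {i<..l}" by auto
      then show "(\<Prod>j\<in>{i<..Suc l}. ?p i j) = (\<Prod>j\<in>{i<..l}. ?p i j) * ?p i (Suc l)" by (simp add: mult.commute)
    qed
    also have "\<dots> = X * (\<Prod>i=1..l. ?p i (Suc l))" unfolding X_def by (rule prod.distrib)
    also have "(\<Prod>i=1..l. ?p i (Suc l)) = G (?R - ?l / 2) / G (?R - ?l)"
      using step[of l] by (simp add: field_simps)
    finally show ?thesis by simp
  qed
  \<comment> \<open>\<open>?D\<close> depends on the sum of its arguments only, so raising
    \<open>l\<close> shifts the index: one factor is lost at the beginning and two are gained at the
    end.\<close>
  have D1': "(\<Prod>i=1..Suc l. ?D (real (Suc l)) (real i)) * ?D ?l 1 = D1 * (rbinom (2 * k) (?R - ?l - 1 / 2) * rbinom (2 * k) (?R - ?l - 1))"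
  proof -
    have "(\<Prod>i=1..m. ?D (real (Suc l)) (real i)) * ?D ?l 1 = (\<Prod>i=1..Suc m. ?D ?l (real i))" for m
    proof (induction m)
      case (Suc m)
      have "?D (real (Suc l)) (real (Suc m)) = ?D ?l (real (Suc (Suc m)))" by (simp add: field_simps)
      then show ?case using Suc by (simp add: mult_ac)
    qed simp
    from this[of "Suc l"] have "(\<Prod>i=1..Suc l. ?D (real (Suc l)) (real i)) * ?D ?l 1 =
      D1 * (?D ?l (real (Suc l)) * ?D ?l (real (Suc (Suc l))))" unfolding D1_def by simp
    moreover have "?R - (?l + real (Suc l)) / 2 = ?R - ?l - 1 / 2" "?R - (?l + real (Suc (Suc l))) / 2 = ?R - ?l - 1"
      by (simp_all add: field_simps)
    ultimately show ?thesis by (simp only:)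
  qed
  define b1 b2 b3 b4 b5 where b: "b1 = rbinom (2 * k) (?R - ?l / 2)" "b2 = rbinom (2 * k) (?R - (?l + 1) / 2)"
    "b3 = rbinom (2 * k) (?R - ?l)" "b4 = rbinom (2 * k) (?R - ?l - 1 / 2)" "b5 = rbinom (2 * k) (?R - ?l - 1)"
  define \<beta> \<beta>' where \<beta>: "\<beta> = rbinom k ((?R - ?l) / 2)" "\<beta>' = rbinom k ((?R - ?l) / 2 - 1)"
  have Rl: "?R - ?l > 0" using lr by simp
  have nz: "b2 \<noteq> 0" "b3 \<noteq> 0" "b4 \<noteq> 0" "b5 \<noteq> 0" "\<beta>' \<noteq> 0"
    unfolding b \<beta> using lr by (auto intro!: rbinom_nonzero simp: field_simps)
  \<comment> \<open>The same number \<open>1 + 2k / (?R - ?l)\<close> written as a ratio of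
    \<open>2k\<close>-binomials and of \<open>k\<close>-binomials.\<close>
  have "1 + real (2 * k) / (?R - ?l) = b3 / b5" unfolding b by (rule rbinom_ratio[OF Rl])
  moreover have "1 + real k / ((?R - ?l) / 2) = \<beta> / \<beta>'" unfolding \<beta> by (rule rbinom_ratio) (use Rl in simp)
  ultimately have "\<beta> / \<beta>' = b3 / b5" by (simp add: mult.commute)
  then have bb: "\<beta> * b5 = b3 * \<beta>'" using nz by (simp add: field_simps)
  have G1: "G (?R - ?l / 2) = b1 * b2" "G (?R - ?l) = b3 * b4"
  proof -
    have "?R - ?l / 2 - 1 / 2 = ?R - (?l + 1) / 2" by (simp add: field_simps)
    then show "G (?R - ?l / 2) = b1 * b2" unfolding G_def b by (simp only:)
    show "G (?R - ?l) = b3 * b4" unfolding G_def b ..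
  qed
  have D: "(\<Prod>i=1..Suc l. ?D (real (Suc l)) (real i)) = D1 * (b4 * b5) / b2"
    using D1' nz(1) unfolding b by (simp add: field_simps)
  have D2': "(\<Prod>i=1..Suc l. rbinom k ((?R - real i + 1) / 2)) = D2 * \<beta>"
    unfolding D2_def \<beta> by simp
  have N1': "(\<Prod>i=1..Suc l. rbinom (2 * k) (?R + (1 - real i) / 2)) = N1 * b1"
    unfolding N1_def b by simp
  have N2': "(\<Prod>i=1..Suc l. rbinom k ((?R - real i - 1) / 2)) = N2 * \<beta>'"
  proof -
    have "(?R - real (Suc l) - 1) / 2 = (?R - ?l) / 2 - 1" by (simp add: field_simps)
    moreover have "(\<Prod>i=1..Suc l. rbinom k ((?R - real i - 1) / 2)) = N2 * rbinom k ((?R - real (Suc l) - 1) / 2)"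
      unfolding N2_def by simp
    ultimately show ?thesis unfolding \<beta> by (simp only:)
  qed
  have "X * (b1 * b2 / (b3 * b4)) * (D1 * (b4 * b5) / b2 * (D2 * \<beta>)) = (X * (D1 * D2)) * b1 * (\<beta> * b5) / b3"
    using nz by (simp add: field_simps)
  also have "\<dots> = N1 * b1 * (N2 * \<beta>')" unfolding IH bb using nz by (simp add: field_simps)
  finally show ?case unfolding inner D D2' N1' N2' G1 .
qed simp

text \<open>Between the ascending and the descending string there remains
  \<open>rbinom K (r - i) / rbinom K (r + t - i - 1)\<close>. It is the factor
  \<open>1 + K / (r - i)\<close> for \<open>t = 0\<close>, it is 1 for \<open>t = 1\<close>, and it
  cancels the factor of the long root \<open>2 e i\<close> for \<open>t = 2\<close>. This makes the
  three types uniform.\<close>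

lemma BCD_product:
  assumes "L \<le> r" and t: "t \<in> {0, 1, 2::nat}" "t = 0 \<Longrightarrow> L < r"
    and w: "\<And>i. w i = (if i \<le> L then real K else 0)"
  shows "(\<Prod>i=1..r. \<Prod>j\<in>{i<..r}. (1 + (w i - w j) / (real j - real i)) *
      (1 + (w i + w j) / (real (2 * r + t) - real i - real j))) *
      (if t = 0 then 1 else \<Prod>i=1..r. 1 + w i / (real r - real i + real t / 2)) =
    (if t = 2 then 1 else \<Prod>i=1..L. 1 + real K / (real r + real t / 2 - real i)) *
    (\<Prod>i=1..L. rbinom K (real (2 * r + t) - real i - real L - 1) / rbinom K (real L - real i)) *
    (\<Prod>i=1..L. \<Prod>j\<in>{i<..L}. 1 + 2 * real K / (real (2 * r + t) - real i - real j))"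
proof -
  let ?A = "(\<Prod>i=1..L. (\<Prod>j\<in>{L<..r}. 1 + real K / (real j - real i)) *
      (\<Prod>j\<in>{L<..r}. 1 + real K / (real (2 * r + t) - real i - real j)))"
  have "?A = (\<Prod>i=1..L. rbinom K (real r - real i) / rbinom K (real L - real i) *
    (rbinom K (real (2 * r + t) - real i - real L - 1) / rbinom K (real r + real t - real i - 1)))"
    by (rule prod.cong[OF refl], rule dim_BCD_factor) (use assms in auto)
  also have "\<dots> = (\<Prod>i=1..L. rbinom K (real r - real i) / rbinom K (real r + real t - real i - 1)) *
    (\<Prod>i=1..L. rbinom K (real (2 * r + t) - real i - real L - 1) / rbinom K (real L - real i))"
    by (simp only: prod.distrib[symmetric]) (simp add: mult_ac)
  finally have A: "?A = \<dots>" .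
  have "(\<Prod>i=1..r. \<Prod>j\<in>{i<..r}. (1 + (w i - w j) / (real j - real i)) *
      (1 + (w i + w j) / (real (2 * r + t) - real i - real j))) =
    ?A * (\<Prod>i=1..L. \<Prod>j\<in>{i<..L}. 1 + 2 * real K / (real (2 * r + t) - real i - real j))"
    by (rule prod_two_level) (use assms(1) w in auto)
  moreover have "(if t = 0 then 1 else \<Prod>i=1..r. 1 + w i / (real r - real i + real t / 2)) =
      (\<Prod>i=1..L. if t = 0 then 1 else 1 + real K / (real r - real i + real t / 2))"
  proof (cases "t = 0")
    case False
    have "(\<Prod>i=1..r. 1 + w i / (real r - real i + real t / 2)) = (\<Prod>i=1..L. 1 + w i / (real r - real i + real t / 2))"
      by (rule prod.mono_neutral_right) (use assms(1) w in auto)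
    then show ?thesis using False w by simp
  qed simp
  moreover have "(\<Prod>i=1..L. rbinom K (real r - real i) / rbinom K (real r + real t - real i - 1)) *
      (\<Prod>i=1..L. if t = 0 then 1 else 1 + real K / (real r - real i + real t / 2)) =
      (\<Prod>i=1..L. if t = 2 then 1 else 1 + real K / (real r + real t / 2 - real i))"
    unfolding prod.distrib[symmetric]
  proof (rule prod.cong[OF refl])
    fix i assume i: "i \<in> {1..L}"
    then have "rbinom K (real r - real i) \<noteq> 0" "rbinom K (real r - real i + 1) \<noteq> 0"
      using assms(1) by (auto intro!: rbinom_nonzero)
    moreover have "1 + real K / (real r - real i + 1) = rbinom K (real r - real i + 1) / rbinom K (real r - real i)"
      using rbinom_ratio[of "real r - real i + 1" K] i assms(1) by simp
    moreover have "t = 0 \<Longrightarrow> 1 + real K / (real r - real i) = rbinom K (real r - real i) / rbinom K (real r - real i - 1)"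
      using t(2) i by (intro rbinom_ratio) auto
    note * = calculation this
    show "rbinom K (real r - real i) / rbinom K (real r + real t - real i - 1) *
        (if t = 0 then 1 else 1 + real K / (real r - real i + real t / 2)) =
        (if t = 2 then 1 else 1 + real K / (real r + real t / 2 - real i))"
    proof -
      have e: "real r + real t - real i - 1 = real r - real i + (real t - 1)"
        "real r + real t / 2 - real i = real r - real i + real t / 2" by simp_all
      show ?thesis using * t(1) unfolding e by (elim insertE emptyE) simp_all
    qed
  qed
  moreover have "(\<Prod>i=1..L. if t = 2 then 1 else f i) = (if t = 2 then 1 else \<Prod>i=1..L. f i)" for f :: "nat \<Rightarrow> real"
    by simp
  ultimately show ?thesis unfolding A by (simp only: mult_ac) (simp only: mult.assoc[symmetric])
qed

text \<open>Since \<open>\<beta> i = 2 e i\<close>, all strings carry \<open>2k\<close>, while the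
  formula has mostly \<open>k\<close>-binomials. \<open>rbinom_double\<close> halves them, and its
  constants, collected in \<open>h\<close>, appear above and below the fraction line.\<close>

lemma SP_product:
  fixes k :: nat
  assumes "1 \<le> l" "l \<le> r"
  defines "w i \<equiv> (if i \<le> l then real (2 * k) else 0)"
  assumes d: "d = (\<Prod>i=1..r. \<Prod>j\<in>{i<..r}. (1 + (w i - w j) / (real j - real i)) *
      (1 + (w i + w j) / (real (2 * r + 2) - real i - real j))) * (\<Prod>i=1..r. 1 + w i / (real r - real i + real 2 / 2))"
  shows "dim_denominator l k 1 (real r + 2) \<noteq> 0 \<and>
    d = dim_numerator l k 1 (real r + 2) / dim_denominator l k 1 (real r + 2)"
proof -
  let ?R = "real r" and ?l = "real l"
  define N1 where "N1 = (\<Prod>i=1..l. rbinom (2 * k) (?R + (1 - real i) / 2))"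
  define N2 where "N2 = (\<Prod>i=1..l. rbinom k (?R + (1 - ?l - real i) / 2))"
  define N3 where "N3 = (\<Prod>i=1..l. rbinom k (?R - (?l + real i) / 2))"
  define N4 where "N4 = (\<Prod>i=1..l. rbinom k ((?R - real i - 1) / 2))"
  define D1 where "D1 = (\<Prod>i=1..l. rbinom (2 * k) (?R - (?l + real i) / 2))"
  define D2 where "D2 = (\<Prod>i=1..l. rbinom k (real i / 2 - 1))"
  define D3 where "D3 = (\<Prod>i=1..l. rbinom k ((real i - 1) / 2))"
  define D4 where "D4 = (\<Prod>i=1..l. rbinom k ((?R - real i + 1) / 2))"
  define Q where "Q = (\<Prod>i=1..l. \<Prod>j\<in>{i<..l}. 1 + 2 * real (2 * k) / (2 * ?R + 2 - real i - real j))"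
  define h where "h = (\<Prod>i=1..l. rbinom k (- 1 / 2))"
  have "rbinom k (- 1 / 2) \<noteq> 0" by (rule rbinom_nonzero) simp
  then have nz: "D1 \<noteq> 0" "D2 \<noteq> 0" "D3 \<noteq> 0" "D4 \<noteq> 0" "h \<noteq> 0"
    unfolding D1_def D2_def D3_def D4_def h_def using assms(2) by (auto intro!: rbinom_nonzero simp: field_simps)
  have pairs: "Q * (D1 * D4) = N1 * N4"
    unfolding Q_def D1_def D4_def N1_def N4_def by (rule sp_pairs[OF assms(2)])
  have num: "dim_numerator l k 1 (?R + 2) = N1 * N2 * N3 * N4"
    unfolding dim_numerator_reversed N1_def N2_def N3_def N4_def by (intro rbinom_congs refl) (simp_all add: field_simps)
  have den: "dim_denominator l k 1 (?R + 2) = D1 * D2 * D3 * D4"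
    unfolding dim_denominator_reversed D1_def D2_def D3_def D4_def by (intro rbinom_congs refl) (simp_all add: field_simps)
  have up: "(\<Prod>i=1..l. rbinom (2 * k) (real (2 * r + 2) - real i - ?l - 1)) * h = N2 * N3"
    unfolding N2_def N3_def h_def prod.distrib[symmetric] rbinom_double
    by (intro rbinom_congs refl) (simp_all add: field_simps)
  have "(\<Prod>i=1..l. rbinom (2 * k) (?l - real i)) = (\<Prod>i=1..l. rbinom (2 * k) (real i - 1))"
    using prod_reverse_real[of "\<lambda>x. rbinom (2 * k) (x - 1)" l] by simp
  then have "(\<Prod>i=1..l. rbinom (2 * k) (?l - real i)) * h = (\<Prod>i=1..l. rbinom (2 * k) (real i - 1) * rbinom k (- 1 / 2))"
    unfolding h_def prod.distrib by simp
  also have "\<dots> = D3 * D2"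
    unfolding D2_def D3_def prod.distrib[symmetric] rbinom_double
    by (intro rbinom_congs refl) (simp_all add: field_simps)
  finally have low: "(\<Prod>i=1..l. rbinom (2 * k) (?l - real i)) * h = D3 * D2" .
  have "Q = (\<Prod>i=1..l. \<Prod>j\<in>{i<..l}. 1 + 2 * real (2 * k) / (real (2 * r + 2) - real i - real j))"
    unfolding Q_def by (simp add: add.commute)
  then have "d = (\<Prod>i=1..l. rbinom (2 * k) (real (2 * r + 2) - real i - ?l - 1) / rbinom (2 * k) (?l - real i)) * Q"
    using BCD_product[OF assms(2), of 2 w "2 * k"] unfolding d by (simp add: w_def)
  then have "d = (\<Prod>i=1..l. rbinom (2 * k) (real (2 * r + 2) - real i - ?l - 1)) * h / ((\<Prod>i=1..l. rbinom (2 * k) (?l - real i)) * h) * Q"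
    using nz(5) by (simp only: prod_dividef) simp
  then have d': "d = N2 * N3 / (D3 * D2) * Q" unfolding up low .
  have "d * (D1 * D2 * D3 * D4) = N2 * N3 * (Q * (D1 * D4))" unfolding d' using nz by (simp add: field_simps)
  also have "\<dots> = N1 * N2 * N3 * N4" unfolding pairs by (simp add: mult_ac)
  finally have "d * (D1 * D2 * D3 * D4) = N1 * N2 * N3 * N4" .
  moreover have "D1 * D2 * D3 * D4 \<noteq> 0" using nz by simp
  ultimately show ?thesis unfolding num den by (simp only: eq_divide_eq) simp
qed

lemma SO_pairs:
  assumes "4 * l \<le> n"
  shows "(\<Prod>i=1..2 * l. \<Prod>j\<in>{i<..2 * l}. 1 + 2 * real k / (real n - real i - real j)) =
    (\<Prod>i=1..l. rbinom (2 * k) (real n - 2 * real i - 1) / rbinom (2 * k) (real n - 2 * real l - 2 * real i))"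
proof -
  have "(\<Prod>i=1..2 * l. \<Prod>j\<in>{i<..2 * l}. 1 + 2 * real k / (real n - real i - real j)) =
    (\<Prod>i=1..2 * l. \<Prod>j\<in>{i<..2 * l}. 1 + 2 * real k / (real n - real (i + j)))"
    by (simp add: diff_diff_eq)
  also have "\<dots> = (\<Prod>i=1..l. \<Prod>s\<in>{2 * i<..2 * i + 2 * l - 1}. 1 + 2 * real k / (real n - real s))"
    by (rule prod_pairs_sum)
  also have "\<dots> = (\<Prod>i=1..l. rbinom (2 * k) (real n - 2 * real i - 1) / rbinom (2 * k) (real n - 2 * real l - 2 * real i))"
  proof (rule prod.cong[OF refl])
    fix i assume i: "i \<in> {1..l}"
    have "(\<Prod>s\<in>{2 * i<..2 * i + 2 * l - 1}. 1 + real (2 * k) / (real n - real s)) =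
      rbinom (2 * k) (real n - real (2 * i) - 1) / rbinom (2 * k) (real n - real (2 * i + 2 * l - 1) - 1)"
      by (rule string_down) (use i assms in auto)
    moreover have e: "real n - real (2 * i + 2 * l - 1) - 1 = real n - 2 * real l - 2 * real i"
      using i by (simp add: of_nat_diff)
    ultimately show "(\<Prod>s\<in>{2 * i<..2 * i + 2 * l - 1}. 1 + 2 * real k / (real n - real s)) =
      rbinom (2 * k) (real n - 2 * real i - 1) / rbinom (2 * k) (real n - 2 * real l - 2 * real i)"
      unfolding e by simp
  qed
  finally show ?thesis .
qed

text \<open>Here \<open>b / 2 = 2\<close>, so the parameters of the formula step by 2 and those of
  the strings by 1. Sorting the string indices by parity matches them. The strict
  \<open>4 * l < n\<close> keeps the denominator from vanishing.\<close>

lemma SO_product: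
  fixes k :: nat
  assumes "1 \<le> l" "4 * l < n" and t: "n = 2 * r + t" "t \<in> {0, 1}"
  defines "w i \<equiv> (if i \<le> 2 * l then real k else 0)"
  assumes d: "d = (\<Prod>i=1..r. \<Prod>j\<in>{i<..r}. (1 + (w i - w j) / (real j - real i)) *
      (1 + (w i + w j) / (real n - real i - real j))) *
      (if t = 0 then 1 else \<Prod>i=1..r. 1 + w i / (real r - real i + real t / 2))"
  shows "dim_denominator l k 4 (real n - 4) \<noteq> 0 \<and>
    d = dim_numerator l k 4 (real n - 4) / dim_denominator l k 4 (real n - 4)"
proof -
  let ?n = "real n" and ?l = "real l" and ?L = "2 * l"
  define N1 where "N1 = (\<Prod>i=1..l. rbinom (2 * k) (?n - 2 * real i - 1))"
  define N2 where "N2 = (\<Prod>i=1..l. rbinom k (?n - 2 * ?l - 2 * real i - 1))"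
  define N3 where "N3 = (\<Prod>i=1..l. rbinom k (?n - 2 * ?l - 2 * real i))"
  define N4 where "N4 = (\<Prod>i=1..l. rbinom k (?n / 2 - 2 * real i + 1))"
  define D1 where "D1 = (\<Prod>i=1..l. rbinom (2 * k) (?n - 2 * ?l - 2 * real i))"
  define D2 where "D2 = (\<Prod>i=1..l. rbinom k (2 * real i - 1))"
  define D3 where "D3 = (\<Prod>i=1..l. rbinom k (2 * real i - 2))"
  define D4 where "D4 = (\<Prod>i=1..l. rbinom k (?n / 2 - 2 * real i - 1))"
  \<comment> \<open>The parameters that occur above and below in the string of \<open>middle\<close>
    and are skipped by the formula.\<close>
  define E where "E = (\<Prod>i=1..l. rbinom k (?n / 2 - 2 * real i))"
  have nz: "D1 \<noteq> 0" "D2 \<noteq> 0" "D3 \<noteq> 0" "D4 \<noteq> 0" "E \<noteq> 0"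
    unfolding D1_def D2_def D3_def D4_def E_def using assms(2) by (auto intro!: rbinom_nonzero simp: field_simps)
  have num: "dim_numerator l k 4 (?n - 4) = N1 * N2 * N3 * N4"
    unfolding dim_numerator_reversed N1_def N2_def N3_def N4_def by (intro rbinom_congs refl) (simp_all add: field_simps)
  have den: "dim_denominator l k 4 (?n - 4) = D1 * D2 * D3 * D4"
    unfolding dim_denominator_reversed D1_def D2_def D3_def D4_def by (intro rbinom_congs refl) (simp_all add: field_simps)
  have up: "(\<Prod>i=1..?L. rbinom k (?n - real i - real ?L - 1)) = N3 * N2"
    unfolding prod_even_odd N3_def N2_def prod.distrib[symmetric]
    by (intro rbinom_congs refl) (auto simp: of_nat_diff)
  have low: "(\<Prod>i=1..?L. rbinom k (real ?L - real i)) = D3 * D2"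
  proof -
    have "(\<Prod>i=1..?L. rbinom k (real ?L - real i)) = (\<Prod>i=1..?L. rbinom k (real i - 1))"
      using prod_reverse_real[of "\<lambda>x. rbinom k (x - 1)" ?L] by simp
    also have "\<dots> = D3 * D2"
      unfolding prod_even_odd D3_def D2_def prod.distrib[symmetric]
      by (intro rbinom_congs refl) (auto simp: of_nat_diff)
    finally show ?thesis .
  qed
  have middle: "(\<Prod>i=1..?L. 1 + real k / (?n / 2 - real i)) = N4 / D4"
  proof -
    have "(\<Prod>i=1..?L. 1 + real k / (?n / 2 - real i)) = (\<Prod>i=1..?L. rbinom k (?n / 2 - real i) / rbinom k (?n / 2 - real i - 1))"
      by (intro prod.cong refl rbinom_ratio) (use assms(2) in auto)
    also have "\<dots> = (\<Prod>i=1..?L. rbinom k (?n / 2 - real i)) / (\<Prod>i=1..?L. rbinom k (?n / 2 - real i - 1))"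
      by (rule prod_dividef)
    also have "(\<Prod>i=1..?L. rbinom k (?n / 2 - real i)) = N4 * E"
      unfolding prod_even_odd N4_def E_def prod.distrib[symmetric]
      by (intro rbinom_congs refl) (auto simp: of_nat_diff)
    also have "(\<Prod>i=1..?L. rbinom k (?n / 2 - real i - 1)) = E * D4"
      unfolding prod_even_odd D4_def E_def prod.distrib[symmetric]
      by (intro rbinom_congs refl) (auto simp: of_nat_diff)
    finally show ?thesis using nz by simp
  qed
  have rt: "?n / 2 = real r + real t / 2" using t(1) by simp
  have Lr: "?L \<le> r" "t = 0 \<Longrightarrow> ?L < r" using assms(2) t by auto
  have N1: "N1 / D1 = (\<Prod>i=1..?L. \<Prod>j\<in>{i<..?L}. 1 + 2 * real k / (?n - real i - real j))"
    unfolding N1_def D1_def prod_dividef[symmetric] by (rule SO_pairs[symmetric]) (use assms(2) in simp)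
  have "d = (\<Prod>i=1..?L. 1 + real k / (?n / 2 - real i)) *
      (\<Prod>i=1..?L. rbinom k (?n - real i - real ?L - 1) / rbinom k (real ?L - real i)) * (N1 / D1)"
  proof -
    have "t \<in> {0, 1, 2}" "t \<noteq> 2" "w i = (if i \<le> ?L then real k else 0)" for i using t(2) by (auto simp: w_def)
    then show ?thesis using BCD_product[OF Lr(1) _ Lr(2), of t w k] unfolding d N1 t(1)[symmetric] rt by simp
  qed
  also have "\<dots> = N4 / D4 * (N3 * N2 / (D3 * D2)) * (N1 / D1)"
    unfolding middle prod_dividef up low ..
  also have "\<dots> = N1 * N2 * N3 * N4 / (D1 * D2 * D3 * D4)" by (simp add: mult_ac)
  finally show ?thesis unfolding num den using nz by simp
qed

lemma rbinom_tendsto [tendsto_intros]: "(f \<longlongrightarrow> x) F \<Longrightarrow> ((\<lambda>a. rbinom K (f a)) \<longlongrightarrow> rbinom K x) F"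
  by (induction K) (auto simp: rbinom_Suc intro!: tendsto_intros)

text \<open>On the line \<open>(a, a(r - 2) + 4)\<close> with \<open>l = r\<close>, the last three binomials of the numerator and of
  the denominator agree up to a permutation of the factors.\<close>

lemma dim_formula_fixed_rank:
  fixes k r :: nat
  defines "Q a \<equiv> \<Prod>i=1..r. rbinom (2 * k) (a * (2 * real r - real i - 1) / 2 + 1) / rbinom (2 * k) (a * (real i - 1) / 2)"
  assumes T: "in_fixed_rank_series r T" and v: "vogel_parameters T = (b, b * (real r - 2) + 4)" and b: "b > 0"
  shows "dim_formula_value T r k (Q b)"
proof -
  let ?c = "\<lambda>a. a * (real r - 2) + 4"
  define M where "M a = (\<Prod>i=1..r. rbinom k (a * (real r - real i - 1) / 2 + 1))" for a
  define D2 where "D2 a = (\<Prod>i=1..r. rbinom k (real i * a / 2 - 1))" for a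
  define D3 where "D3 a = (\<Prod>i=1..r. rbinom k ((real i - 1) * a / 2))" for a
  define N1 where "N1 a = (\<Prod>i=1..r. rbinom (2 * k) (a * (2 * real r - real i - 1) / 2 + 1))" for a
  define D1 where "D1 a = (\<Prod>i=1..r. rbinom (2 * k) (a * (real i - 1) / 2))" for a
  have num: "dim_numerator r k a (?c a) = N1 a * M a * D3 a * D2 a" for a
  proof -
    have "dim_numerator r k a (?c a) = N1 a * M a * (\<Prod>i=1..r. rbinom k ((real r + 1 - real i - 1) * a / 2)) * D2 a"
      unfolding dim_numerator_rbinom prod.distrib[symmetric] N1_def M_def D2_def by (intro rbinom_congs refl) (simp_all add: field_simps)
    also have "(\<Prod>i=1..r. rbinom k ((real r + 1 - real i - 1) * a / 2)) = D3 a"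
      unfolding D3_def by (rule prod_reverse_real[of "\<lambda>x. rbinom k ((x - 1) * a / 2)" r, symmetric])
    finally show ?thesis .
  qed
  have den: "dim_denominator r k a (?c a) = D1 a * D2 a * D3 a * M a" for a
    unfolding dim_denominator_rbinom prod.distrib[symmetric] D1_def D2_def D3_def M_def by (intro rbinom_congs refl) (simp_all add: field_simps)
  have Q: "Q a = N1 a / D1 a" for a unfolding Q_def N1_def D1_def by (rule prod_dividef)
  have D: "D1 a \<noteq> 0" "D2 a \<noteq> 0" "D3 a \<noteq> 0" if "a > 0" for a
    unfolding D1_def D2_def D3_def using that by (auto intro!: rbinom_nonzero less_le_trans[of "- 2" 0, OF _ mult_nonneg_nonneg])
  have val: "dim_numerator r k a (?c a) / dim_denominator r k a (?c a) = Q a" if "a > 0" "M a \<noteq> 0" for a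
    unfolding num den Q using D[OF that(1)] that(2) by simp
  show ?thesis
  proof (cases "dim_denominator r k b (?c b) = 0")
    case False
    then have "M b \<noteq> 0" unfolding den by simp
    then show ?thesis unfolding dim_formula_value_def v using val[OF b] False by simp
  next
    case True
    \<comment> \<open>\<open>M\<close> is the one factor of the denominator that can vanish for
      \<open>a > 0\<close>. Each of its linear factors has at most one zero, so near
      \<open>b\<close> but off \<open>b\<close> the quotient equals the continuous function
      \<open>Q\<close>.\<close>
    have "\<forall>\<^sub>F a in at b. \<forall>i\<in>{1..r}. \<forall>j\<in>{1..k}. a * (real r - real i - 1) / 2 + 1 \<noteq> - real j"
    proof (intro eventually_ball_finite finite_atLeastAtMost ballI)
      fix i j
      let ?q = "real r - real i - 1"
      have "\<forall>\<^sub>F a in at b. a \<noteq> (- real j - 1) * 2 / ?q" by (rule eventually_neq_at_within)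
      then show "\<forall>\<^sub>F a in at b. a * ?q / 2 + 1 \<noteq> - real j"
      proof (rule eventually_mono)
        fix a assume a: "a \<noteq> (- real j - 1) * 2 / ?q"
        show "a * ?q / 2 + 1 \<noteq> - real j"
        proof
          assume e: "a * ?q / 2 + 1 = - real j"
          show False
          proof (cases "?q = 0")
            case True
            then show False using e by simp
          next
            case False
            have "a * ?q = (- real j - 1) * 2" using e by simp
            then show False using a False by (simp add: eq_divide_eq)
          qed
        qed
      qed
    qed
    then have M: "\<forall>\<^sub>F a in at b. M a \<noteq> 0"
      by (rule eventually_mono) (auto simp: M_def rbinom_zero_iff)
    have pos: "\<forall>\<^sub>F a in at b. a > 0"
      using order_tendstoD(1)[OF tendsto_ident_at b] .
    have "(Q \<longlongrightarrow> Q b) (at b)"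
      unfolding Q N1_def D1_def using D(1)[OF b] unfolding D1_def by (intro tendsto_intros) auto
    moreover have "\<forall>\<^sub>F a in at b. Q a = dim_numerator r k a (?c a) / dim_denominator r k a (?c a)"
      using M pos by eventually_elim (rule val[symmetric])
    ultimately have "((\<lambda>a. dim_numerator r k a (?c a) / dim_denominator r k a (?c a)) \<longlongrightarrow> Q b) (at b)"
      by (rule Lim_transform_eventually)
    then show ?thesis unfolding dim_formula_value_def v using True T by auto
  qed
qed

section \<open>Root systems given by lists\<close>

text \<open>The following functions are meant for \<open>code_simp\<close>. They mostly avoid abstractions, under which it
  would unfold the definitions symbolically, and branch by \<open>if\<close>, which it evaluates lazily.\<close>

fun dot :: "int list \<Rightarrow> int list \<Rightarrow> int" where
  "dot (x # xs) (y # ys) = x * y + dot xs ys"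
| "dot _ _ = 0"

definition vadd :: "int list \<Rightarrow> int list \<Rightarrow> int list" where
  "vadd = map2 (+)"

fun member :: "int list \<Rightarrow> int list list \<Rightarrow> bool" where
  "member x [] = False"
| "member x (y # ys) = (if x = y then True else member x ys)"

fun graded_member :: "int \<Rightarrow> int list \<Rightarrow> (int \<times> int list list) list \<Rightarrow> bool" where
  "graded_member h x [] = False"
| "graded_member h x ((g, xs) # G) =
    (if h = g then if member x xs then True else graded_member h x G else graded_member h x G)"

definition unit_vector :: "nat \<Rightarrow> nat \<Rightarrow> int list" where
  "unit_vector n i = (replicate n 0)[i := 1]"

text \<open>\<open>p\<close> is twice the product of \<open>b\<close> with the \<open>i\<close>-th
  simple root and \<open>m\<close> that root's square, so \<open>n\<close> is the Cartan integer.
  The reflected vector has height \<open>sum_list b - n\<close>, which selects the list to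
  search.\<close>

definition reflection_test :: "(int \<times> int list list) list \<Rightarrow> int list \<Rightarrow> nat \<Rightarrow> int \<Rightarrow> int \<Rightarrow> int \<Rightarrow> bool" where
  "reflection_test G b i p m n = (if n * m = p
     then if n = 0 then True else if b = unit_vector (length b) i then True
       else graded_member (sum_list b - n) (b[i := b ! i - n]) G
     else False)"

definition reflection_quotient :: "(int \<times> int list list) list \<Rightarrow> int list \<Rightarrow> nat \<Rightarrow> int \<Rightarrow> int \<Rightarrow> bool" where
  "reflection_quotient G b i p m = reflection_test G b i p m (p div m)"

fun closed_rows :: "(int \<times> int list list) list \<Rightarrow> int list \<Rightarrow> nat \<Rightarrow> int list list \<Rightarrow> bool" where
  "closed_rows G b i [] = True"
| "closed_rows G b i (row # rows) =
    (if reflection_quotient G b i (2 * dot b row) (row ! i) then closed_rows G b (Suc i) rows else False)"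

fun closed_list :: "(int \<times> int list list) list \<Rightarrow> int list list \<Rightarrow> int list list \<Rightarrow> bool" where
  "closed_list G M [] = True"
| "closed_list G M (b # bs) = (if closed_rows G b 0 M then closed_list G M bs else False)"

definition ungrade :: "(int \<times> int list list) list \<Rightarrow> int list list" where
  "ungrade G = concat (map snd G)"

definition pairing :: "int list list \<Rightarrow> int list \<Rightarrow> int list" where
  "pairing M b = map (dot b) M"

fun dominant_vector :: "int list list \<Rightarrow> int list \<Rightarrow> bool" where
  "dominant_vector [] b = True"
| "dominant_vector (row # M) b = (if dot b row < 0 then False else dominant_vector M b)"

definition long_vector :: "int list list \<Rightarrow> int \<Rightarrow> int list list \<Rightarrow> int list \<Rightarrow> int list \<Rightarrow> bool" where
  "long_vector M m cs b p = (if dot b p < m then False else list_all (\<lambda>c. dot c p = 0) cs)"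

text \<open>The candidates for the next \<open>\<beta>\<close> after the orthogonal roots
  \<open>cs\<close> with sum \<open>s\<close>, where \<open>m\<close> is a lower bound for the
  squared length. The inexpensive dominance test comes first.\<close>

fun choices :: "int list list \<Rightarrow> int \<Rightarrow> int list list \<Rightarrow> int list \<Rightarrow> int list list \<Rightarrow> int list list" where
  "choices M m cs s [] = []"
| "choices M m cs s (b # bs) = (if dominant_vector M (vadd s b)
     then if long_vector M m cs b (pairing M b) then b # choices M m cs s bs else choices M m cs s bs
     else choices M m cs s bs)"

definition negatives :: "int list list \<Rightarrow> int list list" where
  "negatives = map (map uminus)"

text \<open>Each stage must leave exactly one candidate and the stage after the last none. So the
  chain is forced and its length bounds \<open>l\<close>.\<close>

fun choice_chain :: "int list list \<Rightarrow> int \<Rightarrow> int list list \<Rightarrow> int list \<Rightarrow> int list list \<Rightarrow> int list list \<Rightarrow> bool" where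
  "choice_chain M m L s cs [] = (choices M m cs s L = [])"
| "choice_chain M m L s cs (b # bs) =
    (if choices M m cs s L = [b] then choice_chain M m L (vadd s b) (cs @ [b]) bs else False)"

fun weight_pairs :: "int list \<Rightarrow> int list \<Rightarrow> int list list \<Rightarrow> (int \<times> int) list" where
  "weight_pairs p d [] = []"
| "weight_pairs p d (b # bs) = (if dot b p = 0 then weight_pairs p d bs else (dot b p, dot b d) # weight_pairs p d bs)"

fun all_positive :: "int list \<Rightarrow> int list list \<Rightarrow> bool" where
  "all_positive d [] = True"
| "all_positive d (b # bs) = (if dot b d \<le> 0 then False else if list_all ((\<le>) 0) b then all_positive d bs else False)"

fun same_elements :: "(int \<times> int) list \<Rightarrow> (int \<times> int) list \<Rightarrow> bool" where
  "same_elements [] ys = (ys = [])"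
| "same_elements (x # xs) ys = (if List.member ys x then same_elements xs (remove1 x ys) else False)"

text \<open>By \<open>rho_simple\<close>, the dot product of a coefficient vector with this diagonal
  is twice the pairing with \<open>\<rho>\<close>, up to the scale \<open>c\<close>.\<close>

fun diagonal :: "nat \<Rightarrow> int list list \<Rightarrow> int list" where
  "diagonal i [] = []"
| "diagonal i (row # M) = row ! i # diagonal (Suc i) M"

section \<open>Correctness of the list functions\<close>

lemma dot_sum: "length xs = n \<Longrightarrow> length ys = n \<Longrightarrow> dot xs ys = (\<Sum>i<n. xs ! i * ys ! i)"
proof (induction xs arbitrary: ys n)
  case (Cons x xs)
  then obtain y zs m where "ys = y # zs" "n = Suc m" by (cases ys; cases n) auto
  then show ?case using Cons by (simp add: sum.lessThan_Suc_shift del: sum.lessThan_Suc)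
qed simp

lemma member_set: "member x ys \<longleftrightarrow> x \<in> set ys"
  by (induction ys) auto

lemma graded_member_set: "graded_member h x G \<Longrightarrow> x \<in> set (ungrade G)"
  by (induction h x G rule: graded_member.induct) (auto simp: ungrade_def member_set split: if_splits)

lemma dominant_vector_iff: "dominant_vector M b \<longleftrightarrow> (\<forall>row\<in>set M. dot b row \<ge> 0)"
  by (induction M) auto

lemma choices_filter: "choices M m cs s bs =
    filter (\<lambda>b. dominant_vector M (vadd s b) \<and> long_vector M m cs b (pairing M b)) bs"
  by (induction bs) auto

lemma closed_list_iff: "closed_list G M bs \<longleftrightarrow> (\<forall>b\<in>set bs. closed_rows G b 0 M)"
  by (induction bs) auto

lemma all_positive_iff: "all_positive d bs \<longleftrightarrow> (\<forall>b\<in>set bs. dot b d > 0 \<and> (\<forall>x\<in>set b. x \<ge> 0))"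
  by (induction bs) (auto simp: list_all_iff)

lemma closed_rows_nth:
  "closed_rows G b i rows \<Longrightarrow> j < length rows \<Longrightarrow> reflection_quotient G b (i + j) (2 * dot b (rows ! j)) (rows ! j ! (i + j))"
proof (induction rows arbitrary: i j)
  case (Cons row rows)
  show ?case
  proof (cases j)
    case 0
    then show ?thesis using Cons.prems by (simp split: if_splits)
  next
    case (Suc j')
    then show ?thesis using Cons.IH[of "Suc i" j'] Cons.prems by (simp split: if_splits)
  qed
qed simp

lemma diagonal_nth: "j < length M \<Longrightarrow> diagonal i M ! j = M ! j ! (i + j)" "length (diagonal i M) = length M"
  by (induction M arbitrary: i j) (auto simp: nth_Cons split: nat.splits)

lemma prod_list_remove1:
  fixes f :: "'b \<Rightarrow> real"
  shows "x \<in> set ys \<Longrightarrow> prod_list (map f ys) = f x * prod_list (map f (remove1 x ys))"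
  by (induction ys) auto

lemma same_elements_prod:
  fixes f :: "int \<times> int \<Rightarrow> real"
  shows "same_elements xs ys \<Longrightarrow> prod_list (map f xs) = prod_list (map f ys)"
proof (induction xs arbitrary: ys)
  case (Cons x xs)
  then have "x \<in> set ys" "same_elements xs (remove1 x ys)" by (auto split: if_splits)
  then show ?case using Cons.IH prod_list_remove1[of x ys f] by simp
qed simp

context root_datum
begin

text \<open>The sequence in terms of the form: long, mutually orthogonal roots with dominant partial
  sums. Outside type \<open>SO\<close>, where the convention fixes the choice, these properties
  determine it.\<close>

definition beta_chain :: "nat \<Rightarrow> (nat \<Rightarrow> 'w) \<Rightarrow> bool" where
  "beta_chain l \<beta> \<longleftrightarrow> (\<forall>i\<in>{1..l}. \<beta> i \<in> R \<and> (\<forall>b\<in>R. b \<cdot> b \<le> \<beta> i \<cdot> \<beta> i) \<and>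
    (\<forall>j\<in>{1..<i}. \<beta> i \<cdot> \<beta> j = 0) \<and> (\<forall>a\<in>P. a \<cdot> (\<Sum>j=1..i. \<beta> j) \<ge> 0))"

definition weyl_product :: "nat \<Rightarrow> 'w \<Rightarrow> real" where
  "weyl_product k \<sigma> = (\<Prod>a\<in>P. 1 + real k * (a \<cdot> \<sigma>) / (a \<cdot> \<rho>))"

lemma R_cases: "a \<in> R \<Longrightarrow> a \<in> P \<or> - a \<in> P"
  using P_neg by blast

end

text \<open>\<open>M\<close> is the Gram matrix of the simple roots up to the factor \<open>c\<close>. \<open>G\<close> lists the coefficient vectors of
  the positive roots, grouped by height to speed up the search for a vector.\<close>

locale listed_roots = root_datum R P form \<rho>
  for R P :: "'w::comm_ring_1 set" and form (infixl "\<cdot>" 70) and \<rho> +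
  fixes \<alpha> :: "nat \<Rightarrow> 'w" and M :: "int list list" and G :: "(int \<times> int list list) list" and c :: real
  assumes simple_eq: "simple = \<alpha> ` {1..length M}" and square: "\<forall>row\<in>set M. length row = length M"
    and c_pos: "c > 0"
    and form_\<alpha>: "i < length M \<Longrightarrow> j < length M \<Longrightarrow> \<alpha> (Suc i) \<cdot> \<alpha> (Suc j) = c * of_int (M ! i ! j)"
    and lengths: "\<forall>b\<in>set (ungrade G). length b = length M"
    and units: "\<forall>i<length M. unit_vector (length M) i \<in> set (ungrade G)"
    and closed: "closed_list G M (ungrade G)"
    and positive: "all_positive (diagonal 0 M) (ungrade G)"
    and separated: "distinct (map (pairing M) (ungrade G))"
begin

abbreviation "n \<equiv> length M"
abbreviation "L \<equiv> ungrade G"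

definition val :: "int list \<Rightarrow> 'w" where
  "val xs = (\<Sum>i<n. of_int (xs ! i) * \<alpha> (Suc i))"

lemma rows: "i < n \<Longrightarrow> length (M ! i) = n"
  using square by simp

lemma M_sym: "i < n \<Longrightarrow> j < n \<Longrightarrow> M ! i ! j = M ! j ! i"
  using form_\<alpha>[of i j] form_\<alpha>[of j i] form_sym[of "\<alpha> (Suc i)" "\<alpha> (Suc j)"] c_pos by simp

lemma form_val_simple: "i < n \<Longrightarrow> length xs = n \<Longrightarrow> val xs \<cdot> \<alpha> (Suc i) = c * of_int (dot xs (M ! i))"
  unfolding val_def form_sum_left form_of_int_left
  by (simp add: form_\<alpha> M_sym[of _ i] dot_sum[OF _ rows] sum_distrib_left mult_ac)

lemma form_val: "length xs = n \<Longrightarrow> length ys = n \<Longrightarrow> val xs \<cdot> val ys = c * of_int (dot ys (pairing M xs))"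
proof -
  assume l: "length xs = n" "length ys = n"
  have "val xs \<cdot> val ys = (\<Sum>i<n. of_int (ys ! i) * (val xs \<cdot> \<alpha> (Suc i)))"
    unfolding form_sym[of "val xs" "val ys"] unfolding val_def[of ys] form_sum_left form_of_int_left
    by (simp add: form_sym[of "\<alpha> _" "val xs"])
  then show ?thesis using l by (simp add: form_val_simple dot_sum[of _ n] pairing_def sum_distrib_left mult_ac)
qed

lemma simple_in: "i < n \<Longrightarrow> \<alpha> (Suc i) \<in> simple"
  unfolding simple_eq by auto

lemma form_val_rho: "length xs = n \<Longrightarrow> val xs \<cdot> \<rho> = c / 2 * of_int (dot xs (diagonal 0 M))"
proof -
  assume l: "length xs = n"
  have "\<alpha> (Suc i) \<cdot> \<rho> = c / 2 * of_int (M ! i ! i)" if "i < n" for i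
    using rho_simple[OF simple_in[OF that]] form_sym[of \<rho> "\<alpha> (Suc i)"] form_\<alpha>[OF that that] by simp
  then have "val xs \<cdot> \<rho> = (\<Sum>i<n. of_int (xs ! i) * (c / 2 * of_int (M ! i ! i)))"
    unfolding val_def form_sum_left form_of_int_left by (intro sum.cong) auto
  then show ?thesis using l by (simp add: dot_sum[of _ n] diagonal_nth sum_distrib_left mult_ac)
qed

lemma simpleE: "a \<in> simple \<Longrightarrow> (\<And>i. i < n \<Longrightarrow> a = \<alpha> (Suc i) \<Longrightarrow> thesis) \<Longrightarrow> thesis"
proof -
  assume a: "a \<in> simple" and E: "\<And>i. i < n \<Longrightarrow> a = \<alpha> (Suc i) \<Longrightarrow> thesis"
  obtain j where j: "j \<in> {1..n}" "a = \<alpha> j" using a unfolding simple_eq by blast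
  show thesis by (rule E[of "j - 1"]) (use j in auto)
qed

lemma val_unit: "i < n \<Longrightarrow> val (unit_vector n i) = \<alpha> (Suc i)"
proof -
  assume i: "i < n"
  have "val (unit_vector n i) = (\<Sum>j<n. if j = i then \<alpha> (Suc i) else 0)"
    unfolding val_def by (rule sum.cong) (auto simp: unit_vector_def nth_list_update)
  then show ?thesis using i by simp
qed

lemma val_vadd: "length xs = n \<Longrightarrow> length ys = n \<Longrightarrow> val (vadd xs ys) = val xs + val ys"
  unfolding val_def by (simp add: vadd_def distrib_right sum.distrib)

lemma length_vadd: "length xs = n \<Longrightarrow> length ys = n \<Longrightarrow> length (vadd xs ys) = n"
  by (simp add: vadd_def)

lemma val_uminus: "length xs = n \<Longrightarrow> val (map uminus xs) = - val xs"
  unfolding val_def by (simp add: sum_negf)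

lemma val_update: "length xs = n \<Longrightarrow> i < n \<Longrightarrow> val (xs[i := xs ! i - m]) = val xs - of_int m * \<alpha> (Suc i)"
proof -
  assume l: "length xs = n" "i < n"
  have "val (xs[i := xs ! i - m]) = (\<Sum>j<n. of_int (xs ! j) * \<alpha> (Suc j) - (if j = i then of_int m * \<alpha> (Suc i) else 0))"
    unfolding val_def by (rule sum.cong) (use l in \<open>auto simp: nth_list_update algebra_simps\<close>)
  then show ?thesis using l unfolding sum_subtractf val_def by simp
qed

text \<open>Equal values have equal products with all simple roots, and by \<open>separated\<close>
  those products tell the listed vectors apart.\<close>

lemma inj_val: "distinct (map val L)"
proof -
  have "xs = ys" if xs: "xs \<in> set L" and ys: "ys \<in> set L" and eq: "val xs = val ys" for xs ys
  proof -
    have "pairing M xs = pairing M ys"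
      unfolding pairing_def
    proof (rule map_cong[OF refl])
      fix row assume "row \<in> set M"
      then obtain i where i: "i < n" "row = M ! i" by (metis in_set_conv_nth)
      then show "dot xs row = dot ys row"
        using form_val_simple[OF i(1), of xs] form_val_simple[OF i(1), of ys] lengths xs ys eq c_pos by simp
    qed
    then show ?thesis using separated xs ys unfolding distinct_map inj_on_def by blast
  qed
  moreover have "distinct L" using separated unfolding distinct_map by simp
  ultimately show ?thesis unfolding distinct_map inj_on_def by blast
qed

lemma P_eq: "P = val ` set L"
proof (rule P_eqI, unfold reflection_closed_def, intro conjI ballI impI)
  show "simple \<subseteq> val ` set L"
  proof
    fix a assume "a \<in> simple"
    then obtain i where i: "i < n" "a = \<alpha> (Suc i)" by (rule simpleE)
    show "a \<in> val ` set L"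
      unfolding i(2) val_unit[OF i(1), symmetric] by (rule imageI) (use units i(1) in blast)
  qed
  show "val ` set L \<subseteq> cone - {0}"
  proof (rule image_subsetI)
    fix b assume b: "b \<in> set L"
    then have l: "length b = n" and p: "dot b (diagonal 0 M) > 0" "\<forall>x\<in>set b. x \<ge> 0"
      using lengths positive unfolding all_positive_iff by auto
    have "of_int (b ! i) * \<alpha> (Suc i) \<in> cone" if "i < n" for i
    proof -
      have "b ! i \<in> set b" using l that by simp
      then have "b ! i \<ge> 0" by (rule bspec[OF p(2)])
      then obtain q where q: "b ! i = int q" by (rule nonneg_int_cases)
      have "of_nat q * a \<in> cone" if "a \<in> cone" for a
        using that by (induction q) (auto simp: cone_zero distrib_right intro: cone_add)
      then show ?thesis unfolding q using simple_in[OF that] by (simp add: cone_P simple_P)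
    qed
    then have "val b \<in> cone" unfolding val_def by (intro cone_sum) auto
    moreover have "val b \<noteq> 0" using form_val_rho[OF l] p(1) c_pos by auto
    ultimately show "val b \<in> cone - {0}" by simp
  qed
  fix x a assume x: "x \<in> val ` set L" and a: "a \<in> simple" and ne: "x \<noteq> a"
  obtain b where b: "b \<in> set L" "x = val b" using x by blast
  have l: "length b = n" using lengths b(1) by blast
  obtain i where i: "i < n" "a = \<alpha> (Suc i)" using a by (rule simpleE)
  have "reflection_quotient G b (0 + i) (2 * dot b (M ! i)) (M ! i ! (0 + i))"
    by (rule closed_rows_nth[OF _ i(1)]) (use closed b(1) in \<open>simp add: closed_list_iff\<close>)
  then have q: "reflection_quotient G b i (2 * dot b (M ! i)) (M ! i ! i)" by simp
  define m where "m = 2 * dot b (M ! i) div M ! i ! i"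
  have aa: "a \<cdot> a = c * of_int (M ! i ! i)" unfolding i(2) by (rule form_\<alpha>[OF i(1) i(1)])
  have "a \<cdot> a > 0" using form_pos P_subset simple_P[OF a] by blast
  moreover have m: "m * (M ! i ! i) = 2 * dot b (M ! i)"
    using q unfolding reflection_quotient_def reflection_test_def m_def by (simp split: if_splits)
  moreover have "2 * (x \<cdot> a) = of_int m * (a \<cdot> a)"
  proof -
    have "2 * (x \<cdot> a) = c * of_int (2 * dot b (M ! i))"
      unfolding b(2) i(2) form_val_simple[OF i(1) l] by simp
    also have "\<dots> = of_int m * (a \<cdot> a)" unfolding m[symmetric] aa by simp
    finally show ?thesis .
  qed
  ultimately have r: "refl a x = x - of_int m * a" using reflI(2)[of x a m] by simp
  have "m = 0 \<or> b = unit_vector n i \<or> b[i := b ! i - m] \<in> set L"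
    using q graded_member_set[of "sum_list b - m" "b[i := b ! i - m]" G] l
    unfolding reflection_quotient_def reflection_test_def m_def by (simp split: if_splits)
  moreover have "b \<noteq> unit_vector n i" using ne val_unit[OF i(1)] unfolding b(2) i(2) by metis
  moreover have "b[i := b ! i - m] \<in> set L" if "m = 0" using b(1) that by simp
  ultimately have "b[i := b ! i - m] \<in> set L" by blast
  moreover have "refl a x = val (b[i := b ! i - m])" using r unfolding b(2) i(2) val_update[OF l i(1)] .
  ultimately show "refl a x \<in> val ` set L" by simp
qed simp

lemma choices_unique:
  assumes chain: "beta_chain l \<beta>" and i: "Suc i \<le> l"
    and cs: "length cs = i" "\<And>j. j < i \<Longrightarrow> \<beta> (Suc j) = val (cs ! j)" "\<forall>b\<in>set cs. length b = n"
    and s: "length s = n" "val s = (\<Sum>j=1..i. \<beta> j)"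
    and m: "b1 \<in> set L" "m = dot b1 (pairing M b1)"
  shows "\<exists>b\<in>set (choices M m cs s (L @ negatives L)). \<beta> (Suc i) = val b"
proof -
  note chain' = bspec[OF chain[unfolded beta_chain_def], of "Suc i"]
  have c: "\<beta> (Suc i) \<in> R" "\<forall>b\<in>R. b \<cdot> b \<le> \<beta> (Suc i) \<cdot> \<beta> (Suc i)"
    "\<forall>j\<in>{1..<Suc i}. \<beta> (Suc i) \<cdot> \<beta> j = 0" "\<forall>a\<in>P. a \<cdot> (\<Sum>j=1..Suc i. \<beta> j) \<ge> 0"
    using chain' i by auto
  have "\<exists>b\<in>set (L @ negatives L). \<beta> (Suc i) = val b"
  proof (cases "\<beta> (Suc i) \<in> P")
    case True
    then show ?thesis unfolding P_eq by auto
  next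
    case False
    then have "- \<beta> (Suc i) \<in> P" using R_cases[OF c(1)] by blast
    then obtain b where b: "b \<in> set L" "- \<beta> (Suc i) = val b" unfolding P_eq by blast
    then have "\<beta> (Suc i) = - val b" by (metis add.inverse_inverse)
    then have "\<beta> (Suc i) = val (map uminus b)" using val_uminus[of b] b(1) lengths by simp
    then show ?thesis using b(1) by (auto simp: negatives_def)
  qed
  then obtain b where b: "b \<in> set (L @ negatives L)" "\<beta> (Suc i) = val b" by blast
  have l: "length b = n" using b(1) lengths by (auto simp: negatives_def)
  have "dominant_vector M (vadd s b)"
    unfolding dominant_vector_iff
  proof
    fix row assume "row \<in> set M"
    then obtain q where q: "q < n" "row = M ! q" by (metis in_set_conv_nth)
    have "val (vadd s b) = (\<Sum>j=1..Suc i. \<beta> j)" unfolding val_vadd[OF s(1) l] s(2) b(2)[symmetric] by simp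
    then have "\<alpha> (Suc q) \<cdot> val (vadd s b) \<ge> 0"
      using c(4) simple_P[OF simple_in[OF q(1)]] by simp
    then have "val (vadd s b) \<cdot> \<alpha> (Suc q) \<ge> 0" unfolding form_sym[of "\<alpha> (Suc q)" "val (vadd s b)"] .
    then show "dot (vadd s b) row \<ge> 0"
      using c_pos unfolding form_val_simple[OF q(1) length_vadd[OF s(1) l]] q(2) by (simp add: zero_le_mult_iff)
  qed
  moreover have "m \<le> dot b (pairing M b)"
  proof -
    have l1: "length b1 = n" using m(1) lengths by blast
    have "val b1 \<in> R" using m(1) P_eq P_subset by blast
    then have "val b1 \<cdot> val b1 \<le> val b \<cdot> val b" using c(2) b(2) by simp
    then show ?thesis using c_pos unfolding form_val[OF l l] form_val[OF l1 l1] m(2) by simp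
  qed
  moreover have "dot d (pairing M b) = 0" if d: "d \<in> set cs" for d
  proof -
    obtain j where j: "j < i" "d = cs ! j" using d cs(1) by (metis in_set_conv_nth)
    have ld: "length d = n" using cs(3) d by blast
    have "\<beta> (Suc i) \<cdot> \<beta> (Suc j) = 0" using c(3) j(1) by simp
    then have "val b \<cdot> val d = 0" unfolding b(2) cs(2)[OF j(1)] j(2) .
    then show ?thesis using c_pos unfolding form_val[OF l ld] by simp
  qed
  ultimately have "b \<in> set (choices M m cs s (L @ negatives L))"
    using b(1) unfolding choices_filter long_vector_def list_all_iff by auto
  then show ?thesis using b(2) by blast
qed

lemma choice_chain_unique:
  assumes chain: "beta_chain l \<beta>" and "choice_chain M m (L @ negatives L) s cs bs"
    and "length cs \<le> l" "\<And>j. j < length cs \<Longrightarrow> \<beta> (Suc j) = val (cs ! j)" "\<forall>b\<in>set cs. length b = n"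
    and "length s = n" "val s = (\<Sum>j=1..length cs. \<beta> j)"
    and m: "b1 \<in> set L" "m = dot b1 (pairing M b1)" and bs: "\<forall>b\<in>set bs. length b = n"
  shows "l \<le> length (cs @ bs) \<and> (\<forall>j<l. \<beta> (Suc j) = val ((cs @ bs) ! j))"
  using assms(2-7) bs
proof (induction bs arbitrary: s cs)
  case Nil
  have "\<not> Suc (length cs) \<le> l"
  proof
    assume "Suc (length cs) \<le> l"
    from choices_unique[OF chain this refl Nil(3,4,5,6) m] show False using Nil(1) by simp
  qed
  then show ?case using Nil by simp
next
  case (Cons b bs)
  show ?case
  proof (cases "length cs = l")
    case True
    then show ?thesis using Cons.prems(3) by (simp add: nth_append)
  next
    case False
    then have i: "Suc (length cs) \<le> l" using Cons.prems(2) by simp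
    have ch: "choices M m cs s (L @ negatives L) = [b]" "choice_chain M m (L @ negatives L) (vadd s b) (cs @ [b]) bs"
      using Cons.prems(1) by (auto split: if_splits)
    have lb: "length b = n" using Cons.prems(7) by simp
    have \<beta>: "\<beta> (Suc (length cs)) = val b"
      using choices_unique[OF chain i refl Cons.prems(3,4,5,6) m] ch(1) by simp
    have "l \<le> length ((cs @ [b]) @ bs) \<and> (\<forall>j<l. \<beta> (Suc j) = val (((cs @ [b]) @ bs) ! j))"
    proof (rule Cons.IH[OF ch(2)])
      show "length (cs @ [b]) \<le> l" using i by simp
      show "\<beta> (Suc j) = val ((cs @ [b]) ! j)" if "j < length (cs @ [b])" for j
        using that \<beta> Cons.prems(3) by (cases "j = length cs") (auto simp: nth_append)
      show "\<forall>x\<in>set (cs @ [b]). length x = n" using lb Cons.prems(4) by simp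
      show "length (vadd s b) = n" by (rule length_vadd[OF Cons.prems(5) lb])
      show "val (vadd s b) = (\<Sum>j=1..length (cs @ [b]). \<beta> j)"
        unfolding val_vadd[OF Cons.prems(5) lb] Cons.prems(6) by (simp add: \<beta>)
      show "\<forall>b\<in>set bs. length b = n" using Cons.prems(7) by simp
    qed
    then show ?thesis by simp
  qed
qed

lemma weyl_product_list:
  assumes s: "length s = n" "val s = \<sigma>"
  shows "weyl_product k \<sigma> = prod_list (map (\<lambda>(p, h). 1 + 2 * real k * of_int p / of_int h)
    (weight_pairs (pairing M s) (diagonal 0 M) L))"
proof -
  have "weyl_product k \<sigma> = (\<Prod>x\<in>set (map val L). 1 + real k * (x \<cdot> \<sigma>) / (x \<cdot> \<rho>))"
    unfolding weyl_product_def by (simp add: P_eq)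
  also have "\<dots> = prod_list (map (\<lambda>b. 1 + real k * (val b \<cdot> \<sigma>) / (val b \<cdot> \<rho>)) L)"
    using prod.distinct_set_conv_list[OF inj_val] by (simp add: comp_def)
  also have "map (\<lambda>b. 1 + real k * (val b \<cdot> \<sigma>) / (val b \<cdot> \<rho>)) L =
      map (\<lambda>b. 1 + 2 * real k * of_int (dot b (pairing M s)) / of_int (dot b (diagonal 0 M))) L"
  proof (rule map_cong[OF refl])
    fix b assume b: "b \<in> set L"
    then have l: "length b = n" using lengths by blast
    have 1: "val b \<cdot> \<sigma> = c * of_int (dot b (pairing M s))"
      using form_val[OF s(1) l] form_sym[of "val s" "val b"] s(2) by simp
    show "1 + real k * (val b \<cdot> \<sigma>) / (val b \<cdot> \<rho>) =
        1 + 2 * real k * of_int (dot b (pairing M s)) / of_int (dot b (diagonal 0 M))"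
      unfolding 1 form_val_rho[OF l] using c_pos by simp
  qed
  also have "prod_list (map (\<lambda>b. 1 + 2 * real k * of_int (dot b p) / of_int (dot b d)) bs) =
      prod_list (map (\<lambda>(p, h). 1 + 2 * real k * of_int p / of_int h) (weight_pairs p d bs))" for p d bs
    by (induction bs) auto
  finally show ?thesis .
qed

end

section \<open>Gram matrices from Dynkin diagrams, and strings of weight factors\<close>

fun gram_row :: "simple_type \<Rightarrow> nat \<Rightarrow> nat list \<Rightarrow> int list" where
  "gram_row T i [] = []"
| "gram_row T i (j # js) = cartan_integer T i j * int (sq_length T j) # gram_row T i js"

fun gram_rows :: "simple_type \<Rightarrow> nat list \<Rightarrow> nat list \<Rightarrow> int list list" where
  "gram_rows T [] js = []"
| "gram_rows T (i # is) js = gram_row T i js # gram_rows T is js"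

text \<open>\<open>m\<close> pairs with the same first entry \<open>p\<close> and second entries
  \<open>a + q, a + 2 q, ...\<close>; such a string becomes one quotient of binomials.\<close>

fun string_pairs :: "int \<Rightarrow> int \<Rightarrow> int \<Rightarrow> nat \<Rightarrow> (int \<times> int) list" where
  "string_pairs p q a 0 = []"
| "string_pairs p q a (Suc m) = (p, q + a) # string_pairs p q (q + a) m"

declare string_pairs.simps [simp del]

fun linked_to :: "simple_type \<Rightarrow> nat \<Rightarrow> nat list \<Rightarrow> bool" where
  "linked_to T j [] = False"
| "linked_to T j (i # is) = (if cartan_integer T i j \<noteq> 0 \<and>
      cartan_integer T i j * int (sq_length T j) = cartan_integer T j i * int (sq_length T i)
     then True else linked_to T j is)"

text \<open>Each node is linked to an earlier one, through which \<open>dynkin_step\<close>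
  determines its norm.\<close>

fun connected_order :: "simple_type \<Rightarrow> nat list \<Rightarrow> nat list \<Rightarrow> bool" where
  "connected_order T is [] = True"
| "connected_order T is (j # js) = (if linked_to T j is then connected_order T (j # is) js else False)"

definition root_list_check :: "simple_type \<Rightarrow> nat list \<Rightarrow> int list list \<Rightarrow> (int \<times> int list list) list \<Rightarrow> bool" where
  "root_list_check T js M G \<longleftrightarrow> sq_length T 1 > 0 \<and> connected_order T [1] js \<and> sort (1 # js) = [1..<Suc (length M)] \<and>
    gram_rows T [1..<Suc (length M)] [1..<Suc (length M)] = M \<and> length M = type_rank T \<and>
    list_all (\<lambda>row. length row = length M) M \<and> list_all (\<lambda>b. length b = length M) (ungrade G) \<and>
    list_all (\<lambda>i. member (unit_vector (length M) i) (ungrade G)) [0..<length M] \<and>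
    closed_list G M (ungrade G) \<and> all_positive (diagonal 0 M) (ungrade G) \<and> distinct (map (pairing M) (ungrade G))"

definition chain_check :: "int list list \<Rightarrow> (int \<times> int list list) list \<Rightarrow> int list list \<Rightarrow> bool" where
  "chain_check M G bs \<longleftrightarrow> list_all (\<lambda>b. length b = length M) bs \<and> member (hd bs) (ungrade G) \<and>
    choice_chain M (dot (hd bs) (pairing M (hd bs))) (ungrade G @ negatives (ungrade G)) (replicate (length M) 0) [] bs"

text \<open>\<open>negs\<close> fills gaps: roots that form a complete string only after some pairs
  are added are treated by adding those pairs on both sides.\<close>

definition pairs_check :: "int list list \<Rightarrow> (int \<times> int list list) list \<Rightarrow> int list list \<Rightarrow>
    (int \<times> int) list \<Rightarrow> (int \<times> int) list \<Rightarrow> bool" where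
  "pairs_check M G bs negs pos \<longleftrightarrow> same_elements (weight_pairs
    (pairing M (foldr vadd bs (replicate (length M) 0))) (diagonal 0 M) (ungrade G) @ negs) pos"

text \<open>\<open>h\<close> is a pairing with \<open>2 \<rho>\<close> and \<open>p\<close> one with
  the weight, whence the factor 2.\<close>

definition pair_factor :: "nat \<Rightarrow> int \<times> int \<Rightarrow> real" where
  "pair_factor k = (\<lambda>(p, h). 1 + 2 * real k * of_int p / of_int h)"

text \<open>With \<open>h = q * (a / q + j)\<close> the factor \<open>1 + 2 k p / h\<close> is
  \<open>1 + K / (a / q + j)\<close>, which telescopes. The two cases in use are
  \<open>q = 2 p\<close> with \<open>K = k\<close> and \<open>q = p\<close> with
  \<open>K = 2 k\<close>.\<close>

lemma string_pairs_prod: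
  assumes "int K * q = 2 * int k * p" "q > 0" "a > - q"
  shows "prod_list (map (pair_factor k) (string_pairs p q a m)) =
    rbinom K (of_int a / of_int q + real m) / rbinom K (of_int a / of_int q)"
  using assms(3)
proof (induction m arbitrary: a)
  case 0
  have "real_of_int a / of_int q > - 1" using 0 assms(2) by (simp add: field_simps)
  then show ?case using rbinom_nonzero[of "of_int a / of_int q" K] by (simp add: string_pairs.simps)
next
  case (Suc m)
  let ?x = "real_of_int a / of_int q"
  have x: "?x > - 1" using Suc.prems assms(2) by (simp add: field_simps)
  have e: "real_of_int (q + a) / of_int q = ?x + 1" using assms(2) by (simp add: field_simps)
  have K: "real K * of_int q = 2 * real k * of_int p"
    using assms(1) by (metis of_int_mult of_int_numeral of_int_of_nat_eq)
  have "1 + 2 * real k * of_int p / of_int (q + a) = 1 + real K / (?x + 1)"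
    unfolding K[symmetric] e[symmetric] by simp
  also have "\<dots> = rbinom K (?x + 1) / rbinom K ?x" using rbinom_ratio[of "?x + 1" K] x by simp
  finally have 1: "1 + 2 * real k * of_int p / of_int (q + a) = rbinom K (?x + 1) / rbinom K ?x" .
  have nz: "rbinom K (?x + 1) \<noteq> 0" using x by (intro rbinom_nonzero) simp
  have "q + a > - q" using Suc.prems assms(2) by simp
  note IH = Suc.IH[OF this, unfolded e]
  show ?case unfolding string_pairs.simps(2) list.map prod_list.Cons IH
    using 1 nz by (simp add: pair_factor_def add_ac)
qed

lemma gram_row_nth: "j < length js \<Longrightarrow> gram_row T i js ! j = cartan_integer T i (js ! j) * int (sq_length T (js ! j))"
  by (induction js arbitrary: j) (auto simp: nth_Cons split: nat.splits)

lemma gram_rows_nth: "i < length is \<Longrightarrow> gram_rows T is js ! i = gram_row T (is ! i) js"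
  by (induction "is" arbitrary: i) (auto simp: nth_Cons split: nat.splits)

context listed_roots
begin

lemma weyl_product_pairs:
  assumes "length s = n" "val s = \<sigma>"
    and "same_elements (weight_pairs (pairing M s) (diagonal 0 M) L @ negs) pos"
  shows "weyl_product k \<sigma> * prod_list (map (pair_factor k) negs) = prod_list (map (pair_factor k) pos)"
  using same_elements_prod[OF assms(3), of "pair_factor k"] weyl_product_list[OF assms(1,2), of k]
  unfolding pair_factor_def[symmetric] by simp

end

context root_datum
begin

definition dynkin :: "simple_type \<Rightarrow> (nat \<Rightarrow> 'w) \<Rightarrow> bool" where
  "dynkin T \<alpha> \<longleftrightarrow> simple = \<alpha> ` {1..type_rank T} \<and>
    (\<forall>i\<in>{1..type_rank T}. \<forall>j\<in>{1..type_rank T}. 2 * (\<alpha> i \<cdot> \<alpha> j) = of_int (cartan_integer T i j) * (\<alpha> j \<cdot> \<alpha> j))"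

text \<open>The form is symmetric, so the two Cartan integers of an edge give the ratio of the norms
  at its ends.\<close>

lemma dynkin_step:
  assumes "dynkin T \<alpha>" "i \<in> {1..type_rank T}" "j \<in> {1..type_rank T}"
    and N: "\<alpha> i \<cdot> \<alpha> i = 2 * c * real (sq_length T i)"
    and "cartan_integer T i j \<noteq> 0"
      "cartan_integer T i j * int (sq_length T j) = cartan_integer T j i * int (sq_length T i)"
  shows "\<alpha> j \<cdot> \<alpha> j = 2 * c * real (sq_length T j)"
proof -
  have "real_of_int (cartan_integer T i j) * (\<alpha> j \<cdot> \<alpha> j) = of_int (cartan_integer T j i) * (\<alpha> i \<cdot> \<alpha> i)"
    using assms(1-3) form_sym[of "\<alpha> i" "\<alpha> j"] unfolding dynkin_def by (metis (no_types, lifting))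
  also have "\<dots> = 2 * c * of_int (cartan_integer T j i * int (sq_length T i))" unfolding N by simp
  also have "\<dots> = of_int (cartan_integer T i j) * (2 * c * real (sq_length T j))" unfolding assms(6)[symmetric] by simp
  finally show ?thesis using assms(5) by simp
qed

lemma dynkin_form:
  assumes "dynkin T \<alpha>" "i \<in> {1..type_rank T}" "j \<in> {1..type_rank T}"
    "\<alpha> j \<cdot> \<alpha> j = 2 * c * real (sq_length T j)"
  shows "\<alpha> i \<cdot> \<alpha> j = c * of_int (cartan_integer T i j * int (sq_length T j))"
proof -
  have "2 * (\<alpha> i \<cdot> \<alpha> j) = of_int (cartan_integer T i j) * (\<alpha> j \<cdot> \<alpha> j)" using assms(1-3) unfolding dynkin_def by blast
  then show ?thesis unfolding assms(4) by simp
qed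

lemma dynkin_pos:
  assumes "dynkin T \<alpha>" "1 \<le> type_rank T" "sq_length T 1 > 0"
  obtains c where "c > 0" "\<alpha> 1 \<cdot> \<alpha> 1 = 2 * c * real (sq_length T 1)"
proof
  have "\<alpha> 1 \<in> simple" using assms(1,2) unfolding dynkin_def by auto
  then have "\<alpha> 1 \<cdot> \<alpha> 1 > 0" using simple_P P_subset form_pos by blast
  then show "\<alpha> 1 \<cdot> \<alpha> 1 / (2 * real (sq_length T 1)) > 0" using assms(3) by simp
  show "\<alpha> 1 \<cdot> \<alpha> 1 = 2 * (\<alpha> 1 \<cdot> \<alpha> 1 / (2 * real (sq_length T 1))) * real (sq_length T 1)"
    using assms(3) by simp
qed

lemma connected_norms:
  assumes "dynkin T \<alpha>" "connected_order T is js"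
    and "\<And>i. i \<in> set is \<Longrightarrow> i \<in> {1..type_rank T} \<and> \<alpha> i \<cdot> \<alpha> i = 2 * c * real (sq_length T i)"
    and "set js \<subseteq> {1..type_rank T}" "j \<in> set is \<union> set js"
  shows "\<alpha> j \<cdot> \<alpha> j = 2 * c * real (sq_length T j)"
  using assms(2-)
proof (induction js arbitrary: "is")
  case (Cons x js)
  have *: "linked_to T x is" "connected_order T (x # is) js" using Cons.prems(1) by (auto split: if_splits)
  have "\<exists>i\<in>set ys. cartan_integer T i x \<noteq> 0 \<and>
      cartan_integer T i x * int (sq_length T x) = cartan_integer T x i * int (sq_length T i)" if "linked_to T x ys" for ys
    using that by (induction ys) (auto split: if_splits)
  then obtain i where i: "i \<in> set is" "cartan_integer T i x \<noteq> 0"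
      "cartan_integer T i x * int (sq_length T x) = cartan_integer T x i * int (sq_length T i)"
    using *(1) by blast
  have x: "x \<in> {1..type_rank T}" using Cons.prems(3) by simp
  have "\<alpha> x \<cdot> \<alpha> x = 2 * c * real (sq_length T x)"
    by (rule dynkin_step[OF assms(1) _ x _ i(2,3)]) (use Cons.prems(2)[OF i(1)] in auto)
  then show ?case using Cons.IH[OF *(2)] Cons.prems x by auto
qed simp

lemma listed_rootsI:
  assumes T: "dynkin T \<alpha>" and check: "root_list_check T js M G"
  obtains c where "listed_roots R P form \<rho> \<alpha> M G c"
proof -
  have M: "length M = type_rank T" "gram_rows T [1..<Suc (length M)] [1..<Suc (length M)] = M"
    and sort: "sort (1 # js) = [1..<Suc (length M)]"
    using check unfolding root_list_check_def by blast+
  have "set (1 # js) = set (sort (1 # js))" by (simp only: set_sort)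
  also have "\<dots> = {1..type_rank T}" unfolding sort M(1) by auto
  finally have js: "set (1 # js) = {1..type_rank T}" .
  have "1 \<le> type_rank T" "sq_length T 1 > 0" using js check by (auto simp: root_list_check_def)
  then obtain c where c: "c > 0" "\<alpha> 1 \<cdot> \<alpha> 1 = 2 * c * real (sq_length T 1)"
    using dynkin_pos[OF T] by blast
  have norms: "\<alpha> j \<cdot> \<alpha> j = 2 * c * real (sq_length T j)" if "j \<in> {1..type_rank T}" for j
    by (rule connected_norms[OF T, of "[1]" js]) (use c js check that in \<open>auto simp: root_list_check_def\<close>)
  have "listed_roots R P form \<rho> \<alpha> M G c"
  proof (unfold_locales, goal_cases)
    case (4 i j)
    have "M ! i ! j = cartan_integer T (Suc i) (Suc j) * int (sq_length T (Suc j))"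
      by (subst M(2)[symmetric]) (use 4 in \<open>simp add: gram_rows_nth gram_row_nth del: upt_Suc\<close>)
    then show ?case using dynkin_form[OF T _ _ norms, of "Suc i" "Suc j"] 4 M(1) by simp
  qed (use T c check in \<open>auto simp: dynkin_def list_all_iff member_set root_list_check_def\<close>)
  then show thesis by (rule that)
qed

lemma listed_weyl_product:
  assumes T: "dynkin T \<alpha>" and chain: "beta_chain l \<beta>" and check: "root_list_check T js M G" "chain_check M G bs"
  shows "l \<le> length bs"
    and "pairs_check M G (take l bs) negs pos \<Longrightarrow> weyl_product k (\<Sum>j=1..l. \<beta> j) *
      prod_list (map (pair_factor k) negs) = prod_list (map (pair_factor k) pos)"
proof -
  obtain c where "listed_roots R P form \<rho> \<alpha> M G c" by (rule listed_rootsI[OF T check(1)])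
  then interpret X: listed_roots R P form \<rho> \<alpha> M G c .
  have bs: "\<forall>b\<in>set bs. length b = length M" "hd bs \<in> set (ungrade G)"
    using check(2) unfolding chain_check_def by (auto simp: list_all_iff member_set)
  have val0: "X.val (replicate (length M) 0) = 0" by (simp add: X.val_def)
  have l: "l \<le> length bs \<and> (\<forall>j<l. \<beta> (Suc j) = X.val (bs ! j))"
    using X.choice_chain_unique[OF chain, where cs = "[]" and bs = bs and s = "replicate (length M) 0", OF _ _ _ _ _ _ bs(2) refl bs(1)]
      check(2) val0 unfolding chain_check_def by simp
  then show "l \<le> length bs" by simp
  assume p: "pairs_check M G (take l bs) negs pos"
  have fold: "length (foldr vadd cs (replicate (length M) 0)) = length M \<and>
      X.val (foldr vadd cs (replicate (length M) 0)) = sum_list (map X.val cs)" if "\<forall>b\<in>set cs. length b = length M" for cs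
    using that by (induction cs) (auto simp: val0 X.val_vadd X.length_vadd)
  have t: "\<forall>b\<in>set (take l bs). length b = length M" using bs(1) by (auto dest: in_set_takeD)
  have "(\<Sum>j=1..l. \<beta> j) = (\<Sum>j<l. \<beta> (Suc j))" by (induction l) auto
  also have "\<dots> = (\<Sum>j<l. X.val (bs ! j))" using l by simp
  also have "\<dots> = sum_list (map X.val (take l bs))" using l by (simp add: sum_list_sum_nth atLeast0LessThan)
  also have "\<dots> = X.val (foldr vadd (take l bs) (replicate (length M) 0))"
    using fold[OF t] by simp
  finally have s: "(\<Sum>j=1..l. \<beta> j) = \<dots>" .
  show "weyl_product k (\<Sum>j=1..l. \<beta> j) * prod_list (map (pair_factor k) negs) = prod_list (map (pair_factor k) pos)"
    by (rule X.weyl_product_pairs[OF _ s[symmetric] p[unfolded pairs_check_def]])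
      (use fold[OF t] in simp)
qed

end

lemma string_pairs_ratio:
  assumes "q > 0" "a > - q"
  shows "q = 2 * p \<Longrightarrow> prod_list (map (pair_factor k) (string_pairs p q a m)) =
      rbinom k (of_int a / of_int q + real m) / rbinom k (of_int a / of_int q)"
    and "q = p \<Longrightarrow> prod_list (map (pair_factor k) (string_pairs p q a m)) =
      rbinom (2 * k) (of_int a / of_int q + real m) / rbinom (2 * k) (of_int a / of_int q)"
  using string_pairs_prod[OF _ assms, of k k p m] string_pairs_prod[OF _ assms, of "2 * k" k p m] by auto

lemma dim_formula_valueI:
  "vogel_parameters T = (b, c) \<Longrightarrow> dim_denominator l k b c \<noteq> 0 \<Longrightarrow>
    d * dim_denominator l k b c = dim_numerator l k b c \<Longrightarrow> dim_formula_value T l k d"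
  unfolding dim_formula_value_def by (simp add: eq_divide_eq)

lemma prod_up_to_two: "prod f {1..2::nat} = f 1 * f 2"
  by (simp add: numeral_2_eq_2)

lemmas exceptional_simps = dim_numerator_rbinom dim_denominator_rbinom prod_up_to_two[simplified]
  string_pairs_ratio rbinom_nonzero field_simps

section \<open>The dimension formula for the classical types\<close>

context type_A_roots
begin

text \<open>The coordinates of \<open>\<beta> 1 + ... + \<beta> m\<close> for
  \<open>\<beta> j = e j - e (n + 1 - j)\<close>.\<close>

definition w :: "nat \<Rightarrow> nat \<Rightarrow> real" where
  "w m i = (if i \<le> m then 1 else 0) - (if n - m < i then 1 else 0)"

lemma form_sigma:
  assumes "\<And>j. j \<in> {1..m} \<Longrightarrow> 2 * j \<le> n \<and> \<beta> j = e j - e (n + 1 - j)" and ab: "u \<in> {1..n}" "z \<in> {1..n}"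
  shows "(e u - e z) \<cdot> (\<Sum>j=1..m. \<beta> j) = c * (w m u - w m z)"
  using assms(1)
proof (induction m)
  case 0
  then show ?case using ab by (simp add: w_def)
next
  case (Suc m)
  have m: "2 * Suc m \<le> n" "\<beta> (Suc m) = e (Suc m) - e (n + 1 - Suc m)" using Suc.prems[of "Suc m"] by auto
  have IH: "(e u - e z) \<cdot> (\<Sum>j=1..m. \<beta> j) = c * (w m u - w m z)" using Suc by simp
  have step: "w (Suc m) i = w m i + (\<delta> i (Suc m) - \<delta> i (n + 1 - Suc m))" if "i \<in> {1..n}" for i
  proof -
    have "n - Suc m < i \<longleftrightarrow> n - m < i \<or> i = n - m" using m(1) by auto
    then show ?thesis using m(1) unfolding w_def by auto
  qed
  have "(e u - e z) \<cdot> (e (Suc m) - e (n + 1 - Suc m)) =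
      c * (\<delta> u (Suc m) - \<delta> u (n + 1 - Suc m) - \<delta> z (Suc m) + \<delta> z (n + 1 - Suc m))"
    by (rule form_e) (use ab m(1) in auto)
  then have "(e u - e z) \<cdot> \<beta> (Suc m) = c * ((\<delta> u (Suc m) - \<delta> u (n + 1 - Suc m)) - (\<delta> z (Suc m) - \<delta> z (n + 1 - Suc m)))"
    unfolding m(2) by (simp only: diff_diff_eq2 diff_add_eq)
  moreover have "(e u - e z) \<cdot> (\<Sum>j=1..Suc m. \<beta> j) = (e u - e z) \<cdot> (\<Sum>j=1..m. \<beta> j) + (e u - e z) \<cdot> \<beta> (Suc m)"
    by (simp add: form_add_right)
  ultimately show ?case unfolding step[OF ab(1)] step[OF ab(2)] IH by (simp only: distrib_left right_diff_distrib)
qed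

lemma root_cases:
  assumes "x \<in> R"
  obtains p q where "p \<in> {1..n}" "q \<in> {1..n}" "p \<noteq> q" "x = e p - e q"
proof -
  have "x \<in> P \<or> - x \<in> P" by (rule R_cases[OF assms])
  then show thesis
  proof
    assume "x \<in> P"
    then obtain i j where "(i, j) \<in> pairs" "x = e i - e j" unfolding P_eq by auto
    then show thesis by (intro that[of i j]) (auto simp: pairs_def)
  next
    assume "- x \<in> P"
    then obtain i j where ij: "(i, j) \<in> pairs" "- x = e i - e j" unfolding P_eq by auto
    have "x = e j - e i" using arg_cong[OF ij(2), of uminus] by simp
    then show thesis using ij(1) by (intro that[of j i]) (auto simp: pairs_def)
  qed
qed

text \<open>Write \<open>\<beta> i = e p - e q\<close>. Orthogonality to the earlier members
  confines \<open>p\<close> and \<open>q\<close> to the indices from \<open>i\<close> to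
  \<open>n + 1 - i\<close>, where the previous sum has weight 0. Dominance tested on
  \<open>e i - e p\<close> and on \<open>e q - e (n + 1 - i)\<close> then pushes them to the two
  ends.\<close>

lemma beta_eq:
  assumes chain: "beta_chain l \<beta>"
  shows "i \<in> {1..l} \<Longrightarrow> 2 * i \<le> n \<and> \<beta> i = e i - e (n + 1 - i)"
proof (induction i rule: less_induct)
  case (less i)
  obtain m where m: "i = Suc m" using less.prems by (cases i) auto
  have IH: "2 * j \<le> n \<and> \<beta> j = e j - e (n + 1 - j)" if "j \<in> {1..m}" for j
    using less.IH[of j] that less.prems m by simp
  note chain_i = bspec[OF chain[unfolded beta_chain_def] less.prems]
  obtain p q where pq: "p \<in> {1..n}" "q \<in> {1..n}" "p \<noteq> q" "\<beta> i = e p - e q"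
    using chain_i root_cases by blast
  have dom: "w m u - w m z + (\<delta> u p - \<delta> u q - \<delta> z p + \<delta> z q) \<ge> 0" if ab: "1 \<le> u" "u < z" "z \<le> n" for u z
  proof -
    have "e u - e z \<in> P" unfolding P_eq using ab by (auto simp: pairs_def intro!: image_eqI[of _ _ "(u, z)"])
    then have "(e u - e z) \<cdot> (\<Sum>j=1..i. \<beta> j) \<ge> 0" using chain_i by blast
    moreover have "(e u - e z) \<cdot> (\<Sum>j=1..m. \<beta> j) = c * (w m u - w m z)"
      by (rule form_sigma) (use IH ab in auto)
    moreover have "(e u - e z) \<cdot> \<beta> i = c * (\<delta> u p - \<delta> u q - \<delta> z p + \<delta> z q)"
      unfolding pq(4) by (rule form_e) (use pq ab in auto)
    ultimately have "0 \<le> c * (w m u - w m z + (\<delta> u p - \<delta> u q - \<delta> z p + \<delta> z q))"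
      unfolding m by (simp add: form_add_right distrib_left)
    then show ?thesis using c_pos by (simp only: zero_le_mult_iff) simp
  qed
  have orth: "\<delta> p j - \<delta> p (n + 1 - j) - \<delta> q j + \<delta> q (n + 1 - j) = 0" if j: "j \<in> {1..m}" for j
  proof -
    have "\<beta> i \<cdot> \<beta> j = 0" using chain_i j m by auto
    moreover have "(e p - e q) \<cdot> (e j - e (n + 1 - j)) =
        c * (\<delta> p j - \<delta> p (n + 1 - j) - \<delta> q j + \<delta> q (n + 1 - j))"
      by (rule form_e) (use pq IH[OF j] j in auto)
    moreover have "\<beta> j = e j - e (n + 1 - j)" using IH[OF j] by simp
    ultimately show ?thesis unfolding pq(4) using c_pos by simp
  qed
  have range: "i \<le> x \<and> x \<le> n + 1 - i"
    if x: "x \<in> {1..n}" "y \<in> {1..n}" "x \<noteq> y"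
      and o: "\<And>j. j \<in> {1..m} \<Longrightarrow> \<delta> x j - \<delta> x (n + 1 - j) - \<delta> y j + \<delta> y (n + 1 - j) = 0" for x y
  proof (rule ccontr)
    assume u: "\<not> ?thesis"
    show False
    proof (cases "x \<le> m")
      case True
      then have j: "x \<in> {1..m}" using x by simp
      have "x \<noteq> n + 1 - x" using IH[OF j] by auto
      then show False using o[OF j] x(3) by (simp split: if_splits)
    next
      case False
      then have j: "n + 1 - x \<in> {1..m}" using u m x by auto
      have "n + 1 - (n + 1 - x) = x" "x \<noteq> n + 1 - x" using IH[OF j] x by auto
      then show False using o[OF j] x(3) by (simp split: if_splits)
    qed
  qed
  have p: "i \<le> p \<and> p \<le> n + 1 - i" by (rule range[OF pq(1-3)]) (use orth in auto)
  have q: "i \<le> q \<and> q \<le> n + 1 - i"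
  proof (rule range[OF pq(2,1)])
    fix j assume "j \<in> {1..m}"
    from orth[OF this] show "\<delta> q j - \<delta> q (n + 1 - j) - \<delta> p j + \<delta> p (n + 1 - j) = 0" by linarith
  qed (use pq in auto)
  have i2: "2 * i \<le> n" using p q pq(3) by linarith
  have w0: "w m x = 0" if "i \<le> x" "x \<le> n + 1 - i" for x using that m by (auto simp: w_def)
  have pi: "p = i"
  proof (rule ccontr)
    assume ne: "p \<noteq> i"
    have "w m i - w m p + (\<delta> i p - \<delta> i q - \<delta> p p + \<delta> p q) \<ge> 0"
      by (rule dom) (use ne p m pq in auto)
    then show False using w0[of i] w0[of p] p i2 ne pq(3) by (simp split: if_splits)
  qed
  have "q = n + 1 - i"
  proof (rule ccontr)
    assume ne: "q \<noteq> n + 1 - i"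
    have "w m q - w m (n + 1 - i) + (\<delta> q p - \<delta> q q - \<delta> (n + 1 - i) p + \<delta> (n + 1 - i) q) \<ge> 0"
      by (rule dom) (use ne q m pq i2 in auto)
    then show False using w0[of q] w0[of "n + 1 - i"] q i2 ne pq(3) by (simp split: if_splits)
  qed
  then show ?case using i2 pi pq(4) by simp
qed

lemma weyl_product_eq:
  assumes "\<And>u z. u \<in> {1..n} \<Longrightarrow> z \<in> {1..n} \<Longrightarrow> (e u - e z) \<cdot> \<sigma> = c * (v u - v z)"
  shows "weyl_product k \<sigma> = (\<Prod>i=1..n. \<Prod>j\<in>{i<..n}. 1 + real k * (v i - v j) / (real j - real i))"
proof -
  have pairs: "pairs = Sigma {1..n} (\<lambda>i. {i<..n})" unfolding pairs_def by auto
  have "weyl_product k \<sigma> = (\<Prod>(i, j)\<in>pairs. 1 + real k * (v i - v j) / (real j - real i))"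
    unfolding weyl_product_def prod_P
  proof (rule prod.cong[OF refl], clarify)
    fix i j assume "(i, j) \<in> pairs"
    then have ij: "1 \<le> i" "i \<le> j" "j \<le> n" unfolding pairs_def by auto
    have "(e i - e j) \<cdot> \<sigma> = c * (v i - v j)" by (rule assms) (use ij in auto)
    then show "1 + real k * ((e i - e j) \<cdot> \<sigma>) / ((e i - e j) \<cdot> \<rho>) = 1 + real k * (v i - v j) / (real j - real i)"
      unfolding form_rho[OF ij] using c_pos by simp
  qed
  then show ?thesis unfolding pairs by (simp add: prod.Sigma)
qed

end

section \<open>Types B, C and D: Weyl products, and the sequence in type C\<close>

context type_BCD_roots
begin

lemma weyl_product_eq:
  assumes "\<forall>i\<in>{1..r}. e i \<cdot> \<sigma> = c * v i"
  shows "weyl_product k \<sigma> = (\<Prod>i=1..r. \<Prod>j\<in>{i<..r}. (1 + (real k * v i - real k * v j) / (real j - real i)) *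
      (1 + (real k * v i + real k * v j) / (real (2 * r + t) - real i - real j))) *
    (if t = 0 then 1 else \<Prod>i=1..r. 1 + real k * v i / (real r - real i + real t / 2))"
proof -
  note v = assms[rule_format]
  have pairs: "pairs = Sigma {1..r} (\<lambda>i. {i<..r})" unfolding pairs_def by auto
  have M: "(\<Prod>(i, j)\<in>pairs. 1 + real k * ((e i - e j) \<cdot> \<sigma>) / ((e i - e j) \<cdot> \<rho>)) =
    (\<Prod>(i, j)\<in>pairs. 1 + (real k * v i - real k * v j) / (real j - real i))"
  proof (rule prod.cong[OF refl], clarify)
    fix i j assume "(i, j) \<in> pairs"
    then have ij: "i \<in> {1..r}" "j \<in> {1..r}" unfolding pairs_def by auto
    have 1: "(e i - e j) \<cdot> \<sigma> = c * (v i - v j)" by (simp add: form_diff_left v[OF ij(1)] v[OF ij(2)] right_diff_distrib)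
    have 2: "(e i - e j) \<cdot> \<rho> = c * (real j - real i)"
      by (simp add: form_diff_left form_rho[OF ij(1)] form_rho[OF ij(2)] algebra_simps)
    show "1 + real k * ((e i - e j) \<cdot> \<sigma>) / ((e i - e j) \<cdot> \<rho>) = 1 + (real k * v i - real k * v j) / (real j - real i)"
      unfolding 1 2 using c_pos by (simp add: right_diff_distrib[symmetric] mult.left_commute[of _ c])
  qed
  have Q: "(\<Prod>(i, j)\<in>pairs. 1 + real k * ((e i + e j) \<cdot> \<sigma>) / ((e i + e j) \<cdot> \<rho>)) =
    (\<Prod>(i, j)\<in>pairs. 1 + (real k * v i + real k * v j) / (real (2 * r + t) - real i - real j))"
  proof (rule prod.cong[OF refl], clarify)
    fix i j assume "(i, j) \<in> pairs"
    then have ij: "i \<in> {1..r}" "j \<in> {1..r}" unfolding pairs_def by auto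
    have 1: "(e i + e j) \<cdot> \<sigma> = c * (v i + v j)" by (simp add: form_add_left v[OF ij(1)] v[OF ij(2)] distrib_left)
    have 2: "(e i + e j) \<cdot> \<rho> = c * (real (2 * r + t) - real i - real j)"
      by (simp add: form_add_left form_rho[OF ij(1)] form_rho[OF ij(2)] algebra_simps)
    show "1 + real k * ((e i + e j) \<cdot> \<sigma>) / ((e i + e j) \<cdot> \<rho>) = 1 + (real k * v i + real k * v j) / (real (2 * r + t) - real i - real j)"
      unfolding 1 2 using c_pos by (simp add: distrib_left[symmetric] mult.left_commute[of _ c] del: of_nat_add of_nat_mult)
  qed
  have S: "(\<Prod>i\<in>singles. 1 + real k * ((of_nat t * e i) \<cdot> \<sigma>) / ((of_nat t * e i) \<cdot> \<rho>)) =
    (if t = 0 then 1 else \<Prod>i=1..r. 1 + real k * v i / (real r - real i + real t / 2))"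
  proof (cases "t = 0")
    case True
    then show ?thesis by (simp add: singles_def)
  next
    case False
    have "1 + real k * ((of_nat t * e i) \<cdot> \<sigma>) / ((of_nat t * e i) \<cdot> \<rho>) = 1 + real k * v i / (real r - real i + real t / 2)"
      if i: "i \<in> {1..r}" for i
      unfolding form_of_nat_left v[OF i] form_rho[OF i] using False c_pos by simp
    then show ?thesis using False by (simp add: singles_def)
  qed
  have nested: "(\<Prod>(i, j)\<in>Sigma {1..r} (\<lambda>i. {i<..r}). F i j) = (\<Prod>i=1..r. \<Prod>j\<in>{i<..r}. F i j)"
    for F :: "nat \<Rightarrow> nat \<Rightarrow> real" by (simp add: prod.Sigma)
  show ?thesis unfolding weyl_product_def prod_P M Q S unfolding pairs nested prod.distrib ..
qed

lemma norms:
  assumes "x \<in> roots_set" "t = 2"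
  shows "x \<cdot> x = 2 * c \<or> (\<exists>p\<in>{1..r}. x = of_nat 2 * e p)"
  using assms(1)
proof (rule roots_set_cases)
  fix i j assume "1 \<le> i" "i < j" "j \<le> r" "x = e i - e j"
  then show ?thesis using form_minus_self[of i j] by (simp add: pairs_def)
next
  fix i j assume "1 \<le> i" "i < j" "j \<le> r" "x = e i + e j"
  then show ?thesis using form_plus_self[of i j] by (simp add: pairs_def)
next
  fix i assume "i \<in> {1..r}" "x = of_nat t * e i"
  then show ?thesis using assms(2) by blast
qed

lemma form_two_e:
  assumes "i \<in> {1..r}" "j \<in> {1..r}"
  shows "(of_nat 2 * e i) \<cdot> (of_nat 2 * e j) = (if i = j then 4 * c else 0)"
  unfolding form_of_nat_left form_of_nat_right form_e[OF assms] by simp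

text \<open>The long roots are \<open>2 e p\<close> and their negatives. Orthogonality excludes
  \<open>p < i\<close>, dominance on \<open>2 e p\<close> the negative sign, and dominance on
  \<open>e i - e p\<close> the case \<open>p > i\<close>.\<close>

lemma beta_eq:
  assumes chain: "beta_chain l \<beta>" and t: "t = 2"
  shows "i \<in> {1..l} \<Longrightarrow> i \<le> r \<and> \<beta> i = of_nat 2 * e i"
proof (induction i rule: less_induct)
  case (less i)
  obtain m where m: "i = Suc m" using less.prems by (cases i) auto
  have IH: "j \<le> r \<and> \<beta> j = of_nat 2 * e j" if "j \<in> {1..m}" for j
    using less.IH[of j] that less.prems m by simp
  note chain_i = bspec[OF chain[unfolded beta_chain_def] less.prems]
  have P2: "of_nat 2 * e j \<in> P" if "j \<in> {1..r}" for j using single_in[of j] that t unfolding P_eq by simp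
  have one: "1 \<in> {1..r}" using r_pos(1) by simp
  have "of_nat 2 * e 1 \<in> R" using P2[OF one] P_subset by blast
  then have long: "4 * c \<le> \<beta> i \<cdot> \<beta> i" using chain_i form_two_e[OF one one] by auto
  have "\<exists>p\<in>{1..r}. \<beta> i = of_nat 2 * e p \<or> \<beta> i = - (of_nat 2 * e p)"
  proof -
    have "\<beta> i \<in> P \<or> - \<beta> i \<in> P" using chain_i R_cases by blast
    then show ?thesis
    proof
      assume "\<beta> i \<in> P"
      then show ?thesis using norms[of "\<beta> i"] t long c_pos unfolding P_eq by auto
    next
      assume "- \<beta> i \<in> P"
      then have "(- \<beta> i) \<cdot> (- \<beta> i) = 2 * c \<or> (\<exists>p\<in>{1..r}. - \<beta> i = of_nat 2 * e p)"
        using norms[of "- \<beta> i"] t unfolding P_eq by blast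
      moreover have "(- \<beta> i) \<cdot> (- \<beta> i) = \<beta> i \<cdot> \<beta> i" by (simp add: form_minus_left form_minus_right)
      ultimately obtain p where "p \<in> {1..r}" "- \<beta> i = of_nat 2 * e p" using long c_pos by auto
      then show ?thesis by (metis add.inverse_inverse)
    qed
  qed
  then obtain p where p: "p \<in> {1..r}" and bp: "\<beta> i = of_nat 2 * e p \<or> \<beta> i = - (of_nat 2 * e p)" by blast
  have ne: "j \<noteq> p" if j: "j \<in> {1..m}" for j
  proof
    assume jp: "j = p"
    have "\<beta> i \<cdot> \<beta> j = 0" using chain_i j m by auto
    moreover have "\<beta> j = of_nat 2 * e p" using IH[OF j] jp by simp
    ultimately show False using bp form_two_e[OF p p] c_pos by (auto simp: form_minus_left)
  qed
  then have ip: "i \<le> p" using p m by (metis atLeastAtMost_iff not_less_eq_eq)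
  have S: "x \<cdot> (\<Sum>j=1..i. \<beta> j) = (\<Sum>j=1..m. x \<cdot> (of_nat 2 * e j)) + x \<cdot> \<beta> i" for x
  proof -
    have "(\<Sum>j=1..m. x \<cdot> \<beta> j) = (\<Sum>j=1..m. x \<cdot> (of_nat 2 * e j))"
    proof (rule sum.cong[OF refl])
      fix j assume "j \<in> {1..m}"
      then have "\<beta> j = of_nat 2 * e j" using IH by blast
      then show "x \<cdot> \<beta> j = x \<cdot> (of_nat 2 * e j)" by (rule arg_cong)
    qed
    moreover have "x \<cdot> (\<Sum>j=1..i. \<beta> j) = (\<Sum>j=1..m. x \<cdot> \<beta> j) + x \<cdot> \<beta> i"
      unfolding m by (simp add: form_add_right form_sum_right)
    ultimately show ?thesis by (simp only:)
  qed
  have "(of_nat 2 * e p) \<cdot> (\<Sum>j=1..i. \<beta> j) \<ge> 0" using chain_i P2[OF p] by blast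
  moreover have "(\<Sum>j=1..m. (of_nat 2 * e p) \<cdot> (of_nat 2 * e j)) = 0"
  proof (intro sum.neutral ballI)
    fix j assume j: "j \<in> {1..m}"
    then have "j \<in> {1..r}" using IH[OF j] by simp
    then show "(of_nat 2 * e p) \<cdot> (of_nat 2 * e j) = 0" using form_two_e[OF p, of j] ne[OF j] by simp
  qed
  ultimately have "(of_nat 2 * e p) \<cdot> \<beta> i \<ge> 0" unfolding S by simp
  then have b: "\<beta> i = of_nat 2 * e p" using bp form_two_e[OF p p] c_pos by (auto simp: form_minus_right)
  have "p = i"
  proof (rule ccontr)
    assume "p \<noteq> i"
    then have lt: "i < p" using ip by simp
    have i: "i \<in> {1..r}" using lt p m by simp
    have "e i - e p \<in> P" unfolding P_eq by (rule minus_in) (use lt p m in auto)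
    then have "(e i - e p) \<cdot> (\<Sum>j=1..i. \<beta> j) \<ge> 0" using chain_i by blast
    moreover have "(\<Sum>j=1..m. (e i - e p) \<cdot> (of_nat 2 * e j)) = 0"
    proof (intro sum.neutral ballI)
      fix j assume j: "j \<in> {1..m}"
      then have "j \<in> {1..r}" using IH[OF j] by simp
      then show "(e i - e p) \<cdot> (of_nat 2 * e j) = 0"
        unfolding form_of_nat_right form_diff_left using form_e[OF i, of j] form_e[OF p, of j] ne[OF j] j m by simp
    qed
    moreover have "(e i - e p) \<cdot> \<beta> i = - 2 * c"
      unfolding b form_of_nat_right form_diff_left form_e[OF i p] form_e[OF p p] using lt by simp
    ultimately show False unfolding S using c_pos by simp
  qed
  then show ?case using p b by simp
qed

end

section \<open>The classical types from their Dynkin diagrams\<close>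

context root_datum
begin

lemma dim_formula_SL:
  assumes n: "n \<ge> 2" and "dynkin (SL n) \<alpha>" "beta_chain l \<beta>" "l \<ge> 1"
  shows "dim_formula_value (SL n) l k (weyl_product k (\<Sum>j=1..l. \<beta> j))"
proof -
  obtain c where c: "c > 0" "\<alpha> 1 \<cdot> \<alpha> 1 = 2 * c * real (sq_length (SL n) 1)"
    by (rule dynkin_pos[OF assms(2)]) (use n in auto)
  have norms: "i < n \<Longrightarrow> \<alpha> i \<cdot> \<alpha> i = 2 * c * real (sq_length (SL n) i)" if "i \<ge> 1" for i
    using that
  proof (induction i rule: dec_induct)
    case (step i)
    show ?case
      by (rule dynkin_step[OF assms(2) _ _ step.IH]) (use step in \<open>auto simp: cartan_integer_def linked_def\<close>)
  qed (use c in simp)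
  interpret A: type_A_roots R P form \<rho> \<alpha> n c
  proof unfold_locales
    show "simple = \<alpha> ` {1..<n}" using assms(2) n by (simp add: dynkin_def atLeastLessThanSuc_atLeastAtMost[symmetric])
    show "c > 0" by (rule c(1))
    fix i j assume ij: "i \<in> {1..<n}" "j \<in> {1..<n}"
    have "\<alpha> i \<cdot> \<alpha> j = c * of_int (cartan_integer (SL n) i j * int (sq_length (SL n) j))"
      by (rule dynkin_form[OF assms(2) _ _ norms]) (use ij in auto)
    then show "\<alpha> i \<cdot> \<alpha> j = c * (if i = j then 2 else if i = Suc j \<or> j = Suc i then - 1 else 0)"
      by (auto simp: cartan_integer_def linked_def min_def max_def split: if_splits)
  qed
  have \<beta>: "2 * i \<le> n \<and> \<beta> i = A.e i - A.e (n + 1 - i)" if "i \<in> {1..l}" for i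
    by (rule A.beta_eq[OF assms(3) that])
  then have l: "2 * l \<le> n" using assms(4) by simp
  have "weyl_product k (\<Sum>j=1..l. \<beta> j) =
      (\<Prod>i=1..n. \<Prod>j\<in>{i<..n}. 1 + real k * (A.w l i - A.w l j) / (real j - real i))"
    by (rule A.weyl_product_eq, rule A.form_sigma) (use \<beta> in auto)
  from SL_product[OF l assms(4) this[unfolded A.w_def]] show ?thesis
    unfolding dim_formula_value_def by simp
qed

text \<open>Starting from the products with \<open>e r\<close>, descending induction along
  \<open>e i = e (Suc i) + \<alpha> i\<close> fills in the whole Gram matrix of the
  coordinates.\<close>

lemma orthogonal_coordinates:
  assumes step: "\<And>i. i \<in> {1..<r} \<Longrightarrow> \<alpha> i = e i - e (Suc i)"
    and form: "\<And>i j. i \<in> {1..<r} \<Longrightarrow> j \<in> {1..<r} \<Longrightarrow>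
      \<alpha> i \<cdot> \<alpha> j = c * (if i = j then 2 else if i = Suc j \<or> j = Suc i then - 1 else 0)"
    and last: "e r \<cdot> e r = c" "\<And>m. m \<in> {1..<r} \<Longrightarrow> e r \<cdot> \<alpha> m = (if r = Suc m then - c else 0)"
    and ij: "i \<in> {1..r}" "j \<in> {1..r}"
  shows "e i \<cdot> e j = (if i = j then c else 0)"
proof -
  have e: "e i = e (Suc i) + \<alpha> i" if "i \<in> {1..<r}" for i using step[OF that] by simp
  have A: "1 \<le> i \<Longrightarrow> e i \<cdot> \<alpha> m = (if i = m then c else if i = Suc m then - c else 0)"
    if "i \<le> r" "m \<in> {1..<r}" for i m
    using that(1)
  proof (induction i rule: inc_induct)
    case base
    then show ?case using last(2)[OF that(2)] that(2) by auto
  next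
    case (step i)
    have i: "i \<in> {1..<r}" using step by simp
    have "e i \<cdot> \<alpha> m = e (Suc i) \<cdot> \<alpha> m + \<alpha> i \<cdot> \<alpha> m" unfolding e[OF i] by (rule form_add_left)
    then show ?case using step.IH form[OF i that(2)] by (auto split: if_splits)
  qed
  have B: "1 \<le> j \<Longrightarrow> e r \<cdot> e j = (if r = j then c else 0)" if "j \<le> r" for j
    using that
  proof (induction j rule: inc_induct)
    case base
    then show ?case using last(1) by simp
  next
    case (step j)
    have j: "j \<in> {1..<r}" using step by simp
    have "e r \<cdot> e j = e r \<cdot> e (Suc j) + e r \<cdot> \<alpha> j" unfolding e[OF j] by (rule form_add_right)
    then show ?case using step.IH last(2)[OF j] j by (auto split: if_splits)
  qed
  have "i \<le> r" "1 \<le> i" using ij by auto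
  then show ?thesis
  proof (induction i rule: inc_induct)
    case base
    then show ?case using B[of j] ij by simp
  next
    case (step i)
    have i: "i \<in> {1..<r}" using step by simp
    have "e i \<cdot> e j = e (Suc i) \<cdot> e j + e j \<cdot> \<alpha> i"
      unfolding e[OF i] form_add_left form_sym[of "\<alpha> i" "e j"] ..
    then show ?case using step.IH A[of j i] i ij by (auto split: if_splits)
  qed
qed

text \<open>The last simple root is \<open>2 e n\<close>; the assumption \<open>half\<close>
  supplies \<open>e n\<close>, as the ring itself has no division.\<close>

lemma dim_formula_SP:
  assumes n: "n \<ge> 1" and "dynkin (SP n) \<alpha>" "beta_chain l \<beta>" "l \<ge> 1" and half: "\<And>x::'w. \<exists>y. y + y = x"
  shows "dim_formula_value (SP n) l k (weyl_product k (\<Sum>j=1..l. \<beta> j))"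
proof -
  obtain c where c: "c > 0" "\<alpha> 1 \<cdot> \<alpha> 1 = 2 * c * real (sq_length (SP n) 1)"
    by (rule dynkin_pos[OF assms(2)]) (use n in auto)
  have norms: "i \<le> n \<Longrightarrow> \<alpha> i \<cdot> \<alpha> i = 2 * c * real (sq_length (SP n) i)" if "i \<ge> 1" for i
    using that
  proof (induction i rule: dec_induct)
    case (step i)
    show ?case
      by (rule dynkin_step[OF assms(2) _ _ step.IH]) (use step in \<open>auto simp: cartan_integer_def linked_def\<close>)
  qed (use c in simp)
  have form: "\<alpha> i \<cdot> \<alpha> j = c * of_int (cartan_integer (SP n) i j * int (sq_length (SP n) j))"
    if "i \<in> {1..n}" "j \<in> {1..n}" for i j
    by (rule dynkin_form[OF assms(2) _ _ norms]) (use that in auto)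
  obtain h where h: "h + h = \<alpha> n" using half by blast
  define e where "e i = h + (\<Sum>m\<in>{i..<n}. \<alpha> m)" for i
  have step: "\<alpha> i = e i - e (Suc i)" if "i \<in> {1..<n}" for i
    using that by (simp add: e_def sum.atLeast_Suc_lessThan)
  have en: "e n + e n = \<alpha> n" by (simp add: e_def h)
  have double: "2 * (e n \<cdot> x) = \<alpha> n \<cdot> x" for x unfolding en[symmetric] form_add_left by simp
  have form_e: "e i \<cdot> e j = (if i = j then c else 0)" if "i \<in> {1..n}" "j \<in> {1..n}" for i j
  proof (rule orthogonal_coordinates[where \<alpha> = \<alpha> and e = e and r = n and c = c, OF step _ _ _ that])
    show "\<alpha> i \<cdot> \<alpha> j = c * (if i = j then 2 else if i = Suc j \<or> j = Suc i then - 1 else 0)"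
      if "i \<in> {1..<n}" "j \<in> {1..<n}" for i j
      using that form[of i j] by (auto simp: cartan_integer_def linked_def min_def max_def split: if_splits)
    have "4 * (e n \<cdot> e n) = \<alpha> n \<cdot> \<alpha> n" unfolding en[symmetric] form_add_left form_add_right by simp
    then show "e n \<cdot> e n = c" using norms[of n] n by simp
    show "e n \<cdot> \<alpha> m = (if n = Suc m then - c else 0)" if "m \<in> {1..<n}" for m
      using that double[of "\<alpha> m"] form[of n m] by (auto simp: cartan_integer_def linked_def min_def max_def split: if_splits)
  qed
  interpret B: type_BCD_roots R P form \<rho> e n 2 c
  proof unfold_locales
    have "simple = \<alpha> ` {1..n}" using assms(2) by (simp add: dynkin_def)
    also have "{1..n} = {1..<n} \<union> {n}" using n by auto
    also have "\<alpha> ` \<dots> = (\<lambda>i. e i - e (Suc i)) ` {1..<n} \<union> {of_nat 2 * e n}"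
    proof -
      have 1: "\<alpha> ` {1..<n} = (\<lambda>i. e i - e (Suc i)) ` {1..<n}" by (rule image_cong[OF refl step])
      have 2: "\<alpha> n = of_nat 2 * e n" unfolding en[symmetric] by (simp only: of_nat_numeral mult_2)
      show ?thesis unfolding image_Un 1 image_insert image_empty 2 ..
    qed
    finally show "simple = (\<lambda>i. e i - e (Suc i)) ` {1..<n} \<union> {if (2::nat) = 0 then e (n - 1) + e n else of_nat 2 * e n}"
      by simp
  qed (use n c form_e in auto)
  have \<beta>: "i \<le> n \<and> \<beta> i = of_nat 2 * e i" if "i \<in> {1..l}" for i
    by (rule B.beta_eq[OF assms(3) refl that])
  then have l: "l \<le> n" using assms(4) by simp
  have v: "e i \<cdot> (\<Sum>j=1..l. \<beta> j) = c * (if i \<le> l then 2 else 0)" if i: "i \<in> {1..n}" for i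
  proof -
    have "e i \<cdot> (\<Sum>j=1..l. \<beta> j) = (\<Sum>j=1..l. if j = i then 2 * c else 0)"
      unfolding form_sum_right
    proof (rule sum.cong[OF refl])
      fix j assume j: "j \<in> {1..l}"
      then have "\<beta> j = of_nat 2 * e j" "j \<in> {1..n}" using \<beta>[OF j] by auto
      then show "e i \<cdot> \<beta> j = (if j = i then 2 * c else 0)"
        using form_e[OF i, of j] form_of_nat_right[of "e i" 2 "e j"] by simp
    qed
    then show ?thesis using i by simp
  qed
  have w: "real k * (if i \<le> l then 2 else 0) = (if i \<le> l then real (2 * k) else 0)" for i by simp
  have "weyl_product k (\<Sum>j=1..l. \<beta> j) = (\<Prod>i=1..n. \<Prod>j\<in>{i<..n}.
      (1 + ((if i \<le> l then real (2 * k) else 0) - (if j \<le> l then real (2 * k) else 0)) / (real j - real i)) *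
      (1 + ((if i \<le> l then real (2 * k) else 0) + (if j \<le> l then real (2 * k) else 0)) / (real (2 * n + 2) - real i - real j))) *
    (\<Prod>i=1..n. 1 + (if i \<le> l then real (2 * k) else 0) / (real n - real i + real 2 / 2))"
    using B.weyl_product_eq[OF ballI[OF v], of k] unfolding w by simp
  from SP_product[OF assms(4) l this] show ?thesis
    unfolding dim_formula_value_def by simp
qed

lemma dim_formula_SO:
  fixes n l k :: nat
  defines "r \<equiv> n div 2"
  assumes n: "n \<ge> 5" and "dynkin (SO n) \<alpha>" "l \<ge> 1"
    and step: "\<And>i. i \<in> {1..<r} \<Longrightarrow> \<alpha> i = e i - e (Suc i)"
    and last: "\<alpha> r = (if odd n then e r else e (r - 1) + e r)"
    and \<beta>: "\<And>i. i \<in> {1..l} \<Longrightarrow> 2 * i \<le> r \<and> \<beta> i = e (2 * i - 1) + e (2 * i)"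
  shows "dim_formula_value (SO n) l k (weyl_product k (\<Sum>j=1..l. \<beta> j))"
proof -
  have r: "r \<ge> 2" "even n \<Longrightarrow> r \<ge> 3" using n unfolding r_def by auto
  have rank: "type_rank (SO n) = r" by (simp add: r_def)
  have L: "sq_length (SO n) i = (if odd n \<and> i = r then 1 else 2)" for i by (simp add: r_def)
  obtain c' where c': "c' > 0" "\<alpha> 1 \<cdot> \<alpha> 1 = 2 * c' * real (sq_length (SO n) 1)"
    by (rule dynkin_pos[OF assms(3)]) (use r in \<open>auto simp: r_def\<close>)
  \<comment> \<open>\<open>sq_length\<close> lists the long roots of \<open>so\<close> with 2, so
    the squared length of a coordinate vector is twice the factor of the Gram matrix.\<close>
  define c where "c = 2 * c'"
  have c: "c > 0" using c' unfolding c_def by simp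
  note [simp del] = sq_length.simps type_rank.simps
  have link: "linked (SO n) i j \<longleftrightarrow> (if odd n \<or> i < r \<and> j < r then i = Suc j \<or> j = Suc i
      else i + 2 = r \<and> j = r \<or> j + 2 = r \<and> i = r)" if "i \<in> {1..r}" "j \<in> {1..r}" for i j
    using that r rank unfolding linked_def by (auto simp: min_def max_def Let_def)
  have norm_step: "\<alpha> j \<cdot> \<alpha> j = 2 * c' * real (sq_length (SO n) j)"
    if "\<alpha> i \<cdot> \<alpha> i = 2 * c' * real (sq_length (SO n) i)" "i \<in> {1..r}" "j \<in> {1..r}" "linked (SO n) i j" "linked (SO n) j i" "i \<noteq> j" for i j
    by (rule dynkin_step[OF assms(3), unfolded rank, OF that(2,3,1)]) (use that in \<open>simp_all add: L cartan_integer_def\<close>)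
  have norms: "i < r \<Longrightarrow> \<alpha> i \<cdot> \<alpha> i = 2 * c' * real (sq_length (SO n) i)" if "i \<ge> 1" for i
    using that
  proof (induction i rule: dec_induct)
    case (step i)
    show ?case by (rule norm_step[of i]) (use step in \<open>auto simp: link\<close>)
  qed (use c' in simp)
  have norm_last: "\<alpha> r \<cdot> \<alpha> r = 2 * c' * real (sq_length (SO n) r)"
  proof (cases "odd n")
    case True
    show ?thesis by (rule norm_step[of "r - 1"]) (use norms[of "r - 1"] r True in \<open>auto simp: link\<close>)
  next
    case False
    show ?thesis by (rule norm_step[of "r - 2"]) (use norms[of "r - 2"] r False in \<open>auto simp: link\<close>)
  qed
  have form: "\<alpha> i \<cdot> \<alpha> j = c' * of_int (cartan_integer (SO n) i j * int (sq_length (SO n) j))"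
    if "i \<in> {1..r}" "j \<in> {1..r}" for i j
  proof (rule dynkin_form[OF assms(3), unfolded rank, OF that])
    show "\<alpha> j \<cdot> \<alpha> j = 2 * c' * real (sq_length (SO n) j)"
      using that norms[of j] norm_last by (cases "j = r") auto
  qed
  have form_less: "\<alpha> i \<cdot> \<alpha> j = c * (if i = j then 2 else if i = Suc j \<or> j = Suc i then - 1 else 0)"
    if "i \<in> {1..<r}" "j \<in> {1..<r}" for i j
    using that form[of i j] link[of i j] by (auto simp: cartan_integer_def L c_def)
  have en: "e r \<cdot> e r = c \<and> (\<forall>m\<in>{1..<r}. e r \<cdot> \<alpha> m = (if r = Suc m then - c else 0))"
  proof (cases "odd n")
    case True
    have e: "e r = \<alpha> r" using last True by simp
    show ?thesis unfolding e
      using form[of r r] r True form link by (auto simp: cartan_integer_def L c_def)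
  next
    case False
    have "Suc (r - 1) = r" using r by simp
    \<comment> \<open>For even \<open>n\<close>, \<open>e r\<close> is half the difference of the
      two end nodes of the fork, so its products are read off from those two roots.\<close>
    then have e: "e r + e r = \<alpha> r - \<alpha> (r - 1)" using last step[of "r - 1"] r False by simp
    have double: "2 * (e r \<cdot> x) = \<alpha> r \<cdot> x - \<alpha> (r - 1) \<cdot> x" for x
      using arg_cong[OF e, of "\<lambda>y. y \<cdot> x"] unfolding form_add_left form_diff_left by simp
    have last_form: "\<alpha> r \<cdot> \<alpha> m = (if m + 2 = r then - c else 0)" if "m \<in> {1..<r}" for m
      using that form[of r m] link[of r m] False by (auto simp: cartan_integer_def L c_def)
    have rr: "\<alpha> r \<cdot> \<alpha> r = 2 * c" using norm_last False by (simp add: L c_def)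
    have r1: "r - 1 \<in> {1..<r}" using r by auto
    have "r - 1 + 2 \<noteq> r" using r by arith
    then have r0: "\<alpha> r \<cdot> \<alpha> (r - 1) = 0" using last_form[OF r1] by (simp only: if_False)
    have "2 * (e r \<cdot> (e r + e r)) = 4 * c"
      unfolding double unfolding e form_diff_right rr form_sym[of "\<alpha> (r - 1)" "\<alpha> r"] r0 form_less[OF r1 r1] by simp
    then have "e r \<cdot> e r = c" unfolding form_add_right by simp
    moreover have "e r \<cdot> \<alpha> m = (if r = Suc m then - c else 0)" if m: "m \<in> {1..<r}" for m
      using double[of "\<alpha> m"] last_form[OF m] form_less[OF r1 m] m r by (auto split: if_splits)
    ultimately show ?thesis by blast
  qed
  have form_e: "e i \<cdot> e j = (if i = j then c else 0)" if "i \<in> {1..r}" "j \<in> {1..r}" for i j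
    by (rule orthogonal_coordinates[where \<alpha> = \<alpha> and e = e and r = r and c = c, OF step form_less _ _ that]) (use en in auto)
  define t :: nat where "t = (if odd n then 1 else 0)"
  have nt: "n = 2 * r + t" unfolding t_def r_def by auto
  interpret B: type_BCD_roots R P form \<rho> e r t c
  proof unfold_locales
    have "simple = \<alpha> ` {1..r}" using assms(3) by (simp add: dynkin_def rank)
    also have "{1..r} = {1..<r} \<union> {r}" using r by auto
    also have "\<alpha> ` \<dots> = (\<lambda>i. e i - e (Suc i)) ` {1..<r} \<union> {\<alpha> r}"
    proof -
      have 1: "\<alpha> ` {1..<r} = (\<lambda>i. e i - e (Suc i)) ` {1..<r}" by (rule image_cong[OF refl step])
      show ?thesis unfolding image_Un 1 image_insert image_empty ..
    qed
    also have "\<alpha> r = (if t = 0 then e (r - 1) + e r else of_nat t * e r)" unfolding last t_def by simp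
    finally show "simple = (\<lambda>i. e i - e (Suc i)) ` {1..<r} \<union> {if t = 0 then e (r - 1) + e r else of_nat t * e r}" .
  qed (use r c form_e in \<open>auto simp: t_def\<close>)
  have lr: "2 * l \<le> r" using \<beta>[of l] assms(4) by simp
  \<comment> \<open>Consecutive pairs fill up the first coordinates, so the weight is 1 on the first
    \<open>2 * l\<close> of them.\<close>
  have "(\<Sum>j=1..m. e (2 * j - 1) + e (2 * j)) = (\<Sum>j=1..2 * m. e j)" for m
    by (induction m) (auto simp: add.assoc)
  then have \<sigma>: "(\<Sum>j=1..l. \<beta> j) = (\<Sum>j=1..2 * l. e j)" using \<beta> by simp
  have v: "e i \<cdot> (\<Sum>j=1..l. \<beta> j) = c * (if i \<le> 2 * l then 1 else 0)" if i: "i \<in> {1..r}" for i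
  proof -
    have "e i \<cdot> (\<Sum>j=1..l. \<beta> j) = (\<Sum>j=1..2 * l. if j = i then c else 0)"
      unfolding \<sigma> form_sum_right by (rule sum.cong) (use form_e[OF i] lr in auto)
    then show ?thesis using i by simp
  qed
  have w: "real k * (if i \<le> 2 * l then 1 else 0) = (if i \<le> 2 * l then real k else 0)" for i by simp
  have "\<forall>i\<in>{1..r}. e i \<cdot> (\<Sum>j=1..l. \<beta> j) = c * (if i \<le> 2 * l then 1 else 0)" using v by blast
  note W = B.weyl_product_eq[OF this, of k, unfolded w nt[symmetric]]
  show ?thesis
  proof (cases "4 * l < n")
    case True
    have "t \<in> {0, 1}" by (simp add: t_def)
    from SO_product[OF assms(4) True nt this W] show ?thesis unfolding dim_formula_value_def by simp
  next
    case False
    \<comment> \<open>Here the denominator vanishes for \<open>k \<ge> 1\<close>. The value is then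
      the limit along the line with fixed rank parameter \<open>l\<close>, so the Weyl product is
      brought into the shape of \<open>dim_formula_fixed_rank\<close>.\<close>
    then have n4: "n = 4 * l" and t0: "t = 0" and rl: "r = 2 * l" using lr nt by auto
    have "weyl_product k (\<Sum>j=1..l. \<beta> j) = (\<Prod>i=1..2 * l. \<Prod>j\<in>{i<..2 * l}. 1 + 2 * real k / (real n - real i - real j))"
      unfolding W unfolding rl using t0 by (auto intro!: prod.cong)
    also have "\<dots> = (\<Prod>i=1..l. rbinom (2 * k) (real n - 2 * real i - 1)) /
        (\<Prod>i=1..l. rbinom (2 * k) (real n - 2 * real l - 2 * real i))"
      unfolding prod_dividef[symmetric] by (rule SO_pairs) (simp add: n4)
    also have "(\<Prod>i=1..l. rbinom (2 * k) (real n - 2 * real l - 2 * real i)) =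
        (\<Prod>i=1..l. rbinom (2 * k) (real n - 2 * real l - 2 * (real l + 1 - real i)))"
      by (rule prod_reverse_real[of "\<lambda>x. rbinom (2 * k) (real n - 2 * real l - 2 * x)"])
    also have "(\<Prod>i=1..l. rbinom (2 * k) (real n - 2 * real i - 1)) /
        (\<Prod>i=1..l. rbinom (2 * k) (real n - 2 * real l - 2 * (real l + 1 - real i))) =
        (\<Prod>i=1..l. rbinom (2 * k) (4 * (2 * real l - real i - 1) / 2 + 1) / rbinom (2 * k) (4 * (real i - 1) / 2))"
      unfolding prod_dividef[symmetric] n4
      by (intro rbinom_congs refl) (simp_all add: field_simps)
    finally have "weyl_product k (\<Sum>j=1..l. \<beta> j) = (\<Prod>i=1..l. rbinom (2 * k) (4 * (2 * real l - real i - 1) / 2 + 1) /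
        rbinom (2 * k) (4 * (real i - 1) / 2))" .
    moreover have "dim_formula_value (SO n) l k (\<Prod>i=1..l. rbinom (2 * k) (4 * (2 * real l - real i - 1) / 2 + 1) /
        rbinom (2 * k) (4 * (real i - 1) / 2))"
      by (rule dim_formula_fixed_rank) (use n n4 in \<open>auto simp: in_fixed_rank_series_def\<close>)
    ultimately show ?thesis by simp
  qed
qed

end

section \<open>The dimension formula for the exceptional types\<close>

definition G2_gram :: "int list list" where
  "G2_gram = [[2, -3],
    [-3, 6]]"

definition G2_roots :: "(int \<times> int list list) list" where
  "G2_roots = [
    (1, [[1,0], [0,1]]), (2, [[1,1]]), (3, [[2,1]]), (4, [[3,1]]), (5, [[3,2]])]"

text \<open>Pairs are \<open>(p, h)\<close> as in \<open>pair_factor\<close>. The highest root gives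
  \<open>(6, 18)\<close>; the four roots with \<open>p = 3\<close> have
  \<open>h = 6, 8, 10, 12\<close>, which fall into three strings of step 6.\<close>

lemma G2_check:
  "root_list_check G2 [2] G2_gram G2_roots"
  "chain_check G2_gram G2_roots [[3, 2]]"
  "pairs_check G2_gram G2_roots [[3, 2]] []
    (string_pairs 6 6 12 1 @ string_pairs 3 6 0 2 @ string_pairs 3 6 4 1 @ string_pairs 3 6 2 1)"
  by code_simp+

lemma (in root_datum) dim_formula_G2:
  assumes "dynkin G2 \<alpha>" "beta_chain l \<beta>" "l \<ge> 1"
  shows "dim_formula_value G2 l k (weyl_product k (\<Sum>j=1..l. \<beta> j))"
proof -
  note W = listed_weyl_product[OF assms(1,2) G2_check(1,2)]
  consider "l = 1" using W(1) assms(3) by fastforce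
  then show ?thesis
  proof cases
    case 1
    show ?thesis unfolding 1
      by (rule dim_formula_valueI[where b = "(10 / 3)" and c = "(8 / 3)"])
        (use W(2)[unfolded 1, simplified, OF G2_check(3), of k] in \<open>simp_all add: exceptional_simps\<close>)
  qed
qed

definition F4_gram :: "int list list" where
  "F4_gram = [[4, -2, 0, 0],
    [-2, 4, -2, 0],
    [0, -2, 2, -1],
    [0, 0, -1, 2]]"

definition F4_roots :: "(int \<times> int list list) list" where
  "F4_roots = [
    (1, [[1,0,0,0], [0,1,0,0], [0,0,1,0], [0,0,0,1]]), (2, [[1,1,0,0], [0,1,1,0], [0,0,1,1]]),
    (3, [[0,1,2,0], [1,1,1,0], [0,1,1,1]]), (4, [[1,1,2,0], [1,1,1,1], [0,1,2,1]]),
    (5, [[0,1,2,2], [1,2,2,0], [1,1,2,1]]), (6, [[1,1,2,2], [1,2,2,1]]), (7, [[1,2,2,2],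
    [1,2,3,1]]), (8, [[1,2,3,2]]), (9, [[1,2,4,2]]), (10, [[1,3,4,2]]), (11, [[2,3,4,2]])]"

text \<open>For \<open>l = 2\<close> the pairs with \<open>p = 2\<close> form two strings of step 4
  from which \<open>h = 16\<close> and \<open>h = 6\<close> are missing. The missing pairs are
  listed on the other side.\<close>

lemma F4_check:
  "root_list_check F4 [2, 3, 4] F4_gram F4_roots"
  "chain_check F4_gram F4_roots [[2, 3, 4, 2], [0, 1, 2, 2]]"
  "pairs_check F4_gram F4_roots [[2, 3, 4, 2]] []
    (string_pairs 4 4 28 1 @ string_pairs 2 4 0 7 @ string_pairs 2 4 6 4 @ string_pairs 2 4 8 3)"
  "pairs_check F4_gram F4_roots [[2, 3, 4, 2], [0, 1, 2, 2]] (string_pairs 2 4 12 1 @ string_pairs 2 4 2 1)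
    (string_pairs 4 4 8 6 @ string_pairs 4 4 18 1 @ string_pairs 2 4 0 5 @ string_pairs 2 4 (- 2) 5)"
  by code_simp+

lemma (in root_datum) dim_formula_F4:
  assumes "dynkin F4 \<alpha>" "beta_chain l \<beta>" "l \<ge> 1"
  shows "dim_formula_value F4 l k (weyl_product k (\<Sum>j=1..l. \<beta> j))"
proof -
  note W = listed_weyl_product[OF assms(1,2) F4_check(1,2)]
  consider "l = 1" | "l = 2" using W(1) assms(3) by fastforce
  then show ?thesis
  proof cases
    case 1
    show ?thesis unfolding 1
      by (rule dim_formula_valueI[where b = "5" and c = "6"])
        (use W(2)[unfolded 1, simplified, OF F4_check(3), of k] in \<open>simp_all add: exceptional_simps\<close>)
  next
    case 2
    show ?thesis unfolding 2
      by (rule dim_formula_valueI[where b = "5" and c = "6"])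
        (use W(2)[unfolded 2, simplified, OF F4_check(4), of k] in \<open>simp_all add: exceptional_simps\<close>)
  qed
qed

definition E6_gram :: "int list list" where
  "E6_gram = [[2, 0, -1, 0, 0, 0],
    [0, 2, 0, -1, 0, 0],
    [-1, 0, 2, -1, 0, 0],
    [0, -1, -1, 2, -1, 0],
    [0, 0, 0, -1, 2, -1],
    [0, 0, 0, 0, -1, 2]]"

definition E6_roots :: "(int \<times> int list list) list" where
  "E6_roots = [
    (1, [[1,0,0,0,0,0], [0,1,0,0,0,0], [0,0,1,0,0,0], [0,0,0,1,0,0], [0,0,0,0,1,0],
    [0,0,0,0,0,1]]), (2, [[1,0,1,0,0,0], [0,1,0,1,0,0], [0,0,1,1,0,0], [0,0,0,1,1,0],
    [0,0,0,0,1,1]]), (3, [[1,0,1,1,0,0], [0,1,1,1,0,0], [0,1,0,1,1,0], [0,0,1,1,1,0],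
    [0,0,0,1,1,1]]), (4, [[1,1,1,1,0,0], [1,0,1,1,1,0], [0,1,1,1,1,0], [0,1,0,1,1,1],
    [0,0,1,1,1,1]]), (5, [[1,1,1,1,1,0], [1,0,1,1,1,1], [0,1,1,2,1,0], [0,1,1,1,1,1]]),
    (6, [[1,1,1,2,1,0], [1,1,1,1,1,1], [0,1,1,2,1,1]]), (7, [[1,1,2,2,1,0], [1,1,1,2,1,1],
    [0,1,1,2,2,1]]), (8, [[1,1,2,2,1,1], [1,1,1,2,2,1]]), (9, [[1,1,2,2,2,1]]),
    (10, [[1,1,2,3,2,1]]), (11, [[1,2,2,3,2,1]])]"

lemma E6_check:
  "root_list_check E6 [3, 4, 2, 5, 6] E6_gram E6_roots"
  "chain_check E6_gram E6_roots [[1, 2, 2, 3, 2, 1], [1, 0, 1, 1, 1, 1]]"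
  "pairs_check E6_gram E6_roots [[1, 2, 2, 3, 2, 1]] []
    (string_pairs 2 2 20 1 @ string_pairs 1 2 0 10 @ string_pairs 1 2 4 6 @ string_pairs 1 2 6 4)"
  "pairs_check E6_gram E6_roots [[1, 2, 2, 3, 2, 1], [1, 0, 1, 1, 1, 1]] []
    (string_pairs 2 2 8 7 @ string_pairs 2 2 14 1 @ string_pairs 1 2 0 7 @ string_pairs 1 2 0 7 @ string_pairs 1 2 6 1 @ string_pairs 1 2 6 1)"
  by code_simp+

lemma (in root_datum) dim_formula_E6:
  assumes "dynkin E6 \<alpha>" "beta_chain l \<beta>" "l \<ge> 1"
  shows "dim_formula_value E6 l k (weyl_product k (\<Sum>j=1..l. \<beta> j))"
proof -
  note W = listed_weyl_product[OF assms(1,2) E6_check(1,2)]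
  consider "l = 1" | "l = 2" using W(1) assms(3) by fastforce
  then show ?thesis
  proof cases
    case 1
    show ?thesis unfolding 1
      by (rule dim_formula_valueI[where b = "6" and c = "8"])
        (use W(2)[unfolded 1, simplified, OF E6_check(3), of k] in \<open>simp_all add: exceptional_simps\<close>)
  next
    case 2
    show ?thesis unfolding 2
      by (rule dim_formula_valueI[where b = "6" and c = "8"])
        (use W(2)[unfolded 2, simplified, OF E6_check(4), of k] in \<open>simp_all add: exceptional_simps\<close>)
  qed
qed

definition E7_gram :: "int list list" where
  "E7_gram = [[2, 0, -1, 0, 0, 0, 0],
    [0, 2, 0, -1, 0, 0, 0],
    [-1, 0, 2, -1, 0, 0, 0],
    [0, -1, -1, 2, -1, 0, 0],
    [0, 0, 0, -1, 2, -1, 0],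
    [0, 0, 0, 0, -1, 2, -1],
    [0, 0, 0, 0, 0, -1, 2]]"

definition E7_roots :: "(int \<times> int list list) list" where
  "E7_roots = [
    (1, [[1,0,0,0,0,0,0], [0,1,0,0,0,0,0], [0,0,1,0,0,0,0], [0,0,0,1,0,0,0], [0,0,0,0,1,0,0],
    [0,0,0,0,0,1,0], [0,0,0,0,0,0,1]]), (2, [[1,0,1,0,0,0,0], [0,1,0,1,0,0,0],
    [0,0,1,1,0,0,0], [0,0,0,1,1,0,0], [0,0,0,0,1,1,0], [0,0,0,0,0,1,1]]),
    (3, [[1,0,1,1,0,0,0], [0,1,1,1,0,0,0], [0,1,0,1,1,0,0], [0,0,1,1,1,0,0], [0,0,0,1,1,1,0],
    [0,0,0,0,1,1,1]]), (4, [[1,1,1,1,0,0,0], [1,0,1,1,1,0,0], [0,1,1,1,1,0,0],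
    [0,1,0,1,1,1,0], [0,0,1,1,1,1,0], [0,0,0,1,1,1,1]]), (5, [[1,1,1,1,1,0,0],
    [1,0,1,1,1,1,0], [0,1,1,2,1,0,0], [0,1,1,1,1,1,0], [0,1,0,1,1,1,1], [0,0,1,1,1,1,1]]),
    (6, [[1,1,1,2,1,0,0], [1,1,1,1,1,1,0], [1,0,1,1,1,1,1], [0,1,1,2,1,1,0],
    [0,1,1,1,1,1,1]]), (7, [[1,1,2,2,1,0,0], [1,1,1,2,1,1,0], [1,1,1,1,1,1,1],
    [0,1,1,2,2,1,0], [0,1,1,2,1,1,1]]), (8, [[1,1,2,2,1,1,0], [1,1,1,2,2,1,0],
    [1,1,1,2,1,1,1], [0,1,1,2,2,1,1]]), (9, [[1,1,2,2,2,1,0], [1,1,2,2,1,1,1],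
    [1,1,1,2,2,1,1], [0,1,1,2,2,2,1]]), (10, [[1,1,2,3,2,1,0], [1,1,2,2,2,1,1],
    [1,1,1,2,2,2,1]]), (11, [[1,2,2,3,2,1,0], [1,1,2,3,2,1,1], [1,1,2,2,2,2,1]]),
    (12, [[1,2,2,3,2,1,1], [1,1,2,3,2,2,1]]), (13, [[1,2,2,3,2,2,1], [1,1,2,3,3,2,1]]),
    (14, [[1,2,2,3,3,2,1]]), (15, [[1,2,2,4,3,2,1]]), (16, [[1,2,3,4,3,2,1]]),
    (17, [[2,2,3,4,3,2,1]])]"

text \<open>For \<open>l = 3\<close> all 27 roots not orthogonal to the weight have
  \<open>p = 2\<close> and lie in strings of step 2. So only \<open>2k\<close>-binomials arise, as
  on the line of fixed rank 3.\<close>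

lemma E7_check:
  "root_list_check E7 [3, 4, 2, 5, 6, 7] E7_gram E7_roots"
  "chain_check E7_gram E7_roots [[2, 2, 3, 4, 3, 2, 1], [0, 1, 1, 2, 2, 2, 1], [0, 0, 0, 0, 0, 0, 1]]"
  "pairs_check E7_gram E7_roots [[2, 2, 3, 4, 3, 2, 1]] []
    (string_pairs 2 2 32 1 @ string_pairs 1 2 0 16 @ string_pairs 1 2 6 10 @ string_pairs 1 2 10 6)"
  "pairs_check E7_gram E7_roots [[2, 2, 3, 4, 3, 2, 1], [0, 1, 1, 2, 2, 2, 1]] []
    (string_pairs 2 2 16 9 @ string_pairs 2 2 24 1 @ string_pairs 1 2 0 12 @ string_pairs 1 2 2 10 @ string_pairs 1 2 6 6 @ string_pairs 1 2 8 4)"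
  "pairs_check E7_gram E7_roots [[2, 2, 3, 4, 3, 2, 1], [0, 1, 1, 2, 2, 2, 1], [0, 0, 0, 0, 0, 0, 1]] []
    (string_pairs 2 2 0 17 @ string_pairs 2 2 8 9 @ string_pairs 2 2 16 1)"
  by code_simp+

lemma (in root_datum) dim_formula_E7:
  assumes "dynkin E7 \<alpha>" "beta_chain l \<beta>" "l \<ge> 1"
  shows "dim_formula_value E7 l k (weyl_product k (\<Sum>j=1..l. \<beta> j))"
proof -
  note W = listed_weyl_product[OF assms(1,2) E7_check(1,2)]
  consider "l = 1" | "l = 2" | "l = 3" using W(1) assms(3) by fastforce
  then show ?thesis
  proof cases
    case 1
    show ?thesis unfolding 1
      by (rule dim_formula_valueI[where b = "8" and c = "12"])
        (use W(2)[unfolded 1, simplified, OF E7_check(3), of k] in \<open>simp_all add: exceptional_simps\<close>)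
  next
    case 2
    show ?thesis unfolding 2
      by (rule dim_formula_valueI[where b = "8" and c = "12"])
        (use W(2)[unfolded 2, simplified, OF E7_check(4), of k] in \<open>simp_all add: exceptional_simps\<close>)
  next
    case 3
    \<comment> \<open>At this point of the plane the denominator vanishes for
      \<open>k \<ge> 3\<close>, so the product is written as the limit function of
      \<open>dim_formula_fixed_rank\<close> at \<open>a = 8\<close>.\<close>
    have e: "weyl_product k (\<Sum>j=1..3. \<beta> j) = (\<Prod>i=1..3. rbinom (2 * k) (8 * (2 * real 3 - real i - 1) / 2 + 1) /
        rbinom (2 * k) (8 * (real i - 1) / 2))"
      using W(2)[unfolded 3, simplified, OF E7_check(5), of k] by (simp add: exceptional_simps numeral_3_eq_3)
    show ?thesis unfolding 3 e by (rule dim_formula_fixed_rank) (simp_all add: in_fixed_rank_series_def)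
  qed
qed

definition E8_gram :: "int list list" where
  "E8_gram = [[2, 0, -1, 0, 0, 0, 0, 0],
    [0, 2, 0, -1, 0, 0, 0, 0],
    [-1, 0, 2, -1, 0, 0, 0, 0],
    [0, -1, -1, 2, -1, 0, 0, 0],
    [0, 0, 0, -1, 2, -1, 0, 0],
    [0, 0, 0, 0, -1, 2, -1, 0],
    [0, 0, 0, 0, 0, -1, 2, -1],
    [0, 0, 0, 0, 0, 0, -1, 2]]"

definition E8_roots :: "(int \<times> int list list) list" where
  "E8_roots = [
    (1, [[1,0,0,0,0,0,0,0], [0,1,0,0,0,0,0,0], [0,0,1,0,0,0,0,0], [0,0,0,1,0,0,0,0],
    [0,0,0,0,1,0,0,0], [0,0,0,0,0,1,0,0], [0,0,0,0,0,0,1,0], [0,0,0,0,0,0,0,1]]),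
    (2, [[1,0,1,0,0,0,0,0], [0,1,0,1,0,0,0,0], [0,0,1,1,0,0,0,0], [0,0,0,1,1,0,0,0],
    [0,0,0,0,1,1,0,0], [0,0,0,0,0,1,1,0], [0,0,0,0,0,0,1,1]]), (3, [[1,0,1,1,0,0,0,0],
    [0,1,1,1,0,0,0,0], [0,1,0,1,1,0,0,0], [0,0,1,1,1,0,0,0], [0,0,0,1,1,1,0,0],
    [0,0,0,0,1,1,1,0], [0,0,0,0,0,1,1,1]]), (4, [[1,1,1,1,0,0,0,0], [1,0,1,1,1,0,0,0],
    [0,1,1,1,1,0,0,0], [0,1,0,1,1,1,0,0], [0,0,1,1,1,1,0,0], [0,0,0,1,1,1,1,0],
    [0,0,0,0,1,1,1,1]]), (5, [[1,1,1,1,1,0,0,0], [1,0,1,1,1,1,0,0], [0,1,1,2,1,0,0,0],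
    [0,1,1,1,1,1,0,0], [0,1,0,1,1,1,1,0], [0,0,1,1,1,1,1,0], [0,0,0,1,1,1,1,1]]),
    (6, [[1,1,1,2,1,0,0,0], [1,1,1,1,1,1,0,0], [1,0,1,1,1,1,1,0], [0,1,1,2,1,1,0,0],
    [0,1,1,1,1,1,1,0], [0,1,0,1,1,1,1,1], [0,0,1,1,1,1,1,1]]), (7, [[1,1,2,2,1,0,0,0],
    [1,1,1,2,1,1,0,0], [1,1,1,1,1,1,1,0], [1,0,1,1,1,1,1,1], [0,1,1,2,2,1,0,0],
    [0,1,1,2,1,1,1,0], [0,1,1,1,1,1,1,1]]), (8, [[1,1,2,2,1,1,0,0], [1,1,1,2,2,1,0,0],
    [1,1,1,2,1,1,1,0], [1,1,1,1,1,1,1,1], [0,1,1,2,2,1,1,0], [0,1,1,2,1,1,1,1]]),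
    (9, [[1,1,2,2,2,1,0,0], [1,1,2,2,1,1,1,0], [1,1,1,2,2,1,1,0], [1,1,1,2,1,1,1,1],
    [0,1,1,2,2,2,1,0], [0,1,1,2,2,1,1,1]]), (10, [[1,1,2,3,2,1,0,0], [1,1,2,2,2,1,1,0],
    [1,1,2,2,1,1,1,1], [1,1,1,2,2,2,1,0], [1,1,1,2,2,1,1,1], [0,1,1,2,2,2,1,1]]),
    (11, [[1,2,2,3,2,1,0,0], [1,1,2,3,2,1,1,0], [1,1,2,2,2,2,1,0], [1,1,2,2,2,1,1,1],
    [1,1,1,2,2,2,1,1], [0,1,1,2,2,2,2,1]]), (12, [[1,2,2,3,2,1,1,0], [1,1,2,3,2,2,1,0],
    [1,1,2,3,2,1,1,1], [1,1,2,2,2,2,1,1], [1,1,1,2,2,2,2,1]]), (13, [[1,2,2,3,2,2,1,0],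
    [1,2,2,3,2,1,1,1], [1,1,2,3,3,2,1,0], [1,1,2,3,2,2,1,1], [1,1,2,2,2,2,2,1]]),
    (14, [[1,2,2,3,3,2,1,0], [1,2,2,3,2,2,1,1], [1,1,2,3,3,2,1,1], [1,1,2,3,2,2,2,1]]),
    (15, [[1,2,2,4,3,2,1,0], [1,2,2,3,3,2,1,1], [1,2,2,3,2,2,2,1], [1,1,2,3,3,2,2,1]]),
    (16, [[1,2,3,4,3,2,1,0], [1,2,2,4,3,2,1,1], [1,2,2,3,3,2,2,1], [1,1,2,3,3,3,2,1]]),
    (17, [[2,2,3,4,3,2,1,0], [1,2,3,4,3,2,1,1], [1,2,2,4,3,2,2,1], [1,2,2,3,3,3,2,1]]),
    (18, [[2,2,3,4,3,2,1,1], [1,2,3,4,3,2,2,1], [1,2,2,4,3,3,2,1]]), (19, [[2,2,3,4,3,2,2,1],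
    [1,2,3,4,3,3,2,1], [1,2,2,4,4,3,2,1]]), (20, [[2,2,3,4,3,3,2,1], [1,2,3,4,4,3,2,1]]),
    (21, [[2,2,3,4,4,3,2,1], [1,2,3,5,4,3,2,1]]), (22, [[2,2,3,5,4,3,2,1],
    [1,3,3,5,4,3,2,1]]), (23, [[2,3,3,5,4,3,2,1], [2,2,4,5,4,3,2,1]]),
    (24, [[2,3,4,5,4,3,2,1]]), (25, [[2,3,4,6,4,3,2,1]]), (26, [[2,3,4,6,5,3,2,1]]),
    (27, [[2,3,4,6,5,4,2,1]]), (28, [[2,3,4,6,5,4,3,1]]), (29, [[2,3,4,6,5,4,3,2]])]"

lemma E8_check:
  "root_list_check E8 [3, 4, 2, 5, 6, 7, 8] E8_gram E8_roots"
  "chain_check E8_gram E8_roots [[2, 3, 4, 6, 5, 4, 3, 2], [2, 2, 3, 4, 3, 2, 1, 0]]"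
  "pairs_check E8_gram E8_roots [[2, 3, 4, 6, 5, 4, 3, 2]] []
    (string_pairs 2 2 56 1 @ string_pairs 1 2 0 28 @ string_pairs 1 2 10 18 @ string_pairs 1 2 18 10)"
  "pairs_check E8_gram E8_roots [[2, 3, 4, 6, 5, 4, 3, 2], [2, 2, 3, 4, 3, 2, 1, 0]] []
    (string_pairs 2 2 32 13 @ string_pairs 2 2 44 1 @ string_pairs 1 2 0 22 @ string_pairs 1 2 6 16 @ string_pairs 1 2 10 12 @ string_pairs 1 2 12 10 @ string_pairs 1 2 18 4)"
  by code_simp+

lemma (in root_datum) dim_formula_E8:
  assumes "dynkin E8 \<alpha>" "beta_chain l \<beta>" "l \<ge> 1"
  shows "dim_formula_value E8 l k (weyl_product k (\<Sum>j=1..l. \<beta> j))"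
proof -
  note W = listed_weyl_product[OF assms(1,2) E8_check(1,2)]
  consider "l = 1" | "l = 2" using W(1) assms(3) by fastforce
  then show ?thesis
  proof cases
    case 1
    show ?thesis unfolding 1
      by (rule dim_formula_valueI[where b = "12" and c = "20"])
        (use W(2)[unfolded 1, simplified, OF E8_check(3), of k] in \<open>simp_all add: exceptional_simps\<close>)
  next
    case 2
    show ?thesis unfolding 2
      by (rule dim_formula_valueI[where b = "12" and c = "20"])
        (use W(2)[unfolded 2, simplified, OF E8_check(4), of k] in \<open>simp_all add: exceptional_simps\<close>)
  qed
qed

section \<open>From Lie algebras to root data\<close>

lemma of_nat_times_fun: "(of_nat k * f :: 'a \<Rightarrow> complex) = (\<lambda>x. of_nat k * f x)"
  by (induction k) (auto simp: fun_eq_iff algebra_simps)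

lemma sigma_eq_sum: "sigma \<beta> i = (\<Sum>j=1..i. \<beta> j)"
proof -
  have "(\<Sum>j\<in>A. \<beta> j) h = (\<Sum>j\<in>A. \<beta> j h)" for A :: "nat set" and h
    by (induction A rule: infinite_finite_induct) auto
  then show ?thesis unfolding sigma_def by (simp add: fun_eq_iff)
qed

text \<open>The rank is positive, and a simple root is a nonzero functional supported on
  \<open>H\<close>.\<close>

lemma (in rooted_simple_lie_algebra) has_type_nontrivial:
  assumes "has_type T \<alpha>"
  shows "\<exists>h\<in>H. h \<noteq> 0"
proof -
  have "1 \<le> type_rank T" using assms unfolding has_type_def by (cases T) auto
  then have "\<alpha> 1 \<in> simple_roots" using assms unfolding has_type_def bij_betw_def by auto
  then have r: "\<alpha> 1 \<in> dual H" "\<alpha> 1 \<noteq> (\<lambda>h. 0)"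
    using positive unfolding simple_roots_def positive_system_def roots_def by auto
  then obtain h where h: "\<alpha> 1 h \<noteq> 0" by auto
  have H: "h \<in> H" using r(1) h unfolding dual_def by blast
  have "\<alpha> 1 (scale 0 h) = 0 * \<alpha> 1 h" using r(1) H unfolding dual_def by blast
  then have "h \<noteq> 0" using h by auto
  then show ?thesis using H by blast
qed

context cartan_lie_algebra
begin

lemma dynkin_has_type:
  assumes "has_type T \<alpha>"
  shows "dynkin T \<alpha>"
proof -
  have s: "simple = \<alpha> ` {1..type_rank T}"
    using assms unfolding has_type_def bij_betw_def simple_roots_eq by simp
  have "2 * form (\<alpha> i) (\<alpha> j) = of_int (cartan_integer T i j) * form (\<alpha> j) (\<alpha> j)"
    if ij: "i \<in> {1..type_rank T}" "j \<in> {1..type_rank T}" for i j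
  proof -
    have "\<alpha> i \<in> simple" "\<alpha> j \<in> simple" unfolding s using ij by auto
    then have r: "\<alpha> i \<in> roots H" "\<alpha> j \<in> roots H" using simple_P P_subset by auto
    have "2 * ip (\<alpha> i) (\<alpha> j) / ip (\<alpha> j) (\<alpha> j) = of_int (cartan_integer T i j)"
      using assms ij unfolding has_type_def by blast
    then have "complex_of_real (2 * form (\<alpha> i) (\<alpha> j) / form (\<alpha> j) (\<alpha> j)) = of_real (of_int (cartan_integer T i j))"
      unfolding ip_root_real[OF r(2,1)] ip_root_real[OF r(2,2)] by simp
    then have "2 * form (\<alpha> i) (\<alpha> j) / form (\<alpha> j) (\<alpha> j) = of_int (cartan_integer T i j)"
      by (simp only: of_real_eq_iff)
    then show ?thesis using form_pos[OF r(2)] by (simp add: field_simps)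
  qed
  then show ?thesis unfolding dynkin_def using s by blast
qed

lemma real_weight_of_nat:
  assumes "real_weight \<phi>"
  shows "real_weight (of_nat m * \<phi>)"
proof (induction m)
  case (Suc m)
  have "of_nat (Suc m) * \<phi> = \<phi> + of_nat m * \<phi>" by (simp only: of_nat_Suc distrib_right mult_1)
  then show ?case using real_weight_add[OF assms Suc] by (simp only:)
qed (simp only: of_nat_0 mult_zero_left real_weight_zero)

lemma dominant_form:
  assumes "dominant \<phi>" "real_weight \<phi>" "a \<in> P"
  shows "form a \<phi> \<ge> 0"
proof -
  have a: "a \<in> roots H" using P_subset assms(3) by blast
  have "2 * ip \<phi> a / ip a a \<in> \<nat>" using assms(1,3) unfolding dominant_def by blast
  then obtain m where "2 * ip \<phi> a / ip a a = of_nat m" by (rule Nats_cases)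
  then have "complex_of_real (2 * form \<phi> a / form a a) = of_real (real m)"
    unfolding ip_real[OF assms(2) real_weight_root[OF a]] ip_root_real[OF a a] by simp
  then have "2 * form \<phi> a / form a a = real m" by (simp only: of_real_eq_iff)
  then have "2 * form \<phi> a = real m * form a a" using form_pos[OF a] by (simp add: field_simps)
  moreover have "real m * form a a \<ge> 0" using form_pos[OF a] by simp
  ultimately show ?thesis using form_sym[of a \<phi>] by simp
qed

lemma beta_chain_sequence:
  assumes seq: "beta_sequence l \<beta>" and dom: "\<And>i. 1 \<le> i \<Longrightarrow> i \<le> l \<Longrightarrow> dominant (sigma \<beta> i)"
  shows "beta_chain l \<beta>"
  unfolding beta_chain_def
proof (intro ballI conjI)
  have root: "\<beta> i \<in> roots H" if "i \<in> {1..l}" for i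
    using seq that unfolding beta_sequence_def long_root_def by blast
  fix i assume i: "i \<in> {1..l}"
  note seq_i = bspec[OF seq[unfolded beta_sequence_def] i]
  show "\<beta> i \<in> roots H" by (rule root[OF i])
  show "form b b \<le> form (\<beta> i) (\<beta> i)" if "b \<in> roots H" for b
  proof -
    have "Re (ip b b) \<le> Re (ip (\<beta> i) (\<beta> i))" using seq_i that unfolding long_root_def by blast
    then show ?thesis unfolding ip_root_real[OF that that] ip_root_real[OF root[OF i] root[OF i]] by simp
  qed
  show "form (\<beta> i) (\<beta> j) = 0" if j: "j \<in> {1..<i}" for j
  proof -
    have jl: "j \<in> {1..l}" using i j by simp
    obtain C where "C \<subseteq> {\<alpha>\<in>roots H. \<forall>j\<in>{1..<i}. ip \<alpha> (\<beta> j) = 0}" "\<beta> i \<in> C"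
      using seq_i unfolding irreducible_component_def highest_root_def by blast
    then have "ip (\<beta> i) (\<beta> j) = 0" using j by blast
    then show ?thesis unfolding ip_root_real[OF root[OF jl] root[OF i]] by simp
  qed
  show "form a (\<Sum>j=1..i. \<beta> j) \<ge> 0" if "a \<in> P" for a
  proof (rule dominant_form[OF _ _ that])
    show "dominant (\<Sum>j=1..i. \<beta> j)" using dom[of i] i unfolding sigma_eq_sum by simp
    show "real_weight (\<Sum>j=1..i. \<beta> j)" using root i by (intro real_weight_sum real_weight_root) auto
  qed
qed

lemma dim_formula_weyl_product:
  assumes "has_type T \<alpha>" "beta_chain l \<beta>" "l \<ge> 1" "so_convention T \<alpha> l \<beta>"
  shows "dim_formula_value T l k (weyl_product k (\<Sum>j=1..l. \<beta> j))"
proof -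
  note dynkin = dynkin_has_type[OF assms(1)]
  have valid: "valid_type T" using assms(1) unfolding has_type_def by blast
  show ?thesis
  proof (cases T)
    case (SL n)
    show ?thesis unfolding SL by (rule dim_formula_SL) (use valid dynkin assms SL in auto)
  next
    case (SP n)
    have "\<exists>y. y + y = x" for x :: "'a \<Rightarrow> complex"
      by (rule exI[of _ "\<lambda>h. x h / 2"]) (simp add: fun_eq_iff)
    then show ?thesis unfolding SP by (intro dim_formula_SP) (use valid dynkin assms SP in auto)
  next
    case (SO n)
    obtain \<epsilon> where \<epsilon>: "so_coordinates n \<alpha> \<epsilon>"
      "\<forall>i\<in>{1..l}. 2 * i \<le> n div 2 \<and> \<beta> i = (\<lambda>h. \<epsilon> (2 * i - 1) h + \<epsilon> (2 * i) h)"
      using assms(4) SO unfolding so_convention_def by blast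
    show ?thesis
      unfolding SO
    proof (rule dim_formula_SO)
      show "\<alpha> i = \<epsilon> i - \<epsilon> (Suc i)" if "i \<in> {1..<n div 2}" for i
        using \<epsilon>(1) that unfolding so_coordinates_def Let_def by (simp add: fun_eq_iff)
      show "\<alpha> (n div 2) = (if odd n then \<epsilon> (n div 2) else \<epsilon> (n div 2 - 1) + \<epsilon> (n div 2))"
        using \<epsilon>(1) unfolding so_coordinates_def Let_def by (simp add: fun_eq_iff)
      show "2 * i \<le> n div 2 \<and> \<beta> i = \<epsilon> (2 * i - 1) + \<epsilon> (2 * i)" if "i \<in> {1..l}" for i
        using \<epsilon>(2) that by (simp add: fun_eq_iff)
    qed (use valid dynkin assms SO in auto)
  qed (use dynkin assms dim_formula_G2 dim_formula_F4 dim_formula_E6 dim_formula_E7 dim_formula_E8 in auto)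
qed

end

lemma (in highest_weight_module) dim_weyl_product:
  assumes "\<Lambda> = of_nat k * \<sigma>" "\<And>a. a \<in> P \<Longrightarrow> form a \<sigma> \<ge> 0"
  shows "real (V.dim (UNIV :: 'v set)) = weyl_product k \<sigma>"
proof -
  have f: "form a \<Lambda> = real k * form a \<sigma>" for a unfolding assms(1) by (rule form_of_nat_right)
  have "form a \<Lambda> \<ge> 0" if "a \<in> P" for a unfolding f using assms(2)[OF that] by simp
  from dimension_formula[OF this] show ?thesis unfolding weyl_product_def f by simp
qed

theorem theorem6p10:
  fixes scaleL :: "complex \<Rightarrow> 'g::ab_group_add \<Rightarrow> 'g" and BasisL :: "'g set"
    and brk :: "'g \<Rightarrow> 'g \<Rightarrow> 'g"
    and H :: "'g set" and P :: "('g \<Rightarrow> complex) set"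
    and T :: simple_type and \<alpha> \<beta> :: "nat \<Rightarrow> 'g \<Rightarrow> complex"
    and scaleV :: "complex \<Rightarrow> 'v::ab_group_add \<Rightarrow> 'v" and BasisV :: "'v set"
    and act :: "'g \<Rightarrow> 'v \<Rightarrow> 'v"
    and l k :: nat
  assumes "rooted_simple_lie_algebra scaleL BasisL brk H P"
    and "rooted_simple_lie_algebra.has_type scaleL BasisL brk H P T \<alpha>"
    and "l \<ge> 1" and "k \<ge> 1"
    and "rooted_simple_lie_algebra.beta_sequence scaleL BasisL brk H P l \<beta>"
    and "so_convention T \<alpha> l \<beta>"
    and "\<And>i. 1 \<le> i \<Longrightarrow> i \<le> l \<Longrightarrow>
           rooted_simple_lie_algebra.dominant scaleL BasisL brk H P (sigma \<beta> i)"
    and "irreducible_lie_module scaleL BasisL brk scaleV BasisV act"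
    and "lie_module.has_highest_weight scaleL brk scaleV act H P (\<lambda>h. of_nat k * sigma \<beta> l h)"
  shows "dim_formula_value T l k (real (vector_space.dim scaleV (UNIV :: 'v set)))"
proof -
  interpret rooted_simple_lie_algebra scaleL BasisL brk H P by (rule assms(1))
  interpret cartan_lie_algebra scaleL BasisL brk H P
    by unfold_locales (rule has_type_nontrivial[OF assms(2)])
  interpret irreducible_lie_module scaleL BasisL brk scaleV BasisV act by (rule assms(8))
  let ?\<sigma> = "\<Sum>j=1..l. \<beta> j"
  have chain: "beta_chain l \<beta>" by (rule beta_chain_sequence[OF assms(5,7)])
  have \<Lambda>: "(\<lambda>h. of_nat k * sigma \<beta> l h) = of_nat k * ?\<sigma>"
    unfolding of_nat_times_fun sigma_eq_sum ..
  have root: "\<beta> j \<in> roots H" if "j \<in> {1..l}" for j using chain that unfolding beta_chain_def by blast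
  have rw: "real_weight ?\<sigma>" using root by (intro real_weight_sum real_weight_root) auto
  have "real_weight (of_nat k * ?\<sigma>)" by (rule real_weight_of_nat[OF rw])
  then interpret highest_weight_module scaleL BasisL brk H P scaleV BasisV act "of_nat k * ?\<sigma>"
    using assms(9) unfolding \<Lambda> by unfold_locales
  have "real (vector_space.dim scaleV (UNIV :: 'v set)) = weyl_product k ?\<sigma>"
    by (rule dim_weyl_product[OF refl]) (use chain assms(3) in \<open>auto simp: beta_chain_def\<close>)
  then show ?thesis
    using dim_formula_weyl_product[OF assms(2) chain assms(3,6)] by simp
qed

end
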